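(* Let $\mathcal{G}$ be a pasting scheme with source $s$ and sink $t$, let $\mathcal{K}$ be a Gray-category, and let $l$ be a labelling of $\mathcal{G}$ in $\mathcal{K}$ (that is, a $2$-dimensional pasting diagram in $\mathcal{K}$). Let $S=l(s)$, $T=l(t)$, and let $p,q\colon S\to T$ be the labels of the top and the bottom path of $\mathcal{G}$. Then this pasting diagram has a unique composition up to a contractible groupoid of choices. Explicitly: the composites of the pasting diagram are the values on objects of the canonical functor $\Phi_l\colon \mathbf{C}_{\mathcal{G}}\to\mathcal{K}(S,T)(p,q)$ defined on the groupoid of choices $\mathbf{C}_{\mathcal{G}}$, and the groupoid $\mathbf{C}_{\mathcal{G}}$ is contractible, i.e. equivalent to the terminal category.
   Context: **Gray-categories.** A Gray-category is a category enriched over $2$-categories and strict $2$-functors with the (pseudo) Gray tensor product $\otimes$. So $\mathcal{K}$ has objects, hom-$2$-categories $\mathcal{K}(A,B)$, identities, and composition $2$-functors $c_{A,B,C}\colon \mathcal{K}(B,C)\otimes\mathcal{K}(A,B)\to\mathcal{K}(A,C)$, strictly associative and unital. Here $\mathcal{X}\otimes\mathcal{Y}$ has objects the pairs $(f,g)$, $1$-cells generated by $(\alpha,g)$ and $(f,\beta)$ (functorial in $\alpha$, resp. $\beta$), and $2$-cells generated by $(\Phi,g)$, $(f,\Psi)$ and invertible Gray cells $\gamma_{\alpha,\beta}\colon (\alpha,g')(f,\beta)\Rightarrow (f',\beta)(\alpha,g)$ for $\alpha\colon f\to f'$, $\beta\colon g\to g'$, natural with respect to $2$-cells and compatible with identities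 and composition in each variable. The image of $\gamma_{\alpha,\beta}$ under a composition $2$-functor is also denoted $\gamma_{\alpha,\beta}$. Juxtaposition denotes whiskering. $\mathcal{K}(S,T)(p,q)$ is the category of $2$-cells $p\Rightarrow q$ and $3$-cells between them. **Pasting schemes.** All graphs are finite, directed, connected and plane (with a specified orientation-preserving embedding in the oriented plane); parallel edges are allowed. All paths are directed. A pasting scheme is such a graph $\mathcal{G}$ without directed cycles, with distinct vertices $s$ (source) and $t$ (sink) on the boundary of the exterior face, such that for every vertex $v$ there are directed paths from $s$ to $v$ and from $v$ to $t$. "Face" means interior face. For every face $F$ there are unique distinct vertices $s_F,t_F$ and directed paths $\sigma_F,\tau_F$ from $s_F$ to $t_F$ such that the boundary of $F$, traversed clockwise, is $\sigma_F$ followed by $\tau_F$ reversed (so $\sigma_F$ is the upper and $\tau_F$ the lower side of $F$). The boundary of the exterior face consists of the top path and the bottom path from $s$ to $t$. **Relations.** $F_1\triangleleft_{\mathcal{G}}F_2$ iff $\tau_{F_1}$ and $\sigma_{F_2}$ share at least one edge; $\triangleleft_{\mathcal{G}}^t$ is its transitive closure (it is a strict partial order). $F_1\prec_{\mathcal{G}}F_2$ iff there is a (possibly empty) directed path from $t_{F_1}$ to $s_{F_2}$. Two distinct faces are $\triangleleft_{\mathcal{G}}^t$-incomparable iff they are $\prec_{\mathcal{G}}$-comparable. **The groupoid $\mathbf{C}_{\mathcal{G}}$.** Objects: strings $F_1F_2\cdots F_n$ listing all faces of $\mathcal{G}$ exactly once, corresponding to strict linear orders extending $\triangleleft_{\mathcal{G}}$.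 Generating morphisms: for each object of the form $\overrightarrow{U}GH\overrightarrow{V}$ ($\overrightarrow{U},\overrightarrow{V}$ substrings) with the adjacent faces $G,H$ not comparable with respect to $\triangleleft_{\mathcal{G}}^t$, a morphism $\overrightarrow{U}\widehat{GH}\overrightarrow{V}\colon \overrightarrow{U}GH\overrightarrow{V}\to\overrightarrow{U}HG\overrightarrow{V}$. Relations, whenever the generators involved exist: (a) $\overrightarrow{U}\widehat{HG}\overrightarrow{V}\circ\overrightarrow{U}\widehat{GH}\overrightarrow{V}=\mathrm{id}$; (b) $\overrightarrow{U}HG\overrightarrow{V}\widehat{KL}\overrightarrow{W}\circ\overrightarrow{U}\widehat{GH}\overrightarrow{V}KL\overrightarrow{W}=\overrightarrow{U}\widehat{GH}\overrightarrow{V}LK\overrightarrow{W}\circ\overrightarrow{U}GH\overrightarrow{V}\widehat{KL}\overrightarrow{W}$ ($\overrightarrow{V}$ possibly empty); (c) $\overrightarrow{U}\widehat{HK}G\overrightarrow{V}\circ\overrightarrow{U}H\widehat{GK}\overrightarrow{V}\circ\overrightarrow{U}\widehat{GH}K\overrightarrow{V}=\overrightarrow{U}K\widehat{GH}\overrightarrow{V}\circ\overrightarrow{U}\widehat{GK}H\overrightarrow{V}\circ\overrightarrow{U}G\widehat{HK}\overrightarrow{V}$. **Labellings.** A labelling $l$ of $\mathcal{G}$ in $\mathcal{K}$ assigns to each vertex $u$ an object $l(u)$, to each edge $e\colon u\to v$ a $1$-cell $l(e)\colon l(u)\to l(v)$, and to each face $F$ a $2$-cell $l(F)\colon l(\sigma_F)\Rightarrow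 l(\tau_F)$, where $l(e_1\cdots e_n)=l(e_n)\circ\cdots\circ l(e_1)$ for a directed path $e_1\cdots e_n$. The image of a labelling is called a ($2$-dimensional) pasting diagram. **Composites and the canonical functor.** For an object $F_1\cdots F_n$ of $\mathbf{C}_{\mathcal{G}}$ let $\pi_0$ be the top path; inductively $\sigma_{F_i}$ is a subpath of $\pi_{i-1}$, $\pi_{i-1}=a_i\,\sigma_{F_i}\,b_i$ (in order of traversal), and $\pi_i=a_i\,\tau_{F_i}\,b_i$, so that $\pi_n$ is the bottom path. $\Phi_l(F_1\cdots F_n)$ is the vertical composite $p\Rightarrow q$ of the whiskered $2$-cells $l(b_i)\,l(F_i)\,l(a_i)\colon l(\pi_{i-1})\Rightarrow l(\pi_i)$, with $i=1$ applied first. These $2$-cells are the composites of the pasting diagram. On a generator $\overrightarrow{U}\widehat{GH}\overrightarrow{V}$ with $G\prec_{\mathcal{G}}H$: the path reached after processing $\overrightarrow{U}$ has the form $w\,\sigma_G\,v\,\sigma_H\,u$ (in order of traversal), and $\Phi_l$ sends the generator to the Gray cell $\gamma_{l(H)l(v),\,l(G)}$ whiskered with the $1$-cells $l(w)$ and $l(u)$ and then, in $\mathcal{K}(S,T)$, with the vertical composites of the $2$-cells coming from $\overrightarrow{U}$ and $\overrightarrow{V}$. If instead $H\prec_{\mathcal{G}}G$, the generator is sent to the inverse of the image of $\overrightarrow{U}\widehat{HG}\overrightarrow{V}$. *)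

theory Defs
  imports "Graph_Theory.Digraph_Component" "Graph_Theory.Arc_Walk"
    "HOL-Complex_Analysis.Winding_Numbers"
begin

section \<open>Categories\<close>

record ('o, 'm) cat =
  Obj :: "'o set"
  Arr :: "'m set"
  Dom :: "'m \<Rightarrow> 'o"
  Cod :: "'m \<Rightarrow> 'o"
  Ident :: "'o \<Rightarrow> 'm"
  Compose :: "'m \<Rightarrow> 'm \<Rightarrow> 'm"  \<comment> \<open>\<open>Compose C g f\<close> is \<open>g\<close> after \<open>f\<close>\<close>

locale category =
  fixes C :: "('o, 'm) cat"
  assumes Dom_in: "f \<in> Arr C \<Longrightarrow> Dom C f \<in> Obj C"
    and Cod_in: "f \<in> Arr C \<Longrightarrow> Cod C f \<in> Obj C"
    and Ident_in: "x \<in> Obj C \<Longrightarrow> Ident C x \<in> Arr C"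
    and Dom_Ident: "x \<in> Obj C \<Longrightarrow> Dom C (Ident C x) = x"
    and Cod_Ident: "x \<in> Obj C \<Longrightarrow> Cod C (Ident C x) = x"
    and Compose_in: "\<lbrakk>f \<in> Arr C; g \<in> Arr C; Dom C g = Cod C f\<rbrakk> \<Longrightarrow> Compose C g f \<in> Arr C"
    and Dom_Compose: "\<lbrakk>f \<in> Arr C; g \<in> Arr C; Dom C g = Cod C f\<rbrakk> \<Longrightarrow> Dom C (Compose C g f) = Dom C f"
    and Cod_Compose: "\<lbrakk>f \<in> Arr C; g \<in> Arr C; Dom C g = Cod C f\<rbrakk> \<Longrightarrow> Cod C (Compose C g f) = Cod C g"
    and Compose_Ident_right: "f \<in> Arr C \<Longrightarrow> Compose C f (Ident C (Dom C f)) = f"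
    and Compose_Ident_left: "f \<in> Arr C \<Longrightarrow> Compose C (Ident C (Cod C f)) f = f"
    and Compose_assoc: "\<lbrakk>f \<in> Arr C; g \<in> Arr C; h \<in> Arr C; Dom C g = Cod C f; Dom C h = Cod C g\<rbrakk>
      \<Longrightarrow> Compose C h (Compose C g f) = Compose C (Compose C h g) f"

definition inverse_arrows :: "('o, 'm) cat \<Rightarrow> 'm \<Rightarrow> 'm \<Rightarrow> bool" where
  "inverse_arrows C f g \<longleftrightarrow> f \<in> Arr C \<and> g \<in> Arr C \<and> Dom C g = Cod C f \<and> Cod C g = Dom C f
     \<and> Compose C g f = Ident C (Dom C f) \<and> Compose C f g = Ident C (Cod C f)"

definition iso_arrow :: "('o, 'm) cat \<Rightarrow> 'm \<Rightarrow> bool" where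
  "iso_arrow C f \<longleftrightarrow> (\<exists>g. inverse_arrows C f g)"

definition inv_arrow :: "('o, 'm) cat \<Rightarrow> 'm \<Rightarrow> 'm" where
  "inv_arrow C f = (THE g. inverse_arrows C f g)"

locale groupoid = category C for C :: "('o, 'm) cat" +
  assumes all_iso: "f \<in> Arr C \<Longrightarrow> iso_arrow C f"

locale is_functor = Src: category C + Tgt: category D
  for C :: "('o, 'm) cat" and D :: "('p, 'n) cat" +
  fixes FO :: "'o \<Rightarrow> 'p" and FA :: "'m \<Rightarrow> 'n"
  assumes FO_in: "x \<in> Obj C \<Longrightarrow> FO x \<in> Obj D"
    and FA_in: "f \<in> Arr C \<Longrightarrow> FA f \<in> Arr D"
    and Dom_FA: "f \<in> Arr C \<Longrightarrow> Dom D (FA f) = FO (Dom C f)"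
    and Cod_FA: "f \<in> Arr C \<Longrightarrow> Cod D (FA f) = FO (Cod C f)"
    and FA_Ident: "x \<in> Obj C \<Longrightarrow> FA (Ident C x) = Ident D (FO x)"
    and FA_Compose: "\<lbrakk>f \<in> Arr C; g \<in> Arr C; Dom C g = Cod C f\<rbrakk>
      \<Longrightarrow> FA (Compose C g f) = Compose D (FA g) (FA f)"

definition naturally_isomorphic ::
  "('o, 'm) cat \<Rightarrow> ('p, 'n) cat \<Rightarrow> ('o \<Rightarrow> 'p) \<Rightarrow> ('m \<Rightarrow> 'n) \<Rightarrow> ('o \<Rightarrow> 'p) \<Rightarrow> ('m \<Rightarrow> 'n) \<Rightarrow> bool" where
  "naturally_isomorphic C D FO FA GO GA \<longleftrightarrow> (\<exists>\<eta>.
     (\<forall>x \<in> Obj C. iso_arrow D (\<eta> x) \<and> Dom D (\<eta> x) = FO x \<and> Cod D (\<eta> x) = GO x) \<and>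
     (\<forall>f \<in> Arr C. Compose D (\<eta> (Cod C f)) (FA f) = Compose D (GA f) (\<eta> (Dom C f))))"

definition equivalent_categories :: "('o, 'm) cat \<Rightarrow> ('p, 'n) cat \<Rightarrow> bool" where
  "equivalent_categories C D \<longleftrightarrow> (\<exists>FO FA GO GA.
     is_functor C D FO FA \<and> is_functor D C GO GA \<and>
     naturally_isomorphic C C (GO \<circ> FO) (GA \<circ> FA) id id \<and>
     naturally_isomorphic D D (FO \<circ> GO) (FA \<circ> GA) id id)"

definition terminal_category :: "(unit, unit) cat" where
  "terminal_category = \<lparr>Obj = UNIV, Arr = UNIV, Dom = (\<lambda>_. ()), Cod = (\<lambda>_. ()),
     Ident = (\<lambda>_. ()), Compose = (\<lambda>_ _. ())\<rparr>"

definition contractible_category :: "('o, 'm) cat \<Rightarrow> bool" where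
  "contractible_category C \<longleftrightarrow> equivalent_categories C terminal_category"


section \<open>2-categories\<close>

record ('a, 'b, 'c) two_cat =
  cells0 :: "'a set"
  cells1 :: "'b set"
  cells2 :: "'c set"
  src1 :: "'b \<Rightarrow> 'a"
  tgt1 :: "'b \<Rightarrow> 'a"
  src2 :: "'c \<Rightarrow> 'b"
  tgt2 :: "'c \<Rightarrow> 'b"
  id1 :: "'a \<Rightarrow> 'b"
  id2 :: "'b \<Rightarrow> 'c"
  comp1 :: "'b \<Rightarrow> 'b \<Rightarrow> 'b"
  vcomp :: "'c \<Rightarrow> 'c \<Rightarrow> 'c"
  hcomp :: "'c \<Rightarrow> 'c \<Rightarrow> 'c"

definition cat1 :: "('a, 'b, 'c) two_cat \<Rightarrow> ('a, 'b) cat" where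
  "cat1 X = \<lparr>Obj = cells0 X, Arr = cells1 X, Dom = src1 X, Cod = tgt1 X,
     Ident = id1 X, Compose = comp1 X\<rparr>"

definition vert_cat :: "('a, 'b, 'c) two_cat \<Rightarrow> ('b, 'c) cat" where
  "vert_cat X = \<lparr>Obj = cells1 X, Arr = cells2 X, Dom = src2 X, Cod = tgt2 X,
     Ident = id2 X, Compose = vcomp X\<rparr>"

definition horiz_cat :: "('a, 'b, 'c) two_cat \<Rightarrow> ('a, 'c) cat" where
  "horiz_cat X = \<lparr>Obj = cells0 X, Arr = cells2 X,
     Dom = (\<lambda>\<Phi>. src1 X (src2 X \<Phi>)), Cod = (\<lambda>\<Phi>. tgt1 X (tgt2 X \<Phi>)),
     Ident = (\<lambda>x. id2 X (id1 X x)), Compose = hcomp X\<rparr>"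

locale two_category =
  fixes X :: "('a, 'b, 'c) two_cat"
  assumes category_cat1: "category (cat1 X)"
    and category_vert: "category (vert_cat X)"
    and category_horiz: "category (horiz_cat X)"
    and globular_src: "\<Phi> \<in> cells2 X \<Longrightarrow> src1 X (src2 X \<Phi>) = src1 X (tgt2 X \<Phi>)"
    and globular_tgt: "\<Phi> \<in> cells2 X \<Longrightarrow> tgt1 X (src2 X \<Phi>) = tgt1 X (tgt2 X \<Phi>)"
    and src2_hcomp: "\<lbrakk>\<Phi> \<in> cells2 X; \<Psi> \<in> cells2 X; src1 X (src2 X \<Psi>) = tgt1 X (src2 X \<Phi>)\<rbrakk>
      \<Longrightarrow> src2 X (hcomp X \<Psi> \<Phi>) = comp1 X (src2 X \<Psi>) (src2 X \<Phi>)"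
    and tgt2_hcomp: "\<lbrakk>\<Phi> \<in> cells2 X; \<Psi> \<in> cells2 X; src1 X (src2 X \<Psi>) = tgt1 X (src2 X \<Phi>)\<rbrakk>
      \<Longrightarrow> tgt2 X (hcomp X \<Psi> \<Phi>) = comp1 X (tgt2 X \<Psi>) (tgt2 X \<Phi>)"
    and hcomp_id2: "\<lbrakk>\<alpha> \<in> cells1 X; \<beta> \<in> cells1 X; src1 X \<beta> = tgt1 X \<alpha>\<rbrakk>
      \<Longrightarrow> hcomp X (id2 X \<beta>) (id2 X \<alpha>) = id2 X (comp1 X \<beta> \<alpha>)"
    and interchange: "\<lbrakk>\<Phi> \<in> cells2 X; \<Phi>' \<in> cells2 X; \<Psi> \<in> cells2 X; \<Psi>' \<in> cells2 X;
        src2 X \<Phi>' = tgt2 X \<Phi>; src2 X \<Psi>' = tgt2 X \<Psi>; src1 X (src2 X \<Psi>) = tgt1 X (src2 X \<Phi>)\<rbrakk>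
      \<Longrightarrow> hcomp X (vcomp X \<Psi>' \<Psi>) (vcomp X \<Phi>' \<Phi>)
        = vcomp X (hcomp X \<Psi>' \<Phi>') (hcomp X \<Psi> \<Phi>)"

definition hom_cat :: "('a, 'b, 'c) two_cat \<Rightarrow> 'a \<Rightarrow> 'a \<Rightarrow> ('b, 'c) cat" where
  "hom_cat X p q =
     \<lparr>Obj = {\<alpha> \<in> cells1 X. src1 X \<alpha> = p \<and> tgt1 X \<alpha> = q},
      Arr = {\<Phi> \<in> cells2 X. src1 X (src2 X \<Phi>) = p \<and> tgt1 X (src2 X \<Phi>) = q},
      Dom = src2 X, Cod = tgt2 X, Ident = id2 X, Compose = vcomp X\<rparr>"

definition strict_two_functor ::
  "('a, 'b, 'c) two_cat \<Rightarrow> ('d, 'e, 'f) two_cat \<Rightarrow> ('a \<Rightarrow> 'd) \<Rightarrow> ('b \<Rightarrow> 'e) \<Rightarrow> ('c \<Rightarrow> 'f) \<Rightarrow> bool" where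
  "strict_two_functor X Y F0 F1 F2 \<longleftrightarrow> two_category X \<and> two_category Y \<and>
     is_functor (cat1 X) (cat1 Y) F0 F1 \<and>
     is_functor (vert_cat X) (vert_cat Y) F1 F2 \<and>
     is_functor (horiz_cat X) (horiz_cat Y) F0 F2"


section \<open>Gray-categories\<close>

text \<open>
  The Gray tensor product of 2-categories \<open>X\<close> and \<open>Y\<close> is presented by generators and relations,
  so a strict 2-functor from it to \<open>Z\<close> amounts to an assignment on the generators that satisfies the
  relations. The record contains the images of the generators: of the objects \<open>(f,g)\<close>, the 1-cells
  \<open>(\<alpha>,g)\<close> and \<open>(f,\<beta>)\<close>, the 2-cells \<open>(\<Phi>,g)\<close> and \<open>(f,\<Psi>)\<close>, and the Gray cells
  \<open>\<gamma>\<^sub>\<alpha>\<^sub>,\<^sub>\<beta>\<close>.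
\<close>

record ('a, 'b, 'c) gray_map =
  on_obj :: "'a \<Rightarrow> 'a \<Rightarrow> 'a"
  on_1L :: "'b \<Rightarrow> 'a \<Rightarrow> 'b"
  on_1R :: "'a \<Rightarrow> 'b \<Rightarrow> 'b"
  on_2L :: "'c \<Rightarrow> 'a \<Rightarrow> 'c"
  on_2R :: "'a \<Rightarrow> 'c \<Rightarrow> 'c"
  gray_cell :: "'b \<Rightarrow> 'b \<Rightarrow> 'c"

locale gray_two_functor =
  fixes X Y Z :: "('a, 'b, 'c) two_cat" and M :: "('a, 'b, 'c) gray_map"
  assumes functor_left: "g \<in> cells0 Y \<Longrightarrow>
      strict_two_functor X Z (\<lambda>f. on_obj M f g) (\<lambda>\<alpha>. on_1L M \<alpha> g) (\<lambda>\<Phi>. on_2L M \<Phi> g)"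
    and functor_right: "f \<in> cells0 X \<Longrightarrow>
      strict_two_functor Y Z (on_obj M f) (on_1R M f) (on_2R M f)"
    and gray_cell_iso: "\<lbrakk>\<alpha> \<in> cells1 X; \<beta> \<in> cells1 Y\<rbrakk> \<Longrightarrow> iso_arrow (vert_cat Z) (gray_cell M \<alpha> \<beta>)"
    and src2_gray_cell: "\<lbrakk>\<alpha> \<in> cells1 X; \<beta> \<in> cells1 Y\<rbrakk> \<Longrightarrow>
      src2 Z (gray_cell M \<alpha> \<beta>) = comp1 Z (on_1L M \<alpha> (tgt1 Y \<beta>)) (on_1R M (src1 X \<alpha>) \<beta>)"
    and tgt2_gray_cell: "\<lbrakk>\<alpha> \<in> cells1 X; \<beta> \<in> cells1 Y\<rbrakk> \<Longrightarrow>
      tgt2 Z (gray_cell M \<alpha> \<beta>) = comp1 Z (on_1R M (tgt1 X \<alpha>) \<beta>) (on_1L M \<alpha> (src1 Y \<beta>))"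
    and gray_cell_natural: "\<lbrakk>\<Phi> \<in> cells2 X; \<Psi> \<in> cells2 Y;
        src2 X \<Phi> = \<alpha>; tgt2 X \<Phi> = \<alpha>'; src2 Y \<Psi> = \<beta>; tgt2 Y \<Psi> = \<beta>'\<rbrakk> \<Longrightarrow>
      vcomp Z (gray_cell M \<alpha>' \<beta>') (hcomp Z (on_2L M \<Phi> (tgt1 Y \<beta>)) (on_2R M (src1 X \<alpha>) \<Psi>))
      = vcomp Z (hcomp Z (on_2R M (tgt1 X \<alpha>) \<Psi>) (on_2L M \<Phi> (src1 Y \<beta>))) (gray_cell M \<alpha> \<beta>)"
    and gray_cell_id_left: "\<lbrakk>f \<in> cells0 X; \<beta> \<in> cells1 Y\<rbrakk> \<Longrightarrow>
      gray_cell M (id1 X f) \<beta> = id2 Z (on_1R M f \<beta>)"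
    and gray_cell_id_right: "\<lbrakk>\<alpha> \<in> cells1 X; g \<in> cells0 Y\<rbrakk> \<Longrightarrow>
      gray_cell M \<alpha> (id1 Y g) = id2 Z (on_1L M \<alpha> g)"
    and gray_cell_comp_left: "\<lbrakk>\<alpha> \<in> cells1 X; \<alpha>' \<in> cells1 X; src1 X \<alpha>' = tgt1 X \<alpha>; \<beta> \<in> cells1 Y\<rbrakk> \<Longrightarrow>
      gray_cell M (comp1 X \<alpha>' \<alpha>) \<beta>
      = vcomp Z (hcomp Z (gray_cell M \<alpha>' \<beta>) (id2 Z (on_1L M \<alpha> (src1 Y \<beta>))))
                (hcomp Z (id2 Z (on_1L M \<alpha>' (tgt1 Y \<beta>))) (gray_cell M \<alpha> \<beta>))"
    and gray_cell_comp_right: "\<lbrakk>\<alpha> \<in> cells1 X; \<beta> \<in> cells1 Y; \<beta>' \<in> cells1 Y; src1 Y \<beta>' = tgt1 Y \<beta>\<rbrakk> \<Longrightarrow>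
      gray_cell M \<alpha> (comp1 Y \<beta>' \<beta>)
      = vcomp Z (hcomp Z (id2 Z (on_1R M (tgt1 X \<alpha>) \<beta>')) (gray_cell M \<alpha> \<beta>))
                (hcomp Z (gray_cell M \<alpha> \<beta>') (id2 Z (on_1R M (src1 X \<alpha>) \<beta>)))"

record ('o, 'a, 'b, 'c) gray_cat =
  gobj :: "'o set"
  ghom :: "'o \<Rightarrow> 'o \<Rightarrow> ('a, 'b, 'c) two_cat"
  gunit :: "'o \<Rightarrow> 'a"
  gcomp :: "'o \<Rightarrow> 'o \<Rightarrow> 'o \<Rightarrow> ('a, 'b, 'c) gray_map"

text \<open>
  Associativity is an equality of 2-functors out of a threefold Gray tensor product. It is stated on
  the generating objects, 1-cells, 2-cells and Gray cells of that tensor product. In the unit laws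
  no equation for Gray cells occurs, because the unit 2-category has only identity 1-cells.
\<close>

locale gray_category =
  fixes K :: "('o, 'a, 'b, 'c) gray_cat"
  assumes hom_two_category: "\<lbrakk>A \<in> gobj K; B \<in> gobj K\<rbrakk> \<Longrightarrow> two_category (ghom K A B)"
    and unit_in: "A \<in> gobj K \<Longrightarrow> gunit K A \<in> cells0 (ghom K A A)"
    and comp_functor: "\<lbrakk>A \<in> gobj K; B \<in> gobj K; C \<in> gobj K\<rbrakk> \<Longrightarrow>
      gray_two_functor (ghom K B C) (ghom K A B) (ghom K A C) (gcomp K A B C)"
    and assoc_obj: "\<lbrakk>A \<in> gobj K; B \<in> gobj K; C \<in> gobj K; D \<in> gobj K;
        h \<in> cells0 (ghom K C D); g \<in> cells0 (ghom K B C); f \<in> cells0 (ghom K A B)\<rbrakk> \<Longrightarrow>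
      on_obj (gcomp K A B D) (on_obj (gcomp K B C D) h g) f
      = on_obj (gcomp K A C D) h (on_obj (gcomp K A B C) g f)"
    and assoc_1L: "\<lbrakk>A \<in> gobj K; B \<in> gobj K; C \<in> gobj K; D \<in> gobj K;
        \<theta> \<in> cells1 (ghom K C D); g \<in> cells0 (ghom K B C); f \<in> cells0 (ghom K A B)\<rbrakk> \<Longrightarrow>
      on_1L (gcomp K A B D) (on_1L (gcomp K B C D) \<theta> g) f
      = on_1L (gcomp K A C D) \<theta> (on_obj (gcomp K A B C) g f)"
    and assoc_1M: "\<lbrakk>A \<in> gobj K; B \<in> gobj K; C \<in> gobj K; D \<in> gobj K;
        h \<in> cells0 (ghom K C D); \<beta> \<in> cells1 (ghom K B C); f \<in> cells0 (ghom K A B)\<rbrakk> \<Longrightarrow>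
      on_1L (gcomp K A B D) (on_1R (gcomp K B C D) h \<beta>) f
      = on_1R (gcomp K A C D) h (on_1L (gcomp K A B C) \<beta> f)"
    and assoc_1R: "\<lbrakk>A \<in> gobj K; B \<in> gobj K; C \<in> gobj K; D \<in> gobj K;
        h \<in> cells0 (ghom K C D); g \<in> cells0 (ghom K B C); \<alpha> \<in> cells1 (ghom K A B)\<rbrakk> \<Longrightarrow>
      on_1R (gcomp K A B D) (on_obj (gcomp K B C D) h g) \<alpha>
      = on_1R (gcomp K A C D) h (on_1R (gcomp K A B C) g \<alpha>)"
    and assoc_2L: "\<lbrakk>A \<in> gobj K; B \<in> gobj K; C \<in> gobj K; D \<in> gobj K;
        \<Theta> \<in> cells2 (ghom K C D); g \<in> cells0 (ghom K B C); f \<in> cells0 (ghom K A B)\<rbrakk> \<Longrightarrow>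
      on_2L (gcomp K A B D) (on_2L (gcomp K B C D) \<Theta> g) f
      = on_2L (gcomp K A C D) \<Theta> (on_obj (gcomp K A B C) g f)"
    and assoc_2M: "\<lbrakk>A \<in> gobj K; B \<in> gobj K; C \<in> gobj K; D \<in> gobj K;
        h \<in> cells0 (ghom K C D); \<Psi> \<in> cells2 (ghom K B C); f \<in> cells0 (ghom K A B)\<rbrakk> \<Longrightarrow>
      on_2L (gcomp K A B D) (on_2R (gcomp K B C D) h \<Psi>) f
      = on_2R (gcomp K A C D) h (on_2L (gcomp K A B C) \<Psi> f)"
    and assoc_2R: "\<lbrakk>A \<in> gobj K; B \<in> gobj K; C \<in> gobj K; D \<in> gobj K;
        h \<in> cells0 (ghom K C D); g \<in> cells0 (ghom K B C); \<Phi> \<in> cells2 (ghom K A B)\<rbrakk> \<Longrightarrow>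
      on_2R (gcomp K A B D) (on_obj (gcomp K B C D) h g) \<Phi>
      = on_2R (gcomp K A C D) h (on_2R (gcomp K A B C) g \<Phi>)"
    and assoc_gray_LM: "\<lbrakk>A \<in> gobj K; B \<in> gobj K; C \<in> gobj K; D \<in> gobj K;
        \<theta> \<in> cells1 (ghom K C D); \<beta> \<in> cells1 (ghom K B C); f \<in> cells0 (ghom K A B)\<rbrakk> \<Longrightarrow>
      on_2L (gcomp K A B D) (gray_cell (gcomp K B C D) \<theta> \<beta>) f
      = gray_cell (gcomp K A C D) \<theta> (on_1L (gcomp K A B C) \<beta> f)"
    and assoc_gray_LR: "\<lbrakk>A \<in> gobj K; B \<in> gobj K; C \<in> gobj K; D \<in> gobj K;
        \<theta> \<in> cells1 (ghom K C D); g \<in> cells0 (ghom K B C); \<alpha> \<in> cells1 (ghom K A B)\<rbrakk> \<Longrightarrow>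
      gray_cell (gcomp K A B D) (on_1L (gcomp K B C D) \<theta> g) \<alpha>
      = gray_cell (gcomp K A C D) \<theta> (on_1R (gcomp K A B C) g \<alpha>)"
    and assoc_gray_MR: "\<lbrakk>A \<in> gobj K; B \<in> gobj K; C \<in> gobj K; D \<in> gobj K;
        h \<in> cells0 (ghom K C D); \<beta> \<in> cells1 (ghom K B C); \<alpha> \<in> cells1 (ghom K A B)\<rbrakk> \<Longrightarrow>
      gray_cell (gcomp K A B D) (on_1R (gcomp K B C D) h \<beta>) \<alpha>
      = on_2R (gcomp K A C D) h (gray_cell (gcomp K A B C) \<beta> \<alpha>)"
    and unit_left_obj: "\<lbrakk>A \<in> gobj K; B \<in> gobj K; f \<in> cells0 (ghom K A B)\<rbrakk> \<Longrightarrow>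
      on_obj (gcomp K A B B) (gunit K B) f = f"
    and unit_left_1: "\<lbrakk>A \<in> gobj K; B \<in> gobj K; \<alpha> \<in> cells1 (ghom K A B)\<rbrakk> \<Longrightarrow>
      on_1R (gcomp K A B B) (gunit K B) \<alpha> = \<alpha>"
    and unit_left_2: "\<lbrakk>A \<in> gobj K; B \<in> gobj K; \<Phi> \<in> cells2 (ghom K A B)\<rbrakk> \<Longrightarrow>
      on_2R (gcomp K A B B) (gunit K B) \<Phi> = \<Phi>"
    and unit_right_obj: "\<lbrakk>A \<in> gobj K; B \<in> gobj K; f \<in> cells0 (ghom K A B)\<rbrakk> \<Longrightarrow>
      on_obj (gcomp K A A B) f (gunit K A) = f"
    and unit_right_1: "\<lbrakk>A \<in> gobj K; B \<in> gobj K; \<alpha> \<in> cells1 (ghom K A B)\<rbrakk> \<Longrightarrow>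
      on_1L (gcomp K A A B) \<alpha> (gunit K A) = \<alpha>"
    and unit_right_2: "\<lbrakk>A \<in> gobj K; B \<in> gobj K; \<Phi> \<in> cells2 (ghom K A B)\<rbrakk> \<Longrightarrow>
      on_2L (gcomp K A A B) \<Phi> (gunit K A) = \<Phi>"

text \<open>\<open>h \<theta> f\<close> for 1-cells \<open>f: A \<rightarrow> B\<close>, \<open>h: C \<rightarrow> D\<close> of \<open>K\<close> and a 2-cell, respectively 3-cell,
  \<open>\<theta>\<close> of \<open>K\<close> that lives in \<open>K(B,C)\<close>.\<close>

definition whisker1 ::
  "('o, 'a, 'b, 'c) gray_cat \<Rightarrow> 'o \<Rightarrow> 'o \<Rightarrow> 'o \<Rightarrow> 'o \<Rightarrow> 'a \<Rightarrow> 'b \<Rightarrow> 'a \<Rightarrow> 'b" where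
  "whisker1 K A B C D h \<theta> f = on_1R (gcomp K A C D) h (on_1L (gcomp K A B C) \<theta> f)"

definition whisker2 ::
  "('o, 'a, 'b, 'c) gray_cat \<Rightarrow> 'o \<Rightarrow> 'o \<Rightarrow> 'o \<Rightarrow> 'o \<Rightarrow> 'a \<Rightarrow> 'c \<Rightarrow> 'a \<Rightarrow> 'c" where
  "whisker2 K A B C D h \<theta> f = on_2R (gcomp K A C D) h (on_2L (gcomp K A B C) \<theta> f)"


section \<open>Plane graphs and pasting schemes\<close>

text \<open>
  The oriented plane is \<open>\<complex>\<close> with its standard orientation (positive winding is counterclockwise).
  The vertices of a plane digraph are points of the plane, and each arc comes with a parametrised
  curve from its tail to its head.
\<close>

record 'e plane_data =
  graph :: "(complex, 'e) pre_digraph"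
  curve :: "'e \<Rightarrow> real \<Rightarrow> complex"

record 'e scheme_data = "'e plane_data" +
  source :: complex
  sink :: complex

definition support :: "('e, 'z) plane_data_scheme \<Rightarrow> complex set" where
  "support P = verts (graph P) \<union> (\<Union>e \<in> arcs (graph P). path_image (curve P e))"

locale plane_digraph =
  fixes P :: "('e, 'z) plane_data_scheme"
  assumes fin_digraph: "fin_digraph (graph P)"
    and connected: "Digraph_Component.connected (graph P)"
    and curve_simple: "e \<in> arcs (graph P) \<Longrightarrow> simple_path (curve P e)"
    and curve_start: "e \<in> arcs (graph P) \<Longrightarrow> pathstart (curve P e) = tail (graph P) e"
    and curve_finish: "e \<in> arcs (graph P) \<Longrightarrow> pathfinish (curve P e) = head (graph P) e"
    and curve_verts: "e \<in> arcs (graph P) \<Longrightarrow>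
      path_image (curve P e) \<inter> verts (graph P) = {tail (graph P) e, head (graph P) e}"
    and curves_disjoint: "\<lbrakk>e \<in> arcs (graph P); e' \<in> arcs (graph P); e \<noteq> e'\<rbrakk> \<Longrightarrow>
      path_image (curve P e) \<inter> path_image (curve P e') \<subseteq> verts (graph P)"

definition faces :: "('e, 'z) plane_data_scheme \<Rightarrow> complex set set" where
  "faces P = {F \<in> components (- support P). bounded F}"

definition exterior_face :: "('e, 'z) plane_data_scheme \<Rightarrow> complex set" where
  "exterior_face P = outside (support P)"

abbreviation dpath :: "('e, 'z) plane_data_scheme \<Rightarrow> complex \<Rightarrow> 'e list \<Rightarrow> complex \<Rightarrow> bool" where
  "dpath P \<equiv> pre_digraph.awalk (graph P)"

locale pasting_scheme = plane_digraph P for P :: "'e scheme_data" +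
  assumes acyclic: "\<not> (\<exists>p. pre_digraph.cycle (graph P) p)"
    and source_in: "source P \<in> verts (graph P)"
    and sink_in: "sink P \<in> verts (graph P)"
    and source_neq_sink: "source P \<noteq> sink P"
    and source_exterior: "source P \<in> frontier (exterior_face P)"
    and sink_exterior: "sink P \<in> frontier (exterior_face P)"
    and from_source: "v \<in> verts (graph P) \<Longrightarrow> \<exists>p. dpath P (source P) p v"
    and to_sink: "v \<in> verts (graph P) \<Longrightarrow> \<exists>p. dpath P v p (sink P)"

text \<open>The curve traced by a directed path; it is only used for paths with at least one arc.\<close>

fun path_curve :: "('e, 'z) plane_data_scheme \<Rightarrow> 'e list \<Rightarrow> real \<Rightarrow> complex" where
  "path_curve P [] = undefined"
| "path_curve P [e] = curve P e"
| "path_curve P (e # e' # es) = curve P e +++ path_curve P (e' # es)"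

text \<open>The loop that runs along the directed path \<open>p\<close> and back along \<open>q\<close>.\<close>

definition boundary_loop :: "('e, 'z) plane_data_scheme \<Rightarrow> 'e list \<Rightarrow> 'e list \<Rightarrow> real \<Rightarrow> complex" where
  "boundary_loop P p q = path_curve P p +++ reversepath (path_curve P q)"

definition is_face_boundary ::
  "('e, 'z) plane_data_scheme \<Rightarrow> complex set \<Rightarrow> complex \<Rightarrow> complex \<Rightarrow> 'e list \<Rightarrow> 'e list \<Rightarrow> bool" where
  "is_face_boundary P F a b p q \<longleftrightarrow> a \<noteq> b \<and> dpath P a p b \<and> dpath P a q b
     \<and> path_image (boundary_loop P p q) = frontier F
     \<and> (\<forall>z \<in> F. winding_number (boundary_loop P p q) z = - 1)"

definition face_boundary ::
  "('e, 'z) plane_data_scheme \<Rightarrow> complex set \<Rightarrow> complex \<times> complex \<times> 'e list \<times> 'e list" where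
  "face_boundary P F = (THE (a, b, p, q). is_face_boundary P F a b p q)"

definition face_source :: "('e, 'z) plane_data_scheme \<Rightarrow> complex set \<Rightarrow> complex" where
  "face_source P F = (case face_boundary P F of (a, b, p, q) \<Rightarrow> a)"

definition face_sink :: "('e, 'z) plane_data_scheme \<Rightarrow> complex set \<Rightarrow> complex" where
  "face_sink P F = (case face_boundary P F of (a, b, p, q) \<Rightarrow> b)"

definition upper :: "('e, 'z) plane_data_scheme \<Rightarrow> complex set \<Rightarrow> 'e list" where
  "upper P F = (case face_boundary P F of (a, b, p, q) \<Rightarrow> p)"

definition lower :: "('e, 'z) plane_data_scheme \<Rightarrow> complex set \<Rightarrow> 'e list" where
  "lower P F = (case face_boundary P F of (a, b, p, q) \<Rightarrow> q)"

text \<open>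
  The boundary of the exterior face need not be a simple closed curve (the top and the bottom path
  may meet). Traversed clockwise it winds once around every point of every interior face.
\<close>

definition is_outer_boundary :: "'e scheme_data \<Rightarrow> 'e list \<Rightarrow> 'e list \<Rightarrow> bool" where
  "is_outer_boundary P p q \<longleftrightarrow> dpath P (source P) p (sink P) \<and> dpath P (source P) q (sink P)
     \<and> path_image (boundary_loop P p q) = frontier (exterior_face P)
     \<and> (\<forall>F \<in> faces P. \<forall>z \<in> F. winding_number (boundary_loop P p q) z = - 1)"

definition outer_boundary :: "'e scheme_data \<Rightarrow> 'e list \<times> 'e list" where
  "outer_boundary P = (THE (p, q). is_outer_boundary P p q)"

definition top_path :: "'e scheme_data \<Rightarrow> 'e list" where
  "top_path P = fst (outer_boundary P)"

definition bottom_path :: "'e scheme_data \<Rightarrow> 'e list" where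
  "bottom_path P = snd (outer_boundary P)"

definition below :: "'e scheme_data \<Rightarrow> complex set \<Rightarrow> complex set \<Rightarrow> bool" where
  "below P F1 F2 \<longleftrightarrow> F1 \<in> faces P \<and> F2 \<in> faces P \<and> set (lower P F1) \<inter> set (upper P F2) \<noteq> {}"

definition prec :: "'e scheme_data \<Rightarrow> complex set \<Rightarrow> complex set \<Rightarrow> bool" where
  "prec P F1 F2 \<longleftrightarrow> F1 \<in> faces P \<and> F2 \<in> faces P \<and> (\<exists>p. dpath P (face_sink P F1) p (face_source P F2))"


section \<open>The groupoid of choices\<close>

text \<open>
  The construction only depends on the set \<open>A\<close> of letters and the relation \<open>R\<close> whose linear
  extensions are the objects. The quadruple \<open>(U, G, H, V)\<close> is the generator
  \<open>U(GH)^V: UGHV \<rightarrow> UHGV\<close>. A word of generators is written in the order of application.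
\<close>

type_synonym 'f swap = "'f list \<times> 'f \<times> 'f \<times> 'f list"

definition linear_extensions :: "'f set \<Rightarrow> ('f \<Rightarrow> 'f \<Rightarrow> bool) \<Rightarrow> 'f list set" where
  "linear_extensions A R = {xs. distinct xs \<and> set xs = A \<and>
     (\<forall>i < length xs. \<forall>j < length xs. R (xs ! i) (xs ! j) \<longrightarrow> i < j)}"

fun swap_dom :: "'f swap \<Rightarrow> 'f list" where
  "swap_dom (U, G, H, V) = U @ [G, H] @ V"

fun swap_cod :: "'f swap \<Rightarrow> 'f list" where
  "swap_cod (U, G, H, V) = U @ [H, G] @ V"

definition swaps :: "'f set \<Rightarrow> ('f \<Rightarrow> 'f \<Rightarrow> bool) \<Rightarrow> 'f swap set" where
  "swaps A R = {(U, G, H, V). U @ [G, H] @ V \<in> linear_extensions A R \<and> \<not> R G H \<and> \<not> R H G}"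

inductive swap_word ::
  "'f set \<Rightarrow> ('f \<Rightarrow> 'f \<Rightarrow> bool) \<Rightarrow> 'f list \<Rightarrow> 'f swap list \<Rightarrow> 'f list \<Rightarrow> bool" for A R where
  nil: "x \<in> linear_extensions A R \<Longrightarrow> swap_word A R x [] x"
| step: "\<lbrakk>g \<in> swaps A R; swap_word A R (swap_cod g) w y\<rbrakk> \<Longrightarrow> swap_word A R (swap_dom g) (g # w) y"

inductive word_eq ::
  "'f set \<Rightarrow> ('f \<Rightarrow> 'f \<Rightarrow> bool) \<Rightarrow> 'f list \<Rightarrow> 'f list \<Rightarrow> 'f swap list \<Rightarrow> 'f swap list \<Rightarrow> bool"
  for A R where
  refl: "swap_word A R x w y \<Longrightarrow> word_eq A R x y w w"
| sym: "word_eq A R x y w w' \<Longrightarrow> word_eq A R x y w' w"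
| trans: "\<lbrakk>word_eq A R x y w w'; word_eq A R x y w' w''\<rbrakk> \<Longrightarrow> word_eq A R x y w w''"
| append: "\<lbrakk>word_eq A R x y w w'; word_eq A R y z v v'\<rbrakk> \<Longrightarrow> word_eq A R x z (w @ v) (w' @ v')"
| rel_a: "\<lbrakk>(U, G, H, V) \<in> swaps A R; (U, H, G, V) \<in> swaps A R\<rbrakk> \<Longrightarrow>
    word_eq A R (U @ [G, H] @ V) (U @ [G, H] @ V) [(U, G, H, V), (U, H, G, V)] []"
| rel_b: "\<lbrakk>(U, G, H, V @ [K, L] @ W) \<in> swaps A R; (U @ [H, G] @ V, K, L, W) \<in> swaps A R;
      (U @ [G, H] @ V, K, L, W) \<in> swaps A R; (U, G, H, V @ [L, K] @ W) \<in> swaps A R\<rbrakk> \<Longrightarrow>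
    word_eq A R (U @ [G, H] @ V @ [K, L] @ W) (U @ [H, G] @ V @ [L, K] @ W)
      [(U, G, H, V @ [K, L] @ W), (U @ [H, G] @ V, K, L, W)]
      [(U @ [G, H] @ V, K, L, W), (U, G, H, V @ [L, K] @ W)]"
| rel_c: "\<lbrakk>(U, G, H, K # V) \<in> swaps A R; (U @ [H], G, K, V) \<in> swaps A R; (U, H, K, G # V) \<in> swaps A R;
      (U @ [G], H, K, V) \<in> swaps A R; (U, G, K, H # V) \<in> swaps A R; (U @ [K], G, H, V) \<in> swaps A R\<rbrakk> \<Longrightarrow>
    word_eq A R (U @ [G, H, K] @ V) (U @ [K, H, G] @ V)
      [(U, G, H, K # V), (U @ [H], G, K, V), (U, H, K, G # V)]
      [(U @ [G], H, K, V), (U, G, K, H # V), (U @ [K], G, H, V)]"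

definition word_class ::
  "'f set \<Rightarrow> ('f \<Rightarrow> 'f \<Rightarrow> bool) \<Rightarrow> 'f list \<Rightarrow> 'f list \<Rightarrow> 'f swap list \<Rightarrow> 'f swap list set" where
  "word_class A R x y w = {w'. word_eq A R x y w w'}"

type_synonym 'f choice_arrow = "'f list \<times> 'f list \<times> 'f swap list set"

definition linear_extension_groupoid ::
  "'f set \<Rightarrow> ('f \<Rightarrow> 'f \<Rightarrow> bool) \<Rightarrow> ('f list, 'f choice_arrow) cat" where
  "linear_extension_groupoid A R =
     \<lparr>Obj = linear_extensions A R,
      Arr = {(x, y, word_class A R x y w) | x y w. swap_word A R x w y},
      Dom = (\<lambda>(x, y, c). x),
      Cod = (\<lambda>(x, y, c). y),
      Ident = (\<lambda>x. (x, x, word_class A R x x [])),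
      Compose = (\<lambda>(y, z, d) (x, y', c). (x, z, \<Union>w \<in> c. \<Union>v \<in> d. word_class A R x z (w @ v)))\<rparr>"

definition choice_groupoid ::
  "'e scheme_data \<Rightarrow> (complex set list, complex set choice_arrow) cat" where
  "choice_groupoid P = linear_extension_groupoid (faces P) (below P)\<^sup>+\<^sup>+"


section \<open>Labellings and their composites\<close>

record ('o, 'a, 'b, 'e) labelling_data =
  lab0 :: "complex \<Rightarrow> 'o"
  lab1 :: "'e \<Rightarrow> 'a"
  lab2 :: "complex set \<Rightarrow> 'b"

text \<open>The label of the directed path \<open>es\<close> starting at the vertex \<open>u\<close>; the empty path is labelled
  by an identity.\<close>

primrec path_label ::
  "('o, 'a, 'b, 'c) gray_cat \<Rightarrow> 'e scheme_data \<Rightarrow> ('o, 'a, 'b, 'e) labelling_data \<Rightarrow> complex \<Rightarrow> 'e list \<Rightarrow> 'a"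
where
  "path_label K P l u [] = gunit K (lab0 l u)"
| "path_label K P l u (e # es) =
     (let v = head (graph P) e; w = last (pre_digraph.awalk_verts (graph P) v es)
      in on_obj (gcomp K (lab0 l u) (lab0 l v) (lab0 l w)) (path_label K P l v es) (lab1 l e))"

locale labelling =
  fixes K :: "('o, 'a, 'b, 'c) gray_cat"
    and P :: "'e scheme_data"
    and l :: "('o, 'a, 'b, 'e) labelling_data"
  assumes lab0_in: "u \<in> verts (graph P) \<Longrightarrow> lab0 l u \<in> gobj K"
    and lab1_in: "e \<in> arcs (graph P) \<Longrightarrow>
      lab1 l e \<in> cells0 (ghom K (lab0 l (tail (graph P) e)) (lab0 l (head (graph P) e)))"
    and lab2_in: "F \<in> faces P \<Longrightarrow>
      lab2 l F \<in> cells1 (ghom K (lab0 l (face_source P F)) (lab0 l (face_sink P F)))"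
    and src_lab2: "F \<in> faces P \<Longrightarrow>
      src1 (ghom K (lab0 l (face_source P F)) (lab0 l (face_sink P F))) (lab2 l F)
      = path_label K P l (face_source P F) (upper P F)"
    and tgt_lab2: "F \<in> faces P \<Longrightarrow>
      tgt1 (ghom K (lab0 l (face_source P F)) (lab0 l (face_sink P F))) (lab2 l F)
      = path_label K P l (face_source P F) (lower P F)"

definition label_hom ::
  "('o, 'a, 'b, 'c) gray_cat \<Rightarrow> 'e scheme_data \<Rightarrow> ('o, 'a, 'b, 'e) labelling_data \<Rightarrow> ('a, 'b, 'c) two_cat"
where
  "label_hom K P l = ghom K (lab0 l (source P)) (lab0 l (sink P))"

definition whiskered_face ::
  "('o, 'a, 'b, 'c) gray_cat \<Rightarrow> 'e scheme_data \<Rightarrow> ('o, 'a, 'b, 'e) labelling_data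
    \<Rightarrow> 'e list \<Rightarrow> complex set \<Rightarrow> 'e list \<Rightarrow> 'b" where
  "whiskered_face K P l a F b =
     whisker1 K (lab0 l (source P)) (lab0 l (face_source P F)) (lab0 l (face_sink P F)) (lab0 l (sink P))
       (path_label K P l (face_sink P F) b) (lab2 l F) (path_label K P l (source P) a)"

text \<open>
  \<open>vertical_composite K P l \<pi> Fs \<rho> \<theta>\<close>: processing the faces \<open>Fs\<close> in this order transforms the
  path \<open>\<pi>\<close> into \<open>\<rho>\<close>, and \<open>\<theta>\<close> is the vertical composite of the corresponding whiskered 2-cells.
\<close>

inductive vertical_composite ::
  "('o, 'a, 'b, 'c) gray_cat \<Rightarrow> 'e scheme_data \<Rightarrow> ('o, 'a, 'b, 'e) labelling_data
    \<Rightarrow> 'e list \<Rightarrow> complex set list \<Rightarrow> 'e list \<Rightarrow> 'b \<Rightarrow> bool" for K P l where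
  nil: "vertical_composite K P l \<pi> [] \<pi> (id1 (label_hom K P l) (path_label K P l (source P) \<pi>))"
| cons: "vertical_composite K P l (a @ lower P F @ b) Fs \<rho> \<theta> \<Longrightarrow>
    vertical_composite K P l (a @ upper P F @ b) (F # Fs) \<rho>
      (comp1 (label_hom K P l) \<theta> (whiskered_face K P l a F b))"

definition composites ::
  "('o, 'a, 'b, 'c) gray_cat \<Rightarrow> 'e scheme_data \<Rightarrow> ('o, 'a, 'b, 'e) labelling_data \<Rightarrow> 'b set" where
  "composites K P l = {\<theta>. \<exists>Fs \<in> Obj (choice_groupoid P).
     vertical_composite K P l (top_path P) Fs (bottom_path P) \<theta>}"

definition Phi_obj ::
  "('o, 'a, 'b, 'c) gray_cat \<Rightarrow> 'e scheme_data \<Rightarrow> ('o, 'a, 'b, 'e) labelling_data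
    \<Rightarrow> complex set list \<Rightarrow> 'b" where
  "Phi_obj K P l Fs = (THE \<theta>. vertical_composite K P l (top_path P) Fs (bottom_path P) \<theta>)"


section \<open>The canonical functor\<close>

text \<open>\<open>l(u) \<gamma> l(w)\<close>, where \<open>\<gamma>\<close> is the Gray cell of \<open>l(H)l(v)\<close> and \<open>l(G)\<close>.\<close>

definition whiskered_gray_cell ::
  "('o, 'a, 'b, 'c) gray_cat \<Rightarrow> 'e scheme_data \<Rightarrow> ('o, 'a, 'b, 'e) labelling_data
    \<Rightarrow> 'e list \<Rightarrow> complex set \<Rightarrow> 'e list \<Rightarrow> complex set \<Rightarrow> 'e list \<Rightarrow> 'c" where
  "whiskered_gray_cell K P l w G v H u =
     (let S = lab0 l (source P); T = lab0 l (sink P);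
          A = lab0 l (face_source P G); B = lab0 l (face_sink P G);
          C = lab0 l (face_source P H); D = lab0 l (face_sink P H);
          \<gamma> = gray_cell (gcomp K A B D)
                (on_1L (gcomp K B C D) (lab2 l H) (path_label K P l (face_sink P G) v)) (lab2 l G)
      in whisker2 K S A D T (path_label K P l (face_sink P H) u) \<gamma> (path_label K P l (source P) w))"

fun forward_swap ::
  "('o, 'a, 'b, 'c) gray_cat \<Rightarrow> 'e scheme_data \<Rightarrow> ('o, 'a, 'b, 'e) labelling_data
    \<Rightarrow> complex set swap \<Rightarrow> 'c" where
  "forward_swap K P l (U, G, H, V) = (THE \<Gamma>. \<exists>w v u \<theta> \<theta>'.
     vertical_composite K P l (top_path P) U (w @ upper P G @ v @ upper P H @ u) \<theta> \<and>
     vertical_composite K P l (w @ lower P G @ v @ lower P H @ u) V (bottom_path P) \<theta>' \<and>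
     \<Gamma> = hcomp (label_hom K P l) (id2 (label_hom K P l) \<theta>')
           (hcomp (label_hom K P l) (whiskered_gray_cell K P l w G v H u) (id2 (label_hom K P l) \<theta>)))"

fun Phi_swap ::
  "('o, 'a, 'b, 'c) gray_cat \<Rightarrow> 'e scheme_data \<Rightarrow> ('o, 'a, 'b, 'e) labelling_data
    \<Rightarrow> complex set swap \<Rightarrow> 'c" where
  "Phi_swap K P l (U, G, H, V) =
     (if prec P G H then forward_swap K P l (U, G, H, V)
      else inv_arrow (vert_cat (label_hom K P l)) (forward_swap K P l (U, H, G, V)))"

fun Phi_word ::
  "('o, 'a, 'b, 'c) gray_cat \<Rightarrow> 'e scheme_data \<Rightarrow> ('o, 'a, 'b, 'e) labelling_data
    \<Rightarrow> complex set list \<Rightarrow> complex set swap list \<Rightarrow> 'c" where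
  "Phi_word K P l x [] = id2 (label_hom K P l) (Phi_obj K P l x)"
| "Phi_word K P l x (g # w) =
     vcomp (label_hom K P l) (Phi_word K P l (swap_cod g) w) (Phi_swap K P l g)"

fun Phi_arr ::
  "('o, 'a, 'b, 'c) gray_cat \<Rightarrow> 'e scheme_data \<Rightarrow> ('o, 'a, 'b, 'e) labelling_data
    \<Rightarrow> complex set choice_arrow \<Rightarrow> 'c" where
  "Phi_arr K P l (x, y, c) = (THE \<Gamma>. \<forall>w \<in> c. \<Gamma> = Phi_word K P l x w)"

end

theory Submission
  imports Defs "HOL-Complex_Analysis.Riemann_Mapping"
begin

text \<open>
  The theorem combines a statement about words, a statement about plane graphs and a computation
  with Gray cells.

  \<^emph>\<open>Contractibility.\<close> For every relation on a finite set, any two parallel words of swaps are equal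
  modulo the relations (a), (b) and (c). Fix a target \<open>z\<close>. Each linear extension has a canonical word
  to \<open>z\<close>, which moves the letters of \<open>z\<close> to the front one after the other. A swap followed by the
  canonical word of its codomain equals the canonical word of its domain
  (\<open>canonical_word_absorbs_swap\<close>): if the travelling letter crosses both swapped letters this is
  (c), if it stays on one side of them it is (b), and if it is one of them it is (a) or trivial.
  So each hom-set of the groupoid of choices has exactly one arrow (\<open>parallel_words_equal\<close>), and any
  object gives an equivalence with the terminal category.

  \<^emph>\<open>Plane geometry.\<close> For the composites to exist, processing the faces in the order of any linear
  extension must transform the top path into the bottom path. For a path \<open>p\<close> and a point \<open>z\<close> off the
  graph let \<open>w\<^sub>z(p)\<close> be the real part of the total winding number of the arcs of \<open>p\<close> around \<open>z\<close>, and
  order the paths from source to sink by \<open>p \<le> q \<longleftrightarrow> (\<forall>z. w\<^sub>z(p) \<le> w\<^sub>z(q))\<close>. Two such paths that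
  differ contain two internally disjoint paths \<open>\<sigma>\<close> and \<open>\<tau>\<close> that bound a Jordan domain. On this
  domain \<open>w\<^sub>z(p) - w\<^sub>z(q)\<close> is \<open>1\<close> or \<open>-1\<close>: the remaining parts of \<open>p\<close> and \<open>q\<close> form two loops, and for each
  of them the domain is joined to the exterior face by a curve that avoids the loop. Exchanging \<open>\<sigma>\<close> and \<open>\<tau>\<close> yields a least and a
  greatest path. If nothing lies strictly between \<open>p\<close> and \<open>q\<close> in this order, then the domain contains no part of
  the graph, because an arc inside it extends to a path strictly between \<open>p\<close> and \<open>q\<close>. Hence the domain
  is a face, and a maximal chain of paths is a sweep through faces (\<open>sweep_to_extremal\<close>), in which
  \<open>w\<^sub>z\<close> grows by one whenever a face containing \<open>z\<close> is crossed. Every face is crossed: if all paths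
  have the same \<open>w\<^sub>z\<close>, then the argument of \<open>x - z\<close> has a continuous branch along the graph, and
  by a theorem of Borsuk \<open>z\<close> lies in the exterior face (\<open>windings_separate_faces\<close>). This also
  identifies the least and the greatest path with the top and the bottom path. An arc that lies on two
  paths lies on all paths between them (\<open>arc_sandwich\<close>), so an arc is on the upper side of at most
  one face. Consequently the set of arcs of the path reached after some faces depends only on the set
  of these faces, and the single sweep yields one for each linear extension (\<open>sweep_complete\<close>).

  \<^emph>\<open>The functor.\<close> Two adjacent incomparable faces lie side by side on the path reached before them, and
  their order along the path is \<open>\<prec>\<close>. So a swap is sent to a Gray cell or its inverse, whiskered by the
  composites of the other faces. Relation (a) holds by construction, (b) is the interchange law of the
  hom-2-category, and (c) concerns three faces side by side. If they are listed from left to right,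
  (c) is the Yang-Baxter equation (\<open>gray_yang_baxter\<close>), which is naturality of the Gray cells
  \<open>\<gamma>\<^sub>c\<^sub>,\<^sub>-\<close> with respect to the 2-cell \<open>\<gamma>\<^sub>b\<^sub>,\<^sub>a\<close>; the other five orders follow by moving sides of the
  hexagon across the equation.
\<close>

section \<open>Directed paths in an acyclic graph\<close>

hide_const (open) Digraph_Component.connected

sublocale plane_digraph \<subseteq> G: fin_digraph "graph P"
  by (rule fin_digraph)

context pasting_scheme
begin

abbreviation src :: "'e \<Rightarrow> complex" where "src e \<equiv> tail (graph P) e"
abbreviation trg :: "'e \<Rightarrow> complex" where "trg e \<equiv> head (graph P) e"
abbreviation im :: "'e \<Rightarrow> complex set" where "im e \<equiv> path_image (curve P e)"
abbreviation vset :: "complex \<Rightarrow> 'e list \<Rightarrow> complex set" where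
  "vset u p \<equiv> set (pre_digraph.awalk_verts (graph P) u p)"

declare G.awalk_append_iff [simp del] G.awalkE' [rule del]

lemma dpath_append:
  "dpath P u (p @ q) v \<longleftrightarrow> (\<exists>m. dpath P u p m \<and> dpath P m q v)"
  by (metis G.awalk_append_iff G.awlast_of_awalk G.awalk_appendI)

lemma dpath_Cons:
  "dpath P u (e # p) v \<longleftrightarrow> e \<in> arcs (graph P) \<and> u = src e \<and> dpath P (trg e) p v"
  by (rule G.awalk_Cons_iff)

lemma dpath_Nil [simp]: "dpath P u [] v \<longleftrightarrow> u = v \<and> u \<in> verts (graph P)"
  by (rule G.awalk_Nil_iff)

text \<open>
  A path back would close a directed cycle.
\<close>

lemma dpath_no_return:
  assumes "dpath P u p v" "dpath P v q u"
  shows "p = []" "q = []"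
proof -
  have "p @ q = []"
    using assms acyclic G.closed_w_imp_cycle[of "p @ q"] G.awalk_appendI unfolding G.closed_w_def by blast
  then show "p = []" "q = []" by auto
qed

lemma dpath_closed_Nil: "dpath P u p u \<Longrightarrow> p = []"
  using dpath_no_return[of u p u p] by simp

lemma dpath_distinct_verts:
  assumes "dpath P u p v"
  shows "distinct (pre_digraph.awalk_verts (graph P) u p)"
  using G.awalk_not_distinct_decomp[OF assms] dpath_closed_Nil by fastforce

lemma dpath_distinct: "dpath P u p v \<Longrightarrow> distinct p"
  using dpath_distinct_verts G.distinct_verts_imp_distinct by blast

lemma dpath_verts_append:
  assumes "dpath P u p m" "dpath P m q v"
  shows "vset u (p @ q)
       = vset u p \<union> vset m q"
  using G.set_awalk_verts_append[OF assms] .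

lemma dpath_arcs: "dpath P u p v \<Longrightarrow> set p \<subseteq> arcs (graph P)"
  by (auto simp: G.awalk_def)

lemma dpath_start_in: "dpath P u p v \<Longrightarrow> u \<in> vset u p"
  by (rule G.hd_in_awalk_verts)

lemma dpath_finish_in: "dpath P u p v \<Longrightarrow> v \<in> vset u p"
  unfolding G.awalk_def using G.awlast_if_cas last_in_set[OF G.awalk_verts_non_Nil] by metis

lemma dpath_verts_in: "dpath P u p v \<Longrightarrow> x \<in> vset u p \<Longrightarrow> x \<in> verts (graph P)"
  unfolding G.awalk_def using G.awalk_verts_in_verts by blast

lemma dpath_ends_in: "dpath P u p v \<Longrightarrow> u \<in> verts (graph P)" "dpath P u p v \<Longrightarrow> v \<in> verts (graph P)"
  using dpath_verts_in dpath_start_in dpath_finish_in by blast+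

lemma dpath_split_at_vertex:
  assumes "dpath P u p v" "x \<in> vset u p"
  obtains q r where "p = q @ r" "dpath P u q x" "dpath P x r v"
  using G.awalk_decomp[OF assms] by blast

lemma dpath_meet:
  assumes "dpath P u p m" "dpath P m q v"
    and "x \<in> vset u p" "x \<in> vset m q"
  shows "x = m"
proof -
  obtain p1 where p1: "dpath P x p1 m" using dpath_split_at_vertex[OF assms(1,3)] by metis
  obtain q1 where q1: "dpath P m q1 x" using dpath_split_at_vertex[OF assms(2,4)] by metis
  then show ?thesis using dpath_no_return[OF p1 q1] p1 by auto
qed

lemma dpath_same_start_only:
  assumes "dpath P u p v" "e \<in> set p" "src e = u"
  shows "\<exists>p'. p = e # p'"
proof -
  obtain p1 p2 where p: "p = p1 @ e # p2" using assms(2) by (meson split_list)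
  then have "dpath P u p1 u" using assms(1,3) by (auto simp: dpath_append dpath_Cons)
  then show ?thesis using dpath_closed_Nil[of u p1] p by auto
qed

text \<open>
  Two arcs of one path never start at the same vertex, so a path is determined by its set of arcs
  within any path with the same ends.
\<close>

lemma dpath_subset_imp_eq:
  assumes "dpath P u p v" "dpath P u q v" "set p \<subseteq> set q"
  shows "p = q"
  using assms
proof (induction p arbitrary: u q)
  case Nil
  then show ?case using dpath_closed_Nil by auto
next
  case (Cons e p)
  obtain q' where q: "q = e # q'"
    using dpath_same_start_only[OF Cons.prems(2), of e] Cons.prems by (auto simp: dpath_Cons)
  have "distinct (e # p)" using dpath_distinct Cons.prems by blast
  then have "set p \<subseteq> set q'" using Cons.prems q by auto
  then show ?case using Cons q by (auto simp: dpath_Cons)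
qed

lemma dpath_arc_between:
  assumes "dpath P u p v" "e \<in> set p"
  obtains q r where "p = q @ e # r" "dpath P u q (src e)" "dpath P (trg e) r v"
proof -
  obtain p1 p2 where p: "p = p1 @ e # p2" using assms(2) by (meson split_list)
  then show ?thesis using assms(1) that by (auto simp: dpath_append dpath_Cons)
qed

lemma dpath_through_arc:
  assumes "e \<in> arcs (graph P)"
  obtains p q where "dpath P (source P) p (src e)" "dpath P (trg e) q (sink P)"
    "dpath P (source P) (p @ e # q) (sink P)"
proof -
  obtain p q where "dpath P (source P) p (src e)" "dpath P (trg e) q (sink P)"
    using from_source[of "src e"] to_sink[of "trg e"] assms by auto
  then show ?thesis using that assms dpath_append dpath_Cons by blast
qed

lemma dpath_split_at_last:
  assumes "dpath P u p v" "vset u p \<inter> S \<noteq> {}"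
  obtains q r a where "p = q @ r" "dpath P u q a" "dpath P a r v" "a \<in> S" "vset a r \<inter> S = {a}"
proof -
  have "\<exists>x \<in> vset u p. x \<in> S" using assms(2) by blast
  then obtain xs a ys where split: "G.awalk_verts u p = xs @ a # ys" "a \<in> S" "\<forall>y \<in> set ys. y \<notin> S"
    using split_list_last_prop[of "G.awalk_verts u p" "\<lambda>x. x \<in> S"] by blast
  have "G.cas u p v" using assms by (auto simp: G.awalk_def)
  from G.awalk_decomp_verts[OF this split(1)] obtain q r where
    qr: "G.cas u q a" "G.cas a r v" "p = q @ r" "G.awalk_verts a r = a # ys" by metis
  have a: "a \<in> verts (graph P)" using dpath_verts_in[OF assms(1), of a] split(1) by simp
  show ?thesis
    by (rule that[of q r a]) (use qr a split assms in \<open>auto simp: G.awalk_def\<close>)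
qed

lemma dpath_split_at_first:
  assumes "dpath P u p v" "vset u p \<inter> S \<noteq> {}"
  obtains q r b where "p = q @ r" "dpath P u q b" "dpath P b r v" "b \<in> S" "vset u q \<inter> S = {b}"
proof -
  have "\<exists>x \<in> vset u p. x \<in> S" using assms(2) by blast
  then obtain xs b ys where split: "G.awalk_verts u p = xs @ b # ys" "b \<in> S" "\<forall>y \<in> set xs. y \<notin> S"
    using split_list_first_prop[of "G.awalk_verts u p" "\<lambda>x. x \<in> S"] by blast
  have "G.cas u p v" using assms by (auto simp: G.awalk_def)
  from G.awalk_decomp_verts[OF this split(1)] obtain q r where
    qr: "G.cas u q b" "G.cas b r v" "p = q @ r" "G.awalk_verts u q = xs @ [b]" by metis
  have b: "b \<in> verts (graph P)" using dpath_verts_in[OF assms(1), of b] split(1) by simp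
  show ?thesis
    by (rule that[of q r b]) (use qr b split assms in \<open>auto simp: G.awalk_def\<close>)
qed

lemma dpath_arcs_meet:
  assumes "dpath P u p m" "dpath P m q v"
  shows "set p \<inter> set q = {}"
  using dpath_distinct[of u "p @ q" v] assms dpath_append by auto

lemma src_in_vset: "e \<in> set p \<Longrightarrow> src e \<in> vset u p"
  by (rule G.awalk_verts_arc1)

lemma trg_in_vset: "dpath P u p v \<Longrightarrow> e \<in> set p \<Longrightarrow> trg e \<in> vset u p"
  by (rule G.awalk_verts_arc2)

lemma src_neq_trg: "e \<in> arcs (graph P) \<Longrightarrow> src e \<noteq> trg e"
  using dpath_closed_Nil[of "src e" "[e]"] by (auto simp: dpath_Cons)

text \<open>
  Two internally disjoint paths with common ends, that is, a simple closed curve consisting of two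
  directed sides.
\<close>

definition piece :: "complex \<Rightarrow> 'e list \<Rightarrow> 'e list \<Rightarrow> complex \<Rightarrow> bool" where
  "piece a p q b \<longleftrightarrow> dpath P a p b \<and> dpath P a q b \<and> a \<noteq> b \<and> vset a p \<inter> vset a q = {a, b} \<and> set p \<inter> set q = {}"

lemma piece_sym: "piece a p q b \<Longrightarrow> piece a q p b"
  by (auto simp: piece_def)

text \<open>
  The side \<open>\<sigma>\<close> runs along \<open>p\<close> from the last vertex of \<open>q\<close> before \<open>e\<close> to the first vertex
  of \<open>q\<close> after \<open>e\<close>. By acyclicity \<open>q\<close> passes these two vertices in the same order.
\<close>

lemma decompose_at_arc:
  assumes p: "dpath P s p t" and q: "dpath P s q t" and e: "e \<in> set p" "e \<notin> set q"
  obtains X \<sigma> Y X' \<tau> Y' a b where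
    "p = X @ \<sigma> @ Y" "q = X' @ \<tau> @ Y'" "e \<in> set \<sigma>" "piece a \<sigma> \<tau> b" "set \<sigma> \<inter> set q = {}"
    "dpath P s X a" "dpath P s X' a" "dpath P b Y t" "dpath P b Y' t"
proof -
  let ?S = "vset s q"
  obtain p1 p2 where p12: "p = p1 @ e # p2" "dpath P s p1 (src e)" "dpath P (trg e) p2 t"
    using dpath_arc_between[OF p e(1)] .
  have ea: "e \<in> arcs (graph P)" using dpath_arcs p e by blast
  obtain X \<sigma>1 a where 1: "p1 = X @ \<sigma>1" "dpath P s X a" "dpath P a \<sigma>1 (src e)" "a \<in> ?S" "vset a \<sigma>1 \<inter> ?S = {a}"
    using dpath_split_at_last[OF p12(2), of ?S] dpath_start_in[OF q] dpath_start_in[OF p12(2)] by blast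
  obtain \<sigma>2 Y b where 2: "p2 = \<sigma>2 @ Y" "dpath P (trg e) \<sigma>2 b" "dpath P b Y t" "b \<in> ?S" "vset (trg e) \<sigma>2 \<inter> ?S = {b}"
    using dpath_split_at_first[OF p12(3), of ?S] dpath_finish_in[OF q] dpath_finish_in[OF p12(3)] by blast
  let ?\<sigma> = "\<sigma>1 @ e # \<sigma>2"
  have \<sigma>: "dpath P a ?\<sigma> b" using 1 2 ea by (auto simp: dpath_append dpath_Cons)
  have vs: "vset a ?\<sigma> = vset a \<sigma>1 \<union> vset (trg e) \<sigma>2"
    using dpath_verts_append[of a \<sigma>1 "src e" "e # \<sigma>2" b] 1 2 ea dpath_finish_in[OF 1(3)] by (auto simp: dpath_Cons)
  obtain X' q' where q': "q = X' @ q'" "dpath P s X' a" "dpath P a q' t"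
    using dpath_split_at_vertex[OF q 1(4)] .
  have "b \<in> vset a q'"
  proof (rule ccontr)
    assume "b \<notin> vset a q'"
    then have "b \<in> vset s X'" using dpath_verts_append[OF q'(2,3)] q'(1) 2(4) by auto
    then obtain r where "dpath P b r a" using dpath_split_at_vertex[OF q'(2)] by metis
    then show False using dpath_no_return[OF \<sigma>] by auto
  qed
  then obtain \<tau> Y' where \<tau>: "q' = \<tau> @ Y'" "dpath P a \<tau> b" "dpath P b Y' t"
    using dpath_split_at_vertex[OF q'(3)] by metis
  have "vset a \<tau> \<subseteq> ?S"
    using dpath_verts_append[OF q'(2,3)] dpath_verts_append[OF \<tau>(2,3)] q'(1) \<tau>(1) by auto
  then have inter: "vset a ?\<sigma> \<inter> vset a \<tau> = {a, b}"
    using vs 1(5) 2(5) dpath_start_in[OF \<sigma>] dpath_start_in[OF \<tau>(2)] dpath_finish_in[OF \<sigma>] dpath_finish_in[OF \<tau>(2)]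
    by blast
  have ab: "a \<noteq> b" using \<sigma> dpath_closed_Nil by blast
  have "f \<notin> set q" if f: "f \<in> set ?\<sigma>" for f
  proof
    assume fq: "f \<in> set q"
    have "f \<noteq> e" using fq e by blast
    then consider "f \<in> set \<sigma>1" | "f \<in> set \<sigma>2" using f by auto
    then show False
    proof cases
      case 1
      have "src f = a" "trg f = a"
        using 1 fq \<open>vset a \<sigma>1 \<inter> ?S = {a}\<close> src_in_vset trg_in_vset[OF \<open>dpath P a \<sigma>1 (src e)\<close>] trg_in_vset[OF q] by blast+
      then show False using src_neq_trg[of f] dpath_arcs[OF q] fq by auto
    next
      case 2
      have "src f = b" "trg f = b"
        using 2 fq \<open>vset (trg e) \<sigma>2 \<inter> ?S = {b}\<close> src_in_vset trg_in_vset[OF \<open>dpath P (trg e) \<sigma>2 b\<close>] trg_in_vset[OF q] by blast+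
      then show False using src_neq_trg[of f] dpath_arcs[OF q] fq by auto
    qed
  qed
  then have \<sigma>q: "set ?\<sigma> \<inter> set q = {}" by blast
  have "set \<tau> \<subseteq> set q" using q'(1) \<tau>(1) by auto
  then have "piece a ?\<sigma> \<tau> b" using \<sigma> \<tau>(2) ab inter \<sigma>q unfolding piece_def by blast
  moreover have "p = X @ ?\<sigma> @ Y" "q = X' @ \<tau> @ Y'" using p12(1) 1(1) 2(1) q'(1) \<tau>(1) by auto
  ultimately show ?thesis
    using that[of X ?\<sigma> Y X' \<tau> Y' a b] \<sigma>q 1(2) 2(3) q'(2) \<tau>(3) by simp
qed

section \<open>Curves and winding numbers of directed paths\<close>

definition trace :: "complex \<Rightarrow> 'e list \<Rightarrow> complex set" where
  "trace u p = vset u p \<union> (\<Union>e \<in> set p. im e)"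

lemma im_verts: "e \<in> arcs (graph P) \<Longrightarrow> im e \<inter> verts (graph P) = {src e, trg e}"
  by (rule curve_verts)

lemma src_in_im: "e \<in> arcs (graph P) \<Longrightarrow> src e \<in> im e" and trg_in_im: "e \<in> arcs (graph P) \<Longrightarrow> trg e \<in> im e"
  using im_verts by blast+

lemma trace_append:
  "dpath P u p m \<Longrightarrow> dpath P m q v \<Longrightarrow> trace u (p @ q) = trace u p \<union> trace m q"
  using dpath_verts_append by (auto simp: trace_def)

lemma trace_Nil [simp]: "trace u [] = {u}"
  by (simp add: trace_def)

lemma trace_Cons:
  assumes "dpath P u (e # p) v"
  shows "trace u (e # p) = im e \<union> trace (trg e) p"
  using assms src_in_im by (auto simp: trace_def dpath_Cons)

lemma trace_subset_support: "dpath P u p v \<Longrightarrow> trace u p \<subseteq> support P"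
  using dpath_verts_in dpath_arcs by (fastforce simp: trace_def support_def)

lemma vset_subset_trace: "vset u p \<subseteq> trace u p"
  by (simp add: trace_def)

lemma im_subset_trace: "e \<in> set p \<Longrightarrow> im e \<subseteq> trace u p"
  by (auto simp: trace_def)

lemma trace_verts:
  assumes "dpath P u p v" "x \<in> trace u p" "x \<in> verts (graph P)"
  shows "x \<in> vset u p"
proof (cases "x \<in> vset u p")
  case False
  then obtain e where e: "e \<in> set p" "x \<in> im e" using assms(2) by (auto simp: trace_def)
  then have "x = src e \<or> x = trg e" using im_verts[of e] dpath_arcs[OF assms(1)] assms(3) by auto
  then show ?thesis using src_in_vset[OF e(1)] trg_in_vset[OF assms(1) e(1)] by auto
qed

lemma trace_Int:
  assumes "dpath P u p v" "dpath P u' q v'" "set p \<inter> set q = {}"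
  shows "trace u p \<inter> trace u' q = vset u p \<inter> vset u' q"
proof -
  have "x \<in> verts (graph P)" if x: "x \<in> trace u p" "x \<in> trace u' q" for x
  proof (cases "x \<in> vset u p \<union> vset u' q")
    case True
    then show ?thesis using dpath_verts_in[OF assms(1)] dpath_verts_in[OF assms(2)] by blast
  next
    case False
    then obtain e f where "e \<in> set p" "x \<in> im e" "f \<in> set q" "x \<in> im f" using x by (auto simp: trace_def)
    then show ?thesis
      using curves_disjoint[of e f] dpath_arcs[OF assms(1)] dpath_arcs[OF assms(2)] assms(3) by blast
  qed
  then show ?thesis
    using trace_verts[OF assms(1)] trace_verts[OF assms(2)] vset_subset_trace by blast
qed

lemma trace_meet:
  assumes "dpath P u p m" "dpath P m q v"
  shows "trace u p \<inter> trace m q = {m}"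
  using trace_Int[OF assms dpath_arcs_meet[OF assms]] dpath_meet[OF assms]
    dpath_finish_in[OF assms(1)] dpath_start_in[OF assms(2)] by auto

lemma trace_disjoint:
  assumes "dpath P u p m" "dpath P m r m'" "r \<noteq> []" "dpath P m' q v"
  shows "trace u p \<inter> trace m' q = {}"
proof -
  have "trace u (p @ r) \<inter> trace m' q = {m'}"
    using trace_meet[of u "p @ r" m' q v] assms dpath_append by blast
  moreover have "m' \<notin> trace u p"
  proof
    assume "m' \<in> trace u p"
    then have "m' \<in> vset u p" using trace_verts[OF assms(1)] dpath_ends_in[OF assms(4)] by blast
    then obtain r' where "dpath P m' r' m" using dpath_split_at_vertex[OF assms(1)] by metis
    then show False using dpath_no_return[OF assms(2)] assms(3) by blast
  qed
  ultimately show ?thesis using trace_append[OF assms(1,2)] by auto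
qed

lemma curve_arc: "e \<in> arcs (graph P) \<Longrightarrow> arc (curve P e)"
  using curve_simple curve_start curve_finish src_neq_trg arc_simple_path by metis

lemma path_curve_Cons: "p \<noteq> [] \<Longrightarrow> path_curve P (e # p) = curve P e +++ path_curve P p"
  by (cases p) auto

lemma path_curve_arc:
  assumes "dpath P u p v" "p \<noteq> []"
  shows "arc (path_curve P p) \<and> pathstart (path_curve P p) = u \<and> pathfinish (path_curve P p) = v
    \<and> path_image (path_curve P p) = trace u p"
  using assms
proof (induction p arbitrary: u)
  case (Cons e p)
  have e: "e \<in> arcs (graph P)" "u = src e" "dpath P (trg e) p v"
    using Cons.prems by (auto simp: dpath_Cons)
  have c: "arc (curve P e)" "pathstart (curve P e) = u" "pathfinish (curve P e) = trg e"
    using curve_arc curve_start curve_finish e by auto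
  show ?case
  proof (cases "p = []")
    case True
    then show ?thesis using c e trg_in_im[OF e(1)] Cons.prems trace_Cons[of u e p v] by auto
  next
    case False
    note IH = Cons.IH[OF e(3) False]
    have "dpath P u [e] (trg e)" using e by (auto simp: dpath_Cons)
    from trace_meet[OF this e(3)] have m: "trace u [e] \<inter> trace (trg e) p = {trg e}" .
    have "trace u [e] = im e" using e src_in_im trg_in_im by (auto simp: trace_def)
    then have i: "im e \<inter> trace (trg e) p = {trg e}" using m by simp
    have "arc (curve P e +++ path_curve P p)"
      by (rule arc_join) (use c IH i in auto)
    moreover have "path_image (curve P e +++ path_curve P p) = im e \<union> trace (trg e) p"
      using path_image_join[of "curve P e" "path_curve P p"] c IH by simp
    ultimately show ?thesis
      using path_curve_Cons[OF False] c IH trace_Cons[OF Cons.prems(1)] by simp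
  qed
qed simp

text \<open>
  The winding number of a curve that is not closed is in general not real; its real part is the change of
  argument as seen from \<open>z\<close>, in full turns. For two paths with the same ends the difference is the
  winding number of the loop that they form.
\<close>

definition wind :: "complex \<Rightarrow> 'e list \<Rightarrow> real" where
  "wind z p = (\<Sum>e\<leftarrow>p. Re (winding_number (curve P e) z))"

lemma wind_Nil [simp]: "wind z [] = 0"
  and wind_Cons: "wind z (e # p) = Re (winding_number (curve P e) z) + wind z p"
  and wind_append [simp]: "wind z (p @ q) = wind z p + wind z q"
  by (simp_all add: wind_def)

lemma wind_path_curve:
  assumes "dpath P u p v" "p \<noteq> []" "z \<notin> trace u p"
  shows "Re (winding_number (path_curve P p) z) = wind z p"
  using assms
proof (induction p arbitrary: u)
  case (Cons e p)
  have e: "e \<in> arcs (graph P)" "u = src e" "dpath P (trg e) p v"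
    using Cons.prems by (auto simp: dpath_Cons)
  have z: "z \<notin> im e" "z \<notin> trace (trg e) p" using Cons.prems trace_Cons[OF Cons.prems(1)] by auto
  show ?case
  proof (cases "p = []")
    case False
    have "winding_number (curve P e +++ path_curve P p) z
        = winding_number (curve P e) z + winding_number (path_curve P p) z"
      by (rule winding_number_join)
        (use path_curve_arc[OF e(3) False] z e curve_arc curve_finish in \<open>auto intro: arc_imp_path\<close>)
    then show ?thesis using path_curve_Cons[OF False] Cons.IH[OF e(3) False z(2)] by (simp add: wind_Cons)
  qed (simp add: wind_Cons)
qed simp

lemma boundary_loop:
  assumes p: "dpath P u p v" "p \<noteq> []" and q: "dpath P u q v" "q \<noteq> []"
  shows "path (boundary_loop P p q)" "pathfinish (boundary_loop P p q) = pathstart (boundary_loop P p q)"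
    "path_image (boundary_loop P p q) = trace u p \<union> trace u q"
  using path_curve_arc[OF p] path_curve_arc[OF q]
  by (auto simp: boundary_loop_def path_image_join arc_imp_path)

lemma winding_boundary_loop:
  assumes p: "dpath P u p v" "p \<noteq> []" and q: "dpath P u q v" "q \<noteq> []"
    and z: "z \<notin> trace u p" "z \<notin> trace u q"
  shows "winding_number (boundary_loop P p q) z = of_real (wind z p - wind z q)"
proof -
  have "winding_number (boundary_loop P p q) z
      = winding_number (path_curve P p) z + winding_number (reversepath (path_curve P q)) z"
    unfolding boundary_loop_def
    by (rule winding_number_join) (use path_curve_arc[OF p] path_curve_arc[OF q] z in \<open>auto intro: arc_imp_path\<close>)
  also have "\<dots> = winding_number (path_curve P p) z - winding_number (path_curve P q) z"
    using winding_number_reversepath path_curve_arc[OF q] z by (simp add: arc_imp_path)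
  finally have 1: "Re (winding_number (boundary_loop P p q) z) = wind z p - wind z q"
    using wind_path_curve[OF p z(1)] wind_path_curve[OF q z(2)] by simp
  have "winding_number (boundary_loop P p q) z \<in> \<int>"
    by (rule integer_winding_number) (use boundary_loop[OF p q] z in auto)
  then show ?thesis using 1 by (metis Ints_cases Re_complex_of_real of_real_of_int_eq)
qed

lemma compact_trace: "dpath P u p v \<Longrightarrow> compact (trace u p)"
  using path_curve_arc[of u p v] compact_arc_image[of "path_curve P p"] by (cases "p = []") auto

lemma connected_trace: "dpath P u p v \<Longrightarrow> connected (trace u p)"
  using path_curve_arc[of u p v] connected_arc_image[of "path_curve P p"] by (cases "p = []") auto

lemma connected_trace_minus_start:
  assumes "dpath P u p v"
  shows "connected (trace u p - {u})"
proof (cases "p = []")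
  case False
  let ?g = "path_curve P p"
  have g: "arc ?g" "pathstart ?g = u" "path_image ?g = trace u p" using path_curve_arc[OF assms False] by auto
  have "trace u p - {u} = ?g ` {0<..1}"
  proof -
    have "inj_on ?g {0..1}" using g by (simp add: arc_def)
    then have "?g ` ({0..1} - {0}) = ?g ` {0..1} - ?g ` {0}" by (rule inj_on_image_set_diff) auto
    moreover have "{0..1} - {0} = {0<..1::real}" by auto
    ultimately show ?thesis using g by (simp add: path_image_def pathstart_def)
  qed
  moreover have "continuous_on {0<..1} ?g"
    by (rule continuous_on_subset[of "{0..1}"]) (use g in \<open>auto simp: arc_def path_def\<close>)
  ultimately show ?thesis using connected_continuous_image by (metis connected_Ioc)
qed simp

lemma connected_trace_minus_finish:
  assumes "dpath P u p v"
  shows "connected (trace u p - {v})"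
proof (cases "p = []")
  case False
  let ?g = "path_curve P p"
  have g: "arc ?g" "pathfinish ?g = v" "path_image ?g = trace u p" using path_curve_arc[OF assms False] by auto
  have "trace u p - {v} = ?g ` {0..<1}"
  proof -
    have "inj_on ?g {0..1}" using g by (simp add: arc_def)
    then have "?g ` ({0..1} - {1}) = ?g ` {0..1} - ?g ` {1}" by (rule inj_on_image_set_diff) auto
    moreover have "{0..1} - {1} = {0..<1::real}" by auto
    ultimately show ?thesis using g by (simp add: path_image_def pathfinish_def)
  qed
  moreover have "continuous_on {0..<1} ?g"
    by (rule continuous_on_subset[of "{0..1}"]) (use g in \<open>auto simp: arc_def path_def\<close>)
  ultimately show ?thesis using connected_continuous_image by (metis connected_Ico)
qed (use assms in simp)

lemma compact_support: "compact (support P)"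
proof -
  have "compact (\<Union>e \<in> arcs (graph P). im e)"
    by (rule compact_UN[OF G.finite_arcs]) (rule compact_arc_image[OF curve_arc])
  then show ?thesis unfolding support_def
    by (rule compact_Un[OF finite_imp_compact[OF G.finite_verts]])
qed

lemma connected_exterior: "connected (exterior_face P)"
  unfolding exterior_face_def
  by (rule connected_outside) (use compact_support compact_imp_bounded in auto)

lemma unbounded_exterior: "\<not> bounded (exterior_face P)"
  unfolding exterior_face_def
  using compact_support compact_imp_bounded unbounded_outside by blast

lemma exterior_Int_support: "exterior_face P \<inter> support P = {}"
  by (simp add: exterior_face_def outside_no_overlap)

lemma terminal_near_exterior:
  "x \<in> {source P, sink P} \<Longrightarrow> x \<in> closure (exterior_face P)"
  using source_exterior sink_exterior by (auto simp: frontier_def)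

text \<open>
  The set \<open>S\<close> reaches a terminal vertex, which borders the exterior face, without meeting the two
  paths. Hence all points near \<open>S\<close> lie in the unbounded component of the complement of the two paths,
  where the loop that they form has winding number zero.
\<close>

lemma wind_eq_near_connected:
  assumes p: "dpath P u p v" and q: "dpath P u q v"
    and S: "connected S" "S \<inter> trace u p = {}" "S \<inter> trace u q = {}"
    and x: "x \<in> S" "x \<in> {source P, sink P}" and w: "w \<in> S"
  shows "\<forall>\<^sub>F z in nhds w. wind z p = wind z q"
proof (cases "p = []")
  case True
  then show ?thesis using p q dpath_closed_Nil[of u q] by auto
next
  case False
  then have q0: "q \<noteq> []" using p q dpath_closed_Nil[of u p] by auto
  let ?T = "trace u p \<union> trace u q" and ?E = "exterior_face P"
  have T: "compact ?T" using p q by (intro compact_Un compact_trace)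
  have wT: "w \<in> - ?T" using w S by auto
  have "open (- ?T)" by (intro open_Compl compact_imp_closed T)
  then obtain r where r: "r > 0" "ball w r \<subseteq> - ?T" using wT open_contains_ball by blast
  have Ex: "connected (insert x ?E)"
    by (rule connected_intermediate_closure[OF connected_exterior])
      (use terminal_near_exterior[OF x(2)] closure_subset[of ?E] in auto)
  have c1: "connected (S \<union> insert x ?E)" by (rule connected_Un) (use S Ex x in auto)
  have C: "connected (ball w r \<union> (S \<union> insert x ?E))"
  proof (rule connected_Un[OF connected_ball c1])
    have "w \<in> ball w r \<inter> (S \<union> insert x ?E)" using w r(1) by simp
    then show "ball w r \<inter> (S \<union> insert x ?E) \<noteq> {}" by blast
  qed
  have "?E \<inter> ?T = {}"
    using exterior_Int_support trace_subset_support[OF p] trace_subset_support[OF q] by blast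
  then have sub: "ball w r \<union> (S \<union> insert x ?E) \<subseteq> - ?T" using r S x by blast
  have "wind z p = wind z q" if z: "z \<in> ball w r" for z
  proof -
    have "ball w r \<union> (S \<union> insert x ?E) \<subseteq> connected_component_set (- ?T) z"
      by (rule connected_component_maximal) (use C sub z in auto)
    then have "\<not> bounded (connected_component_set (- ?T) z)"
      using unbounded_exterior bounded_subset by (metis (no_types, lifting) Un_subset_iff insert_is_Un)
    then have "z \<in> outside ?T" by (simp add: outside)
    then have "winding_number (boundary_loop P p q) z = 0"
      using boundary_loop[OF p False q q0] winding_number_zero_in_outside by metis
    moreover have "z \<notin> ?T" using sub z by blast
    ultimately show ?thesis using winding_boundary_loop[OF p False q q0] by simp
  qed
  then show ?thesis using r unfolding eventually_nhds_metric by (auto simp: dist_commute)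
qed

end

section \<open>Jordan domains bounded by two paths\<close>

lemma connected_subset_inside_loop:
  fixes c :: "real \<Rightarrow> complex"
  assumes c: "simple_path c" "pathfinish c = pathstart c"
    and "connected S" "S \<inter> path_image c = {}" "S \<inter> inside (path_image c) \<noteq> {}"
  shows "S \<subseteq> inside (path_image c)"
proof (rule ccontr)
  assume "\<not> S \<subseteq> inside (path_image c)"
  then have "S \<inter> frontier (inside (path_image c)) \<noteq> {}"
    using connected_Int_frontier[OF assms(3), of "inside (path_image c)"] assms(5) by blast
  then show False using Jordan_inside_outside[OF c] assms(4) by simp
qed

text \<open>
  An arc with interior points would embed an open subset of the plane into the line.
\<close>

lemma interior_arc_image:
  fixes g :: "real \<Rightarrow> complex"
  assumes "arc g"
  shows "interior (path_image g) = {}"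
proof (rule ccontr)
  assume ne: "interior (path_image g) \<noteq> {}"
  obtain h where h: "homeomorphism {0..1} (path_image g) g h"
    using homeomorphism_arc[OF assms] by blast
  have "continuous_on (interior (path_image g)) h"
    using h interior_subset unfolding homeomorphism_def by (meson continuous_on_subset)
  moreover have "inj_on h (interior (path_image g))"
    using h interior_subset unfolding homeomorphism_def by (metis inj_on_def subsetD)
  ultimately have "DIM(complex) \<le> DIM(real)"
    using invariance_of_dimension[of "interior (path_image g)" h] ne by simp
  then show False by simp
qed

lemma interior_UN_closed_empty:
  fixes B :: "'i \<Rightarrow> complex set"
  assumes "finite A" "\<And>x. x \<in> A \<Longrightarrow> closed (B x)" "\<And>x. x \<in> A \<Longrightarrow> interior (B x) = {}"
  shows "interior (\<Union>x\<in>A. B x) = {}"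
  using assms
proof (induction A rule: finite_induct)
  case (insert x A)
  then show ?case
    using interior_closed_Un_empty_interior[of "B x" "\<Union>x\<in>A. B x"] by simp
qed simp

context pasting_scheme
begin

lemma support_arc:
  assumes "z \<in> support P"
  obtains e where "e \<in> arcs (graph P)" "z \<in> im e"
proof (cases "z \<in> verts (graph P)")
  case True
  obtain p where p: "dpath P (source P) p z" using from_source[OF True] by blast
  obtain q where q: "dpath P z q (sink P)" using to_sink[OF True] by blast
  show ?thesis
  proof (cases "p = []")
    case True
    then obtain e q' where "q = e # q'" using p q source_neq_sink by (cases q) auto
    then show ?thesis using q that[of e] src_in_im by (auto simp: dpath_Cons)
  next
    case False
    then obtain e p' where "p = p' @ [e]" by (metis rev_exhaust)
    then show ?thesis using p that[of e] trg_in_im by (auto simp: dpath_append dpath_Cons)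
  qed
qed (use assms that in \<open>auto simp: support_def\<close>)

lemma meets_complement_of_support:
  assumes "open U" "U \<noteq> {}"
  obtains z where "z \<in> U" "z \<notin> support P"
proof -
  have "interior (support P) = {}"
  proof -
    have "interior (\<Union>e \<in> arcs (graph P). im e) = {}"
      by (rule interior_UN_closed_empty[OF G.finite_arcs])
        (auto intro: closed_arc_image curve_arc simp: interior_arc_image[OF curve_arc])
    moreover have "support P = (\<Union>e \<in> arcs (graph P). im e)"
      using support_arc by (auto simp: support_def)
    ultimately show ?thesis by simp
  qed
  then show ?thesis using assms that interior_maximal[of U "support P"] by blast
qed

definition rim :: "complex \<Rightarrow> 'e list \<Rightarrow> 'e list \<Rightarrow> complex set" where
  "rim a p q = trace a p \<union> trace a q"

lemma piece_dest:
  assumes "piece a p q b"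
  shows "dpath P a p b" "dpath P a q b" "p \<noteq> []" "q \<noteq> []" "trace a p \<inter> trace a q = {a, b}"
    "set p \<inter> set q = {}" "a \<noteq> b"
  using assms trace_Int[of a p b a q b] unfolding piece_def by auto

lemma piece_loop:
  assumes "piece a p q b"
  shows "simple_path (boundary_loop P p q)" "pathfinish (boundary_loop P p q) = pathstart (boundary_loop P p q)"
    "path_image (boundary_loop P p q) = rim a p q"
proof -
  note d = piece_dest[OF assms]
  note pc = path_curve_arc[OF d(1,3)] and qc = path_curve_arc[OF d(2,4)]
  show "simple_path (boundary_loop P p q)"
    unfolding boundary_loop_def
    by (rule simple_path_join_loop) (use pc qc d(5) in \<open>auto intro: arc_reversepath\<close>)
  show "pathfinish (boundary_loop P p q) = pathstart (boundary_loop P p q)"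
    "path_image (boundary_loop P p q) = rim a p q"
    using boundary_loop[OF d(1,3) d(2,4)] by (simp_all add: rim_def)
qed

lemma piece_inside:
  assumes "piece a p q b"
  shows "inside (rim a p q) \<noteq> {}" "open (inside (rim a p q))" "connected (inside (rim a p q))"
    "bounded (inside (rim a p q))" "frontier (inside (rim a p q)) = rim a p q"
    "frontier (outside (rim a p q)) = rim a p q" "connected (outside (rim a p q))"
    "\<not> bounded (outside (rim a p q))" "open (outside (rim a p q))"
  using Jordan_inside_outside[OF piece_loop(1,2)[OF assms]] unfolding piece_loop(3)[OF assms] by blast+

lemma piece_wind:
  assumes "piece a p q b"
  obtains \<epsilon> :: real where "\<epsilon> = 1 \<or> \<epsilon> = - 1" "\<And>z. z \<in> inside (rim a p q) \<Longrightarrow> wind z p - wind z q = \<epsilon>"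
proof -
  note d = piece_dest[OF assms]
  have w: "of_real (wind z p - wind z q) = winding_number (boundary_loop P p q) z" if "z \<in> inside (rim a p q)" for z
  proof -
    have "z \<notin> rim a p q" using that inside_no_overlap[of "rim a p q"] by blast
    then show ?thesis using winding_boundary_loop[OF d(1,3) d(2,4), of z] by (simp add: rim_def)
  qed
  show ?thesis
    using simple_closed_path_winding_number_inside[OF piece_loop(1)[OF assms]]
  proof cases
    case 1
    then have "of_real (wind z p - wind z q) = (of_real 1 :: complex)" if "z \<in> inside (rim a p q)" for z
      using w[OF that] that piece_loop(3)[OF assms] by simp
    then show ?thesis using that[of 1] of_real_eq_iff by blast
  next
    case 2
    then have "of_real (wind z p - wind z q) = (of_real (- 1) :: complex)" if "z \<in> inside (rim a p q)" for z
      using w[OF that] that piece_loop(3)[OF assms] by simp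
    then show ?thesis using that[of "- 1"] of_real_eq_iff by blast
  qed
qed

lemma wind_eq_outside:
  assumes "dpath P a p b" "dpath P a q b" "z \<in> outside T" "trace a p \<subseteq> T" "trace a q \<subseteq> T"
  shows "wind z p = wind z q"
proof (cases "p = []")
  case True
  then show ?thesis using assms dpath_closed_Nil[of a q] by auto
next
  case False
  then have q: "q \<noteq> []" using assms dpath_closed_Nil[of a p] by auto
  have "z \<in> outside (trace a p \<union> trace a q)"
    using outside_mono[of "trace a p \<union> trace a q" T] assms by blast
  moreover from this have "z \<notin> trace a p \<union> trace a q" by (simp add: outside_def)
  ultimately show ?thesis
    using winding_number_zero_in_outside boundary_loop[OF assms(1) False assms(2) q]
      winding_boundary_loop[OF assms(1) False assms(2) q, of z] by auto
qed

lemma piece_wind_outside: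
  assumes "piece a p q b" "z \<notin> rim a p q" "z \<notin> inside (rim a p q)"
  shows "wind z p = wind z q"
proof (rule wind_eq_outside)
  show "dpath P a p b" "dpath P a q b" using piece_dest[OF assms(1)] by auto
  show "z \<in> outside (rim a p q)" using assms(2,3) inside_Un_outside[of "rim a p q"] by blast
qed (auto simp: rim_def)

lemma rim_subset_support: "piece a p q b \<Longrightarrow> rim a p q \<subseteq> support P"
  using trace_subset_support[of a p b] trace_subset_support[of a q b] piece_dest(1,2)[of a p q b]
  unfolding rim_def by simp

lemma exterior_subset_outside:
  assumes "T \<subseteq> support P"
  shows "exterior_face P \<subseteq> outside T"
  using outside_mono[OF assms] by (simp add: exterior_face_def)

text \<open>
  A terminal vertex borders the exterior face, which is connected, unbounded and disjoint from the
  closed curve.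
\<close>

lemma terminal_not_inside:
  assumes "piece a p q b" "x \<in> {source P, sink P}"
  shows "x \<notin> inside (rim a p q)"
proof
  assume "x \<in> inside (rim a p q)"
  then have "inside (rim a p q) \<inter> exterior_face P \<noteq> {}"
    using terminal_near_exterior[OF assms(2)] piece_inside(2)[OF assms(1)]
    using open_Int_closure_eq_empty \<open>x \<in> inside (rim a p q)\<close> by blast
  then show False
    using exterior_subset_outside[OF rim_subset_support[OF assms(1)]] inside_Int_outside[of "rim a p q"] by blast
qed

text \<open>
  A path from \<open>b\<close> to the sink meets the curve in \<open>b\<close> only, so if it entered the domain it could not
  leave it, and the sink would be inside.
\<close>

lemma continuation_not_inside:
  assumes "piece a p q b" "dpath P b Y (sink P)"
  shows "trace b Y \<inter> inside (rim a p q) = {}"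
proof -
  note d = piece_dest[OF assms(1)]
  have m: "trace b Y \<inter> rim a p q = {b}"
    using trace_meet[OF d(1) assms(2)] trace_meet[OF d(2) assms(2)] by (auto simp: rim_def)
  have b: "b \<notin> inside (rim a p q)" using m inside_no_overlap[of "rim a p q"] by blast
  show ?thesis
  proof (rule ccontr)
    assume "trace b Y \<inter> inside (rim a p q) \<noteq> {}"
    then have ne: "(trace b Y - {b}) \<inter> inside (rim a p q) \<noteq> {}" using b by blast
    then have "Y \<noteq> []" by auto
    then have "sink P \<noteq> b" using assms(2) dpath_closed_Nil by blast
    have "trace b Y - {b} \<subseteq> inside (rim a p q)"
      using connected_subset_inside_loop[OF piece_loop(1,2)[OF assms(1)] connected_trace_minus_start[OF assms(2)]]
        m ne unfolding piece_loop(3)[OF assms(1)] by blast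
    moreover have "sink P \<in> trace b Y" using dpath_finish_in[OF assms(2)] vset_subset_trace by blast
    ultimately show False using terminal_not_inside[OF assms(1), of "sink P"] \<open>sink P \<noteq> b\<close> by blast
  qed
qed

lemma approach_not_inside:
  assumes "piece a p q b" "dpath P (source P) X a"
  shows "trace (source P) X \<inter> inside (rim a p q) = {}"
proof -
  note d = piece_dest[OF assms(1)]
  have m: "trace (source P) X \<inter> rim a p q = {a}"
    using trace_meet[OF assms(2) d(1)] trace_meet[OF assms(2) d(2)] by (auto simp: rim_def)
  have a: "a \<notin> inside (rim a p q)" using m inside_no_overlap[of "rim a p q"] by blast
  show ?thesis
  proof (rule ccontr)
    assume "trace (source P) X \<inter> inside (rim a p q) \<noteq> {}"
    then have ne: "(trace (source P) X - {a}) \<inter> inside (rim a p q) \<noteq> {}" using a by blast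
    then have "X \<noteq> []" using assms(2) by auto
    then have "source P \<noteq> a" using assms(2) dpath_closed_Nil by blast
    have "trace (source P) X - {a} \<subseteq> inside (rim a p q)"
      using connected_subset_inside_loop[OF piece_loop(1,2)[OF assms(1)] connected_trace_minus_finish[OF assms(2)]]
        m ne unfolding piece_loop(3)[OF assms(1)] by blast
    moreover have "source P \<in> trace (source P) X" using dpath_start_in[OF assms(2)] vset_subset_trace by blast
    ultimately show False using terminal_not_inside[OF assms(1), of "source P"] \<open>source P \<noteq> a\<close> by blast
  qed
qed

lemma connected_inside_with_rim:
  assumes "piece a p q b"
  shows "connected (inside (rim a p q) \<union> (rim a p q - {x}))"
proof (rule connected_intermediate_closure[OF piece_inside(3)[OF assms]])
  show "inside (rim a p q) \<union> (rim a p q - {x}) \<subseteq> closure (inside (rim a p q))"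
    using piece_inside(5)[OF assms] closure_Un_frontier[of "inside (rim a p q)"] by blast
qed auto

section \<open>The order of paths by winding numbers\<close>

definition spath :: "'e list \<Rightarrow> bool" where
  "spath p \<longleftrightarrow> dpath P (source P) p (sink P)"

definition flanked :: "complex \<Rightarrow> 'e list \<Rightarrow> 'e list \<Rightarrow> complex \<Rightarrow> 'e list \<Rightarrow> 'e list \<Rightarrow> bool" where
  "flanked a p q b X Y \<longleftrightarrow> piece a p q b \<and> dpath P (source P) X a \<and> dpath P b Y (sink P)"

lemma flanked_spath: "flanked a p q b X Y \<Longrightarrow> spath (X @ p @ Y)" "flanked a p q b X Y \<Longrightarrow> spath (X @ q @ Y)"
  using dpath_append by (auto simp: flanked_def piece_def spath_def)

text \<open>
  The closed domain without \<open>b\<close>, extended by \<open>X\<close>, connects its points to the source and avoids both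
  continuations.
\<close>

lemma wind_continuations_eq:
  assumes "flanked a p q b X Y" "dpath P b Y' (sink P)" "w \<in> inside (rim a p q) \<union> (rim a p q - {b})"
  shows "\<forall>\<^sub>F z in nhds w. wind z Y = wind z Y'"
proof -
  have pc: "piece a p q b" and X: "dpath P (source P) X a" and Y: "dpath P b Y (sink P)"
    using assms(1) by (auto simp: flanked_def)
  note d = piece_dest[OF pc]
  let ?S = "(inside (rim a p q) \<union> (rim a p q - {b})) \<union> trace (source P) X"
  have a: "a \<in> rim a p q" "a \<in> trace (source P) X"
    using dpath_start_in[OF d(1)] dpath_finish_in[OF X] vset_subset_trace by (auto simp: rim_def)
  have con: "connected ?S"
    by (rule connected_Un[OF connected_inside_with_rim[OF pc] connected_trace[OF X]]) (use a d(7) in blast)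
  have disj: "?S \<inter> trace b Z = {}" if Z: "dpath P b Z (sink P)" for Z
  proof -
    have "trace (source P) X \<inter> trace b Z = {}" by (rule trace_disjoint[OF X d(1,3) Z])
    moreover have "rim a p q \<inter> trace b Z = {b}"
      using trace_meet[OF d(1) Z] trace_meet[OF d(2) Z] by (auto simp: rim_def)
    ultimately show ?thesis using continuation_not_inside[OF pc Z] by blast
  qed
  show ?thesis
    by (rule wind_eq_near_connected[OF Y assms(2) con disj[OF Y] disj[OF assms(2)], of "source P"])
      (use dpath_start_in[OF X] vset_subset_trace assms(3) in auto)
qed

text \<open>
  The mirror image: the closed domain without \<open>a\<close>, extended by \<open>Y\<close>, connects its points to the
  sink and avoids both approaches.
\<close>

lemma wind_approaches_eq:
  assumes "flanked a p q b X Y" "dpath P (source P) X' a" "w \<in> inside (rim a p q) \<union> (rim a p q - {a})"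
  shows "\<forall>\<^sub>F z in nhds w. wind z X = wind z X'"
proof -
  have pc: "piece a p q b" and X: "dpath P (source P) X a" and Y: "dpath P b Y (sink P)"
    using assms(1) by (auto simp: flanked_def)
  note d = piece_dest[OF pc]
  let ?S = "(inside (rim a p q) \<union> (rim a p q - {a})) \<union> trace b Y"
  have b: "b \<in> rim a p q" "b \<in> trace b Y"
    using dpath_finish_in[OF d(1)] dpath_start_in[OF Y] vset_subset_trace by (auto simp: rim_def)
  have con: "connected ?S"
    by (rule connected_Un[OF connected_inside_with_rim[OF pc] connected_trace[OF Y]]) (use b d(7) in blast)
  have disj: "?S \<inter> trace (source P) Z = {}" if Z: "dpath P (source P) Z a" for Z
  proof -
    have "trace (source P) Z \<inter> trace b Y = {}" by (rule trace_disjoint[OF Z d(1,3) Y])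
    moreover have "rim a p q \<inter> trace (source P) Z = {a}"
      using trace_meet[OF Z d(1)] trace_meet[OF Z d(2)] by (auto simp: rim_def)
    ultimately show ?thesis using approach_not_inside[OF pc Z] by blast
  qed
  show ?thesis
    by (rule wind_eq_near_connected[OF X assms(2) con disj[OF X] disj[OF assms(2)], of "sink P"])
      (use dpath_finish_in[OF Y] vset_subset_trace assms(3) in auto)
qed

text \<open>
  The parts of \<open>p\<close> and \<open>q\<close> outside the piece have equal winding numbers around the points of the
  domain and around the points near its boundary, except at its two corners. So only \<open>\<sigma>\<close> and \<open>\<tau>\<close>
  contribute to the difference.
\<close>

lemma decompose_spaths:
  assumes "spath p" "spath q" "e \<in> set p" "e \<notin> set q"
  obtains X \<sigma> Y X' \<tau> Y' a b \<epsilon> where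
    "p = X @ \<sigma> @ Y" "q = X' @ \<tau> @ Y'" "e \<in> set \<sigma>" "flanked a \<sigma> \<tau> b X Y" "flanked a \<sigma> \<tau> b X' Y'"
    "set \<sigma> \<inter> set q = {}" "set p \<inter> set \<tau> = {}"
    "\<epsilon> = 1 \<or> \<epsilon> = (-1::real)" "\<And>z. z \<in> inside (rim a \<sigma> \<tau>) \<Longrightarrow> wind z \<sigma> - wind z \<tau> = \<epsilon>"
    "\<And>z. z \<in> inside (rim a \<sigma> \<tau>) \<Longrightarrow> wind z p - wind z q = \<epsilon>"
    "\<And>w. w \<in> rim a \<sigma> \<tau> - {a, b} \<Longrightarrow> \<forall>\<^sub>F z in nhds w. wind z p - wind z q = wind z \<sigma> - wind z \<tau>"
proof -
  obtain X \<sigma> Y X' \<tau> Y' a b where dec: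
    "p = X @ \<sigma> @ Y" "q = X' @ \<tau> @ Y'" "e \<in> set \<sigma>" "piece a \<sigma> \<tau> b" "set \<sigma> \<inter> set q = {}"
    "dpath P (source P) X a" "dpath P (source P) X' a" "dpath P b Y (sink P)" "dpath P b Y' (sink P)"
    using decompose_at_arc[of "source P" p "sink P" q e] assms unfolding spath_def by metis
  have fl: "flanked a \<sigma> \<tau> b X Y" "flanked a \<sigma> \<tau> b X' Y'" using dec by (auto simp: flanked_def)
  note d = piece_dest[OF dec(4)]
  have set: "set p \<inter> set \<tau> = {}"
    using d(6) dpath_arcs_meet[OF dec(6) d(2)] dpath_arcs_meet[OF d(2) dec(8)] dec(1) by auto
  obtain \<epsilon> :: real where \<epsilon>: "\<epsilon> = 1 \<or> \<epsilon> = - 1" "\<And>z. z \<in> inside (rim a \<sigma> \<tau>) \<Longrightarrow> wind z \<sigma> - wind z \<tau> = \<epsilon>"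
    using piece_wind[OF dec(4)] by metis
  have near: "\<forall>\<^sub>F z in nhds w. wind z p - wind z q = wind z \<sigma> - wind z \<tau>"
    if "w \<in> inside (rim a \<sigma> \<tau>) \<union> (rim a \<sigma> \<tau> - {a, b})" for w
  proof -
    have "\<forall>\<^sub>F z in nhds w. wind z Y = wind z Y'" "\<forall>\<^sub>F z in nhds w. wind z X = wind z X'"
      using wind_continuations_eq[OF fl(1) dec(9), of w] wind_approaches_eq[OF fl(1) dec(7), of w] that by blast+
    from eventually_conj[OF this] show ?thesis by (rule eventually_mono) (simp add: dec(1,2))
  qed
  have inn: "wind z p - wind z q = \<epsilon>" if "z \<in> inside (rim a \<sigma> \<tau>)" for z
    using eventually_nhds_x_imp_x[OF near[of z]] that \<epsilon>(2)[OF that] by simp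
  show ?thesis
    by (rule that[OF dec(1,2,3) fl dec(5) set \<epsilon> inn near]) auto
qed

lemma detour_smaller:
  assumes "flanked a \<sigma> \<tau> b X Y"
  shows "set \<sigma> \<noteq> {}" "X @ \<sigma> @ Y \<noteq> X @ \<tau> @ Y"
  using assms piece_dest[of a \<sigma> \<tau> b] by (auto simp: flanked_def)

lemma finite_spaths: "finite {p. spath p}"
  by (rule finite_subset[OF _ finite_subset_distinct[OF G.finite_arcs]])
    (auto simp: spath_def dest: dpath_distinct dpath_arcs)

lemma spath_subset_imp_eq: "spath p \<Longrightarrow> spath q \<Longrightarrow> set p \<subseteq> set q \<Longrightarrow> p = q"
  unfolding spath_def by (rule dpath_subset_imp_eq)

text \<open>
  Exchanging one side of a piece does not change the winding number outside the domain and brings \<open>p\<close>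
  closer to \<open>q\<close>; inside the domain the difference is known.
\<close>

lemma wind_spaths_diff:
  assumes "spath p" "spath q" "z \<notin> support P"
  shows "wind z p - wind z q \<in> {-1, 0, 1}"
  using assms
proof (induction "card (set p - set q)" arbitrary: p rule: less_induct)
  case less
  show ?case
  proof (cases "set p \<subseteq> set q")
    case True
    then show ?thesis using spath_subset_imp_eq less by auto
  next
    case False
    then obtain e where e: "e \<in> set p" "e \<notin> set q" by blast
    obtain X \<sigma> Y X' \<tau> Y' a b \<epsilon> where dec: "p = X @ \<sigma> @ Y" "q = X' @ \<tau> @ Y'" "e \<in> set \<sigma>"
      "flanked a \<sigma> \<tau> b X Y" "\<epsilon> = 1 \<or> \<epsilon> = (-1::real)" "\<And>z. z \<in> inside (rim a \<sigma> \<tau>) \<Longrightarrow> wind z p - wind z q = \<epsilon>"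
      by (rule decompose_spaths[OF less.prems(1,2) e]) blast
    have pc: "piece a \<sigma> \<tau> b" using dec(4) by (simp add: flanked_def)
    let ?p = "X @ \<tau> @ Y"
    show ?thesis
    proof (cases "z \<in> inside (rim a \<sigma> \<tau>)")
      case True
      then show ?thesis using dec(5,6) by auto
    next
      case False
      have "z \<notin> rim a \<sigma> \<tau>" using rim_subset_support[OF pc] less.prems(3) by blast
      then have eq: "wind z ?p = wind z p" using piece_wind_outside[OF pc _ False] dec(1) by simp
      have "e \<notin> set ?p" using dec(1,2,3) e dpath_distinct[of "source P" p "sink P"] less.prems(1)
        by (auto simp: spath_def)
      then have "set ?p - set q \<subset> set p - set q" using dec(1,2) e by auto
      then have "card (set ?p - set q) < card (set p - set q)" by (intro psubset_card_mono) auto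
      then show ?thesis using less.hyps[of ?p] flanked_spath(2)[OF dec(4)] less.prems eq by simp
    qed
  qed
qed

lemma spaths_differ:
  assumes "spath p" "spath q" "p \<noteq> q"
  obtains z where "z \<notin> support P" "wind z p \<noteq> wind z q"
proof -
  obtain e where e: "e \<in> set p" "e \<notin> set q" using spath_subset_imp_eq assms by blast
  obtain \<sigma> \<tau> a b X Y and \<epsilon> :: real where dec: "flanked a \<sigma> \<tau> b X Y" "\<epsilon> = 1 \<or> \<epsilon> = -1"
    "\<And>z. z \<in> inside (rim a \<sigma> \<tau>) \<Longrightarrow> wind z p - wind z q = \<epsilon>"
    by (rule decompose_spaths[OF assms(1,2) e]) blast
  then have "piece a \<sigma> \<tau> b" by (simp add: flanked_def)
  then obtain z where "z \<in> inside (rim a \<sigma> \<tau>)" "z \<notin> support P"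
    using meets_complement_of_support piece_inside by metis
  then show ?thesis using that[of z] dec(2) dec(3)[of z] by auto
qed

text \<open>
  With \<open>\<kappa> = 1\<close> this says that \<open>p\<close> runs above \<open>q\<close>: the loop that runs clockwise along \<open>p\<close> and back
  along \<open>q\<close> has negative winding numbers. The value \<open>\<kappa> = -1\<close> gives the opposite order, so
  that least and greatest paths are obtained together.
\<close>

definition above :: "real \<Rightarrow> 'e list \<Rightarrow> 'e list \<Rightarrow> bool" where
  "above \<kappa> p q \<longleftrightarrow> (\<forall>z. z \<notin> support P \<longrightarrow> \<kappa> * wind z p \<le> \<kappa> * wind z q)"

lemma above_refl: "above \<kappa> p p" and above_trans: "above \<kappa> p q \<Longrightarrow> above \<kappa> q r \<Longrightarrow> above \<kappa> p r"
  by (auto simp: above_def intro: order_trans)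

lemma above_antisym:
  assumes "above \<kappa> p q" "above \<kappa> q p" "\<kappa> = 1 \<or> \<kappa> = - 1" "spath p" "spath q"
  shows "p = q"
proof (rule ccontr)
  assume "p \<noteq> q"
  then obtain z where "z \<notin> support P" "wind z p \<noteq> wind z q" using spaths_differ assms by blast
  then show False using assms unfolding above_def by fastforce
qed

lemma minimal_in:
  assumes "C p" "\<And>q. C q \<Longrightarrow> spath q" "\<kappa> = 1 \<or> \<kappa> = (-1::real)"
  obtains m where "C m" "\<And>q. C q \<Longrightarrow> above \<kappa> q m \<Longrightarrow> q = m"
proof -
  let ?f = "\<lambda>p. card {q. spath q \<and> above \<kappa> q p}"
  obtain m where m: "C m" "\<And>q. C q \<Longrightarrow> ?f m \<le> ?f q"
    using ex_has_least_nat[of C p ?f] assms(1) by blast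
  show ?thesis
  proof (rule that[OF m(1)], rule ccontr)
    fix q assume q: "C q" "above \<kappa> q m" "q \<noteq> m"
    have "{r. spath r \<and> above \<kappa> r q} \<subset> {r. spath r \<and> above \<kappa> r m}"
      using q above_trans above_antisym[OF _ _ assms(3)] assms(2) m(1) above_refl by blast
    then have "?f q < ?f m" by (intro psubset_card_mono) (use finite_spaths in auto)
    then show False using m(2)[OF q(1)] by simp
  qed
qed

lemma spath_exists: "\<exists>p. spath p"
  using from_source[OF sink_in] by (auto simp: spath_def)

text \<open>
  A minimal path is least. Wherever it differs from \<open>q\<close> in a piece, the exchange of the sides of this
  piece in the minimal path cannot make it smaller; this fixes the sign of the piece, and the same exchange
  applied to \<open>q\<close> gives a smaller path that has more arcs in common with the minimal one.
\<close>

lemma extremal_spath: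
  assumes \<kappa>: "\<kappa> = 1 \<or> \<kappa> = (-1::real)"
  obtains p where "spath p" "\<And>q. spath q \<Longrightarrow> above \<kappa> p q"
proof -
  obtain m where m: "spath m" "\<And>q. spath q \<Longrightarrow> above \<kappa> q m \<Longrightarrow> q = m"
    using minimal_in[of spath] spath_exists \<kappa> by metis
  have "above \<kappa> m q" if "spath q" for q
    using that
  proof (induction "card (set m - set q)" arbitrary: q rule: less_induct)
    case less
    show ?case
    proof (cases "set m \<subseteq> set q")
      case True
      then show ?thesis using spath_subset_imp_eq less m(1) above_refl by blast
    next
      case False
      then obtain e where e: "e \<in> set m" "e \<notin> set q" by blast
      obtain X \<sigma> Y X' \<tau> Y' a b \<epsilon> where dec: "m = X @ \<sigma> @ Y" "q = X' @ \<tau> @ Y'" "e \<in> set \<sigma>"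
        "flanked a \<sigma> \<tau> b X Y" "flanked a \<sigma> \<tau> b X' Y'" "set m \<inter> set \<tau> = {}" "\<epsilon> = 1 \<or> \<epsilon> = (-1::real)"
        "\<And>z. z \<in> inside (rim a \<sigma> \<tau>) \<Longrightarrow> wind z \<sigma> - wind z \<tau> = \<epsilon>"
        "\<And>z. z \<in> inside (rim a \<sigma> \<tau>) \<Longrightarrow> wind z m - wind z q = \<epsilon>"
        by (rule decompose_spaths[OF m(1) less.prems e]) blast
      have pc: "piece a \<sigma> \<tau> b" using dec(4) by (simp add: flanked_def)
      have out: "wind z \<sigma> = wind z \<tau>" if "z \<notin> support P" "z \<notin> inside (rim a \<sigma> \<tau>)" for z
        using piece_wind_outside[OF pc _ that(2)] rim_subset_support[OF pc] that(1) by blast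
      \<comment> \<open>With the other sign, exchanging the sides of the piece in \<open>m\<close> would give a smaller path.\<close>
      have sign: "\<kappa> * \<epsilon> = - 1"
      proof (rule ccontr)
        assume "\<kappa> * \<epsilon> \<noteq> - 1"
        then have 1: "\<kappa> * \<epsilon> = 1" using \<kappa> dec(7) by auto
        have "\<kappa> * wind z (X @ \<tau> @ Y) \<le> \<kappa> * wind z m" if z: "z \<notin> support P" for z
        proof (cases "z \<in> inside (rim a \<sigma> \<tau>)")
          case True
          have "\<kappa> * wind z m - \<kappa> * wind z (X @ \<tau> @ Y) = \<kappa> * (wind z \<sigma> - wind z \<tau>)"
            by (simp add: dec(1) algebra_simps)
          then show ?thesis using dec(8)[OF True] 1 by simp
        qed (use out[OF z] dec(1) in simp)
        then have "above \<kappa> (X @ \<tau> @ Y) m" by (simp add: above_def)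
        then show False using m(2) flanked_spath(2)[OF dec(4)] detour_smaller(2)[OF dec(4)] dec(1) by metis
      qed
      let ?q = "X' @ \<sigma> @ Y'"
      have "set m - set ?q \<subseteq> set m - set q - {e}" using dec(1,2,3,6) by auto
      then have "card (set m - set ?q) < card (set m - set q)"
        using e by (intro psubset_card_mono) auto
      then have IH: "above \<kappa> m ?q" using less.hyps flanked_spath(1)[OF dec(5)] by blast
      have "\<kappa> * wind z m \<le> \<kappa> * wind z q" if z: "z \<notin> support P" for z
      proof (cases "z \<in> inside (rim a \<sigma> \<tau>)")
        case True
        have "\<kappa> * wind z m - \<kappa> * wind z q = \<kappa> * \<epsilon>"
          using dec(9)[OF True] by (simp add: algebra_simps flip: right_diff_distrib)
        then show ?thesis using sign by simp
      next
        case False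
        then have "wind z q = wind z ?q" using out[OF z] dec(2) by simp
        then show ?thesis using IH z by (simp add: above_def)
      qed
      then show ?thesis by (simp add: above_def)
    qed
  qed
  then show ?thesis using that m(1) by blast
qed

end

section \<open>Neighbouring paths enclose a face\<close>

context pasting_scheme
begin

lemma outside_loop_with_inside:
  assumes "piece a p q b" "z \<in> outside (rim a p q)"
  shows "z \<in> outside (rim a p q \<union> inside (rim a p q))"
proof -
  have eq: "- (rim a p q \<union> inside (rim a p q)) = outside (rim a p q)"
    using inside_Un_outside[of "rim a p q"] inside_Int_outside[of "rim a p q"]
      outside_no_overlap[of "rim a p q"] by blast
  have "outside (rim a p q) \<subseteq> connected_component_set (outside (rim a p q)) z"
    by (rule connected_component_maximal) (use assms piece_inside(7)[OF assms(1)] in auto)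
  then show ?thesis
    unfolding outside[of "rim a p q \<union> inside (rim a p q)"] eq
    using piece_inside(8)[OF assms(1)] bounded_subset by blast
qed

lemma along_piece_to:
  assumes "piece a \<sigma> \<tau> b" "x \<in> vset a \<sigma> \<union> vset a \<tau>"
  obtains d where "dpath P a d x" "set d \<subseteq> set \<sigma> \<union> set \<tau>" "trace a d \<subseteq> rim a \<sigma> \<tau>"
proof -
  note pd = piece_dest[OF assms(1)]
  consider "x \<in> vset a \<sigma>" | "x \<in> vset a \<tau>" using assms(2) by blast
  then show ?thesis
  proof cases
    case 1
    obtain d r where "\<sigma> = d @ r" "dpath P a d x" "dpath P x r b" using dpath_split_at_vertex[OF pd(1) 1] .
    then show ?thesis using that[of d] trace_append[of a d x r b] by (auto simp: rim_def)
  next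
    case 2
    obtain d r where "\<tau> = d @ r" "dpath P a d x" "dpath P x r b" using dpath_split_at_vertex[OF pd(2) 2] .
    then show ?thesis using that[of d] trace_append[of a d x r b] by (auto simp: rim_def)
  qed
qed

lemma along_piece_from:
  assumes "piece a \<sigma> \<tau> b" "x \<in> vset a \<sigma> \<union> vset a \<tau>"
  obtains d where "dpath P x d b" "set d \<subseteq> set \<sigma> \<union> set \<tau>" "trace x d \<subseteq> rim a \<sigma> \<tau>"
proof -
  note pd = piece_dest[OF assms(1)]
  consider "x \<in> vset a \<sigma>" | "x \<in> vset a \<tau>" using assms(2) by blast
  then show ?thesis
  proof cases
    case 1
    obtain r d where "\<sigma> = r @ d" "dpath P a r x" "dpath P x d b" using dpath_split_at_vertex[OF pd(1) 1] .
    then show ?thesis using that[of d] trace_append[of a r x d b] by (auto simp: rim_def)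
  next
    case 2
    obtain r d where "\<tau> = r @ d" "dpath P a r x" "dpath P x d b" using dpath_split_at_vertex[OF pd(2) 2] .
    then show ?thesis using that[of d] trace_append[of a r x d b] by (auto simp: rim_def)
  qed
qed

lemma trace_Int_rim:
  assumes "piece a \<sigma> \<tau> b" "dpath P u p v" "set p \<inter> (set \<sigma> \<union> set \<tau>) = {}"
  shows "trace u p \<inter> rim a \<sigma> \<tau> = vset u p \<inter> (vset a \<sigma> \<union> vset a \<tau>)"
  using trace_Int[OF assms(2) piece_dest(1)[OF assms(1)]] trace_Int[OF assms(2) piece_dest(2)[OF assms(1)]] assms(3)
  unfolding rim_def by blast

lemma arc_off_piece:
  assumes "piece a \<sigma> \<tau> b" "z \<in> im e" "z \<in> inside (rim a \<sigma> \<tau>)"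
  shows "e \<notin> set \<sigma>" "e \<notin> set \<tau>"
  using assms im_subset_trace[of e \<sigma> a] im_subset_trace[of e \<tau> a] inside_no_overlap[of "rim a \<sigma> \<tau>"]
  unfolding rim_def by blast+

lemma avoids_piece_arcs:
  assumes "piece a \<sigma> \<tau> b" "dpath P u p v" "vset u p \<inter> (vset a \<sigma> \<union> vset a \<tau>) \<subseteq> {x}"
  shows "set p \<inter> (set \<sigma> \<union> set \<tau>) = {}"
proof (rule ccontr)
  assume "set p \<inter> (set \<sigma> \<union> set \<tau>) \<noteq> {}"
  then obtain f where f: "f \<in> set p" "f \<in> set \<sigma> \<union> set \<tau>" by blast
  note pd = piece_dest[OF assms(1)]
  have "src f \<in> vset a \<sigma> \<union> vset a \<tau>" "trg f \<in> vset a \<sigma> \<union> vset a \<tau>"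
    using f(2) src_in_vset[of f] trg_in_vset[OF pd(1), of f] trg_in_vset[OF pd(2), of f] by blast+
  then have "src f = x" "trg f = x"
    using assms(3) src_in_vset[OF f(1)] trg_in_vset[OF assms(2) f(1)] by blast+
  then show False using src_neq_trg[of f] dpath_arcs[OF assms(2)] f(1) by auto
qed

text \<open>
  Otherwise the path from the source up to the end of \<open>e\<close> would lead into the domain without crossing its
  boundary.
\<close>

lemma enters_piece_before:
  assumes pc: "piece a \<sigma> \<tau> b" and e: "e \<in> arcs (graph P)" "z \<in> im e" "z \<in> inside (rim a \<sigma> \<tau>)"
    and r: "dpath P (source P) r (src e)"
  shows "vset (source P) r \<inter> (vset a \<sigma> \<union> vset a \<tau>) \<noteq> {}"
proof
  assume none: "vset (source P) r \<inter> (vset a \<sigma> \<union> vset a \<tau>) = {}"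
  let ?r = "r @ [e]" and ?V = "vset a \<sigma> \<union> vset a \<tau>" and ?J = "rim a \<sigma> \<tau>"
  have e1: "dpath P (src e) [e] (trg e)" using e(1) by (auto simp: dpath_Cons)
  have re: "dpath P (source P) ?r (trg e)" using r e1 dpath_append by blast
  have "set ?r \<inter> (set \<sigma> \<union> set \<tau>) = {}"
    using avoids_piece_arcs[OF pc r, of "src e"] none arc_off_piece[OF pc e(2,3)] by auto
  from trace_Int_rim[OF pc re this]
  have TJ: "trace (source P) ?r \<inter> ?J = vset (source P) ?r \<inter> ?V" .
  have "vset (source P) ?r = vset (source P) r \<union> {src e, trg e}"
    using dpath_verts_append[OF r e1] by simp
  then have TJ': "trace (source P) ?r \<inter> ?J \<subseteq> {trg e}" unfolding TJ using none dpath_finish_in[OF r] by blast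
  \<comment> \<open>The head of \<open>e\<close> may lie on the curve; without it the trace is still connected.\<close>
  define S where "S = trace (source P) ?r - (if trg e \<in> ?J then {trg e} else {})"
  have SJ: "S \<inter> ?J = {}" using TJ' unfolding S_def by auto
  have "connected S"
    unfolding S_def using connected_trace_minus_finish[OF re] connected_trace[OF re] by auto
  have "z \<notin> ?J" using e(3) inside_no_overlap[of ?J] by blast
  then have "z \<in> S" using e(2) im_subset_trace[of e ?r "source P"] unfolding S_def by auto
  then have "S \<subseteq> inside ?J"
    using connected_subset_inside_loop[OF piece_loop(1,2)[OF pc] \<open>connected S\<close>] SJ e(3)
    unfolding piece_loop(3)[OF pc] by blast
  moreover have "source P \<in> trace (source P) ?r" using dpath_start_in[OF re] vset_subset_trace by blast
  then have "source P \<in> S" using dpath_closed_Nil[of "trg e" ?r] re unfolding S_def by auto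
  ultimately show False using terminal_not_inside[OF pc, of "source P"] by blast
qed

lemma leaves_piece_after:
  assumes pc: "piece a \<sigma> \<tau> b" and e: "e \<in> arcs (graph P)" "z \<in> im e" "z \<in> inside (rim a \<sigma> \<tau>)"
    and r: "dpath P (trg e) r (sink P)"
  shows "vset (trg e) r \<inter> (vset a \<sigma> \<union> vset a \<tau>) \<noteq> {}"
proof
  assume none: "vset (trg e) r \<inter> (vset a \<sigma> \<union> vset a \<tau>) = {}"
  let ?r = "e # r" and ?V = "vset a \<sigma> \<union> vset a \<tau>" and ?J = "rim a \<sigma> \<tau>"
  have re: "dpath P (src e) ?r (sink P)" using r e(1) dpath_Cons by blast
  have "set ?r \<inter> (set \<sigma> \<union> set \<tau>) = {}"
    using avoids_piece_arcs[OF pc r, of "src e"] none arc_off_piece[OF pc e(2,3)] by auto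
  from trace_Int_rim[OF pc re this]
  have TJ: "trace (src e) ?r \<inter> ?J = vset (src e) ?r \<inter> ?V" .
  moreover have "vset (src e) ?r = insert (src e) (vset (trg e) r)" by simp
  ultimately have TJ': "trace (src e) ?r \<inter> ?J \<subseteq> {src e}" using none by blast
  define S where "S = trace (src e) ?r - (if src e \<in> ?J then {src e} else {})"
  have SJ: "S \<inter> ?J = {}" using TJ' unfolding S_def by auto
  have "connected S"
    unfolding S_def using connected_trace_minus_start[OF re] connected_trace[OF re] by auto
  have "z \<notin> ?J" using e(3) inside_no_overlap[of ?J] by blast
  then have "z \<in> S" using e(2) im_subset_trace[of e ?r "src e"] unfolding S_def by auto
  then have "S \<subseteq> inside ?J"
    using connected_subset_inside_loop[OF piece_loop(1,2)[OF pc] \<open>connected S\<close>] SJ e(3)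
    unfolding piece_loop(3)[OF pc] by blast
  moreover have "sink P \<in> trace (src e) ?r" using dpath_finish_in[OF re] vset_subset_trace by blast
  then have "sink P \<in> S" using dpath_closed_Nil[of "src e" ?r] re unfolding S_def by auto
  ultimately show False using terminal_not_inside[OF pc, of "sink P"] by blast
qed

text \<open>
  An arc inside the domain lies on a path from source to sink, which crosses the boundary before and
  after this arc. The part between the two crossings nearest to the arc stays inside; it is completed to a
  path from \<open>a\<close> to \<open>b\<close> along the sides.
\<close>

lemma path_through_inside:
  assumes pc: "piece a \<sigma> \<tau> b" and z: "z \<in> inside (rim a \<sigma> \<tau>)" "z \<in> support P"
  obtains \<rho> where "dpath P a \<rho> b" "\<rho> \<noteq> \<sigma>" "\<rho> \<noteq> \<tau>" "trace a \<rho> \<subseteq> rim a \<sigma> \<tau> \<union> inside (rim a \<sigma> \<tau>)"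
proof -
  let ?V = "vset a \<sigma> \<union> vset a \<tau>" and ?J = "rim a \<sigma> \<tau>"
  obtain e where e: "e \<in> arcs (graph P)" "z \<in> im e" using support_arc[OF z(2)] .
  obtain r1 r2 where r1: "dpath P (source P) r1 (src e)" and r2: "dpath P (trg e) r2 (sink P)"
    using dpath_through_arc[OF e(1)] by metis
  obtain q1 c1 x where c1: "dpath P x c1 (src e)" "x \<in> ?V" "vset x c1 \<inter> ?V = {x}"
    using dpath_split_at_last[OF r1 enters_piece_before[OF pc e z(1) r1]] by metis
  obtain c2 q2 y where c2: "dpath P (trg e) c2 y" "y \<in> ?V" "vset (trg e) c2 \<inter> ?V = {y}"
    using dpath_split_at_first[OF r2 leaves_piece_after[OF pc e z(1) r2]] by metis
  let ?c = "c1 @ e # c2"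
  have c: "dpath P x ?c y" using c1(1) c2(1) e(1) by (auto simp: dpath_append dpath_Cons)
  have xy: "x \<noteq> y" using dpath_closed_Nil c by blast
  have "vset x ?c = vset x c1 \<union> vset (trg e) c2"
    using dpath_verts_append[of x c1 "src e" "e # c2" y] c1 c2 e(1) dpath_finish_in[OF c1(1)]
    by (auto simp: dpath_Cons)
  then have vc: "vset x ?c \<inter> ?V = {x, y}" using c1(3) c2(3) by auto
  have off: "set ?c \<inter> (set \<sigma> \<union> set \<tau>) = {}"
    using avoids_piece_arcs[OF pc c1(1), of x] avoids_piece_arcs[OF pc c2(1), of y] c1(3) c2(3)
      arc_off_piece[OF pc e(2) z(1)] by auto
  have TJ: "trace x ?c \<inter> ?J = {x, y}" using trace_Int_rim[OF pc c off] vc by simp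
  have con: "connected (trace x ?c - {x, y})"
    using connected_simple_path_endless[OF arc_imp_simple_path, of "path_curve P ?c"] path_curve_arc[OF c] by simp
  have "z \<in> trace x ?c - {x, y}"
  proof -
    have "z \<notin> ?J" using z(1) inside_no_overlap[of ?J] by blast
    then have "z \<noteq> x" "z \<noteq> y" using TJ by auto
    then show ?thesis using e(2) im_subset_trace[of e ?c x] by auto
  qed
  then have "trace x ?c - {x, y} \<subseteq> inside ?J"
    using connected_subset_inside_loop[OF piece_loop(1,2)[OF pc] con] TJ z(1)
    unfolding piece_loop(3)[OF pc] by blast
  then have Tc: "trace x ?c \<subseteq> ?J \<union> inside ?J" using TJ by blast
  obtain d1 where d1: "dpath P a d1 x" "trace a d1 \<subseteq> ?J" using along_piece_to[OF pc c1(2)] by metis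
  obtain d2 where d2: "dpath P y d2 b" "trace y d2 \<subseteq> ?J" using along_piece_from[OF pc c2(2)] by metis
  let ?\<rho> = "d1 @ ?c @ d2"
  have cd: "dpath P x (?c @ d2) b" using c d2(1) dpath_append by blast
  have "dpath P a ?\<rho> b" using d1(1) cd dpath_append by blast
  moreover have "trace a ?\<rho> \<subseteq> ?J \<union> inside ?J"
    using trace_append[OF d1(1) cd] trace_append[OF c d2(1)] d1(2) d2(2) Tc by auto
  moreover have "?\<rho> \<noteq> \<sigma>" "?\<rho> \<noteq> \<tau>" using arc_off_piece[OF pc e(2) z(1)] by auto
  ultimately show ?thesis using that by blast
qed

text \<open>
  The path directly below \<open>p\<close> arises from \<open>p\<close> by exchanging one side of a piece. An arc inside
  this piece would give a path strictly in between, because winding numbers of two paths differ by at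
  most one.
\<close>

lemma cover_step:
  assumes p: "spath p" and q: "spath q" "above 1 p q" "q \<noteq> p"
  obtains X Y a \<sigma> \<tau> b where "p = X @ \<sigma> @ Y" "flanked a \<sigma> \<tau> b X Y" "inside (rim a \<sigma> \<tau>) \<inter> support P = {}"
    "\<And>z. z \<in> inside (rim a \<sigma> \<tau>) \<Longrightarrow> wind z \<sigma> - wind z \<tau> = - 1"
proof -
  let ?C = "\<lambda>r. spath r \<and> above 1 p r \<and> r \<noteq> p"
  obtain p' where p': "?C p'" and min: "\<And>r. ?C r \<Longrightarrow> above 1 r p' \<Longrightarrow> r = p'"
    by (rule minimal_in[of ?C q 1]) (use q in auto)
  obtain e where e: "e \<in> set p" "e \<notin> set p'" using spath_subset_imp_eq p p' by blast
  obtain X \<sigma> Y a \<tau> b \<epsilon> where dec: "p = X @ \<sigma> @ Y" "flanked a \<sigma> \<tau> b X Y" "\<epsilon> = 1 \<or> \<epsilon> = (-1::real)"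
    "\<And>z. z \<in> inside (rim a \<sigma> \<tau>) \<Longrightarrow> wind z \<sigma> - wind z \<tau> = \<epsilon>"
    "\<And>z. z \<in> inside (rim a \<sigma> \<tau>) \<Longrightarrow> wind z p - wind z p' = \<epsilon>"
    by (rule decompose_spaths[OF p conjunct1[OF p'] e]) blast
  have pc: "piece a \<sigma> \<tau> b" using dec(2) by (simp add: flanked_def)
  note pd = piece_dest[OF pc]
  let ?J = "rim a \<sigma> \<tau>" and ?p = "X @ \<tau> @ Y"
  obtain z where z: "z \<in> inside ?J" "z \<notin> support P"
    using meets_complement_of_support piece_inside[OF pc] by metis
  then have \<epsilon>: "\<epsilon> = - 1" using dec(3) dec(5)[of z] p' unfolding above_def by fastforce
  have out: "wind z \<sigma> = wind z \<tau>" if "z \<notin> support P" "z \<notin> inside ?J" for z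
    using piece_wind_outside[OF pc _ that(2)] rim_subset_support[OF pc] that(1) by blast
  have "?C ?p"
  proof (intro conjI)
    show "spath ?p" using flanked_spath(2)[OF dec(2)] .
    show "?p \<noteq> p" using detour_smaller(2)[OF dec(2)] dec(1) by metis
    have "wind z p \<le> wind z ?p" if "z \<notin> support P" for z
      using dec(4)[of z] out[OF that] \<epsilon> dec(1) by (cases "z \<in> inside ?J") auto
    then show "above 1 p ?p" by (simp add: above_def)
  qed
  moreover have "above 1 ?p p'"
  proof -
    have "wind z ?p \<le> wind z p'" if zs: "z \<notin> support P" for z
    proof (cases "z \<in> inside ?J")
      case True
      then show ?thesis using dec(4,5)[of z] dec(1) by simp
    next
      case False
      then have "wind z ?p = wind z p" using out[OF zs] dec(1) by simp
      then show ?thesis using p' zs by (simp add: above_def)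
    qed
    then show ?thesis by (simp add: above_def)
  qed
  ultimately have peq: "?p = p'" using min by blast
  have "inside ?J \<inter> support P = {}"
  proof (rule ccontr)
    assume "inside ?J \<inter> support P \<noteq> {}"
    then obtain z0 where z0: "z0 \<in> inside ?J" "z0 \<in> support P" by blast
    obtain \<rho> where \<rho>: "dpath P a \<rho> b" "\<rho> \<noteq> \<sigma>" "\<rho> \<noteq> \<tau>" "trace a \<rho> \<subseteq> ?J \<union> inside ?J"
      using path_through_inside[OF pc z0] .
    let ?r = "X @ \<rho> @ Y"
    have r: "spath ?r" using dec(2) \<rho>(1) dpath_append unfolding spath_def flanked_def by blast
    have out': "wind z \<rho> = wind z \<sigma>" if "z \<notin> support P" "z \<notin> inside ?J" for z
    proof (rule wind_eq_outside[OF \<rho>(1) pd(1)])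
      have "z \<in> outside ?J"
        using that rim_subset_support[OF pc] inside_Un_outside[of ?J] by blast
      then show "z \<in> outside (?J \<union> inside ?J)" by (rule outside_loop_with_inside[OF pc])
    qed (use \<rho>(4) in \<open>auto simp: rim_def\<close>)
    have rng: "wind z p \<le> wind z ?r \<and> wind z ?r \<le> wind z p'" if zs: "z \<notin> support P" for z
    proof (cases "z \<in> inside ?J")
      case True
      have "wind z p - wind z p' = - 1" using dec(5)[OF True] \<epsilon> by simp
      then show ?thesis
        using wind_spaths_diff[OF r p zs] wind_spaths_diff[OF conjunct1[OF p'] r zs] by auto
    next
      case False
      then show ?thesis using out'[OF zs False] out[OF zs False] dec(1) peq by auto
    qed
    then have "above 1 p ?r" "above 1 ?r p'" by (simp_all add: above_def)
    moreover have "?r \<noteq> p" using \<rho>(2) dec(1) by simp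
    ultimately have "?r = p'" using min r by blast
    then have "X @ \<rho> @ Y = X @ \<tau> @ Y" using peq by simp
    then show False using \<rho>(3) by simp
  qed
  then show ?thesis using that[OF dec(1,2)] dec(4) \<epsilon> by blast
qed

lemma arc_covered:
  assumes f: "f \<in> arcs (graph P)" and A: "A \<subseteq> arcs (graph P)"
    and sub: "im f \<subseteq> verts (graph P) \<union> (\<Union>g \<in> A. im g)"
  shows "f \<in> A"
proof (rule ccontr)
  assume nf: "f \<notin> A"
  have "im f \<subseteq> verts (graph P)"
  proof
    fix x assume x: "x \<in> im f"
    show "x \<in> verts (graph P)"
    proof (rule ccontr)
      assume nv: "x \<notin> verts (graph P)"
      then obtain g where "g \<in> A" "x \<in> im g" using sub x by blast
      then show False using curves_disjoint[OF f, of g] A nf x nv by blast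
    qed
  qed
  then have "im f = {src f, trg f}" using im_verts[OF f] by blast
  moreover have "connected (im f)" using connected_arc_image[OF curve_arc[OF f]] .
  ultimately show False using connected_finite_iff_sing[of "im f"] src_neq_trg[OF f] by auto
qed

lemma traces_determine_arcs:
  assumes "dpath P a p b" "dpath P a q b" "dpath P a' p' b'" "dpath P a' q' b'"
    and "trace a p \<union> trace a q \<subseteq> trace a' p' \<union> trace a' q'"
  shows "set p \<union> set q \<subseteq> set p' \<union> set q'"
proof
  fix f assume f: "f \<in> set p \<union> set q"
  have "im f \<subseteq> trace a' p' \<union> trace a' q'"
    using f im_subset_trace[of f p a] im_subset_trace[of f q a] assms(5) by auto
  moreover have "\<dots> \<subseteq> verts (graph P) \<union> (\<Union>g \<in> set p' \<union> set q'. im g)"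
    using dpath_verts_in[OF assms(3)] dpath_verts_in[OF assms(4)] by (auto simp: trace_def)
  ultimately show "f \<in> set p' \<union> set q'"
    using arc_covered[of f "set p' \<union> set q'"] f dpath_arcs assms(1-4) by blast
qed

lemma dpath_no_arc_into_start:
  assumes "dpath P a p b" "g \<in> set p"
  shows "trg g \<noteq> a"
proof
  assume "trg g = a"
  obtain q r where "dpath P a q (src g)" "p = q @ g # r" using dpath_arc_between[OF assms] .
  then have "dpath P a (q @ [g]) a"
    using \<open>trg g = a\<close> dpath_arcs[OF assms(1)] assms(2) dpath_ends_in(1)[OF assms(1)]
    by (auto simp: dpath_append dpath_Cons)
  then show False using dpath_closed_Nil by blast
qed

lemma dpath_no_arc_out_of_finish:
  assumes "dpath P a p b" "g \<in> set p"
  shows "src g \<noteq> b"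
proof
  assume "src g = b"
  obtain q r where "dpath P (trg g) r b" "p = q @ g # r" using dpath_arc_between[OF assms] .
  then have "dpath P b (g # r) b"
    using \<open>src g = b\<close> dpath_arcs[OF assms(1)] assms(2) by (auto simp: dpath_Cons)
  then show False using dpath_closed_Nil by blast
qed

text \<open>
  A path on the boundary curve cannot change sides at an inner vertex, since the sides have only their
  ends in common.
\<close>

lemma dpath_in_piece:
  assumes pc: "piece a \<sigma> \<tau> b" and p: "dpath P a p b" "set p \<subseteq> set \<sigma> \<union> set \<tau>"
  shows "p = \<sigma> \<or> p = \<tau>"
proof -
  have main: "p = \<sigma>'" if pc: "piece a \<sigma>' \<tau>' b" and sub: "set p \<subseteq> set \<sigma>' \<union> set \<tau>'" and hd: "hd p \<in> set \<sigma>'" for \<sigma>' \<tau>'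
  proof -
    note pd = piece_dest[OF pc]
    have "set p \<subseteq> set \<sigma>'"
    proof (rule ccontr)
      assume "\<not> set p \<subseteq> set \<sigma>'"
      then obtain g where "g \<in> set p" "g \<in> set \<tau>'" using sub by blast
      then obtain u g r where p': "p = u @ g # r" "g \<in> set \<tau>'" "\<forall>h \<in> set u. h \<notin> set \<tau>'"
        using split_list_first_prop[of p "\<lambda>x. x \<in> set \<tau>'"] by blast
      have "u \<noteq> []" using p' hd pd(6) by auto
      then obtain u' h where u: "u = u' @ [h]" by (metis rev_exhaust)
      have h: "h \<in> set \<sigma>'" using u p' sub by auto
      have d: "dpath P a u (src g)" "trg h = src g" "dpath P (src g) (g # r) b"
        using p(1) p'(1) u by (auto simp: dpath_append dpath_Cons)
      have "src g \<in> vset a \<sigma>' \<inter> vset a \<tau>'"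
        using trg_in_vset[OF pd(1) h] src_in_vset[OF p'(2)] d(2) by simp
      then consider "src g = a" | "src g = b" using pc by (auto simp: piece_def)
      then show False
      proof cases
        case 1
        then show ?thesis using d(1) \<open>u \<noteq> []\<close> dpath_closed_Nil by blast
      next
        case 2
        then show ?thesis using d(3) dpath_closed_Nil[of b "g # r"] by simp
      qed
    qed
    then show ?thesis using dpath_subset_imp_eq[OF p(1) pd(1)] by blast
  qed
  have "p \<noteq> []" using p(1) piece_dest(7)[OF pc] by auto
  then have "hd p \<in> set \<sigma> \<union> set \<tau>" using p(2) hd_in_set by blast
  then show ?thesis using main[OF pc p(2)] main[OF piece_sym[OF pc]] p(2) by blast
qed

text \<open>
  The point set of the curve determines its arcs; among these arcs \<open>a\<close> is the only vertex
  without an incoming and \<open>b\<close> the only one without an outgoing arc.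
\<close>

lemma piece_rim_determines:
  assumes pc: "piece a \<sigma> \<tau> b" and pq: "dpath P a' p b'" "dpath P a' q b'" "a' \<noteq> b'"
    and eq: "trace a' p \<union> trace a' q = rim a \<sigma> \<tau>"
  shows "a' = a \<and> b' = b \<and> ((p = \<sigma> \<and> q = \<tau>) \<or> (p = \<tau> \<and> q = \<sigma>))"
proof -
  note pd = piece_dest[OF pc]
  have sets: "set p \<union> set q = set \<sigma> \<union> set \<tau>"
    using traces_determine_arcs[OF pd(1,2) pq(1,2)] traces_determine_arcs[OF pq(1,2) pd(1,2)] eq
    unfolding rim_def by blast
  have no_in: "trg g \<noteq> a" "src g \<noteq> b" if "g \<in> set p \<union> set q" for g
    using that sets dpath_no_arc_into_start[OF pd(1), of g] dpath_no_arc_into_start[OF pd(2), of g]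
      dpath_no_arc_out_of_finish[OF pd(1), of g] dpath_no_arc_out_of_finish[OF pd(2), of g] by auto
  have start: "a' = a"
  proof -
    let ?s = "hd \<sigma>"
    have s: "src ?s = a" "?s \<in> set p \<union> set q" using pd(1,3) sets by (cases \<sigma>; auto simp: dpath_Cons)+
    then obtain r u where r: "dpath P a' r b'" "r = p \<or> r = q" "?s \<in> set r" using pq by blast
    obtain u w where u: "r = u @ ?s # w" "dpath P a' u a" using dpath_arc_between[OF r(1,3)] s(1) by metis
    show ?thesis
    proof (cases u rule: rev_cases)
      case (snoc u' g)
      then have "trg g = a" using u(2) by (auto simp: dpath_append dpath_Cons)
      moreover have "g \<in> set p \<union> set q" using snoc u(1) r(2) by auto
      ultimately show ?thesis using no_in by blast
    qed (use u in simp)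
  qed
  have finish: "b' = b"
  proof -
    let ?s = "last \<sigma>"
    have s: "trg ?s = b" "?s \<in> set p \<union> set q"
      using pd(1,3) sets by (cases \<sigma> rule: rev_cases; auto simp: dpath_append dpath_Cons)+
    then obtain r u where r: "dpath P a' r b'" "r = p \<or> r = q" "?s \<in> set r" using pq by blast
    obtain u w where u: "r = u @ ?s # w" "dpath P b w b'" using dpath_arc_between[OF r(1,3)] s(1) by metis
    show ?thesis
    proof (cases w)
      case (Cons g w')
      then have "src g = b" using u(2) by (auto simp: dpath_Cons)
      moreover have "g \<in> set p \<union> set q" using Cons u(1) r(2) by auto
      ultimately show ?thesis using no_in by blast
    qed (use u in simp)
  qed
  have "p = \<sigma> \<or> p = \<tau>" "q = \<sigma> \<or> q = \<tau>"
    using dpath_in_piece[OF pc, of p] dpath_in_piece[OF pc, of q] pq start finish sets by auto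
  moreover have "hd \<sigma> \<in> set \<sigma>" "hd \<tau> \<in> set \<tau>" using pd(3,4) by auto
  then have "set \<sigma> \<union> set \<tau> \<noteq> set \<sigma>" "set \<sigma> \<union> set \<tau> \<noteq> set \<tau>" using pd(6) by (metis UnCI disjoint_iff)+
  ultimately show ?thesis using start finish sets by auto
qed

text \<open>
  The uniqueness of the boundary of a face is part of the claim: the curve determines the two sides, and
  the clockwise orientation tells which of them is the upper one.
\<close>

lemma empty_piece_is_face:
  assumes pc: "piece a \<sigma> \<tau> b" and empty: "inside (rim a \<sigma> \<tau>) \<inter> support P = {}"
    and neg: "\<And>z. z \<in> inside (rim a \<sigma> \<tau>) \<Longrightarrow> wind z \<sigma> - wind z \<tau> = - 1"
  shows "inside (rim a \<sigma> \<tau>) \<in> faces P" "face_boundary P (inside (rim a \<sigma> \<tau>)) = (a, b, \<sigma>, \<tau>)"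
proof -
  let ?J = "rim a \<sigma> \<tau>"
  let ?F = "inside ?J"
  note pd = piece_dest[OF pc] and pin = piece_inside[OF pc]
  have "D = ?F" if "?F \<subseteq> D" "D \<subseteq> - support P" "connected D" for D
    using connected_subset_inside_loop[OF piece_loop(1,2)[OF pc] that(3)] that(1,2) pin(1) rim_subset_support[OF pc]
    unfolding piece_loop(3)[OF pc] by blast
  then show F: "?F \<in> faces P"
    using pin empty unfolding faces_def in_components_maximal by auto
  have w: "winding_number (boundary_loop P \<sigma> \<tau>) z = - 1" if "z \<in> ?F" for z
  proof -
    have "z \<notin> ?J" using that inside_no_overlap[of ?J] by blast
    then show ?thesis using winding_boundary_loop[OF pd(1,3) pd(2,4), of z] neg[OF that] by (simp add: rim_def)
  qed
  have 1: "is_face_boundary P ?F a b \<sigma> \<tau>"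
    unfolding is_face_boundary_def using pd pin(5) piece_loop(3)[OF pc] w by auto
  have uni: "(a', b', p, q) = (a, b, \<sigma>, \<tau>)" if B: "is_face_boundary P ?F a' b' p q" for a' b' p q
  proof -
    have b: "dpath P a' p b'" "dpath P a' q b'" "a' \<noteq> b'" "path_image (boundary_loop P p q) = ?J"
      and wz: "\<And>z. z \<in> ?F \<Longrightarrow> winding_number (boundary_loop P p q) z = - 1"
      using B pin(5) by (auto simp: is_face_boundary_def)
    have ne: "p \<noteq> []" "q \<noteq> []" using b by auto
    have "trace a' p \<union> trace a' q = ?J" using boundary_loop(3)[OF b(1) ne(1) b(2) ne(2)] b(4) by simp
    from piece_rim_determines[OF pc b(1-3) this]
    have cs: "a' = a" "b' = b" "(p = \<sigma> \<and> q = \<tau>) \<or> (p = \<tau> \<and> q = \<sigma>)" by auto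
    \<comment> \<open>With the sides exchanged the loop runs counterclockwise.\<close>
    have "\<not> (p = \<tau> \<and> q = \<sigma>)"
    proof
      assume sw: "p = \<tau> \<and> q = \<sigma>"
      obtain z where z: "z \<in> ?F" using pin(1) by blast
      have "z \<notin> ?J" using z inside_no_overlap[of ?J] by blast
      moreover have eq: "wind z \<tau> - wind z \<sigma> = 1" using neg[OF z] by simp
      ultimately have "winding_number (boundary_loop P \<tau> \<sigma>) z = 1"
        using winding_boundary_loop[OF pd(2,4) pd(1,3), of z] unfolding eq by (simp add: rim_def)
      then show False using wz[OF z] sw by simp
    qed
    with cs(3) have "p = \<sigma> \<and> q = \<tau>" by blast
    then show ?thesis using cs(1,2) by simp
  qed
  show "face_boundary P ?F = (a, b, \<sigma>, \<tau>)"
    unfolding face_boundary_def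
  proof (rule the_equality)
    show "case (a, b, \<sigma>, \<tau>) of (a, b, p, q) \<Rightarrow> is_face_boundary P ?F a b p q" using 1 by simp
    show "x = (a, b, \<sigma>, \<tau>)" if "case x of (a, b, p, q) \<Rightarrow> is_face_boundary P ?F a b p q" for x
      using that uni by (cases x) auto
  qed
qed

end

section \<open>Sweeping faces in turn\<close>

text \<open>
  The effect of a sequence of faces on paths, without the accompanying cells.
\<close>

inductive sweep :: "'e scheme_data \<Rightarrow> 'e list \<Rightarrow> complex set list \<Rightarrow> 'e list \<Rightarrow> bool" for P where
  nil: "sweep P \<pi> [] \<pi>"
| cons: "sweep P (a @ lower P F @ b) Fs \<rho> \<Longrightarrow> sweep P (a @ upper P F @ b) (F # Fs) \<rho>"

lemma sweep_append: "sweep P \<pi> Fs \<rho> \<Longrightarrow> sweep P \<rho> Gs \<sigma> \<Longrightarrow> sweep P \<pi> (Fs @ Gs) \<sigma>"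
  by (induction rule: sweep.induct) (auto intro: sweep.cons)

lemma sweep_split:
  assumes "sweep P \<pi> (Fs @ Gs) \<rho>"
  obtains \<sigma> where "sweep P \<pi> Fs \<sigma>" "sweep P \<sigma> Gs \<rho>"
  using assms
proof (induction Fs arbitrary: \<pi> thesis)
  case Nil
  then show ?case by (auto intro: sweep.nil)
next
  case (Cons F Fs)
  from Cons.prems(2) obtain a b where "\<pi> = a @ upper P F @ b" "sweep P (a @ lower P F @ b) (Fs @ Gs) \<rho>"
    by (auto elim: sweep.cases)
  then show ?case using Cons.IH Cons.prems(1) by (metis append_Cons sweep.cons)
qed

lemma sweep_Nil [simp]: "sweep P \<pi> [] \<rho> \<longleftrightarrow> \<pi> = \<rho>"
  by (auto elim: sweep.cases intro: sweep.nil)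

lemma sweep_Cons:
  "sweep P \<pi> (F # Fs) \<rho> \<longleftrightarrow> (\<exists>a b. \<pi> = a @ upper P F @ b \<and> sweep P (a @ lower P F @ b) Fs \<rho>)"
  by (subst sweep.simps) auto

lemma sgn_exp: "sgn (exp w) = exp (\<i> * of_real (Im w))"
proof -
  have "exp w = of_real (exp (Re w)) * exp (\<i> * of_real (Im w))"
    using exp_add[of "of_real (Re w)" "\<i> * of_real (Im w)"] complex_eq[of w] by (simp add: exp_of_real)
  moreover have "sgn (of_real (exp (Re w)) :: complex) = 1" by (simp add: sgn_of_real)
  moreover have "sgn (exp (\<i> * of_real (Im w))) = exp (\<i> * of_real (Im w))" by (simp add: sgn_div_norm)
  ultimately show ?thesis by (simp only: sgn_mult mult_1)
qed

context pasting_scheme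
begin

text \<open>
  A face that is enclosed clockwise by two directed sides. In a pasting scheme every
  face has this property, but this is known only after the sweep through all faces is constructed.
\<close>

definition jordan_face :: "complex set \<Rightarrow> bool" where
  "jordan_face F \<longleftrightarrow> F \<in> faces P \<and> piece (face_source P F) (upper P F) (lower P F) (face_sink P F)
     \<and> F = inside (rim (face_source P F) (upper P F) (lower P F)) \<and> F \<inter> support P = {}
     \<and> (\<forall>z \<in> F. wind z (upper P F) - wind z (lower P F) = - 1)"

lemma empty_piece_jordan_face:
  assumes "piece a \<sigma> \<tau> b" "inside (rim a \<sigma> \<tau>) \<inter> support P = {}"
    and "\<And>z. z \<in> inside (rim a \<sigma> \<tau>) \<Longrightarrow> wind z \<sigma> - wind z \<tau> = - 1"
  shows "jordan_face (inside (rim a \<sigma> \<tau>))" "upper P (inside (rim a \<sigma> \<tau>)) = \<sigma>" "lower P (inside (rim a \<sigma> \<tau>)) = \<tau>"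
proof -
  note f = empty_piece_is_face[OF assms]
  show "upper P (inside (rim a \<sigma> \<tau>)) = \<sigma>" "lower P (inside (rim a \<sigma> \<tau>)) = \<tau>"
    by (simp_all add: upper_def lower_def f(2))
  show "jordan_face (inside (rim a \<sigma> \<tau>))"
    unfolding jordan_face_def using f assms
    by (simp add: upper_def lower_def face_source_def face_sink_def)
qed

text \<open>
  Repeated covering steps; the number of paths below the current one decreases.
\<close>

lemma sweep_to_extremal:
  assumes m: "spath m" "\<And>q. spath q \<Longrightarrow> above 1 q m" and "spath p"
  shows "\<exists>Fs. sweep P p Fs m \<and> (\<forall>F \<in> set Fs. jordan_face F)"
  using assms(3)
proof (induction "card {q. spath q \<and> above 1 p q}" arbitrary: p rule: less_induct)
  case less
  show ?case
  proof (cases "p = m")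
    case True
    then show ?thesis by (intro exI[of _ "[]"]) simp
  next
    case False
    obtain X Y a \<sigma> \<tau> b where c: "p = X @ \<sigma> @ Y" "flanked a \<sigma> \<tau> b X Y" "inside (rim a \<sigma> \<tau>) \<inter> support P = {}"
      "\<And>z. z \<in> inside (rim a \<sigma> \<tau>) \<Longrightarrow> wind z \<sigma> - wind z \<tau> = - 1"
      using cover_step[OF less.prems m(1) m(2)[OF less.prems]] False by metis
    have pc: "piece a \<sigma> \<tau> b" using c(2) by (simp add: flanked_def)
    note jf = empty_piece_jordan_face[OF pc c(3,4)]
    let ?p = "X @ \<tau> @ Y"
    have p': "spath ?p" using flanked_spath(2)[OF c(2)] .
    have "wind z p \<le> wind z ?p" if "z \<notin> support P" for z
    proof (cases "z \<in> inside (rim a \<sigma> \<tau>)")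
      case False
      have "z \<notin> rim a \<sigma> \<tau>" using rim_subset_support[OF pc] that by blast
      then show ?thesis using piece_wind_outside[OF pc _ False] c(1) by simp
    qed (use c(1) c(4)[of z] in simp)
    then have ab: "above 1 p ?p" by (simp add: above_def)
    have "\<not> above 1 ?p p"
      using above_antisym[OF ab _ _ less.prems p'] detour_smaller(2)[OF c(2)] c(1) by blast
    then have "{q. spath q \<and> above 1 ?p q} \<subset> {q. spath q \<and> above 1 p q}"
      using above_trans[OF ab] less.prems above_refl by blast
    then have "card {q. spath q \<and> above 1 ?p q} < card {q. spath q \<and> above 1 p q}"
      by (intro psubset_card_mono) (use finite_spaths in auto)
    then obtain Fs where "sweep P ?p Fs m" "\<forall>F \<in> set Fs. jordan_face F" using less.hyps p' by blast
    then show ?thesis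
      using jf c(1) sweep.cons[of P X "inside (rim a \<sigma> \<tau>)" Y Fs m]
      by (intro exI[of _ "inside (rim a \<sigma> \<tau>) # Fs"]) auto
  qed
qed

lemma jordan_face_wind:
  assumes "jordan_face F" "z \<notin> support P"
  shows "wind z (lower P F) - wind z (upper P F) = (if z \<in> F then 1 else 0)"
proof -
  have pc: "piece (face_source P F) (upper P F) (lower P F) (face_sink P F)"
    and F: "F = inside (rim (face_source P F) (upper P F) (lower P F))"
    and w: "\<And>z. z \<in> F \<Longrightarrow> wind z (upper P F) - wind z (lower P F) = - 1"
    using assms(1) by (auto simp: jordan_face_def)
  show ?thesis
  proof (cases "z \<in> F")
    case True
    then show ?thesis using w[OF True] by simp
  next
    case False
    have "z \<notin> rim (face_source P F) (upper P F) (lower P F)"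
      using rim_subset_support[OF pc] assms(2) by blast
    then show ?thesis using piece_wind_outside[OF pc, of z] F False by simp
  qed
qed

text \<open>
  Crossing a face increases the winding number by one around its points and leaves it unchanged
  elsewhere.
\<close>

lemma sweep_wind:
  assumes "sweep P p Fs q" "\<And>F. F \<in> set Fs \<Longrightarrow> jordan_face F" "z \<notin> support P"
  shows "wind z q - wind z p = (\<Sum>F\<leftarrow>Fs. if z \<in> F then 1 else 0)"
  using assms
proof (induction rule: sweep.induct)
  case (cons a F b Fs \<rho>)
  then show ?case using jordan_face_wind[of F z] by simp
qed simp

lemma sweep_above:
  assumes "sweep P p Fs q" "\<And>F. F \<in> set Fs \<Longrightarrow> jordan_face F"
  shows "above 1 p q"
proof -
  have "0 \<le> (\<Sum>F\<leftarrow>Fs. if z \<in> F then 1 else (0::real))" for z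
    by (rule sum_list_nonneg) auto
  then show ?thesis using sweep_wind[OF assms] unfolding above_def by (smt (verit) mult_1)
qed

lemma spath_replace_upper:
  assumes "spath (a @ upper P F @ b)" "jordan_face F"
  shows "dpath P (source P) a (face_source P F)" "dpath P (face_sink P F) b (sink P)" "spath (a @ lower P F @ b)"
proof -
  have pc: "piece (face_source P F) (upper P F) (lower P F) (face_sink P F)"
    using assms(2) by (auto simp: jordan_face_def)
  note pd = piece_dest[OF pc]
  obtain x y where xy: "dpath P (source P) a x" "dpath P x (upper P F) y" "dpath P y b (sink P)"
    using assms(1) by (auto simp: spath_def dpath_append)
  then have "x = face_source P F" "y = face_sink P F" using G.awalk_ends[OF pd(1) xy(2)] pd(3) by auto
  then show "dpath P (source P) a (face_source P F)" "dpath P (face_sink P F) b (sink P)" using xy by auto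
  then show "spath (a @ lower P F @ b)" using pd(2) dpath_append unfolding spath_def by blast
qed

lemma sweep_spath:
  assumes "sweep P p Fs q" "\<And>F. F \<in> set Fs \<Longrightarrow> jordan_face F" "spath p"
  shows "spath q"
  using assms by (induction rule: sweep.induct) (auto intro: spath_replace_upper)

section \<open>Winding numbers of paths detect the interior faces\<close>

text \<open>
  A branch of the argument of \<open>x - z\<close> along one arc, with prescribed value \<open>c\<close> at its tail.
\<close>

lemma arc_logarithm:
  assumes e: "e \<in> arcs (graph P)" and z: "z \<notin> im e" and c: "exp (\<i> * of_real c) = sgn (src e - z)"
  obtains h where "continuous_on (im e) h" "\<And>x. x \<in> im e \<Longrightarrow> sgn (x - z) = exp (\<i> * of_real (h x))"
    "h (src e) = c" "h (trg e) = c + 2 * pi * Re (winding_number (curve P e) z)"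
proof -
  note arc = curve_arc[OF e]
  obtain q where q: "path q" "pathfinish q - pathstart q = 2 * of_real pi * \<i> * winding_number (curve P e) z"
    "\<And>t. t \<in> {0..1} \<Longrightarrow> curve P e t = z + exp (q t)"
    using winding_number_as_continuous_log[OF arc_imp_path[OF arc] z] by metis
  obtain k where k: "homeomorphism {0..1} (im e) (curve P e) k" using homeomorphism_arc[OF arc] by blast
  let ?h = "\<lambda>x. Im (q (k x)) - Im (q 0) + c"
  have k01: "k x \<in> {0..1}" "curve P e (k x) = x" if "x \<in> im e" for x
    using k that unfolding homeomorphism_def by auto
  have ends: "curve P e 0 = src e" "curve P e 1 = trg e"
    using curve_start[OF e] curve_finish[OF e] by (auto simp: pathstart_def pathfinish_def)
  have kends: "k (src e) = 0" "k (trg e) = 1"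
    using k ends unfolding homeomorphism_def by (metis atLeastAtMost_iff order_refl zero_le_one)+
  have "src e - z = exp (q 0)" using q(3)[of 0] ends by simp
  then have c0: "exp (\<i> * of_real (Im (q 0))) = exp (\<i> * of_real c)" using c by (simp add: sgn_exp)
  show ?thesis
  proof (rule that[of ?h])
    have "continuous_on (im e) (q \<circ> k)"
    proof (rule continuous_on_compose)
      show "continuous_on (im e) k" "continuous_on (k ` im e) q"
        using k q(1) by (auto simp: homeomorphism_def path_def)
    qed
    then show "continuous_on (im e) ?h" by (auto intro!: continuous_intros simp: o_def)
    show "sgn (x - z) = exp (\<i> * of_real (?h x))" if "x \<in> im e" for x
    proof -
      have "x = z + exp (q (k x))" using q(3)[OF k01(1)[OF that]] k01(2)[OF that] by simp
      then have "x - z = exp (q (k x))" by (metis add_diff_cancel_left')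
      then have "sgn (x - z) = exp (\<i> * of_real (Im (q (k x))))" by (simp add: sgn_exp)
      also have "\<dots> = exp (\<i> * of_real (Im (q (k x)))) * (exp (\<i> * of_real c) / exp (\<i> * of_real (Im (q 0))))"
        using c0 by simp
      also have "\<dots> = exp (\<i> * of_real (?h x))"
        by (simp add: algebra_simps exp_add exp_diff)
      finally show ?thesis .
    qed
    show "?h (src e) = c" using kends by simp
    have "Im (q 1) - Im (q 0) = 2 * pi * Re (winding_number (curve P e) z)"
      using arg_cong[OF q(2), of Im] by (simp add: pathstart_def pathfinish_def)
    then show "?h (trg e) = c + 2 * pi * Re (winding_number (curve P e) z)" using kends by simp
  qed
qed

text \<open>
  If the winding numbers around \<open>z\<close> of all paths from source to sink agree, then so do those of all
  paths from the source to a given vertex. This gives a value of the argument of \<open>x - z\<close> at every vertex,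
  and the branches along the arcs fit together to a continuous branch on the whole graph. So the
  direction map \<open>x \<mapsto> (x - z) / \<bar>x - z\<bar>\<close> is inessential, and Borsuk's criterion places \<open>z\<close> in the
  unbounded component.
\<close>

lemma windings_separate_faces:
  assumes z: "z \<notin> support P" and same: "\<And>p q. spath p \<Longrightarrow> spath q \<Longrightarrow> wind z p = wind z q"
  shows "z \<in> exterior_face P"
proof -
  have "z \<noteq> source P" using z source_in by (auto simp: support_def)
  then have "norm (sgn (source P - z)) = 1" by (simp add: norm_sgn)
  then obtain c0 where c0: "exp (\<i> * of_real c0) = sgn (source P - z)"
    by (metis complex_norm_eq_1_exp_eq)
  have zim: "z \<notin> im e" if "e \<in> arcs (graph P)" for e using z that by (auto simp: support_def)
  \<comment> \<open>The change of the argument from the source to \<open>v\<close>, in full turns; it is the same along all paths.\<close>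
  define \<theta> where "\<theta> v = wind z (SOME r. dpath P (source P) r v)" for v
  have \<theta>: "wind z r = \<theta> v" if r: "dpath P (source P) r v" for r v
  proof -
    let ?r = "SOME r. dpath P (source P) r v"
    have r': "dpath P (source P) ?r v" using r by (rule someI)
    obtain t where "dpath P v t (sink P)" using to_sink dpath_ends_in(2)[OF r] by blast
    then have "spath (r @ t)" "spath (?r @ t)" using r r' dpath_append unfolding spath_def by blast+
    then show ?thesis using same[of "r @ t" "?r @ t"] by (simp add: \<theta>_def)
  qed
  have base: "exp (\<i> * of_real (c0 + 2 * pi * \<theta> v)) = sgn (v - z)" if v: "v \<in> verts (graph P)" for v
  proof -
    obtain r where r: "dpath P (source P) r v" using from_source[OF v] by blast
    have "z \<notin> trace (source P) r" using z trace_subset_support[OF r] by blast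
    show ?thesis
    proof (cases "r = []")
      case True
      then show ?thesis using \<theta>[OF r] r c0 by simp
    next
      case False
      note pc = path_curve_arc[OF r False]
      let ?w = "winding_number (path_curve P r) z"
      have "v - z = exp (2 * pi * \<i> * ?w) * (source P - z)"
        using winding_number_exp_2pi[of "path_curve P r" z] pc \<open>z \<notin> trace (source P) r\<close> by (auto simp: arc_imp_path)
      then have "sgn (v - z) = sgn (exp (2 * pi * \<i> * ?w)) * sgn (source P - z)" by (simp add: sgn_mult)
      also have "sgn (exp (2 * pi * \<i> * ?w)) = exp (\<i> * of_real (2 * pi * Re ?w))" by (simp add: sgn_exp)
      also have "Re ?w = \<theta> v" using wind_path_curve[OF r False] \<open>z \<notin> trace (source P) r\<close> \<theta>[OF r] by simp
      finally show ?thesis using c0 by (simp add: exp_add algebra_simps)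
    qed
  qed
  have "\<exists>h. continuous_on (im e) h \<and> (\<forall>x \<in> im e. sgn (x - z) = exp (\<i> * of_real (h x)))
      \<and> h (src e) = c0 + 2 * pi * \<theta> (src e) \<and> h (trg e) = c0 + 2 * pi * \<theta> (trg e)" if e: "e \<in> arcs (graph P)" for e
  proof -
    obtain r where r: "dpath P (source P) r (src e)" using dpath_through_arc[OF e] by metis
    then have re: "dpath P (source P) (r @ [e]) (trg e)" using e by (auto simp: dpath_append dpath_Cons)
    have "\<theta> (trg e) = \<theta> (src e) + Re (winding_number (curve P e) z)"
      using \<theta>[OF r] \<theta>[OF re] by (simp add: wind_Cons)
    moreover obtain h where "continuous_on (im e) h" "\<And>x. x \<in> im e \<Longrightarrow> sgn (x - z) = exp (\<i> * of_real (h x))"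
      "h (src e) = c0 + 2 * pi * \<theta> (src e)"
      "h (trg e) = c0 + 2 * pi * \<theta> (src e) + 2 * pi * Re (winding_number (curve P e) z)"
      using arc_logarithm[OF e zim[OF e] base[of "src e"]] e by auto
    ultimately show ?thesis by (intro exI[of _ h]) (auto simp: algebra_simps)
  qed
  then obtain h where h: "\<And>e. e \<in> arcs (graph P) \<Longrightarrow> continuous_on (im e) (h e)"
      "\<And>e x. e \<in> arcs (graph P) \<Longrightarrow> x \<in> im e \<Longrightarrow> sgn (x - z) = exp (\<i> * of_real (h e x))"
      "\<And>e. e \<in> arcs (graph P) \<Longrightarrow> h e (src e) = c0 + 2 * pi * \<theta> (src e)"
      "\<And>e. e \<in> arcs (graph P) \<Longrightarrow> h e (trg e) = c0 + 2 * pi * \<theta> (trg e)"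
    by metis
  have sup: "support P = (\<Union>e \<in> arcs (graph P). im e)" using support_arc by (auto simp: support_def)
  have agree: "h e x = h f x" if ef: "e \<in> arcs (graph P)" "f \<in> arcs (graph P)" and x: "x \<in> im e" "x \<in> im f" for e f x
  proof (cases "e = f")
    case False
    then have "x \<in> verts (graph P)" using curves_disjoint[OF ef] x by blast
    have "h e' x = c0 + 2 * pi * \<theta> x" if e': "e' \<in> arcs (graph P)" "x \<in> im e'" for e'
    proof -
      have "x = src e' \<or> x = trg e'" using im_verts[OF e'(1)] e'(2) \<open>x \<in> verts (graph P)\<close> by blast
      then show ?thesis using h(3)[OF e'(1)] h(4)[OF e'(1)] by metis
    qed
    then show ?thesis using ef x by simp
  qed simp
  obtain g where g: "continuous_map (top_of_set (support P)) euclidean g"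
    "\<And>x e. e \<in> arcs (graph P) \<Longrightarrow> x \<in> topspace (top_of_set (support P)) \<inter> im e \<Longrightarrow> g x = h e x"
  proof (rule pasting_lemma_exists_closed[of "arcs (graph P)" "top_of_set (support P)" im euclidean h])
    show "closedin (top_of_set (support P)) (im e)" if "e \<in> arcs (graph P)" for e
      using closed_arc_image[OF curve_arc[OF that]] that sup by (auto intro: closed_subset)
    show "continuous_map (subtopology (top_of_set (support P)) (im e)) euclidean (h e)" if "e \<in> arcs (graph P)" for e
    proof -
      have "support P \<inter> im e = im e" using that sup by blast
      then show ?thesis using h(1)[OF that] by (simp add: subtopology_subtopology)
    qed
    show "finite (arcs (graph P))" by (rule G.finite_arcs)
    show "topspace (top_of_set (support P)) \<subseteq> \<Union> (im ` arcs (graph P))" unfolding sup by simp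
    show "h i x = h j x" if "i \<in> arcs (graph P)" "j \<in> arcs (graph P)"
        "x \<in> topspace (top_of_set (support P)) \<inter> im i \<inter> im j" for i j x
      using agree[of i j x] that by blast
  qed blast
  have "continuous_on (support P) g" using g(1) by simp
  moreover have "inverse (norm (x - z)) *\<^sub>R (x - z) = exp (\<i> * of_real (g x))" if xs: "x \<in> support P" for x
  proof -
    obtain e where e: "e \<in> arcs (graph P)" "x \<in> im e" using support_arc[OF xs] .
    then show ?thesis using g(2)[of e x] h(2)[of e x] xs by (simp add: sgn_div_norm divide_inverse)
  qed
  ultimately have "\<exists>a. homotopic_with_canon (\<lambda>h. True) (support P) (sphere 0 1)
      (\<lambda>x. inverse (norm (x - z)) *\<^sub>R (x - z)) (\<lambda>t. a)"
    unfolding inessential_eq_continuous_logarithm_circle by blast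
  then have "\<not> bounded (connected_component_set (- support P) z)"
    using Borsuk_map_essential_bounded_component[OF compact_support z] by blast
  then show ?thesis by (simp add: exterior_face_def outside)
qed

section \<open>Paths through a common arc\<close>

lemma inner_arc_dense: "e \<in> arcs (graph P) \<Longrightarrow> im e \<subseteq> closure (im e - {src e, trg e})"
proof -
  assume e: "e \<in> arcs (graph P)"
  note arc = curve_arc[OF e]
  have ends: "curve P e 0 = src e" "curve P e 1 = trg e"
    using curve_start[OF e] curve_finish[OF e] by (auto simp: pathstart_def pathfinish_def)
  have sub: "curve P e ` {0<..<1} \<subseteq> im e - {src e, trg e}"
  proof
    fix x assume "x \<in> curve P e ` {0<..<1}"
    then obtain t where t: "0 < t" "t < 1" "x = curve P e t" by auto
    have inj: "inj_on (curve P e) {0..1}" using arc by (simp add: arc_def)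
    have "x \<noteq> src e" using inj_onD[OF inj, of t 0] t ends by auto
    moreover have "x \<noteq> trg e" using inj_onD[OF inj, of t 1] t ends by auto
    ultimately show "x \<in> im e - {src e, trg e}" using t by (auto simp: path_image_def)
  qed
  have "curve P e ` closure {0<..<1} \<subseteq> closure (im e - {src e, trg e})"
  proof (rule image_closure_subset)
    show "continuous_on (closure {0<..<1}) (curve P e)" using arc by (simp add: arc_def path_def)
    show "curve P e ` {0<..<1} \<subseteq> closure (im e - {src e, trg e})"
      using sub closure_subset by (rule order_trans)
  qed simp
  then show ?thesis by (simp add: path_image_def)
qed

text \<open>
  The arc and the rest of \<open>p\<close> connect \<open>w\<close> to the sink without meeting the parts before the arc, and
  to the source without meeting the parts after it.
\<close>

lemma wind_eq_near_common_arc: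
  assumes p: "spath p" "e \<in> set p" and q: "spath q" "e \<in> set q" and w: "w \<in> im e - {src e, trg e}"
  shows "\<forall>\<^sub>F z in nhds w. wind z p = wind z q"
proof -
  obtain p1 p2 where p12: "p = p1 @ e # p2" "dpath P (source P) p1 (src e)" "dpath P (trg e) p2 (sink P)"
    using dpath_arc_between p unfolding spath_def by metis
  obtain q1 q2 where q12: "q = q1 @ e # q2" "dpath P (source P) q1 (src e)" "dpath P (trg e) q2 (sink P)"
    using dpath_arc_between q unfolding spath_def by metis
  have e: "e \<in> arcs (graph P)" using p dpath_arcs unfolding spath_def by blast
  have ep2: "dpath P (src e) (e # p2) (sink P)" using e p12(3) dpath_Cons by blast
  have e1: "dpath P (src e) [e] (trg e)" using e by (auto simp: dpath_Cons)
  have p1e: "dpath P (source P) (p1 @ [e]) (trg e)" using e1 p12(2) dpath_append by blast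
  have "\<forall>\<^sub>F z in nhds w. wind z p1 = wind z q1"
  proof (rule wind_eq_near_connected[OF p12(2) q12(2) connected_trace_minus_start[OF ep2], of "sink P"])
    show "sink P \<in> trace (src e) (e # p2) - {src e}"
      using dpath_finish_in[OF ep2] vset_subset_trace[of "src e" "e # p2"] dpath_closed_Nil[of "src e" "e # p2"] ep2 by auto
  qed (use trace_meet[OF p12(2) ep2] trace_meet[OF q12(2) ep2] w im_subset_trace[of e "e # p2" "src e"] in auto)
  moreover have "\<forall>\<^sub>F z in nhds w. wind z p2 = wind z q2"
  proof (rule wind_eq_near_connected[OF p12(3) q12(3) connected_trace_minus_finish[OF p1e], of "source P"])
    show "source P \<in> trace (source P) (p1 @ [e]) - {trg e}"
      using dpath_start_in[OF p1e] vset_subset_trace[of "source P" "p1 @ [e]"] dpath_closed_Nil[of "trg e" "p1 @ [e]"] p1e by auto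
  qed (use trace_meet[OF p1e p12(3)] trace_meet[OF p1e q12(3)] w im_subset_trace[of e "p1 @ [e]" "source P"] in auto)
  ultimately have "\<forall>\<^sub>F z in nhds w. wind z p1 = wind z q1 \<and> wind z p2 = wind z q2" by (rule eventually_conj)
  then show ?thesis by (rule eventually_mono) (simp add: p12(1) q12(1) wind_Cons)
qed

text \<open>
  The arc borders the domain of a piece, on which the winding numbers differ.
\<close>

lemma wind_differs_near_arc:
  assumes "spath p" "spath q" "e \<in> set p" "e \<notin> set q" "w \<in> im e" "open U" "w \<in> U"
  obtains z where "z \<in> U" "z \<notin> support P" "wind z p \<noteq> wind z q"
proof -
  obtain \<sigma> \<tau> a b X Y and \<epsilon> :: real where dec: "flanked a \<sigma> \<tau> b X Y" "e \<in> set \<sigma>" "\<epsilon> = 1 \<or> \<epsilon> = -1"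
    "\<And>z. z \<in> inside (rim a \<sigma> \<tau>) \<Longrightarrow> wind z p - wind z q = \<epsilon>"
    by (rule decompose_spaths[OF assms(1-4)]) blast
  have pc: "piece a \<sigma> \<tau> b" using dec(1) by (simp add: flanked_def)
  have "w \<in> rim a \<sigma> \<tau>" using im_subset_trace[OF dec(2), of a] assms(5) by (auto simp: rim_def)
  then have "w \<in> closure (inside (rim a \<sigma> \<tau>))" using piece_inside(5)[OF pc] by (auto simp: frontier_def)
  then have "U \<inter> inside (rim a \<sigma> \<tau>) \<noteq> {}" using open_Int_closure_eq_empty assms(6,7) by blast
  then obtain z where "z \<in> U \<inter> inside (rim a \<sigma> \<tau>)" "z \<notin> support P"
    using meets_complement_of_support[of "U \<inter> inside (rim a \<sigma> \<tau>)"] assms(6) piece_inside(2)[OF pc] by blast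
  then show ?thesis using that[of z] dec(3) dec(4)[of z] by auto
qed

text \<open>
  Near an arc of \<open>p\<close> that is not on \<open>q\<close> the difference comes from one piece only, and the arc also borders
  the outside of this piece.
\<close>

lemma wind_agrees_near_arc:
  assumes "spath p" "spath q" "e \<in> set p" "w \<in> im e - {src e, trg e}" "open U" "w \<in> U"
  obtains z where "z \<in> U" "z \<notin> support P" "wind z p = wind z q"
proof (cases "e \<in> set q")
  case True
  obtain N where "open N" "w \<in> N" "\<And>z. z \<in> N \<Longrightarrow> wind z p = wind z q"
    using wind_eq_near_common_arc[OF assms(1,3) assms(2) True assms(4)] unfolding eventually_nhds by blast
  then show ?thesis using meets_complement_of_support[of "U \<inter> N"] assms(5,6) that by blast
next
  case False
  obtain \<sigma> \<tau> a b X Y where dec: "flanked a \<sigma> \<tau> b X Y" "e \<in> set \<sigma>"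
    "\<And>w. w \<in> rim a \<sigma> \<tau> - {a, b} \<Longrightarrow> \<forall>\<^sub>F z in nhds w. wind z p - wind z q = wind z \<sigma> - wind z \<tau>"
    by (rule decompose_spaths[OF assms(1-3) False]) blast
  have pc: "piece a \<sigma> \<tau> b" using dec(1) by (simp add: flanked_def)
  note pd = piece_dest[OF pc]
  have w: "w \<in> rim a \<sigma> \<tau>" using im_subset_trace[OF dec(2), of a] assms(4) by (auto simp: rim_def)
  have "a \<in> verts (graph P)" "b \<in> verts (graph P)" using dpath_ends_in[OF pd(1)] by auto
  then have "w \<noteq> a" "w \<noteq> b" using im_verts[of e] dpath_arcs[OF pd(1)] dec(2) assms(4) by auto
  then obtain N where N: "open N" "w \<in> N" "\<And>z. z \<in> N \<Longrightarrow> wind z p - wind z q = wind z \<sigma> - wind z \<tau>"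
    using dec(3)[of w] w unfolding eventually_nhds by blast
  have "w \<in> closure (outside (rim a \<sigma> \<tau>))" using piece_inside(6)[OF pc] w by (auto simp: frontier_def)
  then have "(U \<inter> N) \<inter> outside (rim a \<sigma> \<tau>) \<noteq> {}"
    using open_Int_closure_eq_empty[of "U \<inter> N"] assms(5,6) N(1,2) by blast
  moreover have "open ((U \<inter> N) \<inter> outside (rim a \<sigma> \<tau>))"
    using assms(5) N(1) piece_inside(9)[OF pc] by (intro open_Int)
  ultimately obtain z where z: "z \<in> (U \<inter> N) \<inter> outside (rim a \<sigma> \<tau>)" "z \<notin> support P"
    using meets_complement_of_support by blast
  then have "z \<notin> inside (rim a \<sigma> \<tau>)" using inside_Int_outside[of "rim a \<sigma> \<tau>"] by blast
  then have "wind z \<sigma> = wind z \<tau>"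
    using piece_wind_outside[OF pc, of z] rim_subset_support[OF pc] z(2) by blast
  then show ?thesis using that[of z] N(3)[of z] z by auto
qed

text \<open>
  Near the common arc the winding numbers of \<open>p\<close> and \<open>q\<close> agree, hence that of \<open>r\<close> is the same; but if
  \<open>r\<close> avoided the arc, it would differ from \<open>p\<close> somewhere near the arc.
\<close>

lemma arc_sandwich:
  assumes "spath p" "spath q" "spath r" "above 1 p r" "above 1 r q" "e \<in> set p" "e \<in> set q"
  shows "e \<in> set r"
proof (rule ccontr)
  assume nr: "e \<notin> set r"
  have e: "e \<in> arcs (graph P)" using assms(1,6) dpath_arcs unfolding spath_def by blast
  have "im e - {src e, trg e} \<noteq> {}"
  proof
    assume "im e - {src e, trg e} = {}"
    then show False using inner_arc_dense[OF e] src_in_im[OF e] closure_empty by (metis empty_iff subsetD)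
  qed
  then obtain w where w: "w \<in> im e - {src e, trg e}" by blast
  obtain N where N: "open N" "w \<in> N" "\<And>z. z \<in> N \<Longrightarrow> wind z p = wind z q"
    using wind_eq_near_common_arc[OF assms(1,6,2,7) w] unfolding eventually_nhds by blast
  have "w \<in> im e" using w by blast
  obtain z where z: "z \<in> N" "z \<notin> support P" "wind z p \<noteq> wind z r"
    using wind_differs_near_arc[OF assms(1,3,6) nr \<open>w \<in> im e\<close> N(1,2)] .
  have "wind z p \<le> wind z r" "wind z r \<le> wind z q"
    using assms(4,5) z(2) by (simp_all add: above_def)
  then show False using N(3)[OF z(1)] z(3) by simp
qed

section \<open>The outer boundary and the sweep through all faces\<close>

lemma exterior_or_face:
  assumes "z \<notin> support P" "z \<notin> exterior_face P"
  obtains F where "F \<in> faces P" "z \<in> F"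
proof -
  let ?C = "connected_component_set (- support P) z"
  have "bounded ?C" using assms by (auto simp: exterior_face_def outside)
  moreover have "?C \<in> components (- support P)" using assms(1) by (auto simp: components_def)
  moreover have "z \<in> ?C" using assms(1) by simp
  ultimately show ?thesis using that by (auto simp: faces_def)
qed

lemma face_off_support: "F \<in> faces P \<Longrightarrow> F \<inter> support P = {}"
  using in_components_subset by (fastforce simp: faces_def)

lemma face_not_exterior:
  assumes "F \<in> faces P" "z \<in> F"
  shows "z \<notin> exterior_face P"
proof -
  have "F = connected_component_set (- support P) z"
    using assms connected_component_eq unfolding faces_def components_def by blast
  then show ?thesis using assms by (auto simp: exterior_face_def outside faces_def)
qed

lemma faces_disjoint:
  assumes "F \<in> faces P" "F' \<in> faces P" "z \<in> F" "z \<in> F'"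
  shows "F = F'"
  using assms components_eq[of F "- support P" F'] by (auto simp: faces_def)

lemma wind_eq_exterior:
  assumes "spath p" "spath q" "z \<in> exterior_face P"
  shows "wind z p = wind z q"
  using assms wind_eq_outside[of "source P" p "sink P" q z "support P"] trace_subset_support
  unfolding spath_def exterior_face_def by blast

lemma frontier_exterior_subset: "frontier (exterior_face P) \<subseteq> support P"
  unfolding exterior_face_def by (rule frontier_outside_subset[OF compact_imp_closed[OF compact_support]])

lemma wind_spath_loop:
  assumes "spath p" "spath q" "z \<notin> support P"
  shows "winding_number (boundary_loop P p q) z = of_real (wind z p - wind z q)"
    "path_image (boundary_loop P p q) = trace (source P) p \<union> trace (source P) q"
proof -
  have d: "dpath P (source P) p (sink P)" "dpath P (source P) q (sink P)" using assms by (auto simp: spath_def)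
  have ne: "p \<noteq> []" "q \<noteq> []" using d source_neq_sink by auto
  show "winding_number (boundary_loop P p q) z = of_real (wind z p - wind z q)"
    by (rule winding_boundary_loop[OF d(1) ne(1) d(2) ne(2)])
      (use trace_subset_support[OF d(1)] trace_subset_support[OF d(2)] assms(3) in auto)
  show "path_image (boundary_loop P p q) = trace (source P) p \<union> trace (source P) q"
    by (rule boundary_loop(3)[OF d(1) ne(1) d(2) ne(2)])
qed

context
  fixes t m
  assumes t: "spath t" "\<And>q. spath q \<Longrightarrow> above 1 t q"
    and m: "spath m" "\<And>q. spath q \<Longrightarrow> above 1 q m"
begin

text \<open>
  All winding numbers lie between those of \<open>t\<close> and \<open>m\<close>, so if these agree, all agree.
\<close>

lemma exterior_iff_wind:
  assumes "z \<notin> support P"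
  shows "z \<in> exterior_face P \<longleftrightarrow> wind z t = wind z m"
proof
  assume eq: "wind z t = wind z m"
  have "wind z p = wind z t" if "spath p" for p
    using t(2)[OF that] m(2)[OF that] assms eq unfolding above_def by fastforce
  then show "z \<in> exterior_face P" by (intro windings_separate_faces[OF assms]) simp
qed (rule wind_eq_exterior[OF t(1) m(1)])

lemma wind_drop_on_face:
  assumes "F \<in> faces P" "z \<in> F"
  shows "wind z t - wind z m = - 1"
proof -
  have z: "z \<notin> support P" using face_off_support[OF assms(1)] assms(2) by blast
  have "wind z t \<noteq> wind z m" using exterior_iff_wind[OF z] face_not_exterior[OF assms] by blast
  moreover have "wind z t \<le> wind z m" using t(2)[OF m(1)] z by (simp add: above_def)
  ultimately show ?thesis using wind_spaths_diff[OF t(1) m(1) z] by auto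
qed

text \<open>
  Near an arc of an extremal path there are points around which \<open>t\<close> and \<open>m\<close> have equal winding
  number, and these points are exterior.
\<close>

lemma extremal_arc_in_exterior_frontier:
  assumes p: "p = t \<or> p = m" and e: "e \<in> set p"
  shows "im e \<subseteq> frontier (exterior_face P)"
proof -
  have sp: "spath p" using p t(1) m(1) by blast
  have ea: "e \<in> arcs (graph P)" using e sp dpath_arcs unfolding spath_def by blast
  have "im e - {src e, trg e} \<subseteq> closure (exterior_face P)"
  proof
    fix w assume w: "w \<in> im e - {src e, trg e}"
    show "w \<in> closure (exterior_face P)"
    proof (rule ccontr)
      assume "w \<notin> closure (exterior_face P)"
      then have U: "open (- closure (exterior_face P))" "w \<in> - closure (exterior_face P)" by auto
      have "\<exists>z. z \<in> - closure (exterior_face P) \<and> z \<notin> support P \<and> wind z t = wind z m"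
        using p
      proof
        assume "p = t"
        then show ?thesis using wind_agrees_near_arc[OF t(1) m(1) _ w U] e by metis
      next
        assume "p = m"
        then show ?thesis using wind_agrees_near_arc[OF m(1) t(1) _ w U] e by metis
      qed
      then show False using exterior_iff_wind closure_subset by blast
    qed
  qed
  then have "im e \<subseteq> closure (exterior_face P)"
    using inner_arc_dense[OF ea] closure_mono[of "im e - {src e, trg e}" "closure (exterior_face P)"] by simp
  moreover have "im e \<inter> exterior_face P = {}"
    using exterior_Int_support ea by (auto simp: support_def)
  moreover have "open (exterior_face P)"
    unfolding exterior_face_def by (rule open_outside[OF compact_imp_closed[OF compact_support]])
  ultimately show ?thesis by (auto simp: frontier_def interior_open)
qed

text \<open>
  Let \<open>w\<close> be a frontier point off \<open>t\<close> and \<open>m\<close>. Points near \<open>w\<close> lie outside the loop of \<open>t\<close> and \<open>m\<close>, so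
  that off the graph all paths have the same winding number there; but a path through an arc at \<open>w\<close> differs from
  \<open>t\<close> on one side of this arc.
\<close>

lemma frontier_exterior:
  "frontier (exterior_face P) = trace (source P) t \<union> trace (source P) m"
proof
  have ne: "p \<noteq> []" if "spath p" for p using that source_neq_sink by (auto simp: spath_def)
  have tr: "trace (source P) p = (\<Union>e \<in> set p. im e)" if "spath p" for p
  proof -
    have "vset (source P) p \<subseteq> (\<Union>e \<in> set p. im e)"
    proof
      fix v assume v: "v \<in> vset (source P) p"
      have d: "dpath P (source P) p (sink P)" using that by (simp add: spath_def)
      have "\<exists>e \<in> set p. v = src e \<or> v = trg e" using G.set_awalk_verts_not_Nil[OF d ne[OF that]] v by auto
      then show "v \<in> (\<Union>e \<in> set p. im e)" using src_in_im trg_in_im dpath_arcs[OF d] by blast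
    qed
    then show ?thesis by (auto simp: trace_def)
  qed
  show "trace (source P) t \<union> trace (source P) m \<subseteq> frontier (exterior_face P)"
    using extremal_arc_in_exterior_frontier unfolding tr[OF t(1)] tr[OF m(1)] by blast
  show "frontier (exterior_face P) \<subseteq> trace (source P) t \<union> trace (source P) m"
  proof
    let ?T = "trace (source P) t \<union> trace (source P) m"
    fix w assume w: "w \<in> frontier (exterior_face P)"
    show "w \<in> ?T"
    proof (rule ccontr)
      assume nw: "w \<notin> ?T"
      obtain e where e: "e \<in> arcs (graph P)" "w \<in> im e"
        using support_arc frontier_exterior_subset w by blast
      have et: "e \<notin> set t" using e(2) nw im_subset_trace by blast
      obtain r1 r2 where "dpath P (source P) (r1 @ e # r2) (sink P)" using dpath_through_arc[OF e(1)] by metis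
      then obtain r where r: "spath r" "e \<in> set r" by (auto simp: spath_def)
      have T: "compact ?T" using t(1) m(1) unfolding spath_def by (intro compact_Un compact_trace)
      have "open (- ?T)" by (intro open_Compl compact_imp_closed T)
      then obtain \<delta> where \<delta>: "\<delta> > 0" "ball w \<delta> \<subseteq> - ?T" using nw open_contains_ball[of "- ?T"] by blast
      obtain z2 where z2: "z2 \<in> ball w \<delta>" "z2 \<notin> support P" "wind z2 r \<noteq> wind z2 t"
        using wind_differs_near_arc[OF r(1) t(1) r(2) et e(2), of "ball w \<delta>"] \<delta>(1) by auto
      have "w \<in> closure (exterior_face P)" using w by (simp add: frontier_def)
      then have "ball w \<delta> \<inter> exterior_face P \<noteq> {}"
        using open_Int_closure_eq_empty[of "ball w \<delta>" "exterior_face P"] centre_in_ball[of w \<delta>] \<delta>(1) by blast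
      then obtain z1 where z1: "z1 \<in> ball w \<delta>" "z1 \<in> exterior_face P" by blast
      have sub: "?T \<subseteq> support P" using trace_subset_support t(1) m(1) unfolding spath_def by blast
      have "connected_component (- ?T) z1 z2"
        using connected_component_of_subset[OF _ \<delta>(2)] connected_ball z1(1) z2(1)
        by (metis connected_iff_connected_component)
      then have "z2 \<in> outside ?T"
        using outside_same_component[of ?T z1 z2] exterior_subset_outside[OF sub] z1(2) by blast
      then have "wind z2 t = wind z2 m"
        using wind_eq_outside[of "source P" t "sink P" m z2 ?T] t(1) m(1) unfolding spath_def by blast
      moreover have "wind z2 t \<le> wind z2 r" "wind z2 r \<le> wind z2 m"
        using t(2)[OF r(1)] m(2)[OF r(1)] z2(2) by (simp_all add: above_def)
      ultimately show False using z2(3) by simp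
    qed
  qed
qed

text \<open>
  For a pair \<open>p\<close>, \<open>q\<close> that also bounds all faces clockwise, the inequalities between \<open>t\<close> and \<open>p\<close> and
  between \<open>q\<close> and \<open>m\<close> add up to an equality, so both are equalities.
\<close>

lemma outer_boundary_extremal: "outer_boundary P = (t, m)"
proof -
  have spaths: "is_outer_boundary P p q \<longleftrightarrow> spath p \<and> spath q
      \<and> trace (source P) p \<union> trace (source P) q = frontier (exterior_face P)
      \<and> (\<forall>F \<in> faces P. \<forall>z \<in> F. wind z p - wind z q = - 1)" for p q
  proof (cases "spath p \<and> spath q")
    case True
    have "winding_number (boundary_loop P p q) z = - 1 \<longleftrightarrow> wind z p - wind z q = - 1"
      if "F \<in> faces P" "z \<in> F" for F z
    proof -
      have "z \<notin> support P" using face_off_support that by blast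
      then have "winding_number (boundary_loop P p q) z = of_real (wind z p - wind z q)"
        using wind_spath_loop(1) True by blast
      then show ?thesis by (metis of_real_1 of_real_eq_iff of_real_minus)
    qed
    moreover obtain z0 where "z0 \<notin> support P" using meets_complement_of_support[of UNIV] by auto
    ultimately show ?thesis using True wind_spath_loop(2)[of p q z0] unfolding is_outer_boundary_def spath_def by simp
  qed (auto simp: is_outer_boundary_def spath_def)
  have tm: "is_outer_boundary P t m"
    unfolding spaths using t(1) m(1) frontier_exterior wind_drop_on_face by simp
  have uni: "p = t \<and> q = m" if B: "is_outer_boundary P p q" for p q
  proof -
    have p: "spath p" and q: "spath q" using B spaths by blast+
    have eq: "wind z p = wind z t \<and> wind z q = wind z m" if z: "z \<notin> support P" for z
    proof (cases "z \<in> exterior_face P")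
      case True
      then show ?thesis using wind_eq_exterior t(1) m(1) p q by metis
    next
      case False
      then obtain F where F: "F \<in> faces P" "z \<in> F" using exterior_or_face z by blast
      have "wind z p - wind z q = - 1" using B F spaths by blast
      moreover have "wind z t \<le> wind z p" "wind z q \<le> wind z m"
        using t(2)[OF p] m(2)[OF q] z by (simp_all add: above_def)
      ultimately show ?thesis using wind_drop_on_face[OF F] by linarith
    qed
    then show ?thesis using spaths_differ[OF p t(1)] spaths_differ[OF q m(1)] by metis
  qed
  show ?thesis
    unfolding outer_boundary_def
  proof (rule the_equality)
    show "case (t, m) of (p, q) \<Rightarrow> is_outer_boundary P p q" using tm by simp
    show "x = (t, m)" if "case x of (p, q) \<Rightarrow> is_outer_boundary P p q" for x
      using that uni[of "fst x" "snd x"] by (cases x) simp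
  qed
qed

text \<open>
  The total growth of the winding number around a point of a face is one, and each crossing of that face
  contributes one.
\<close>

lemma sweep_lists_faces:
  assumes sw: "sweep P t Fs m" and jf: "\<And>F. F \<in> set Fs \<Longrightarrow> jordan_face F"
  shows "set Fs = faces P" "distinct Fs"
proof -
  have sum: "(\<Sum>F\<leftarrow>Fs. if z \<in> F then 1 else 0) = (1::real)" if "F \<in> faces P" "z \<in> F" for F z
  proof -
    have "z \<notin> support P" using face_off_support that by blast
    then show ?thesis using sweep_wind[OF sw jf] wind_drop_on_face[OF that] by fastforce
  qed
  show "set Fs = faces P"
  proof
    show "set Fs \<subseteq> faces P" using jf by (auto simp: jordan_face_def)
    show "faces P \<subseteq> set Fs"
    proof
      fix F assume F: "F \<in> faces P"
      then obtain z where z: "z \<in> F" using in_components_nonempty by (fastforce simp: faces_def)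
      have "\<exists>F' \<in> set Fs. z \<in> F'"
      proof (rule ccontr)
        assume none: "\<not> ?thesis"
        have "map (\<lambda>F. if z \<in> F then 1 else (0::real)) Fs = map (\<lambda>F. 0) Fs"
          by (rule map_cong) (use none in auto)
        then have "(\<Sum>F\<leftarrow>Fs. if z \<in> F then 1 else (0::real)) = (\<Sum>F\<leftarrow>Fs. 0)" by (rule arg_cong)
        then show False using sum[OF F z] by simp
      qed
      then show "F \<in> set Fs" using faces_disjoint[OF F _ z] jf by (auto simp: jordan_face_def)
    qed
  qed
  show "distinct Fs"
  proof (rule ccontr)
    assume "\<not> distinct Fs"
    then obtain as F bs cs where Fs: "Fs = as @ F # bs @ F # cs" using not_distinct_decomp by fastforce
    have F: "F \<in> faces P" using jf[of F] Fs by (auto simp: jordan_face_def)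
    then obtain z where z: "z \<in> F" using in_components_nonempty by (fastforce simp: faces_def)
    have nn: "0 \<le> (\<Sum>F\<leftarrow>xs. if z \<in> F then 1 else (0::real))" for xs by (rule sum_list_nonneg) auto
    show False using sum[OF F z] nn[of as] nn[of bs] nn[of cs] z unfolding Fs by simp
  qed
qed

end

lemma sweep_cons_split:
  assumes "sweep P p (Fs @ F # Gs) q" "\<And>F'. F' \<in> set (Fs @ F # Gs) \<Longrightarrow> jordan_face F'" "spath p"
  obtains a b where "sweep P (a @ lower P F @ b) Gs q"
    "spath (a @ upper P F @ b)" "spath (a @ lower P F @ b)" "above 1 p (a @ upper P F @ b)"
    "above 1 (a @ upper P F @ b) (a @ lower P F @ b)"
    "set (upper P F) \<inter> set (a @ lower P F @ b) = {}" "set (lower P F) \<inter> set (a @ upper P F @ b) = {}"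
proof -
  obtain r where r: "sweep P p Fs r" "sweep P r (F # Gs) q" using sweep_split[OF assms(1)] .
  then obtain a b where ab: "r = a @ upper P F @ b" "sweep P (a @ lower P F @ b) Gs q"
    by (auto simp: sweep_Cons)
  have jF: "jordan_face F" using assms(2) by simp
  have su: "spath (a @ upper P F @ b)" using sweep_spath[OF r(1) _ assms(3)] assms(2) ab(1) by simp
  have sl: "spath (a @ lower P F @ b)" using spath_replace_upper(3)[OF su jF] .
  have du: "distinct (a @ upper P F @ b)" "distinct (a @ lower P F @ b)"
    using su sl dpath_distinct unfolding spath_def by blast+
  have ul: "set (upper P F) \<inter> set (lower P F) = {}" using jF piece_dest(6) unfolding jordan_face_def by blast
  have one: "sweep P (a @ upper P F @ b) [F] (a @ lower P F @ b)" by (simp add: sweep_Cons) blast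
  show ?thesis
  proof (rule that[OF ab(2) su sl])
    show "above 1 p (a @ upper P F @ b)" using sweep_above[OF r(1)] assms(2) ab(1) by simp
    show "above 1 (a @ upper P F @ b) (a @ lower P F @ b)" using sweep_above[OF one] jF by simp
  qed (use du ul in auto)
qed

text \<open>
  An arc of \<open>p\<close> that is on the lower side of \<open>F\<close> would, by the sandwich property, already be on the
  path just before \<open>F\<close> is crossed, which contains the upper side of \<open>F\<close> instead.
\<close>

lemma sweep_lower_new:
  assumes sw: "sweep P p Fs q" and jf: "\<And>F'. F' \<in> set Fs \<Longrightarrow> jordan_face F'" and p: "spath p" and F: "F \<in> set Fs"
  shows "set (lower P F) \<inter> set p = {}"
proof (rule ccontr)
  assume "set (lower P F) \<inter> set p \<noteq> {}"
  then obtain e where e: "e \<in> set (lower P F)" "e \<in> set p" by blast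
  obtain As Bs where Fs: "Fs = As @ F # Bs" using F by (meson split_list)
  show False
  proof (rule sweep_cons_split[of p As F Bs q])
    fix a b
    assume h: "spath (a @ upper P F @ b)" "spath (a @ lower P F @ b)" "above 1 p (a @ upper P F @ b)"
      "above 1 (a @ upper P F @ b) (a @ lower P F @ b)" "set (lower P F) \<inter> set (a @ upper P F @ b) = {}"
    have "e \<in> set (a @ upper P F @ b)"
      using arc_sandwich[OF p h(2,1,3,4) e(2)] e(1) by simp
    then show False using h(5) e(1) by blast
  qed (use sw jf p Fs in auto)
qed

text \<open>
  An arc that leaves the path when the first of the two faces is crossed cannot be on the path again
  when the second one is reached.
\<close>

lemma sweep_uppers_disjoint:
  assumes sw: "sweep P p Fs q" and jf: "\<And>F'. F' \<in> set Fs \<Longrightarrow> jordan_face F'" and p: "spath p"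
    and F: "F \<in> set Fs" "F' \<in> set Fs" "F \<noteq> F'"
  shows "set (upper P F) \<inter> set (upper P F') = {}"
proof -
  have "set (upper P F) \<inter> set (upper P F') = {}"
    if Fs: "Fs = As @ F # Bs @ F' # Cs" for As Bs Cs F F'
  proof (rule sweep_cons_split[of p As F "Bs @ F' # Cs" q])
    fix a b
    let ?u = "a @ upper P F @ b" and ?l = "a @ lower P F @ b"
    assume h: "sweep P ?l (Bs @ F' # Cs) q" "spath ?u" "spath ?l" "above 1 ?u ?l" "set (upper P F) \<inter> set ?l = {}"
    show ?thesis
    proof (rule sweep_cons_split[OF h(1) _ h(3)])
      fix a' b'
      let ?u' = "a' @ upper P F' @ b'"
      assume h': "spath ?u'" "above 1 ?l ?u'"
      show "set (upper P F) \<inter> set (upper P F') = {}"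
      proof (rule ccontr)
        assume "set (upper P F) \<inter> set (upper P F') \<noteq> {}"
        then obtain e where e: "e \<in> set ?u" "e \<in> set ?u'" "e \<in> set (upper P F)" by auto
        then have "e \<in> set ?l" using arc_sandwich[OF h(2) h'(1) h(3,4) h'(2)] by blast
        then show False using h(5) e(3) by blast
      qed
    qed (use jf Fs in auto)
  qed (use sw jf p Fs in auto)
  moreover have "(\<exists>As Bs Cs. Fs = As @ F # Bs @ F' # Cs) \<or> (\<exists>As Bs Cs. Fs = As @ F' # Bs @ F # Cs)"
  proof -
    obtain As Bs where Fs: "Fs = As @ F # Bs" using F(1) by (meson split_list)
    then have "F' \<in> set As \<or> F' \<in> set Bs" using F by auto
    then show ?thesis using Fs by (metis append.assoc append_Cons split_list)
  qed
  ultimately show ?thesis by (metis inf_commute)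
qed

theorem sweep_of_pasting_scheme:
  obtains Fs where "sweep P (top_path P) Fs (bottom_path P)" "distinct Fs" "set Fs = faces P"
    "spath (top_path P)" "spath (bottom_path P)" "\<And>F. F \<in> faces P \<Longrightarrow> jordan_face F"
    "\<And>F F'. F \<in> faces P \<Longrightarrow> F' \<in> faces P \<Longrightarrow> F \<noteq> F' \<Longrightarrow> set (upper P F) \<inter> set (upper P F') = {}"
proof -
  obtain t where t: "spath t" "\<And>q. spath q \<Longrightarrow> above 1 t q" using extremal_spath[of 1] by auto
  obtain m where "spath m" "\<And>q. spath q \<Longrightarrow> above (- 1) m q" using extremal_spath[of "- 1"] by auto
  then have m: "spath m" "\<And>q. spath q \<Longrightarrow> above 1 q m" by (auto simp: above_def)
  obtain Fs where Fs: "sweep P t Fs m" "\<And>F. F \<in> set Fs \<Longrightarrow> jordan_face F"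
    using sweep_to_extremal[OF m t(1)] by blast
  have ob: "outer_boundary P = (t, m)" by (rule outer_boundary_extremal[OF t m])
  note faces = sweep_lists_faces[OF t m Fs]
  have tm: "top_path P = t" "bottom_path P = m" using ob by (simp_all add: top_path_def bottom_path_def)
  show ?thesis
  proof (rule that[of Fs, unfolded tm])
    show "sweep P t Fs m" "distinct Fs" "set Fs = faces P" "spath t" "spath m"
      using Fs(1) faces t(1) m(1) by simp_all
    fix F assume "F \<in> faces P"
    then have F: "F \<in> set Fs" using faces(1) by simp
    show "jordan_face F" by (rule Fs(2)[OF F])
    fix F' assume "F' \<in> faces P" and ne: "F \<noteq> F'"
    then have F': "F' \<in> set Fs" using faces(1) by simp
    show "set (upper P F) \<inter> set (upper P F') = {}"
      by (rule sweep_uppers_disjoint[OF Fs t(1) F F' ne])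
  qed
qed

end

section \<open>Words of swaps\<close>

text \<open>
  The form of the definition that simplifies along concatenation of lists.
\<close>

lemma linear_extensions_iff:
  "xs \<in> linear_extensions A R \<longleftrightarrow>
     distinct xs \<and> set xs = A \<and> (\<forall>a\<in>A. \<not> R a a) \<and> sorted_wrt (\<lambda>a b. \<not> R b a) xs"
proof -
  have "(\<forall>i < length xs. \<forall>j < length xs. R (xs ! i) (xs ! j) \<longrightarrow> i < j) \<longleftrightarrow>
    (\<forall>a\<in>set xs. \<not> R a a) \<and> sorted_wrt (\<lambda>a b. \<not> R b a) xs" (is "?L \<longleftrightarrow> ?R")
  proof
    assume ?L
    then show ?R
      unfolding sorted_wrt_iff_nth_less
      by (metis in_set_conv_nth less_irrefl less_not_sym order.strict_trans)
  next
    assume ?R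
    then show ?L
      unfolding sorted_wrt_iff_nth_less by (metis in_set_conv_nth linorder_neqE_nat)
  qed
  then show ?thesis unfolding linear_extensions_def by blast
qed

lemma swaps_iff:
  "(U, G, H, V) \<in> swaps A R \<longleftrightarrow> U @ G # H # V \<in> linear_extensions A R \<and> \<not> R G H \<and> \<not> R H G"
  by (simp add: swaps_def)

lemma word_eq_swap_word: "word_eq A R x y w w' \<Longrightarrow> swap_word A R x w y \<and> swap_word A R x w' y"
proof (induction rule: word_eq.induct)
  case (append x y w w' z v v')
  have app: "swap_word A R x w y \<Longrightarrow> swap_word A R y v z \<Longrightarrow> swap_word A R x (w @ v) z" for x y z w v
    by (induction rule: swap_word.induct) (auto intro: swap_word.step)
  then show ?case using append by blast
next
  case (rel_a U G H V)
  have "swap_word A R (swap_dom (U, G, H, V)) [(U, G, H, V), (U, H, G, V)] (U @ [G, H] @ V)"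
    by (rule swap_word.step[OF rel_a(1)])
      (use swap_word.step[OF rel_a(2), of "[]" "U @ [G, H] @ V"] rel_a(1) in
        \<open>auto intro: swap_word.nil simp: swaps_iff\<close>)
  then show ?case using rel_a by (auto simp: swaps_iff intro: swap_word.nil)
next
  case (rel_b U G H V K L W)
  show ?case
    using swap_word.step[OF rel_b(1), of "[(U @ [H, G] @ V, K, L, W)]" "U @ [H, G] @ V @ [L, K] @ W"]
      swap_word.step[OF rel_b(2), of "[]" "U @ [H, G] @ V @ [L, K] @ W"]
      swap_word.step[OF rel_b(3), of "[(U, G, H, V @ [L, K] @ W)]" "U @ [H, G] @ V @ [L, K] @ W"]
      swap_word.step[OF rel_b(4), of "[]" "U @ [H, G] @ V @ [L, K] @ W"]
      rel_b swap_word.nil[of "U @ [H, G] @ V @ [L, K] @ W" A R]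
    by (auto simp: swaps_iff linear_extensions_iff sorted_wrt_append)
next
  case (rel_c U G H K V)
  let ?y = "U @ [K, H, G] @ V"
  have "?y \<in> linear_extensions A R"
    using rel_c by (auto simp: swaps_iff linear_extensions_iff sorted_wrt_append)
  then show ?case
    using swap_word.step[OF rel_c(1), of "[(U @ [H], G, K, V), (U, H, K, G # V)]" ?y]
      swap_word.step[OF rel_c(2), of "[(U, H, K, G # V)]" ?y] swap_word.step[OF rel_c(3), of "[]" ?y]
      swap_word.step[OF rel_c(4), of "[(U, G, K, H # V), (U @ [K], G, H, V)]" ?y]
      swap_word.step[OF rel_c(5), of "[(U @ [K], G, H, V)]" ?y] swap_word.step[OF rel_c(6), of "[]" ?y]
      swap_word.nil[of ?y A R]
    by auto
qed (auto intro: swap_word.nil)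

lemma swap_word_append:
  "swap_word A R x w y \<Longrightarrow> swap_word A R y v z \<Longrightarrow> swap_word A R x (w @ v) z"
  using word_eq_swap_word word_eq.append word_eq.refl by meson

lemma swap_word_single:
  assumes "(U, G, H, V) \<in> swaps A R"
  shows "swap_word A R (U @ G # H # V) [(U, G, H, V)] (U @ H # G # V)"
proof -
  have "U @ H # G # V \<in> linear_extensions A R"
    using assms by (auto simp: swaps_iff linear_extensions_iff sorted_wrt_append)
  then show ?thesis
    using swap_word.step[OF assms, of "[]" "U @ H # G # V"] by (auto intro: swap_word.nil)
qed

lemma swap_word_singleI:
  assumes "(U, G, H, V) \<in> swaps A R" "x = U @ G # H # V" "y = U @ H # G # V"
  shows "swap_word A R x [(U, G, H, V)] y"
  unfolding assms(2,3) using assms(1) by (rule swap_word_single)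

lemma swap_word_ends:
  "swap_word A R x w y \<Longrightarrow> x \<in> linear_extensions A R \<and> y \<in> linear_extensions A R"
  by (induction rule: swap_word.induct) (auto simp: swaps_def)

lemma word_eq_flanked:
  assumes "word_eq A R x y w w'" "swap_word A R y v z"
  shows "word_eq A R x z (w @ v) (w' @ v)"
  using assms by (blast intro: word_eq.append word_eq.refl)

lemma word_eq_after:
  assumes "swap_word A R x u y" "word_eq A R y z w w'"
  shows "word_eq A R x z (u @ w) (u @ w')"
  using assms by (blast intro: word_eq.append word_eq.refl)

text \<open>
  The word that moves \<open>m\<close> to the left across \<open>U\<close>, nearest letter first.
\<close>

fun bubble :: "'f list \<Rightarrow> 'f \<Rightarrow> 'f list \<Rightarrow> 'f list \<Rightarrow> 'f swap list" where
  "bubble Q m [] V = []"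
| "bubble Q m (u # U) V = bubble (Q @ [u]) m U V @ [(Q, u, m, U @ V)]"

lemma bubble_snoc: "bubble Q m (U @ [u]) V = (Q @ U, u, m, V) # bubble Q m U (u # V)"
  by (induction U arbitrary: Q) auto

lemma bubble_swap_word:
  assumes "Q @ U @ m # V \<in> linear_extensions A R" "\<And>u. u \<in> set U \<Longrightarrow> \<not> R u m"
  shows "swap_word A R (Q @ U @ m # V) (bubble Q m U V) (Q @ m # U @ V)"
  using assms
proof (induction U arbitrary: Q)
  case Nil
  then show ?case by (auto intro: swap_word.nil)
next
  case (Cons u U)
  have "swap_word A R (Q @ u # U @ m # V) (bubble (Q @ [u]) m U V) (Q @ u # m # U @ V)"
    using Cons.IH[of "Q @ [u]"] Cons.prems by simp
  moreover have "swap_word A R (Q @ u # m # U @ V) [(Q, u, m, U @ V)] (Q @ m # u # U @ V)"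
    by (rule swap_word_single)
      (use Cons.prems in \<open>auto simp: swaps_iff linear_extensions_iff sorted_wrt_append\<close>)
  ultimately show ?case by (auto intro: swap_word_append)
qed

lemma word_eq_commute:
  assumes "P @ G # H # M @ K # L # W \<in> linear_extensions A R"
    and "\<not> R G H" "\<not> R H G" "\<not> R K L" "\<not> R L K"
  shows "word_eq A R (P @ G # H # M @ K # L # W) (P @ H # G # M @ L # K # W)
      [(P, G, H, M @ K # L # W), (P @ H # G # M, K, L, W)]
      [(P @ G # H # M, K, L, W), (P, G, H, M @ L # K # W)]"
  using word_eq.rel_b[of P G H M K L W A R] assms
  by (auto simp: swaps_iff linear_extensions_iff sorted_wrt_append)

lemma bubble_commutes_with_earlier_swap:
  assumes "P @ G # H # M @ U @ m # V \<in> linear_extensions A R" "\<And>u. u \<in> set U \<Longrightarrow> \<not> R u m"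
    and "\<not> R G H" "\<not> R H G"
  shows "word_eq A R (P @ G # H # M @ U @ m # V) (P @ H # G # M @ m # U @ V)
     ((P, G, H, M @ U @ m # V) # bubble (P @ H # G # M) m U V)
     (bubble (P @ G # H # M) m U V @ [(P, G, H, M @ m # U @ V)])"
  using assms
proof (induction U arbitrary: M)
  case Nil
  then show ?case using swap_word_single[of P G H "M @ m # V" A R]
    by (auto intro: word_eq.refl simp: swaps_iff)
next
  case (Cons u U)
  have "word_eq A R (P @ G # H # M @ (u # U) @ m # V) (P @ H # G # M @ u # m # U @ V)
     ((P, G, H, M @ (u # U) @ m # V) # bubble (P @ H # G # M @ [u]) m U V)
     (bubble (P @ G # H # M @ [u]) m U V @ [(P, G, H, M @ u # m # U @ V)])"
    using Cons.IH[of "M @ [u]"] Cons.prems by simp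
  moreover have "swap_word A R (P @ H # G # M @ u # m # U @ V) [(P @ H # G # M, u, m, U @ V)]
     (P @ H # G # M @ m # u # U @ V)"
    by (rule swap_word_singleI) (use Cons.prems in \<open>auto simp: swaps_iff linear_extensions_iff sorted_wrt_append\<close>)
  ultimately have 1: "word_eq A R (P @ G # H # M @ (u # U) @ m # V) (P @ H # G # M @ m # u # U @ V)
     ((P, G, H, M @ (u # U) @ m # V) # bubble (P @ H # G # M) m (u # U) V)
     (bubble (P @ G # H # M @ [u]) m U V @ [(P, G, H, M @ u # m # U @ V), (P @ H # G # M, u, m, U @ V)])"
    using word_eq_flanked by fastforce
  have "word_eq A R (P @ G # H # M @ u # m # U @ V) (P @ H # G # M @ m # u # U @ V)
     [(P, G, H, M @ u # m # U @ V), (P @ H # G # M, u, m, U @ V)]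
     [(P @ G # H # M, u, m, U @ V), (P, G, H, M @ m # u # U @ V)]"
    by (rule word_eq_commute) (use Cons.prems in \<open>auto simp: linear_extensions_iff sorted_wrt_append\<close>)
  moreover have "swap_word A R (P @ G # H # M @ (u # U) @ m # V) (bubble (P @ G # H # M @ [u]) m U V)
     (P @ G # H # M @ u # m # U @ V)"
    using bubble_swap_word[of "P @ G # H # M @ [u]" U m V A R] Cons.prems by simp
  ultimately have "word_eq A R (P @ G # H # M @ (u # U) @ m # V) (P @ H # G # M @ m # u # U @ V)
     (bubble (P @ G # H # M @ [u]) m U V @ [(P, G, H, M @ u # m # U @ V), (P @ H # G # M, u, m, U @ V)])
     (bubble (P @ G # H # M) m (u # U) V @ [(P, G, H, M @ m # (u # U) @ V)])"
    using word_eq_after by fastforce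
  with 1 show ?case by (auto intro: word_eq.trans)
qed

lemma bubble_commutes_with_later_swap:
  assumes "Q @ U @ m # V @ G # H # W \<in> linear_extensions A R" "\<And>u. u \<in> set U \<Longrightarrow> \<not> R u m"
    and "\<not> R G H" "\<not> R H G"
  shows "word_eq A R (Q @ U @ m # V @ G # H # W) (Q @ m # U @ V @ H # G # W)
     ((Q @ U @ m # V, G, H, W) # bubble Q m U (V @ H # G # W))
     (bubble Q m U (V @ G # H # W) @ [(Q @ m # U @ V, G, H, W)])"
  using assms
proof (induction U arbitrary: Q)
  case Nil
  then show ?case using swap_word_single[of "Q @ m # V" G H W A R]
    by (auto intro: word_eq.refl simp: swaps_iff)
next
  case (Cons u U)
  have "word_eq A R (Q @ (u # U) @ m # V @ G # H # W) (Q @ u # m # U @ V @ H # G # W)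
     ((Q @ (u # U) @ m # V, G, H, W) # bubble (Q @ [u]) m U (V @ H # G # W))
     (bubble (Q @ [u]) m U (V @ G # H # W) @ [(Q @ u # m # U @ V, G, H, W)])"
    using Cons.IH[of "Q @ [u]"] Cons.prems by simp
  moreover have "swap_word A R (Q @ u # m # U @ V @ H # G # W) [(Q, u, m, U @ V @ H # G # W)]
     (Q @ m # u # U @ V @ H # G # W)"
    by (rule swap_word_singleI) (use Cons.prems in \<open>auto simp: swaps_iff linear_extensions_iff sorted_wrt_append\<close>)
  ultimately have 1: "word_eq A R (Q @ (u # U) @ m # V @ G # H # W) (Q @ m # u # U @ V @ H # G # W)
     ((Q @ (u # U) @ m # V, G, H, W) # bubble Q m (u # U) (V @ H # G # W))
     (bubble (Q @ [u]) m U (V @ G # H # W) @ [(Q @ u # m # U @ V, G, H, W), (Q, u, m, U @ V @ H # G # W)])"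
    using word_eq_flanked by fastforce
  have "word_eq A R (Q @ u # m # (U @ V) @ G # H # W) (Q @ m # u # (U @ V) @ H # G # W)
     [(Q, u, m, (U @ V) @ G # H # W), (Q @ m # u # (U @ V), G, H, W)]
     [(Q @ u # m # (U @ V), G, H, W), (Q, u, m, (U @ V) @ H # G # W)]"
    by (rule word_eq_commute) (use Cons.prems in \<open>auto simp: linear_extensions_iff sorted_wrt_append\<close>)
  moreover have "swap_word A R (Q @ (u # U) @ m # V @ G # H # W) (bubble (Q @ [u]) m U (V @ G # H # W))
     (Q @ u # m # U @ V @ G # H # W)"
    using bubble_swap_word[of "Q @ [u]" U m "V @ G # H # W" A R] Cons.prems by simp
  ultimately have "word_eq A R (Q @ (u # U) @ m # V @ G # H # W) (Q @ m # u # U @ V @ H # G # W)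
     (bubble (Q @ [u]) m U (V @ G # H # W) @ [(Q @ u # m # U @ V, G, H, W), (Q, u, m, U @ V @ H # G # W)])
     (bubble Q m (u # U) (V @ G # H # W) @ [(Q @ m # (u # U) @ V, G, H, W)])"
    using word_eq_after word_eq.sym by fastforce
  with 1 show ?case by (auto intro: word_eq.trans)
qed

text \<open>
  The travelling letter crosses a pair of adjacent letters. Relation (c) exchanges the crossing with the swap
  of this pair; the letters around the pair are handled by (b).
\<close>

lemma bubble_past_swap:
  assumes "Q @ U @ G # H # V @ m # W \<in> linear_extensions A R"
    and "\<And>u. u \<in> set (U @ G # H # V) \<Longrightarrow> \<not> R u m"
    and "\<not> R G H" "\<not> R H G"
  shows "word_eq A R (Q @ U @ G # H # V @ m # W) (Q @ m # U @ H # G # V @ W)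
     ((Q @ U, G, H, V @ m # W) # bubble Q m (U @ H # G # V) W)
     (bubble Q m (U @ G # H # V) W @ [(Q @ m # U, G, H, V @ W)])"
  using assms
proof (induction U arbitrary: Q)
  case Nil
  let ?x = "Q @ G # H # V @ m # W" and ?y = "Q @ m # H # G # V @ W"
  have "word_eq A R ?x (Q @ H # G # m # V @ W)
     ((Q, G, H, V @ m # W) # bubble (Q @ H # [G]) m V W)
     (bubble (Q @ G # [H]) m V W @ [(Q, G, H, m # V @ W)])"
    using bubble_commutes_with_earlier_swap[of Q G H "[]" V m W A R] Nil by simp
  moreover have c: "word_eq A R (Q @ [G, H, m] @ V @ W) (Q @ [m, H, G] @ V @ W)
      [(Q, G, H, m # V @ W), (Q @ [H], G, m, V @ W), (Q, H, m, G # V @ W)]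
      [(Q @ [G], H, m, V @ W), (Q, G, m, H # V @ W), (Q @ [m], G, H, V @ W)]"
    by (rule word_eq.rel_c)
      (use Nil in \<open>auto simp: swaps_iff linear_extensions_iff sorted_wrt_append\<close>)
  moreover have "swap_word A R (Q @ H # G # m # V @ W) [(Q @ [H], G, m, V @ W), (Q, H, m, G # V @ W)] ?y"
  proof -
    have "Q @ H # G # m # V @ W \<in> linear_extensions A R"
      using Nil by (auto simp: linear_extensions_iff sorted_wrt_append)
    then show ?thesis using bubble_swap_word[of Q "[H, G]" m "V @ W" A R] Nil by auto
  qed
  ultimately have 1: "word_eq A R ?x ?y
     (((Q, G, H, V @ m # W) # bubble (Q @ [H, G]) m V W) @ [(Q @ [H], G, m, V @ W), (Q, H, m, G # V @ W)])
     ((bubble (Q @ [G, H]) m V W @ [(Q, G, H, m # V @ W)]) @ [(Q @ [H], G, m, V @ W), (Q, H, m, G # V @ W)])"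
    using word_eq_flanked by fastforce
  have "swap_word A R ?x (bubble (Q @ [G, H]) m V W) (Q @ G # H # m # V @ W)"
    using bubble_swap_word[of "Q @ [G, H]" V m W A R] Nil by simp
  then have 2: "word_eq A R ?x ?y
     (bubble (Q @ [G, H]) m V W @ [(Q, G, H, m # V @ W), (Q @ [H], G, m, V @ W), (Q, H, m, G # V @ W)])
     (bubble (Q @ [G, H]) m V W @ [(Q @ [G], H, m, V @ W), (Q, G, m, H # V @ W), (Q @ [m], G, H, V @ W)])"
    using word_eq_after c by fastforce
  show ?case using word_eq.trans[OF _ 2] 1 by simp
next
  case (Cons u U)
  let ?x = "Q @ (u # U) @ G # H # V @ m # W" and ?y = "Q @ m # u # U @ H # G # V @ W"
  have "word_eq A R ?x (Q @ u # m # U @ H # G # V @ W)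
     ((Q @ (u # U), G, H, V @ m # W) # bubble (Q @ [u]) m (U @ H # G # V) W)
     (bubble (Q @ [u]) m (U @ G # H # V) W @ [(Q @ u # m # U, G, H, V @ W)])"
    using Cons.IH[of "Q @ [u]"] Cons.prems by simp
  moreover have "swap_word A R (Q @ u # m # U @ H # G # V @ W) [(Q, u, m, U @ H # G # V @ W)] ?y"
    by (rule swap_word_singleI) (use Cons.prems in \<open>auto simp: swaps_iff linear_extensions_iff sorted_wrt_append\<close>)
  ultimately have 1: "word_eq A R ?x ?y
     ((Q @ (u # U), G, H, V @ m # W) # bubble Q m ((u # U) @ H # G # V) W)
     (bubble (Q @ [u]) m (U @ G # H # V) W @ [(Q @ u # m # U, G, H, V @ W), (Q, u, m, U @ H # G # V @ W)])"
    using word_eq_flanked by fastforce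
  have "word_eq A R (Q @ u # m # U @ G # H # V @ W) (Q @ m # u # U @ H # G # V @ W)
     [(Q, u, m, U @ G # H # V @ W), (Q @ m # u # U, G, H, V @ W)]
     [(Q @ u # m # U, G, H, V @ W), (Q, u, m, U @ H # G # V @ W)]"
    by (rule word_eq_commute) (use Cons.prems in \<open>auto simp: linear_extensions_iff sorted_wrt_append\<close>)
  moreover have "swap_word A R ?x (bubble (Q @ [u]) m (U @ G # H # V) W) (Q @ u # m # U @ G # H # V @ W)"
    using bubble_swap_word[of "Q @ [u]" "U @ G # H # V" m W A R] Cons.prems by simp
  ultimately have "word_eq A R ?x ?y
     (bubble (Q @ [u]) m (U @ G # H # V) W @ [(Q @ u # m # U, G, H, V @ W), (Q, u, m, U @ H # G # V @ W)])
     (bubble Q m ((u # U) @ G # H # V) W @ [(Q @ m # (u # U), G, H, V @ W)])"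
    using word_eq_after word_eq.sym by fastforce
  with 1 show ?case by (auto intro: word_eq.trans)
qed

section \<open>Canonical words\<close>

text \<open>
  Selection sort with target \<open>Q @ z\<close>, where the prefix \<open>Q\<close> is already in place.
\<close>

fun canonical_word :: "'f list \<Rightarrow> 'f list \<Rightarrow> 'f list \<Rightarrow> 'f swap list" where
  "canonical_word Q [] x = []"
| "canonical_word Q (m # z) x =
     (let U = takeWhile (\<lambda>f. f \<noteq> m) x; V = tl (dropWhile (\<lambda>f. f \<noteq> m) x)
      in bubble Q m U V @ canonical_word (Q @ [m]) z (U @ V))"

lemma canonical_word_split:
  assumes "m \<notin> set U"
  shows "canonical_word Q (m # z) (U @ m # V) = bubble Q m U V @ canonical_word (Q @ [m]) z (U @ V)"
proof -
  have "\<forall>x\<in>set U. x \<noteq> m" using assms by blast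
  then have "takeWhile (\<lambda>f. f \<noteq> m) (U @ m # V) = U" "dropWhile (\<lambda>f. f \<noteq> m) (U @ m # V) = m # V"
    by (simp_all add: takeWhile_append2 dropWhile_append2)
  then show ?thesis by simp
qed

lemma linear_extensions_same_set:
  assumes "Q @ x \<in> linear_extensions A R" "Q @ z \<in> linear_extensions A R"
  shows "set x = set z"
  using assms by (auto simp: linear_extensions_iff)

text \<open>
  The first letter \<open>m\<close> of the remaining target is minimal among the remaining letters, so that it can be
  moved across all of them.
\<close>

lemma canonical_word:
  assumes "Q @ z \<in> linear_extensions A R" "Q @ x \<in> linear_extensions A R"
  shows "swap_word A R (Q @ x) (canonical_word Q z x) (Q @ z)"
  using assms
proof (induction z arbitrary: Q x)
  case Nil
  then show ?case using linear_extensions_same_set[OF Nil(1,2)] by (auto intro: swap_word.nil)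
next
  case (Cons m z)
  have "m \<in> set x" using linear_extensions_same_set[OF Cons.prems] by auto
  then obtain U V where x: "x = U @ m # V" "m \<notin> set U" by (meson split_list_first)
  have min: "\<not> R u m" if "u \<in> set U" for u
    using that linear_extensions_same_set[OF Cons.prems] Cons.prems x
    by (auto simp: linear_extensions_iff sorted_wrt_append)
  have 1: "swap_word A R (Q @ x) (bubble Q m U V) (Q @ m # U @ V)"
    using bubble_swap_word[of Q U m V A R] Cons.prems x min by simp
  then have "swap_word A R ((Q @ [m]) @ U @ V) (canonical_word (Q @ [m]) z (U @ V)) ((Q @ [m]) @ z)"
    using Cons.IH[of "Q @ [m]" "U @ V"] Cons.prems swap_word_ends[OF 1] by simp
  then show ?case using swap_word_append[OF 1] x canonical_word_split[of m U] by auto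
qed

text \<open>
  The letter \<open>m\<close> that the canonical word moves first can be one of the swapped letters, stand to the left of
  them, or stand to the right of them and cross both.
\<close>

lemma canonical_word_absorbs_swap:
  assumes "Q @ z \<in> linear_extensions A R" "Q @ U @ G # H # V \<in> linear_extensions A R"
    and inc: "\<not> R G H" "\<not> R H G"
  shows "word_eq A R (Q @ U @ G # H # V) (Q @ z)
    ((Q @ U, G, H, V) # canonical_word Q z (U @ H # G # V)) (canonical_word Q z (U @ G # H # V))"
  using assms
proof (induction z arbitrary: Q U V)
  case Nil
  then show ?case using linear_extensions_same_set[OF Nil(1,2)] by auto
next
  case (Cons m z)
  let ?x = "U @ G # H # V" and ?y = "U @ H # G # V"
  note sets = linear_extensions_same_set[OF Cons.prems(1,2)]
  have x: "Q @ ?x \<in> linear_extensions A R" and y: "Q @ ?y \<in> linear_extensions A R"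
    using Cons.prems by (auto simp: linear_extensions_iff sorted_wrt_append)
  have dist: "distinct ?x" using Cons.prems by (auto simp: linear_extensions_iff)
  have min: "\<not> R u m" if "u \<in> set ?x" "u \<noteq> m" for u
    using that sets Cons.prems by (auto simp: linear_extensions_iff sorted_wrt_append)
  have "m \<in> set ?x" using sets by auto
  then consider "m = H" | "m = G" | "m \<in> set U" | "m \<in> set V" by auto
  then show ?case
  proof cases
    case 1
    then have "m \<notin> set U" "m \<noteq> G" using dist by auto
    then have eq: "canonical_word Q (m # z) ?x = (Q @ U, G, H, V) # canonical_word Q (m # z) ?y"
      using canonical_word_split[of m "U @ [G]" Q z V] canonical_word_split[of m U Q z "G # V"] 1
      by (simp add: bubble_snoc)
    show ?thesis
      using word_eq.refl[OF canonical_word[OF Cons.prems(1) x]] unfolding eq .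
  next
    case 2
    then have "m \<notin> set U" "m \<noteq> H" using dist by auto
    then have eq: "canonical_word Q (m # z) ?y = (Q @ U, H, G, V) # canonical_word Q (m # z) ?x"
      using canonical_word_split[of m "U @ [H]" Q z V] canonical_word_split[of m U Q z "H # V"] 2
      by (simp add: bubble_snoc)
    have "word_eq A R (Q @ ?x) (Q @ ?x) [(Q @ U, G, H, V), (Q @ U, H, G, V)] []"
      using word_eq.rel_a[of "Q @ U" G H V A R] x y inc by (auto simp: swaps_iff)
    from word_eq_flanked[OF this canonical_word[OF Cons.prems(1) x]] show ?thesis
      unfolding eq by simp
  next
    case 3
    then obtain U1 U2 where U: "U = U1 @ m # U2" "m \<notin> set U1" by (meson split_list_first)
    have minU: "\<not> R u m" if "u \<in> set U1" for u using min[of u] that U by auto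
    have 1: "word_eq A R (Q @ ?x) (Q @ m # U1 @ U2 @ H # G # V)
       ((Q @ U, G, H, V) # bubble Q m U1 (U2 @ H # G # V))
       (bubble Q m U1 (U2 @ G # H # V) @ [(Q @ m # U1 @ U2, G, H, V)])"
      using bubble_commutes_with_later_swap[of Q U1 m U2 G H V A R] x U minU inc by simp
    have b: "swap_word A R (Q @ ?x) (bubble Q m U1 (U2 @ G # H # V)) (Q @ m # U1 @ U2 @ G # H # V)"
      using bubble_swap_word[of Q U1 m "U2 @ G # H # V" A R] x U minU by simp
    have IH: "word_eq A R (Q @ m # U1 @ U2 @ G # H # V) (Q @ m # z)
       ((Q @ m # U1 @ U2, G, H, V) # canonical_word (Q @ [m]) z (U1 @ U2 @ H # G # V))
       (canonical_word (Q @ [m]) z (U1 @ U2 @ G # H # V))"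
      using Cons.IH[of "Q @ [m]" "U1 @ U2" V] swap_word_ends[OF b] Cons.prems by simp
    have "swap_word A R (Q @ m # U1 @ U2 @ H # G # V)
        (canonical_word (Q @ [m]) z (U1 @ U2 @ H # G # V)) (Q @ m # z)"
      using canonical_word[of "Q @ [m]" z A R "U1 @ U2 @ H # G # V"] Cons.prems
        swap_word_ends[of A R] word_eq_swap_word[OF 1] by force
    from word_eq_flanked[OF 1 this] word_eq_after[OF b IH] show ?thesis
      using U canonical_word_split[of m U1] by (auto intro: word_eq.trans)
  next
    case 4
    then obtain V1 V2 where V: "V = V1 @ m # V2" by (meson split_list_first)
    then have m: "m \<notin> set (U @ G # H # V1)" "m \<notin> set (U @ H # G # V1)" using dist by auto
    have minU: "\<not> R u m" if "u \<in> set (U @ G # H # V1)" for u using min[of u] that V m by auto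
    have 1: "word_eq A R (Q @ ?x) (Q @ m # U @ H # G # V1 @ V2)
       ((Q @ U, G, H, V) # bubble Q m (U @ H # G # V1) V2)
       (bubble Q m (U @ G # H # V1) V2 @ [(Q @ m # U, G, H, V1 @ V2)])"
      using bubble_past_swap[of Q U G H V1 m V2 A R] x V minU inc by simp
    have b: "swap_word A R (Q @ ?x) (bubble Q m (U @ G # H # V1) V2) (Q @ m # U @ G # H # V1 @ V2)"
      using bubble_swap_word[of Q "U @ G # H # V1" m "V2" A R] x V minU by simp
    have IH: "word_eq A R (Q @ m # U @ G # H # V1 @ V2) (Q @ m # z)
       ((Q @ m # U, G, H, V1 @ V2) # canonical_word (Q @ [m]) z (U @ H # G # V1 @ V2))
       (canonical_word (Q @ [m]) z (U @ G # H # V1 @ V2))"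
      using Cons.IH[of "Q @ [m]" "U" "V1 @ V2"] swap_word_ends[OF b] Cons.prems by simp
    have "swap_word A R (Q @ m # U @ H # G # V1 @ V2)
        (canonical_word (Q @ [m]) z (U @ H # G # V1 @ V2)) (Q @ m # z)"
      using canonical_word[of "Q @ [m]" z A R "U @ H # G # V1 @ V2"] Cons.prems
        swap_word_ends[of A R] word_eq_swap_word[OF 1] by force
    from word_eq_flanked[OF 1 this] word_eq_after[OF b IH] show ?thesis
      using V canonical_word_split[OF m(1), of Q z V2] canonical_word_split[OF m(2), of Q z V2]
      by (auto intro: word_eq.trans)
  qed
qed

lemma word_absorbed_by_canonical_word:
  assumes "swap_word A R x w y" "z \<in> linear_extensions A R"
  shows "word_eq A R x z (w @ canonical_word [] z y) (canonical_word [] z x)"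
  using assms
proof (induction rule: swap_word.induct)
  case (nil x)
  then show ?case using canonical_word[of "[]" z A R x] by (auto intro: word_eq.refl)
next
  case (step g w y)
  obtain U G H V where g: "g = (U, G, H, V)" by (cases g)
  have "word_eq A R (swap_dom g) z (g # canonical_word [] z (swap_cod g)) (canonical_word [] z (swap_dom g))"
    using canonical_word_absorbs_swap[of "[]" z A R U G H V] step g by (simp add: swaps_iff)
  moreover have "word_eq A R (swap_dom g) z ([g] @ (w @ canonical_word [] z y))
       ([g] @ canonical_word [] z (swap_cod g))"
    by (rule word_eq_after[of A R _ _ "swap_cod g"])
      (use step swap_word_single[of U G H V A R] g in auto)
  ultimately show ?case by (auto intro: word_eq.trans)
qed

lemma word_inverse:
  assumes "swap_word A R x w y"
  shows "\<exists>v. swap_word A R y v x \<and> word_eq A R x x (w @ v) []"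
  using assms
proof (induction rule: swap_word.induct)
  case (nil x)
  then show ?case by (auto intro!: exI[of _ "[]"] word_eq.refl swap_word.nil)
next
  case (step g w y)
  obtain U G H V where g: "g = (U, G, H, V)" by (cases g)
  from step obtain v where v: "swap_word A R y v (swap_cod g)" "word_eq A R (swap_cod g) (swap_cod g) (w @ v) []"
    by blast
  have inv: "(U, H, G, V) \<in> swaps A R"
    using step g by (auto simp: swaps_iff linear_extensions_iff sorted_wrt_append)
  have s: "swap_word A R (swap_cod g) [(U, H, G, V)] (swap_dom g)" "swap_word A R (swap_dom g) [g] (swap_cod g)"
    using swap_word_single[OF inv] swap_word_single[of U G H V A R] step g by auto
  have a: "word_eq A R (swap_dom g) (swap_dom g) [g, (U, H, G, V)] []"
    using word_eq.rel_a[of U G H V A R] step inv g by simp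
  have "word_eq A R (swap_dom g) (swap_dom g) ([g] @ (w @ v) @ [(U, H, G, V)]) ([g] @ [] @ [(U, H, G, V)])"
    using word_eq_after[OF s(2) word_eq_flanked[OF v(2) s(1)]] by simp
  with a have "word_eq A R (swap_dom g) (swap_dom g) ((g # w) @ (v @ [(U, H, G, V)])) []"
    by (auto intro: word_eq.trans)
  with swap_word_append[OF v(1) s(1)] show ?case by blast
qed

text \<open>
  Both words become equal after composition with a canonical word, and words are invertible.
\<close>

theorem parallel_words_equal:
  assumes "swap_word A R x w y" "swap_word A R x w' y"
  shows "word_eq A R x y w w'"
proof -
  have x: "x \<in> linear_extensions A R" and y: "y \<in> linear_extensions A R"
    using swap_word_ends[OF assms(1)] by auto
  let ?c = "canonical_word [] y y"
  have c: "swap_word A R y ?c y" using canonical_word[of "[]" y A R y] y by simp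
  obtain v where v: "swap_word A R y v y" "word_eq A R y y (?c @ v) []"
    using word_inverse[OF c] by blast
  have "word_eq A R x y (w @ ?c) (w' @ ?c)"
    using word_absorbed_by_canonical_word[OF assms(1) y] word_absorbed_by_canonical_word[OF assms(2) y]
    by (blast intro: word_eq.trans word_eq.sym)
  then have 1: "word_eq A R x y (w @ ?c @ v) (w' @ ?c @ v)"
    using word_eq_flanked[OF _ v(1)] by fastforce
  have "word_eq A R x y (w @ ?c @ v) w" "word_eq A R x y (w' @ ?c @ v) w'"
    using word_eq_after[OF assms(1) v(2)] word_eq_after[OF assms(2) v(2)] by auto
  with 1 show ?thesis by (blast intro: word_eq.trans word_eq.sym)
qed

lemma linear_extensions_connected:
  assumes "x \<in> linear_extensions A R" "y \<in> linear_extensions A R"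
  shows "\<exists>w. swap_word A R x w y"
  using canonical_word[of "[]" y A R x] assms by auto

section \<open>The groupoid of linear extensions\<close>

lemma word_class_eq:
  assumes "swap_word A R x w y"
  shows "word_class A R x y w = {w'. swap_word A R x w' y}"
  using parallel_words_equal[OF assms] word_eq_swap_word[of A R x y] by (auto simp: word_class_def)

lemma Obj_groupoid [simp]: "Obj (linear_extension_groupoid A R) = linear_extensions A R"
  by (simp add: linear_extension_groupoid_def)

text \<open>
  Since parallel words are equal, an arrow is just a pair of objects.
\<close>

lemma Arr_groupoid:
  "Arr (linear_extension_groupoid A R) =
     {(x, y, {w. swap_word A R x w y}) | x y. x \<in> linear_extensions A R \<and> y \<in> linear_extensions A R}"
proof -
  have "(x, y, word_class A R x y w) = (x, y, {w. swap_word A R x w y})" if "swap_word A R x w y" for x y w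
    using word_class_eq[OF that] by simp
  then show ?thesis
    unfolding linear_extension_groupoid_def
    using swap_word_ends[of A R] linear_extensions_connected[of _ A R] by (auto; metis)
qed

lemma Compose_groupoid:
  assumes "x \<in> linear_extensions A R" "y \<in> linear_extensions A R" "z \<in> linear_extensions A R"
  shows "Compose (linear_extension_groupoid A R) (y, z, {w. swap_word A R y w z}) (x, y, {w. swap_word A R x w y})
    = (x, z, {w. swap_word A R x w z})"
proof -
  obtain w v where "swap_word A R x w y" "swap_word A R y v z"
    using linear_extensions_connected assms by metis
  then show ?thesis
    unfolding linear_extension_groupoid_def
    by (auto simp: word_class_eq[OF swap_word_append] intro: swap_word_append)
qed

lemma Ident_groupoid:
  assumes "x \<in> linear_extensions A R"
  shows "Ident (linear_extension_groupoid A R) x = (x, x, {w. swap_word A R x w x})"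
  using word_class_eq[OF swap_word.nil[OF assms]] by (simp add: linear_extension_groupoid_def)

lemma Dom_groupoid [simp]: "Dom (linear_extension_groupoid A R) (x, y, c) = x"
  and Cod_groupoid [simp]: "Cod (linear_extension_groupoid A R) (x, y, c) = y"
  by (simp_all add: linear_extension_groupoid_def)

lemma groupoid_linear_extension_groupoid: "groupoid (linear_extension_groupoid A R)"
proof
  show "iso_arrow (linear_extension_groupoid A R) f" if f_in: "f \<in> Arr (linear_extension_groupoid A R)" for f
  proof -
    obtain x y where f: "f = (x, y, {w. swap_word A R x w y})"
      and xy: "x \<in> linear_extensions A R" "y \<in> linear_extensions A R"
      using f_in unfolding Arr_groupoid by blast
    have "inverse_arrows (linear_extension_groupoid A R) f (y, x, {w. swap_word A R y w x})"
      unfolding inverse_arrows_def f using xy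
      by (auto simp: Arr_groupoid Compose_groupoid Ident_groupoid)
    then show ?thesis unfolding iso_arrow_def by blast
  qed
qed (auto simp: Arr_groupoid Compose_groupoid Ident_groupoid)

lemma category_terminal_category: "category terminal_category"
  by unfold_locales (auto simp: terminal_category_def)

lemma contractible_linear_extension_groupoid:
  assumes "z \<in> linear_extensions A R"
  shows "contractible_category (linear_extension_groupoid A R)"
proof -
  let ?C = "linear_extension_groupoid A R"
  let ?arr = "\<lambda>x y. (x, y, {w. swap_word A R x w y})"
  interpret groupoid ?C by (rule groupoid_linear_extension_groupoid)
  interpret T: category terminal_category by (rule category_terminal_category)
  have "is_functor ?C terminal_category (\<lambda>_. ()) (\<lambda>_. ())"
    by unfold_locales (auto simp: terminal_category_def)
  moreover have "is_functor terminal_category ?C (\<lambda>_. z) (\<lambda>_. ?arr z z)"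
    by unfold_locales
      (use assms in \<open>auto simp: terminal_category_def Arr_groupoid Compose_groupoid Ident_groupoid\<close>)
  moreover have "naturally_isomorphic ?C ?C ((\<lambda>_. z) \<circ> (\<lambda>_. ())) ((\<lambda>_. ?arr z z) \<circ> (\<lambda>_. ())) id id"
    unfolding naturally_isomorphic_def
  proof (intro exI[of _ "\<lambda>x. ?arr z x"] conjI ballI)
    fix x assume "x \<in> Obj ?C"
    then show "iso_arrow ?C (?arr z x)" using assms by (intro all_iso) (auto simp: Arr_groupoid)
  qed (use assms in \<open>auto simp: Arr_groupoid Compose_groupoid\<close>)
  moreover have "naturally_isomorphic terminal_category terminal_category
      ((\<lambda>_. ()) \<circ> (\<lambda>_. z)) ((\<lambda>_. ()) \<circ> (\<lambda>_. ?arr z z)) id id"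
    unfolding naturally_isomorphic_def iso_arrow_def inverse_arrows_def by (auto simp: terminal_category_def)
  ultimately show ?thesis unfolding contractible_category_def equivalent_categories_def by blast
qed

section \<open>Whiskering and inverses in 2-categories\<close>

lemma (in category) inverse_unique:
  assumes "inverse_arrows C f g" "inverse_arrows C f h"
  shows "g = h"
proof -
  have "g = Compose C g (Ident C (Dom C g))" using assms Compose_Ident_right[of g] by (simp add: inverse_arrows_def)
  also have "\<dots> = Compose C g (Compose C f h)" using assms by (simp add: inverse_arrows_def)
  also have "\<dots> = Compose C (Compose C g f) h" using assms Compose_assoc[of h f g] by (simp add: inverse_arrows_def)
  also have "\<dots> = Compose C (Ident C (Cod C h)) h" using assms by (simp add: inverse_arrows_def)
  also have "\<dots> = h" using assms Compose_Ident_left[of h] by (simp add: inverse_arrows_def)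
  finally show ?thesis .
qed

lemma (in category) inv_arrow_eq: "inverse_arrows C f g \<Longrightarrow> inv_arrow C f = g"
  unfolding inv_arrow_def using inverse_unique by blast

lemma (in category) inverse_inv_arrow: "iso_arrow C f \<Longrightarrow> inverse_arrows C f (inv_arrow C f)"
  using inv_arrow_eq by (auto simp: iso_arrow_def)

definition cell1 :: "('a, 'b, 'c) two_cat \<Rightarrow> 'b \<Rightarrow> 'a \<Rightarrow> 'a \<Rightarrow> bool" where
  "cell1 X \<alpha> x y \<longleftrightarrow> \<alpha> \<in> cells1 X \<and> src1 X \<alpha> = x \<and> tgt1 X \<alpha> = y"

definition cell2 :: "('a, 'b, 'c) two_cat \<Rightarrow> 'c \<Rightarrow> 'b \<Rightarrow> 'b \<Rightarrow> bool" where
  "cell2 X \<Phi> \<alpha> \<beta> \<longleftrightarrow> \<Phi> \<in> cells2 X \<and> src2 X \<Phi> = \<alpha> \<and> tgt2 X \<Phi> = \<beta>"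

definition inverse2 :: "('a, 'b, 'c) two_cat \<Rightarrow> 'c \<Rightarrow> 'c \<Rightarrow> 'b \<Rightarrow> 'b \<Rightarrow> bool" where
  "inverse2 X \<Phi> \<Psi> \<alpha> \<beta> \<longleftrightarrow> cell2 X \<Phi> \<alpha> \<beta> \<and> cell2 X \<Psi> \<beta> \<alpha> \<and> vcomp X \<Psi> \<Phi> = id2 X \<alpha> \<and> vcomp X \<Phi> \<Psi> = id2 X \<beta>"

lemma inverse2_sym: "inverse2 X \<Phi> \<Psi> \<alpha> \<beta> \<Longrightarrow> inverse2 X \<Psi> \<Phi> \<beta> \<alpha>"
  by (auto simp: inverse2_def)

lemma inverse2_iff: "inverse2 X \<Phi> \<Psi> \<alpha> \<beta> \<longleftrightarrow> inverse_arrows (vert_cat X) \<Phi> \<Psi> \<and> cell2 X \<Phi> \<alpha> \<beta>"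
  by (auto simp: inverse2_def inverse_arrows_def vert_cat_def cell2_def)

context two_category
begin

lemmas cat1_laws = category.Dom_in[OF category_cat1] category.Cod_in[OF category_cat1]
  category.Ident_in[OF category_cat1] category.Dom_Ident[OF category_cat1] category.Cod_Ident[OF category_cat1]
  category.Compose_in[OF category_cat1] category.Dom_Compose[OF category_cat1] category.Cod_Compose[OF category_cat1]
  category.Compose_Ident_right[OF category_cat1] category.Compose_Ident_left[OF category_cat1]
  category.Compose_assoc[OF category_cat1]

lemmas vert_laws = category.Dom_in[OF category_vert] category.Cod_in[OF category_vert]
  category.Ident_in[OF category_vert] category.Dom_Ident[OF category_vert] category.Cod_Ident[OF category_vert]
  category.Compose_in[OF category_vert] category.Dom_Compose[OF category_vert] category.Cod_Compose[OF category_vert]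
  category.Compose_Ident_right[OF category_vert] category.Compose_Ident_left[OF category_vert]
  category.Compose_assoc[OF category_vert]

lemmas horiz_laws = category.Compose_in[OF category_horiz] category.Compose_assoc[OF category_horiz]

lemma cell1_ends: "cell1 X \<alpha> x y \<Longrightarrow> x \<in> cells0 X" "cell1 X \<alpha> x y \<Longrightarrow> y \<in> cells0 X"
  using cat1_laws(1,2) by (auto simp: cell1_def cat1_def)

lemma cell1_id: "x \<in> cells0 X \<Longrightarrow> cell1 X (id1 X x) x x"
  using cat1_laws(3-5) by (auto simp: cell1_def cat1_def)

lemma cell1_comp: "cell1 X \<alpha> x y \<Longrightarrow> cell1 X \<beta> y z \<Longrightarrow> cell1 X (comp1 X \<beta> \<alpha>) x z"
  using cat1_laws(6-8) by (auto simp: cell1_def cat1_def)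

lemma comp1_id: "cell1 X \<alpha> x y \<Longrightarrow> comp1 X \<alpha> (id1 X x) = \<alpha>" "cell1 X \<alpha> x y \<Longrightarrow> comp1 X (id1 X y) \<alpha> = \<alpha>"
  using cat1_laws(9,10) by (auto simp: cell1_def cat1_def)

lemma comp1_assoc: "cell1 X \<alpha> w x \<Longrightarrow> cell1 X \<beta> x y \<Longrightarrow> cell1 X \<gamma> y z \<Longrightarrow>
  comp1 X (comp1 X \<gamma> \<beta>) \<alpha> = comp1 X \<gamma> (comp1 X \<beta> \<alpha>)"
  using cat1_laws(11) by (auto simp: cell1_def cat1_def)

lemma cell2_source: "cell2 X \<Phi> \<alpha> \<beta> \<Longrightarrow> \<exists>x y. cell1 X \<alpha> x y \<and> cell1 X \<beta> x y"
  using vert_laws(1,2) globular_src globular_tgt by (auto simp: cell1_def cell2_def vert_cat_def)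

lemma cell2_cell1: "cell2 X \<Phi> \<alpha> \<beta> \<Longrightarrow> cell1 X \<alpha> x y \<Longrightarrow> cell1 X \<beta> x y"
  using cell2_source by (fastforce simp: cell1_def)

lemma cell2_id: "cell1 X \<alpha> x y \<Longrightarrow> cell2 X (id2 X \<alpha>) \<alpha> \<alpha>"
  using vert_laws(3-5) by (auto simp: cell1_def cell2_def vert_cat_def)

lemma cell2_vcomp: "cell2 X \<Phi> \<alpha> \<beta> \<Longrightarrow> cell2 X \<Psi> \<beta> \<gamma> \<Longrightarrow> cell2 X (vcomp X \<Psi> \<Phi>) \<alpha> \<gamma>"
  using vert_laws(6-8) by (auto simp: cell2_def vert_cat_def)

lemma vcomp_id: "cell2 X \<Phi> \<alpha> \<beta> \<Longrightarrow> vcomp X \<Phi> (id2 X \<alpha>) = \<Phi>" "cell2 X \<Phi> \<alpha> \<beta> \<Longrightarrow> vcomp X (id2 X \<beta>) \<Phi> = \<Phi>"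
  using vert_laws(9,10) by (auto simp: cell2_def vert_cat_def)

lemma vcomp_assoc: "cell2 X \<Phi> \<alpha> \<beta> \<Longrightarrow> cell2 X \<Psi> \<beta> \<gamma> \<Longrightarrow> cell2 X \<Theta> \<gamma> \<delta> \<Longrightarrow>
  vcomp X (vcomp X \<Theta> \<Psi>) \<Phi> = vcomp X \<Theta> (vcomp X \<Psi> \<Phi>)"
  using vert_laws(11) by (auto simp: cell2_def vert_cat_def)

lemma cell2_hcomp:
  assumes "cell2 X \<Phi> \<alpha> \<alpha>'" "cell2 X \<Psi> \<beta> \<beta>'" "cell1 X \<alpha> x y" "cell1 X \<beta> y z"
  shows "cell2 X (hcomp X \<Psi> \<Phi>) (comp1 X \<beta> \<alpha>) (comp1 X \<beta>' \<alpha>')"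
proof -
  have "cell1 X \<alpha>' x y" using cell2_cell1 assms by blast
  then have "hcomp X \<Psi> \<Phi> \<in> cells2 X"
    using horiz_laws(1)[of \<Phi> \<Psi>] assms by (auto simp: cell1_def cell2_def horiz_cat_def)
  then show ?thesis using assms src2_hcomp[of \<Phi> \<Psi>] tgt2_hcomp[of \<Phi> \<Psi>] by (auto simp: cell1_def cell2_def)
qed

lemma hcomp_assoc:
  assumes "cell2 X \<Phi> \<alpha> \<alpha>'" "cell2 X \<Psi> \<beta> \<beta>'" "cell2 X \<Theta> \<gamma> \<gamma>'" "cell1 X \<alpha> w x" "cell1 X \<beta> x y" "cell1 X \<gamma> y z"
  shows "hcomp X (hcomp X \<Theta> \<Psi>) \<Phi> = hcomp X \<Theta> (hcomp X \<Psi> \<Phi>)"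
proof -
  have "cell1 X \<alpha>' w x" "cell1 X \<beta>' x y" using cell2_cell1 assms by blast+
  then show ?thesis
    using horiz_laws(2)[of \<Phi> \<Psi> \<Theta>] assms by (auto simp: cell1_def cell2_def horiz_cat_def)
qed

lemma interchange':
  assumes "cell2 X \<Phi> \<alpha> \<alpha>'" "cell2 X \<Phi>' \<alpha>' \<alpha>''" "cell2 X \<Psi> \<beta> \<beta>'" "cell2 X \<Psi>' \<beta>' \<beta>''" "cell1 X \<alpha> x y" "cell1 X \<beta> y z"
  shows "vcomp X (hcomp X \<Psi>' \<Phi>') (hcomp X \<Psi> \<Phi>) = hcomp X (vcomp X \<Psi>' \<Psi>) (vcomp X \<Phi>' \<Phi>)"
  using interchange[of \<Phi> \<Phi>' \<Psi> \<Psi>'] assms by (auto simp: cell1_def cell2_def)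

lemma hcomp_id2': "cell1 X \<alpha> x y \<Longrightarrow> cell1 X \<beta> y z \<Longrightarrow> hcomp X (id2 X \<beta>) (id2 X \<alpha>) = id2 X (comp1 X \<beta> \<alpha>)"
  using hcomp_id2 by (auto simp: cell1_def)

definition lw :: "'b \<Rightarrow> 'c \<Rightarrow> 'c" where "lw \<theta> \<Phi> = hcomp X (id2 X \<theta>) \<Phi>"
definition rw :: "'c \<Rightarrow> 'b \<Rightarrow> 'c" where "rw \<Phi> \<theta> = hcomp X \<Phi> (id2 X \<theta>)"

lemma cell2_lw: "cell2 X \<Phi> \<alpha> \<beta> \<Longrightarrow> cell1 X \<alpha> x y \<Longrightarrow> cell1 X \<theta> y z \<Longrightarrow> cell2 X (lw \<theta> \<Phi>) (comp1 X \<theta> \<alpha>) (comp1 X \<theta> \<beta>)"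
  unfolding lw_def by (rule cell2_hcomp[OF _ cell2_id]) auto

lemma cell2_rw: "cell2 X \<Phi> \<alpha> \<beta> \<Longrightarrow> cell1 X \<theta> x y \<Longrightarrow> cell1 X \<alpha> y z \<Longrightarrow> cell2 X (rw \<Phi> \<theta>) (comp1 X \<alpha> \<theta>) (comp1 X \<beta> \<theta>)"
  unfolding rw_def by (rule cell2_hcomp[OF cell2_id]) auto

lemma lw_vcomp:
  assumes "cell2 X \<Phi> \<alpha> \<beta>" "cell2 X \<Psi> \<beta> \<gamma>" "cell1 X \<alpha> x y" "cell1 X \<theta> y z"
  shows "lw \<theta> (vcomp X \<Psi> \<Phi>) = vcomp X (lw \<theta> \<Psi>) (lw \<theta> \<Phi>)"
  using interchange'[OF assms(1,2) cell2_id[OF assms(4)] cell2_id[OF assms(4)] assms(3,4)]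
    vcomp_id(1)[OF cell2_id[OF assms(4)]] unfolding lw_def by simp

lemma rw_vcomp:
  assumes "cell2 X \<Phi> \<alpha> \<beta>" "cell2 X \<Psi> \<beta> \<gamma>" "cell1 X \<theta> x y" "cell1 X \<alpha> y z"
  shows "rw (vcomp X \<Psi> \<Phi>) \<theta> = vcomp X (rw \<Psi> \<theta>) (rw \<Phi> \<theta>)"
  using interchange'[OF cell2_id[OF assms(3)] cell2_id[OF assms(3)] assms(1,2,3,4)]
    vcomp_id(1)[OF cell2_id[OF assms(3)]] unfolding rw_def by simp

lemma lw_id2: "cell1 X \<alpha> x y \<Longrightarrow> cell1 X \<theta> y z \<Longrightarrow> lw \<theta> (id2 X \<alpha>) = id2 X (comp1 X \<theta> \<alpha>)"
  and rw_id2: "cell1 X \<theta> x y \<Longrightarrow> cell1 X \<alpha> y z \<Longrightarrow> rw (id2 X \<alpha>) \<theta> = id2 X (comp1 X \<alpha> \<theta>)"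
  unfolding lw_def rw_def by (auto intro: hcomp_id2')

lemma lw_lw:
  assumes "cell2 X \<Phi> \<alpha> \<beta>" "cell1 X \<alpha> w x" "cell1 X \<theta> x y" "cell1 X \<theta>' y z"
  shows "lw \<theta>' (lw \<theta> \<Phi>) = lw (comp1 X \<theta>' \<theta>) \<Phi>"
  using hcomp_assoc[OF assms(1) cell2_id[OF assms(3)] cell2_id[OF assms(4)] assms(2-4)]
    hcomp_id2'[OF assms(3,4)] unfolding lw_def by simp

lemma rw_rw:
  assumes "cell2 X \<Phi> \<alpha> \<beta>" "cell1 X \<theta> w x" "cell1 X \<theta>' x y" "cell1 X \<alpha> y z"
  shows "rw (rw \<Phi> \<theta>') \<theta> = rw \<Phi> (comp1 X \<theta>' \<theta>)"
  using hcomp_assoc[OF cell2_id[OF assms(2)] cell2_id[OF assms(3)] assms(1) assms(2-4)]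
    hcomp_id2'[OF assms(2,3)] unfolding rw_def by simp

lemma lw_rw:
  assumes "cell2 X \<Phi> \<alpha> \<beta>" "cell1 X \<theta> w x" "cell1 X \<alpha> x y" "cell1 X \<theta>' y z"
  shows "rw (lw \<theta>' \<Phi>) \<theta> = lw \<theta>' (rw \<Phi> \<theta>)"
  using hcomp_assoc[OF cell2_id[OF assms(2)] assms(1) cell2_id[OF assms(4)] assms(2-4)]
  unfolding lw_def rw_def by simp

lemma whisker_interchange:
  assumes "cell2 X \<Phi> \<alpha> \<alpha>'" "cell2 X \<Psi> \<beta> \<beta>'" "cell1 X \<alpha> x y" "cell1 X \<beta> y z"
  shows "vcomp X (rw \<Psi> \<alpha>') (lw \<beta> \<Phi>) = vcomp X (lw \<beta>' \<Phi>) (rw \<Psi> \<alpha>)"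
proof -
  have c: "cell1 X \<alpha>' x y" "cell1 X \<beta>' y z" using cell2_cell1 assms by blast+
  have "vcomp X (rw \<Psi> \<alpha>') (lw \<beta> \<Phi>) = hcomp X \<Psi> \<Phi>"
    using interchange'[OF assms(1) cell2_id[OF c(1)] cell2_id[OF assms(4)] assms(2,3,4)]
      vcomp_id[OF assms(1)] vcomp_id[OF assms(2)] unfolding rw_def lw_def by simp
  moreover have "vcomp X (lw \<beta>' \<Phi>) (rw \<Psi> \<alpha>) = hcomp X \<Psi> \<Phi>"
    using interchange'[OF cell2_id[OF assms(3)] assms(1,2) cell2_id[OF c(2)] assms(3,4)]
      vcomp_id[OF assms(1)] vcomp_id[OF assms(2)] unfolding rw_def lw_def by simp
  ultimately show ?thesis by simp
qed

lemma inverse2_lw: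
  assumes "inverse2 X \<Phi> \<Psi> \<alpha> \<beta>" "cell1 X \<alpha> x y" "cell1 X \<theta> y z"
  shows "inverse2 X (lw \<theta> \<Phi>) (lw \<theta> \<Psi>) (comp1 X \<theta> \<alpha>) (comp1 X \<theta> \<beta>)"
proof -
  have c: "cell2 X \<Phi> \<alpha> \<beta>" "cell2 X \<Psi> \<beta> \<alpha>" using assms(1) by (auto simp: inverse2_def)
  have b: "cell1 X \<beta> x y" using cell2_cell1[OF c(1) assms(2)] .
  show ?thesis
    using cell2_lw[OF c(1) assms(2,3)] cell2_lw[OF c(2) b assms(3)]
      lw_vcomp[OF c assms(2,3)] lw_vcomp[OF c(2,1) b assms(3)] lw_id2[OF assms(2,3)] lw_id2[OF b assms(3)] assms(1)
    by (simp add: inverse2_def)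
qed

lemma inverse2_rw:
  assumes "inverse2 X \<Phi> \<Psi> \<alpha> \<beta>" "cell1 X \<theta> x y" "cell1 X \<alpha> y z"
  shows "inverse2 X (rw \<Phi> \<theta>) (rw \<Psi> \<theta>) (comp1 X \<alpha> \<theta>) (comp1 X \<beta> \<theta>)"
proof -
  have c: "cell2 X \<Phi> \<alpha> \<beta>" "cell2 X \<Psi> \<beta> \<alpha>" using assms(1) by (auto simp: inverse2_def)
  have b: "cell1 X \<beta> y z" using cell2_cell1[OF c(1) assms(3)] .
  show ?thesis
    using cell2_rw[OF c(1) assms(2,3)] cell2_rw[OF c(2) assms(2) b]
      rw_vcomp[OF c assms(2,3)] rw_vcomp[OF c(2,1) assms(2) b] rw_id2[OF assms(2,3)] rw_id2[OF assms(2) b] assms(1)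
    by (simp add: inverse2_def)
qed

lemma inverse2_inv_arrow:
  assumes "inverse2 X \<Phi> \<Psi> \<alpha> \<beta>"
  shows "inv_arrow (vert_cat X) \<Phi> = \<Psi>"
  using assms category.inv_arrow_eq[OF category_vert] by (auto simp: inverse2_iff)

lemma iso_inverse2:
  assumes "iso_arrow (vert_cat X) \<Phi>" "cell2 X \<Phi> \<alpha> \<beta>"
  shows "inverse2 X \<Phi> (inv_arrow (vert_cat X) \<Phi>) \<alpha> \<beta>"
  using assms category.inverse_inv_arrow[OF category_vert] by (auto simp: inverse2_iff)

lemma vcomp_cancel:
  assumes "inverse2 X \<Phi> \<Phi>' \<alpha> \<beta>" "cell2 X \<Psi> \<beta> \<gamma>"
  shows "vcomp X (vcomp X \<Psi> \<Phi>) \<Phi>' = \<Psi>"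
  using assms vcomp_assoc[of \<Phi>' \<beta> \<alpha> \<Phi> \<beta> \<Psi> \<gamma>] vcomp_id by (simp add: inverse2_def)

lemma vcomp_cancel':
  assumes "inverse2 X \<Phi> \<Phi>' \<alpha> \<beta>" "cell2 X \<Psi> \<gamma> \<alpha>"
  shows "vcomp X \<Phi>' (vcomp X \<Phi> \<Psi>) = \<Psi>"
  using assms vcomp_assoc[of \<Psi> \<gamma> \<alpha> \<Phi> \<beta> \<Phi>' \<alpha>] vcomp_id by (simp add: inverse2_def)

text \<open>
  From \<open>c b a = f e d\<close> one obtains \<open>e d a' = f' c b\<close>, by composing with the inverse of \<open>a\<close> on the right
  and that of \<open>f\<close> on the left. In this way the hexagon for one order of three faces turns into the hexagon for another.
\<close>

lemma hexagon_rotate: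
  assumes eq: "vcomp X c (vcomp X b a) = vcomp X f (vcomp X e d)"
    and cells: "cell2 X b x2 x3" "cell2 X c x3 x4" "cell2 X d x1 y1" "cell2 X e y1 y2"
    and a: "inverse2 X a a' x1 x2" and f: "inverse2 X f f' y2 x4"
  shows "vcomp X e (vcomp X d a') = vcomp X f' (vcomp X c b)"
proof -
  have cs: "cell2 X a x1 x2" "cell2 X a' x2 x1" "cell2 X f y2 x4" "cell2 X f' x4 y2"
    using a f by (auto simp: inverse2_def)
  have cb: "cell2 X (vcomp X c b) x2 x4" and ed: "cell2 X (vcomp X e d) x1 y2"
    using cell2_vcomp cells by blast+
  have "vcomp X c b = vcomp X (vcomp X (vcomp X c b) a) a'" using vcomp_cancel[OF a cb] by simp
  also have "vcomp X (vcomp X c b) a = vcomp X f (vcomp X e d)" using eq vcomp_assoc[OF cs(1) cells(1,2)] by simp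
  also have "vcomp X (vcomp X f (vcomp X e d)) a' = vcomp X f (vcomp X (vcomp X e d) a')"
    using vcomp_assoc[OF cs(2) ed cs(3)] .
  finally have "vcomp X f' (vcomp X c b) = vcomp X (vcomp X e d) a'"
    using vcomp_cancel'[OF f cell2_vcomp[OF cs(2) ed]] by simp
  then show ?thesis using vcomp_assoc[OF cs(2) cells(3,4)] by simp
qed

end

lemma strict_two_functor_compose:
  assumes F: "strict_two_functor X Y F0 F1 F2" and G: "strict_two_functor Y Z G0 G1 G2"
  shows "strict_two_functor X Z (\<lambda>x. G0 (F0 x)) (\<lambda>\<alpha>. G1 (F1 \<alpha>)) (\<lambda>\<Phi>. G2 (F2 \<Phi>))"
proof -
  have comp: "is_functor C E (\<lambda>x. GO (FO x)) (\<lambda>f. GA (FA f))"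
    if f: "is_functor C D FO FA" and g: "is_functor D E GO GA"
    for C :: "('x, 'y) cat" and D :: "('z, 'w) cat" and E :: "('u, 'v) cat" and FO FA GO GA
  proof -
    interpret f: is_functor C D FO FA by (rule f)
    interpret g: is_functor D E GO GA by (rule g)
    show ?thesis
      by unfold_locales (simp_all add: f.FO_in f.FA_in f.Dom_FA f.Cod_FA f.FA_Ident f.FA_Compose
        g.FO_in g.FA_in g.Dom_FA g.Cod_FA g.FA_Ident g.FA_Compose)
  qed
  show ?thesis using F G unfolding strict_two_functor_def by (blast intro: comp)
qed

context
  fixes X :: "('a, 'b, 'c) two_cat" and Y :: "('d, 'e, 'f) two_cat" and F0 F1 F2
  assumes F: "strict_two_functor X Y F0 F1 F2"
begin

lemma functor0: "x \<in> cells0 X \<Longrightarrow> F0 x \<in> cells0 Y"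
  using F is_functor.FO_in[of "cat1 X" "cat1 Y" F0 F1] by (simp add: strict_two_functor_def cat1_def)

lemma functor1: "cell1 X \<alpha> x y \<Longrightarrow> cell1 Y (F1 \<alpha>) (F0 x) (F0 y)"
  using F is_functor.FA_in[of "cat1 X" "cat1 Y" F0 F1] is_functor.Dom_FA[of "cat1 X" "cat1 Y" F0 F1]
    is_functor.Cod_FA[of "cat1 X" "cat1 Y" F0 F1]
  by (simp add: strict_two_functor_def cat1_def cell1_def)

lemma functor2: "cell2 X \<Phi> \<alpha> \<beta> \<Longrightarrow> cell2 Y (F2 \<Phi>) (F1 \<alpha>) (F1 \<beta>)"
  using F is_functor.FA_in[of "vert_cat X" "vert_cat Y" F1 F2] is_functor.Dom_FA[of "vert_cat X" "vert_cat Y" F1 F2]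
    is_functor.Cod_FA[of "vert_cat X" "vert_cat Y" F1 F2]
  by (simp add: strict_two_functor_def vert_cat_def cell2_def)

lemma functor_comp1: "cell1 X \<alpha> x y \<Longrightarrow> cell1 X \<beta> y z \<Longrightarrow> F1 (comp1 X \<beta> \<alpha>) = comp1 Y (F1 \<beta>) (F1 \<alpha>)"
  using F is_functor.FA_Compose[of "cat1 X" "cat1 Y" F0 F1 \<alpha> \<beta>]
  by (simp add: strict_two_functor_def cat1_def cell1_def)

lemma functor_vcomp: "cell2 X \<Phi> \<alpha> \<beta> \<Longrightarrow> cell2 X \<Psi> \<beta> \<gamma> \<Longrightarrow> F2 (vcomp X \<Psi> \<Phi>) = vcomp Y (F2 \<Psi>) (F2 \<Phi>)"
  using F is_functor.FA_Compose[of "vert_cat X" "vert_cat Y" F1 F2 \<Phi> \<Psi>]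
  by (simp add: strict_two_functor_def vert_cat_def cell2_def)

lemma functor_id2: "cell1 X \<alpha> x y \<Longrightarrow> F2 (id2 X \<alpha>) = id2 Y (F1 \<alpha>)"
  using F is_functor.FA_Ident[of "vert_cat X" "vert_cat Y" F1 F2 \<alpha>]
  by (simp add: strict_two_functor_def vert_cat_def cell1_def)

lemma functor_hcomp:
  assumes "cell2 X \<Phi> \<alpha> \<alpha>'" "cell2 X \<Psi> \<beta> \<beta>'" "cell1 X \<alpha> x y" "cell1 X \<beta> y z"
  shows "F2 (hcomp X \<Psi> \<Phi>) = hcomp Y (F2 \<Psi>) (F2 \<Phi>)"
proof -
  have "two_category X" using F by (simp add: strict_two_functor_def)
  then have "cell1 X \<alpha>' x y" using two_category.cell2_cell1[OF _ assms(1,3)] by blast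
  then show ?thesis
    using F is_functor.FA_Compose[of "horiz_cat X" "horiz_cat Y" F0 F2 \<Phi> \<Psi>] assms
    by (simp add: strict_two_functor_def horiz_cat_def cell1_def cell2_def)
qed

lemma functor_inverse2:
  assumes "inverse2 X \<Phi> \<Psi> \<alpha> \<beta>"
  shows "inverse2 Y (F2 \<Phi>) (F2 \<Psi>) (F1 \<alpha>) (F1 \<beta>)"
proof -
  have c: "cell2 X \<Phi> \<alpha> \<beta>" "cell2 X \<Psi> \<beta> \<alpha>" using assms by (auto simp: inverse2_def)
  have "two_category X" using F by (simp add: strict_two_functor_def)
  then obtain x y where "cell1 X \<alpha> x y" "cell1 X \<beta> x y" using two_category.cell2_source[OF _ c(1)] by blast
  then show ?thesis
    using functor2[OF c(1)] functor2[OF c(2)] functor_vcomp[OF c] functor_vcomp[OF c(2,1)] functor_id2 assms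
    by (simp add: inverse2_def)
qed

end

section \<open>The Yang-Baxter equation in a Gray-category\<close>

context gray_category
begin

lemma right_functor:
  assumes "A \<in> gobj K" "B \<in> gobj K" "C \<in> gobj K" "h \<in> cells0 (ghom K B C)"
  shows "strict_two_functor (ghom K A B) (ghom K A C)
    (on_obj (gcomp K A B C) h) (on_1R (gcomp K A B C) h) (on_2R (gcomp K A B C) h)"
  using gray_two_functor.functor_right[OF comp_functor[OF assms(1-3)] assms(4)] .

lemma left_functor:
  assumes "A \<in> gobj K" "B \<in> gobj K" "C \<in> gobj K" "f \<in> cells0 (ghom K A B)"
  shows "strict_two_functor (ghom K B C) (ghom K A C)
    (\<lambda>h. on_obj (gcomp K A B C) h f) (\<lambda>\<alpha>. on_1L (gcomp K A B C) \<alpha> f) (\<lambda>\<Phi>. on_2L (gcomp K A B C) \<Phi> f)"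
  using gray_two_functor.functor_left[OF comp_functor[OF assms(1-3)] assms(4)] .

lemma whisker_functor:
  assumes "A \<in> gobj K" "B \<in> gobj K" "C \<in> gobj K" "D \<in> gobj K"
    and "f \<in> cells0 (ghom K A B)" "h \<in> cells0 (ghom K C D)"
  shows "strict_two_functor (ghom K B C) (ghom K A D)
    (\<lambda>x. on_obj (gcomp K A C D) h (on_obj (gcomp K A B C) x f))
    (\<lambda>\<theta>. whisker1 K A B C D h \<theta> f) (\<lambda>\<Theta>. whisker2 K A B C D h \<Theta> f)"
  unfolding whisker1_def whisker2_def
  by (rule strict_two_functor_compose[OF left_functor right_functor]) (use assms in auto)

lemma gray_cell2:
  assumes "A \<in> gobj K" "B \<in> gobj K" "C \<in> gobj K" "cell1 (ghom K B C) \<alpha> f f'" "cell1 (ghom K A B) \<beta> g g'"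
  shows "cell2 (ghom K A C) (gray_cell (gcomp K A B C) \<alpha> \<beta>)
      (comp1 (ghom K A C) (on_1L (gcomp K A B C) \<alpha> g') (on_1R (gcomp K A B C) f \<beta>))
      (comp1 (ghom K A C) (on_1R (gcomp K A B C) f' \<beta>) (on_1L (gcomp K A B C) \<alpha> g))"
    "iso_arrow (vert_cat (ghom K A C)) (gray_cell (gcomp K A B C) \<alpha> \<beta>)"
proof -
  interpret gray_two_functor "ghom K B C" "ghom K A B" "ghom K A C" "gcomp K A B C"
    by (rule comp_functor[OF assms(1-3)])
  show "iso_arrow (vert_cat (ghom K A C)) (gray_cell (gcomp K A B C) \<alpha> \<beta>)"
    using gray_cell_iso assms by (simp add: cell1_def)
  then have "gray_cell (gcomp K A B C) \<alpha> \<beta> \<in> cells2 (ghom K A C)"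
    by (auto simp: iso_arrow_def inverse_arrows_def vert_cat_def)
  then show "cell2 (ghom K A C) (gray_cell (gcomp K A B C) \<alpha> \<beta>)
      (comp1 (ghom K A C) (on_1L (gcomp K A B C) \<alpha> g') (on_1R (gcomp K A B C) f \<beta>))
      (comp1 (ghom K A C) (on_1R (gcomp K A B C) f' \<beta>) (on_1L (gcomp K A B C) \<alpha> g))"
    using src2_gray_cell tgt2_gray_cell assms(4,5) by (auto simp: cell1_def cell2_def)
qed

text \<open>
  Naturality of the Gray cell of \<open>c\<close> with respect to the 2-cell \<open>\<gamma>\<^sub>b\<^sub>,\<^sub>a\<close>, whose source and target are
  composites of two 1-cells. Each of the two Gray cells with a composite index splits into two, and associativity of
  composition identifies these four with Gray cells of \<open>c\<close>, \<open>b\<close> and of \<open>c\<close>, \<open>a\<close>. The 2-functor \<open>F\<close> stands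
  for the whiskering with the remaining parts of a path.
\<close>

lemma gray_yang_baxter:
  fixes a b c \<sigma>a \<tau>a \<sigma>b \<tau>b \<sigma>c \<tau>c A B C D
  defines "bt \<equiv> on_1L (gcomp K A B C) b \<tau>a" and "bs \<equiv> on_1L (gcomp K A B C) b \<sigma>a"
    and "ta \<equiv> on_1R (gcomp K A B C) \<tau>b a" and "sa \<equiv> on_1R (gcomp K A B C) \<sigma>b a"
    and "cc \<equiv> \<lambda>x y. on_1L (gcomp K A C D) c (on_obj (gcomp K A B C) x y)"
    and "lc \<equiv> on_1R (gcomp K A C D)"
    and "\<gamma>cb \<equiv> \<lambda>x. on_2L (gcomp K A B D) (gray_cell (gcomp K B C D) c b) x"
    and "\<gamma>ca \<equiv> \<lambda>y. gray_cell (gcomp K A B D) (on_1L (gcomp K B C D) c y) a"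
    and "\<gamma>ba \<equiv> \<lambda>z. on_2R (gcomp K A C D) z (gray_cell (gcomp K A B C) b a)"
  assumes obs: "A \<in> gobj K" "B \<in> gobj K" "C \<in> gobj K" "D \<in> gobj K"
    and a: "cell1 (ghom K A B) a \<sigma>a \<tau>a" and b: "cell1 (ghom K B C) b \<sigma>b \<tau>b" and c: "cell1 (ghom K C D) c \<sigma>c \<tau>c"
    and F: "strict_two_functor (ghom K A D) Z F0 F1 F2"
  shows "vcomp Z
      (two_category.lw Z (F1 (lc \<tau>c ta)) (F2 (\<gamma>cb \<sigma>a)))
      (vcomp Z
        (two_category.rw Z (F2 (\<gamma>ca \<tau>b)) (F1 (lc \<sigma>c bs)))
        (two_category.lw Z (F1 (cc \<tau>b \<tau>a)) (F2 (\<gamma>ba \<sigma>c))))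
    = vcomp Z
      (two_category.rw Z (F2 (\<gamma>ba \<tau>c)) (F1 (cc \<sigma>b \<sigma>a)))
      (vcomp Z
        (two_category.lw Z (F1 (lc \<tau>c bt)) (F2 (\<gamma>ca \<sigma>b)))
        (two_category.rw Z (F2 (\<gamma>cb \<tau>a)) (F1 (lc \<sigma>c sa))))"
proof -
  interpret AB: two_category "ghom K A B" by (rule hom_two_category[OF obs(1,2)])
  interpret BC: two_category "ghom K B C" by (rule hom_two_category[OF obs(2,3)])
  interpret CD: two_category "ghom K C D" by (rule hom_two_category[OF obs(3,4)])
  interpret AC: two_category "ghom K A C" by (rule hom_two_category[OF obs(1,3)])
  interpret AD: two_category "ghom K A D" by (rule hom_two_category[OF obs(1,4)])
  interpret Z: two_category Z using F by (simp add: strict_two_functor_def)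
  interpret ACD: gray_two_functor "ghom K C D" "ghom K A C" "ghom K A D" "gcomp K A C D"
    by (rule comp_functor[OF obs(1,3,4)])
  let ?ob = "on_obj (gcomp K A B C)" and ?g = "comp1 (ghom K A D)" and ?V = "vcomp (ghom K A D)"
  note ea = AB.cell1_ends[OF a] and eb = BC.cell1_ends[OF b] and ec = CD.cell1_ends[OF c]
  have in1: "a \<in> cells1 (ghom K A B)" "b \<in> cells1 (ghom K B C)" "c \<in> cells1 (ghom K C D)"
    using a b c by (auto simp: cell1_def)
  have bt: "cell1 (ghom K A C) bt (?ob \<sigma>b \<tau>a) (?ob \<tau>b \<tau>a)" and bs: "cell1 (ghom K A C) bs (?ob \<sigma>b \<sigma>a) (?ob \<tau>b \<sigma>a)"
    using functor1[OF left_functor[OF obs(1-3)] b] ea by (auto simp: bt_def bs_def)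
  have ta: "cell1 (ghom K A C) ta (?ob \<tau>b \<sigma>a) (?ob \<tau>b \<tau>a)" and sa: "cell1 (ghom K A C) sa (?ob \<sigma>b \<sigma>a) (?ob \<sigma>b \<tau>a)"
    using functor1[OF right_functor[OF obs(1-3)] a] eb by (auto simp: ta_def sa_def)
  let ?\<beta> = "comp1 (ghom K A C) bt sa" and ?\<beta>' = "comp1 (ghom K A C) ta bs"
  let ?\<Psi> = "gray_cell (gcomp K A B C) b a"
  have \<Psi>: "cell2 (ghom K A C) ?\<Psi> ?\<beta> ?\<beta>'"
    using gray_cell2(1)[OF obs(1-3) b a] by (simp add: bt_def bs_def ta_def sa_def)
  have \<beta>: "cell1 (ghom K A C) ?\<beta> (?ob \<sigma>b \<sigma>a) (?ob \<tau>b \<tau>a)" using AC.cell1_comp[OF sa bt] .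
  have cc: "cell1 (ghom K A D) (cc x y) (on_obj (gcomp K A C D) \<sigma>c (?ob x y)) (on_obj (gcomp K A C D) \<tau>c (?ob x y))"
    if "x \<in> cells0 (ghom K B C)" "y \<in> cells0 (ghom K A B)" for x y
    unfolding cc_def
    using functor1[OF left_functor[OF obs(1,3,4)] c] functor0[OF left_functor[OF obs(1-3) that(2)] that(1)] by blast
  have lc: "cell1 (ghom K A D) (lc z \<alpha>) (on_obj (gcomp K A C D) z x) (on_obj (gcomp K A C D) z y)"
    if "z \<in> cells0 (ghom K C D)" "cell1 (ghom K A C) \<alpha> x y" for z \<alpha> x y
    unfolding lc_def using functor1[OF right_functor[OF obs(1,3,4) that(1)] that(2)] .
  have lc_comp: "lc z (comp1 (ghom K A C) \<beta> \<alpha>) = ?g (lc z \<beta>) (lc z \<alpha>)"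
    if "z \<in> cells0 (ghom K C D)" "cell1 (ghom K A C) \<alpha> x y" "cell1 (ghom K A C) \<beta> y w" for z \<alpha> \<beta> x y w
    unfolding lc_def using functor_comp1[OF right_functor[OF obs(1,3,4) that(1)] that(2,3)] .
  note lcs = lc[OF ec(1) bt] lc[OF ec(1) bs] lc[OF ec(1) ta] lc[OF ec(1) sa]
  note lct = lc[OF ec(2) bt] lc[OF ec(2) bs] lc[OF ec(2) ta] lc[OF ec(2) sa]
  note ccs = cc[OF eb(1) ea(1)] cc[OF eb(1) ea(2)] cc[OF eb(2) ea(1)] cc[OF eb(2) ea(2)]
  have ba: "cell2 (ghom K A D) (\<gamma>ba z) (?g (lc z bt) (lc z sa)) (?g (lc z ta) (lc z bs))"
    if "z \<in> cells0 (ghom K C D)" for z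
    using functor2[OF right_functor[OF obs(1,3,4) that] \<Psi>]
    unfolding \<gamma>ba_def lc_comp[OF that sa bt, symmetric] lc_comp[OF that bs ta, symmetric] by (simp add: lc_def)
  have ca: "cell2 (ghom K A D) (\<gamma>ca y) (?g (cc y \<tau>a) (lc \<sigma>c (on_1R (gcomp K A B C) y a)))
      (?g (lc \<tau>c (on_1R (gcomp K A B C) y a)) (cc y \<sigma>a))" if y: "y \<in> cells0 (ghom K B C)" for y
  proof -
    have "cell1 (ghom K B D) (on_1L (gcomp K B C D) c y) (on_obj (gcomp K B C D) \<sigma>c y) (on_obj (gcomp K B C D) \<tau>c y)"
      using functor1[OF left_functor[OF obs(2-4) y] c] .
    from gray_cell2(1)[OF obs(1,2,4) this a] show ?thesis
      unfolding assoc_1L[OF obs in1(3) y ea(1)] assoc_1L[OF obs in1(3) y ea(2)]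
        assoc_1R[OF obs ec(1) y in1(1)] assoc_1R[OF obs ec(2) y in1(1)] \<gamma>ca_def cc_def lc_def .
  qed
  have cb: "cell2 (ghom K A D) (\<gamma>cb x) (?g (cc \<tau>b x) (lc \<sigma>c (on_1L (gcomp K A B C) b x)))
      (?g (lc \<tau>c (on_1L (gcomp K A B C) b x)) (cc \<sigma>b x))" if x: "x \<in> cells0 (ghom K A B)" for x
  proof -
    have cy: "cell1 (ghom K B D) (on_1L (gcomp K B C D) c y) (on_obj (gcomp K B C D) \<sigma>c y) (on_obj (gcomp K B C D) \<tau>c y)"
      if "y \<in> cells0 (ghom K B C)" for y
      using functor1[OF left_functor[OF obs(2-4) that] c] .
    have zb: "cell1 (ghom K B D) (on_1R (gcomp K B C D) z b) (on_obj (gcomp K B C D) z \<sigma>b) (on_obj (gcomp K B C D) z \<tau>b)"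
      if "z \<in> cells0 (ghom K C D)" for z
      using functor1[OF right_functor[OF obs(2-4) that] b] .
    note lf = left_functor[OF obs(1,2,4) x]
    from functor2[OF lf gray_cell2(1)[OF obs(2-4) c b]] show ?thesis
      unfolding functor_comp1[OF lf zb[OF ec(1)] cy[OF eb(2)]] functor_comp1[OF lf cy[OF eb(1)] zb[OF ec(2)]]
        assoc_1L[OF obs in1(3) eb(1) x] assoc_1L[OF obs in1(3) eb(2) x]
        assoc_1M[OF obs ec(1) in1(2) x] assoc_1M[OF obs ec(2) in1(2) x] \<gamma>cb_def cc_def lc_def .
  qed
  have cbs: "cell2 (ghom K A D) (\<gamma>cb \<sigma>a) (?g (cc \<tau>b \<sigma>a) (lc \<sigma>c bs)) (?g (lc \<tau>c bs) (cc \<sigma>b \<sigma>a))"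
    and cbt: "cell2 (ghom K A D) (\<gamma>cb \<tau>a) (?g (cc \<tau>b \<tau>a) (lc \<sigma>c bt)) (?g (lc \<tau>c bt) (cc \<sigma>b \<tau>a))"
    and cas: "cell2 (ghom K A D) (\<gamma>ca \<sigma>b) (?g (cc \<sigma>b \<tau>a) (lc \<sigma>c sa)) (?g (lc \<tau>c sa) (cc \<sigma>b \<sigma>a))"
    and cat: "cell2 (ghom K A D) (\<gamma>ca \<tau>b) (?g (cc \<tau>b \<tau>a) (lc \<sigma>c ta)) (?g (lc \<tau>c ta) (cc \<tau>b \<sigma>a))"
    using cb[OF ea(1)] cb[OF ea(2)] ca[OF eb(1)] ca[OF eb(2)] by (simp_all add: bs_def bt_def sa_def ta_def)
  \<comment> \<open>The 1-cell boundaries are brought into right-nested form, so that the whiskered cells compose.\<close>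
  note src = AD.cell1_comp[OF lcs(3) ccs(4)] AD.cell1_comp[OF lcs(2) ccs(3)] AD.cell1_comp[OF lcs(4) ccs(2)]
    AD.cell1_comp[OF lcs(1) ccs(4)] AD.cell1_comp[OF lct(4) lct(1)]
  have r: "cell2 (ghom K A D) (AD.lw (cc \<tau>b \<tau>a) (\<gamma>ba \<sigma>c)) (?g (cc \<tau>b \<tau>a) (?g (lc \<sigma>c bt) (lc \<sigma>c sa)))
      (?g (cc \<tau>b \<tau>a) (?g (lc \<sigma>c ta) (lc \<sigma>c bs)))"
    using AD.cell2_lw[OF ba[OF ec(1)] AD.cell1_comp[OF lcs(4,1)] ccs(4)] .
  have q: "cell2 (ghom K A D) (AD.rw (\<gamma>ca \<tau>b) (lc \<sigma>c bs)) (?g (cc \<tau>b \<tau>a) (?g (lc \<sigma>c ta) (lc \<sigma>c bs)))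
      (?g (lc \<tau>c ta) (?g (cc \<tau>b \<sigma>a) (lc \<sigma>c bs)))"
    using AD.cell2_rw[OF cat lcs(2) src(1)]
    unfolding AD.comp1_assoc[OF lcs(2,3) ccs(4)] AD.comp1_assoc[OF lcs(2) ccs(3) lct(3)] .
  have p: "cell2 (ghom K A D) (AD.lw (lc \<tau>c ta) (\<gamma>cb \<sigma>a)) (?g (lc \<tau>c ta) (?g (cc \<tau>b \<sigma>a) (lc \<sigma>c bs)))
      (?g (lc \<tau>c ta) (?g (lc \<tau>c bs) (cc \<sigma>b \<sigma>a)))"
    using AD.cell2_lw[OF cbs src(2) lct(3)] .
  have u: "cell2 (ghom K A D) (AD.rw (\<gamma>cb \<tau>a) (lc \<sigma>c sa)) (?g (cc \<tau>b \<tau>a) (?g (lc \<sigma>c bt) (lc \<sigma>c sa)))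
      (?g (lc \<tau>c bt) (?g (cc \<sigma>b \<tau>a) (lc \<sigma>c sa)))"
    using AD.cell2_rw[OF cbt lcs(4) src(4)]
    unfolding AD.comp1_assoc[OF lcs(4,1) ccs(4)] AD.comp1_assoc[OF lcs(4) ccs(2) lct(1)] .
  have t: "cell2 (ghom K A D) (AD.lw (lc \<tau>c bt) (\<gamma>ca \<sigma>b)) (?g (lc \<tau>c bt) (?g (cc \<sigma>b \<tau>a) (lc \<sigma>c sa)))
      (?g (lc \<tau>c bt) (?g (lc \<tau>c sa) (cc \<sigma>b \<sigma>a)))"
    using AD.cell2_lw[OF cas src(3) lct(1)] .
  have s: "cell2 (ghom K A D) (AD.rw (\<gamma>ba \<tau>c) (cc \<sigma>b \<sigma>a)) (?g (lc \<tau>c bt) (?g (lc \<tau>c sa) (cc \<sigma>b \<sigma>a)))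
      (?g (lc \<tau>c ta) (?g (lc \<tau>c bs) (cc \<sigma>b \<sigma>a)))"
    using AD.cell2_rw[OF ba[OF ec(2)] ccs(1) src(5)]
    unfolding AD.comp1_assoc[OF ccs(1) lct(4,1)] AD.comp1_assoc[OF ccs(1) lct(2,3)] .
  have main: "?V (AD.lw (lc \<tau>c ta) (\<gamma>cb \<sigma>a)) (?V (AD.rw (\<gamma>ca \<tau>b) (lc \<sigma>c bs)) (AD.lw (cc \<tau>b \<tau>a) (\<gamma>ba \<sigma>c)))
    = ?V (AD.rw (\<gamma>ba \<tau>c) (cc \<sigma>b \<sigma>a)) (?V (AD.lw (lc \<tau>c bt) (\<gamma>ca \<sigma>b)) (AD.rw (\<gamma>cb \<tau>a) (lc \<sigma>c sa)))"
  proof -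
    let ?cAD = "gcomp K A C D"
    have ci: "cell2 (ghom K C D) (id2 (ghom K C D) c) c c" using CD.cell2_id[OF c] .
    have nat: "?V (gray_cell ?cAD c ?\<beta>') (hcomp (ghom K A D) (on_2L ?cAD (id2 (ghom K C D) c) (?ob \<tau>b \<tau>a)) (\<gamma>ba \<sigma>c))
      = ?V (hcomp (ghom K A D) (\<gamma>ba \<tau>c) (on_2L ?cAD (id2 (ghom K C D) c) (?ob \<sigma>b \<sigma>a))) (gray_cell ?cAD c ?\<beta>)"
      using ACD.gray_cell_natural[of "id2 (ghom K C D) c" ?\<Psi> c c ?\<beta> ?\<beta>'] ci \<Psi> \<beta> c
      by (simp add: cell1_def cell2_def \<gamma>ba_def)
    have ids: "on_2L ?cAD (id2 (ghom K C D) c) (?ob x y) = id2 (ghom K A D) (cc x y)"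
      if "?ob x y \<in> cells0 (ghom K A C)" for x y
      unfolding cc_def using functor_id2[OF left_functor[OF obs(1,3,4) that] c] .
    have LM: "gray_cell ?cAD c (on_1L (gcomp K A B C) b x) = \<gamma>cb x" if "x \<in> cells0 (ghom K A B)" for x
      unfolding \<gamma>cb_def using assoc_gray_LM[OF obs in1(3,2) that] by simp
    have LR: "gray_cell ?cAD c (on_1R (gcomp K A B C) y a) = \<gamma>ca y" if "y \<in> cells0 (ghom K B C)" for y
      unfolding \<gamma>ca_def using assoc_gray_LR[OF obs in1(3) that in1(1)] by simp
    have e1: "gray_cell ?cAD c ?\<beta>' = ?V (AD.lw (lc \<tau>c ta) (\<gamma>cb \<sigma>a)) (AD.rw (\<gamma>ca \<tau>b) (lc \<sigma>c bs))"
      using ACD.gray_cell_comp_right[of c bs ta] bs ta c LM[OF ea(1)] LR[OF eb(2)]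
      by (simp add: cell1_def AD.lw_def AD.rw_def lc_def bs_def[symmetric] ta_def[symmetric])
    have e2: "gray_cell ?cAD c ?\<beta> = ?V (AD.lw (lc \<tau>c bt) (\<gamma>ca \<sigma>b)) (AD.rw (\<gamma>cb \<tau>a) (lc \<sigma>c sa))"
      using ACD.gray_cell_comp_right[of c sa bt] sa bt c LM[OF ea(2)] LR[OF eb(1)]
      by (simp add: cell1_def AD.lw_def AD.rw_def lc_def sa_def[symmetric] bt_def[symmetric])
    show ?thesis
      using nat AD.vcomp_assoc[OF r q p]
      unfolding ids[OF AC.cell1_ends(2)[OF \<beta>]] ids[OF AC.cell1_ends(1)[OF \<beta>]] e1 e2
      unfolding AD.lw_def AD.rw_def by simp
  qed
  have F_lw: "F2 (AD.lw \<theta> \<Phi>) = Z.lw (F1 \<theta>) (F2 \<Phi>)"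
    if "cell2 (ghom K A D) \<Phi> \<alpha> \<alpha>'" "cell1 (ghom K A D) \<alpha> x y" "cell1 (ghom K A D) \<theta> y z" for \<theta> \<Phi> \<alpha> \<alpha>' x y z
    unfolding AD.lw_def Z.lw_def
    using functor_hcomp[OF F that(1) AD.cell2_id[OF that(3)] that(2,3)] functor_id2[OF F that(3)] by simp
  have F_rw: "F2 (AD.rw \<Phi> \<theta>) = Z.rw (F2 \<Phi>) (F1 \<theta>)"
    if "cell2 (ghom K A D) \<Phi> \<alpha> \<alpha>'" "cell1 (ghom K A D) \<theta> x y" "cell1 (ghom K A D) \<alpha> y z" for \<theta> \<Phi> \<alpha> \<alpha>' x y z
    unfolding AD.rw_def Z.rw_def
    using functor_hcomp[OF F AD.cell2_id[OF that(2)] that] functor_id2[OF F that(2)] by simp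
  note FV = functor_vcomp[OF F]
  show ?thesis
    using arg_cong[OF main, of F2]
    unfolding FV[OF AD.cell2_vcomp[OF r q] p] FV[OF r q] FV[OF AD.cell2_vcomp[OF u t] s] FV[OF u t]
      F_lw[OF ba[OF ec(1)] AD.cell1_comp[OF lcs(4,1)] ccs(4)] F_rw[OF cat lcs(2) src(1)] F_lw[OF cbs src(2) lct(3)]
      F_rw[OF cbt lcs(4) src(4)] F_lw[OF cas src(3) lct(1)] F_rw[OF ba[OF ec(2)] ccs(1) src(5)] .
qed

end

section \<open>Linear extensions are sweeps\<close>

lemma linear_extension_tranclp:
  assumes "distinct xs" "set xs = A"
    and "\<And>i j. i < length xs \<Longrightarrow> j < length xs \<Longrightarrow> B (xs ! i) (xs ! j) \<Longrightarrow> i < j"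
    and "\<And>a b. B a b \<Longrightarrow> b \<in> A"
  shows "xs \<in> linear_extensions A B\<^sup>+\<^sup>+"
proof -
  have "i < j" if "B\<^sup>+\<^sup>+ a b" "i < length xs" "xs ! i = a" "j < length xs" "xs ! j = b" for a b i j
    using that
  proof (induction arbitrary: j rule: tranclp_induct)
    case (step b c)
    then obtain k where "k < length xs" "xs ! k = b"
      by (metis assms(2,4) in_set_conv_nth tranclp.cases)
    then show ?case using step assms(3)[of k j] by fastforce
  qed (use assms(3) in blast)
  then show ?thesis using assms(1,2) unfolding linear_extensions_def by blast
qed

lemma sweep_upper_origin:
  assumes "sweep P p Fs q" "e \<in> set q \<or> (\<exists>F \<in> set Fs. e \<in> set (upper P F))"
  shows "e \<in> set p \<or> (\<exists>G \<in> set Fs. e \<in> set (lower P G))"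
  using assms by (induction rule: sweep.induct) auto

context pasting_scheme
begin

lemma face_jordan: "F \<in> faces P \<Longrightarrow> jordan_face F"
  by (rule sweep_of_pasting_scheme) blast

lemma face_piece: "F \<in> faces P \<Longrightarrow> piece (face_source P F) (upper P F) (lower P F) (face_sink P F)"
  using face_jordan by (simp add: jordan_face_def)

lemmas face_dest = piece_dest[OF face_piece]

lemma uppers_disjoint:
  assumes "F \<in> faces P" "G \<in> faces P" "F \<noteq> G"
  shows "set (upper P F) \<inter> set (upper P G) = {}"
proof (rule sweep_of_pasting_scheme)
  assume "\<And>F G. F \<in> faces P \<Longrightarrow> G \<in> faces P \<Longrightarrow> F \<noteq> G \<Longrightarrow> set (upper P F) \<inter> set (upper P G) = {}"
  from this[OF assms] show ?thesis .
qed

lemma spath_top: "spath (top_path P)" and spath_bottom: "spath (bottom_path P)"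
  by (rule sweep_of_pasting_scheme; blast)+

text \<open>
  If \<open>F\<^sub>i \<triangleleft> F\<^sub>j\<close> with \<open>j \<le> i\<close>, a common arc would be on the path before \<open>F\<^sub>j\<close> is crossed, but lower arcs of
  faces that are still to be crossed are not on this path.
\<close>

lemma sweep_is_linear_extension:
  obtains Fs where "sweep P (top_path P) Fs (bottom_path P)" "Fs \<in> linear_extensions (faces P) (below P)\<^sup>+\<^sup>+"
proof (rule sweep_of_pasting_scheme)
  fix Fs
  assume sw: "sweep P (top_path P) Fs (bottom_path P)" and d: "distinct Fs" "set Fs = faces P"
    and jf: "\<And>F. F \<in> faces P \<Longrightarrow> jordan_face F"
  have "i < j" if ij: "i < length Fs" "j < length Fs" "below P (Fs ! i) (Fs ! j)" for i j
  proof (rule ccontr)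
    assume "\<not> i < j"
    have split: "Fs = take j Fs @ drop j Fs" "drop j Fs = Fs ! j # drop (Suc j) Fs"
      using ij(2) by (simp_all add: Cons_nth_drop_Suc)
    obtain r where r: "sweep P (top_path P) (take j Fs) r" "sweep P r (drop j Fs) (bottom_path P)"
      using sweep_split[of P "top_path P" "take j Fs" "drop j Fs" "bottom_path P"] sw split(1) by auto
    have sub: "set (take j Fs) \<subseteq> faces P" "set (drop j Fs) \<subseteq> faces P" using d(2) set_take_subset set_drop_subset by fast+
    have sr: "spath r" using sweep_spath[OF r(1) _ spath_top] sub(1) jf by blast
    have "Fs ! i \<in> set (drop j Fs)"
      using nth_mem[of "i - j" "drop j Fs"] \<open>\<not> i < j\<close> ij(1) by simp
    then have "set (lower P (Fs ! i)) \<inter> set r = {}"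
      using sweep_lower_new[OF r(2) _ sr] sub(2) jf by blast
    moreover have "set (upper P (Fs ! j)) \<subseteq> set r"
      using r(2) unfolding split(2) by (auto simp: sweep_Cons)
    ultimately show False using ij(3) by (auto simp: below_def)
  qed
  moreover have "b \<in> faces P" if "below P a b" for a b using that by (simp add: below_def)
  ultimately have "Fs \<in> linear_extensions (faces P) (below P)\<^sup>+\<^sup>+"
    by (rule linear_extension_tranclp[OF d])
  then show ?thesis using that sw by blast
qed

abbreviation lin :: "complex set list set" where
  "lin \<equiv> linear_extensions (faces P) (below P)\<^sup>+\<^sup>+"

text \<open>
  The arcs of the path that is reached when the faces in \<open>U\<close> have been processed; they depend on the set of
  these faces only.
\<close>

definition arcs_after :: "complex set list \<Rightarrow> 'e set" where
  "arcs_after U = (set (top_path P) \<union> (\<Union>F \<in> set U. set (lower P F))) - (\<Union>F \<in> set U. set (upper P F))"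

lemma dpath_continues_along:
  assumes "dpath P u c v" "dpath P u \<sigma> y" "dpath P s a u" "set \<sigma> \<subseteq> set (a @ c)"
  shows "\<exists>b. c = \<sigma> @ b"
  using assms
proof (induction \<sigma> arbitrary: u c a)
  case (Cons f \<sigma>)
  have f: "f \<in> arcs (graph P)" "u = src f" "dpath P (trg f) \<sigma> y" using Cons.prems(2) by (auto simp: dpath_Cons)
  have "f \<notin> set a" using dpath_no_arc_out_of_finish[OF Cons.prems(3), of f] f(2) by blast
  then have "f \<in> set c" using Cons.prems(4) by auto
  then obtain c' where c: "c = f # c'" using dpath_same_start_only[OF Cons.prems(1)] f(2) by blast
  have "dpath P (trg f) c' v" using Cons.prems(1) c by (auto simp: dpath_Cons)
  moreover have "dpath P s (a @ [f]) (trg f)" using Cons.prems(3) f by (auto simp: dpath_append dpath_Cons)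
  ultimately show ?case using Cons.IH[of "trg f" c' "a @ [f]"] f(3) Cons.prems(4) c by auto
qed simp

text \<open>
  At each vertex the path \<open>p\<close> has only one way to continue, so arcs that form a path occur in \<open>p\<close> without
  interruption.
\<close>

lemma dpath_contains_contiguously:
  assumes "dpath P s p t" "dpath P x \<sigma> y" "\<sigma> \<noteq> []" "set \<sigma> \<subseteq> set p"
  obtains a b where "p = a @ \<sigma> @ b"
proof -
  obtain f \<sigma>' where \<sigma>: "\<sigma> = f # \<sigma>'" using assms(3) by (cases \<sigma>) auto
  then have "f \<in> set p" using assms(4) by auto
  then obtain a c where ac: "p = a @ f # c" "dpath P s a (src f)" "dpath P (trg f) c t"
    using dpath_arc_between[OF assms(1)] by metis
  have x: "x = src f" "f \<in> arcs (graph P)" using assms(2) \<sigma> by (auto simp: dpath_Cons)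
  have "dpath P x (f # c) t" using ac(3) x by (auto simp: dpath_Cons)
  then obtain b where "f # c = \<sigma> @ b"
    using dpath_continues_along[OF _ assms(2), of "f # c" t s a] ac(1,2) assms(4) x(1) by auto
  then show ?thesis using that ac(1) by simp
qed

lemma upper_arc_origin:
  assumes "F \<in> faces P" "e \<in> set (upper P F)"
  shows "e \<in> set (top_path P) \<or> (\<exists>G \<in> faces P. e \<in> set (lower P G))"
proof -
  obtain Fs where Fs: "sweep P (top_path P) Fs (bottom_path P)" "set Fs = faces P"
    by (rule sweep_of_pasting_scheme) blast
  then show ?thesis using sweep_upper_origin[OF Fs(1)] assms by blast
qed

lemma linear_extension_precedes:
  assumes "U @ V \<in> lin" "below P G F" "F \<in> set (U @ take 1 V)"
  shows "G \<in> set U"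
proof -
  have x: "set (U @ V) = faces P" "sorted_wrt (\<lambda>a b. \<not> (below P)\<^sup>+\<^sup>+ b a) (U @ V)" "\<not> (below P)\<^sup>+\<^sup>+ F F"
    using assms by (auto simp: linear_extensions_iff below_def)
  have G: "(below P)\<^sup>+\<^sup>+ G F" "G \<in> faces P"
    using assms(2) tranclp.r_into_trancl[of "below P"] by (blast, simp add: below_def)
  have "G \<notin> set V"
  proof
    assume "G \<in> set V"
    then show False
      using x G assms(3) by (cases V) (auto simp: sorted_wrt_append)
  qed
  then show ?thesis using x(1) G(2) by auto
qed

text \<open>
  An arc of the upper side of \<open>F\<close> that is not on the top path is on the lower side of a face below which
  \<open>F\<close> lies, and this face has been processed. No other face removes the arc, since upper sides are disjoint.
\<close>

lemma upper_within_arcs_after: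
  assumes "U @ F # V \<in> lin"
  shows "set (upper P F) \<subseteq> arcs_after U"
proof
  fix e assume e: "e \<in> set (upper P F)"
  have F: "F \<in> faces P" "F \<notin> set U" "set U \<subseteq> faces P" using assms by (auto simp: linear_extensions_iff)
  have "e \<notin> set (upper P G)" if "G \<in> set U" for G
    using uppers_disjoint[of F G] F that e by blast
  moreover have "e \<in> set (top_path P) \<or> (\<exists>G \<in> set U. e \<in> set (lower P G))"
  proof (cases "e \<in> set (top_path P)")
    case False
    then obtain G where G: "G \<in> faces P" "e \<in> set (lower P G)" using upper_arc_origin F(1) e by blast
    then have "below P G F" using F(1) e by (auto simp: below_def)
    then have "G \<in> set U" using linear_extension_precedes[OF assms] by simp
    then show ?thesis using G(2) by blast
  qed simp
  ultimately show "e \<in> arcs_after U" by (auto simp: arcs_after_def)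
qed

lemma arcs_after_snoc:
  assumes "U @ F # V \<in> lin"
  shows "arcs_after (U @ [F]) = (arcs_after U - set (upper P F)) \<union> set (lower P F)"
proof -
  have F: "F \<in> faces P" using assms by (auto simp: linear_extensions_iff)
  have "e \<notin> set (upper P G)" if "e \<in> set (lower P F)" "G \<in> insert F (set U)" for e G
  proof
    assume "e \<in> set (upper P G)"
    moreover have "G \<in> faces P" using that(2) assms by (auto simp: linear_extensions_iff)
    ultimately have "below P F G" using that(1) F by (auto simp: below_def)
    then have "F \<in> set U" using linear_extension_precedes[OF assms, of F G] that(2) by simp
    then show False using assms by (auto simp: linear_extensions_iff)
  qed
  then show ?thesis unfolding arcs_after_def by auto
qed

lemma sweep_prefix:
  assumes "U @ V \<in> lin"
  shows "\<exists>\<pi>. sweep P (top_path P) U \<pi> \<and> spath \<pi> \<and> set \<pi> = arcs_after U"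
  using assms
proof (induction U arbitrary: V rule: rev_induct)
  case Nil
  then show ?case using spath_top by (simp add: arcs_after_def)
next
  case (snoc F U)
  then have UV: "U @ F # V \<in> lin" by simp
  then obtain \<pi> where \<pi>: "sweep P (top_path P) U \<pi>" "spath \<pi>" "set \<pi> = arcs_after U" using snoc.IH by blast
  have F: "F \<in> faces P" using UV by (auto simp: linear_extensions_iff)
  obtain a b where ab: "\<pi> = a @ upper P F @ b"
    using dpath_contains_contiguously[of "source P" \<pi> "sink P"] face_dest(1,3)[OF F]
      upper_within_arcs_after[OF UV] \<pi>(2,3) unfolding spath_def by metis
  let ?\<rho> = "a @ lower P F @ b"
  have sp: "spath ?\<rho>" using spath_replace_upper(3)[of a F b] \<pi>(2) ab face_jordan[OF F] by simp
  have "sweep P \<pi> [F] ?\<rho>" using ab by (auto simp: sweep_Cons)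
  then have "sweep P (top_path P) (U @ [F]) ?\<rho>" using sweep_append[OF \<pi>(1)] by blast
  moreover have "set ?\<rho> = arcs_after (U @ [F])"
  proof -
    have "distinct \<pi>" using \<pi>(2) dpath_distinct unfolding spath_def by blast
    then have "set a \<union> set b = set \<pi> - set (upper P F)" using ab by auto
    then show ?thesis using arcs_after_snoc[OF UV] \<pi>(3) by auto
  qed
  ultimately show ?case using sp by blast
qed

lemma split_unique:
  assumes "distinct (a @ \<sigma> @ b)" "a @ \<sigma> @ b = a' @ \<sigma> @ b'" "\<sigma> \<noteq> []"
  shows "a = a' \<and> b = b'"
proof -
  obtain f \<sigma>' where \<sigma>: "\<sigma> = f # \<sigma>'" using assms(3) by (cases \<sigma>) auto
  have "f \<notin> set a" "f \<notin> set (\<sigma>' @ b)" using assms(1) \<sigma> by auto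
  then have "a = a'" using assms(2) append_Cons_eq_iff[of f a "\<sigma>' @ b" a' "\<sigma>' @ b'"] \<sigma> by simp
  then show ?thesis using assms(2) by simp
qed

lemma sweep_deterministic:
  assumes "sweep P p Fs q" "sweep P p Fs q'" "spath p" "set Fs \<subseteq> faces P"
  shows "q = q'"
  using assms
proof (induction Fs arbitrary: p)
  case (Cons F Fs)
  obtain a b where ab: "p = a @ upper P F @ b" "sweep P (a @ lower P F @ b) Fs q"
    using Cons.prems(1) by (auto simp: sweep_Cons)
  obtain a' b' where ab': "p = a' @ upper P F @ b'" "sweep P (a' @ lower P F @ b') Fs q'"
    using Cons.prems(2) by (auto simp: sweep_Cons)
  have F: "F \<in> faces P" using Cons.prems(4) by simp
  have "distinct p" using Cons.prems(3) dpath_distinct unfolding spath_def by blast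
  then have "a = a' \<and> b = b'"
    using split_unique[OF _ _ face_dest(3)[OF F], of a b a' b'] ab(1) ab'(1) by metis
  moreover have "spath (a @ lower P F @ b)" using spath_replace_upper(3)[of a F b] Cons.prems(3) ab(1) face_jordan[OF F] by simp
  ultimately show ?case using Cons.IH[OF ab(2)] ab'(2) Cons.prems(4) by simp
qed simp

text \<open>
  The path reached at the end has the same arcs as the one reached by the known sweep, which ends with the
  bottom path.
\<close>

lemma sweep_complete:
  assumes "Fs \<in> lin"
  shows "sweep P (top_path P) Fs (bottom_path P)"
proof -
  obtain Gs where Gs: "sweep P (top_path P) Gs (bottom_path P)" "Gs \<in> lin" by (rule sweep_is_linear_extension)
  obtain \<pi> where \<pi>: "sweep P (top_path P) Fs \<pi>" "spath \<pi>" "set \<pi> = arcs_after Fs"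
    using sweep_prefix[of Fs "[]"] assms by auto
  obtain \<pi>' where \<pi>': "sweep P (top_path P) Gs \<pi>'" "spath \<pi>'" "set \<pi>' = arcs_after Gs"
    using sweep_prefix[of Gs "[]"] Gs(2) by auto
  have "set Fs = set Gs" using assms Gs(2) by (auto simp: linear_extensions_iff)
  then have eq: "\<pi> = \<pi>'" using spath_subset_imp_eq[OF \<pi>(2) \<pi>'(2)] \<pi>(3) \<pi>'(3) by (simp add: arcs_after_def)
  have "sweep P (top_path P) Gs \<pi>'" by (fact \<pi>'(1))
  moreover have "set Gs = faces P" using Gs(2) by (auto simp: linear_extensions_iff)
  ultimately have "\<pi>' = bottom_path P"
    using sweep_deterministic Gs(1) spath_top by blast
  then show ?thesis using \<pi>(1) eq by simp
qed

end

section \<open>Faces side by side on a path\<close>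

lemma disjoint_sublists_ordered:
  assumes "a @ x @ b = c @ y @ d" "set x \<inter> set y = {}" "x \<noteq> []" "y \<noteq> []"
  shows "(\<exists>v. c = a @ x @ v \<and> b = v @ y @ d) \<or> (\<exists>v. a = c @ y @ v \<and> d = v @ x @ b)"
proof -
  have main: "\<exists>v. c = a @ x @ v \<and> b = v @ y @ d"
    if h: "x @ b = us @ y @ d" "c = a @ us" "set x \<inter> set y = {}" "y \<noteq> []" for a b c d us and x y :: "'a list"
  proof -
    consider vs where "x = us @ vs" "vs @ b = y @ d" | vs where "us = x @ vs" "b = vs @ y @ d"
      using h(1) append_eq_append_conv2[of x b us "y @ d"] by blast
    then show ?thesis
    proof cases
      case 1
      have "vs = []"
      proof (rule ccontr)
        assume "vs \<noteq> []"
        then have "hd vs = hd y" using 1(2) h(4) by (metis hd_append2)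
        then show False using 1(1) h(3,4) \<open>vs \<noteq> []\<close> by (metis disjoint_iff hd_in_set in_set_conv_decomp append_assoc Un_iff set_append)
      qed
      then show ?thesis using 1 h(2) by (intro exI[of _ "[]"]) simp
    next
      case 2
      then show ?thesis using h(2) by auto
    qed
  qed
  obtain us where "(a = c @ us \<and> us @ x @ b = y @ d) \<or> (a @ us = c \<and> x @ b = us @ y @ d)"
    using assms(1) append_eq_append_conv2[of a "x @ b" c "y @ d"] by blast
  then show ?thesis
  proof
    assume "a = c @ us \<and> us @ x @ b = y @ d"
    then show ?thesis using main[of y d us x b a c] assms(2,3) by auto
  next
    assume "a @ us = c \<and> x @ b = us @ y @ d"
    then show ?thesis using main[of x b us y d c a] assms(2,4) by auto
  qed
qed

context pasting_scheme
begin

text \<open>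
  The face \<open>F\<close> can be processed next on the path \<open>\<pi>\<close>, which then becomes \<open>after \<pi> F\<close>.
\<close>

definition ready :: "'e list \<Rightarrow> complex set \<Rightarrow> bool" where
  "ready \<pi> F \<longleftrightarrow> spath \<pi> \<and> F \<in> faces P \<and> set (upper P F) \<subseteq> set \<pi>"

definition after :: "'e list \<Rightarrow> complex set \<Rightarrow> 'e list" where
  "after \<pi> F = (THE \<rho>. \<exists>a b. \<pi> = a @ upper P F @ b \<and> \<rho> = a @ lower P F @ b)"

definition left_of :: "'e list \<Rightarrow> complex set \<Rightarrow> complex set \<Rightarrow> bool" where
  "left_of \<pi> G H \<longleftrightarrow> (\<exists>w v u. \<pi> = w @ upper P G @ v @ upper P H @ u)"

lemma spath_distinct: "spath \<pi> \<Longrightarrow> distinct \<pi>"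
  using dpath_distinct unfolding spath_def by blast

lemma spath_split_unique:
  assumes "spath \<pi>" "F \<in> faces P" "\<pi> = a @ upper P F @ b" "\<pi> = a' @ upper P F @ b'"
  shows "a = a'" "b = b'"
  using split_unique[of a "upper P F" b a' b'] spath_distinct[OF assms(1)] face_dest(3)[OF assms(2)] assms(3,4)
  by metis+

lemma spath_parts:
  assumes "spath (a @ upper P F @ b)" "F \<in> faces P"
  shows "dpath P (source P) a (face_source P F)" "dpath P (face_sink P F) b (sink P)" "spath (a @ lower P F @ b)"
  using spath_replace_upper[OF assms(1) face_jordan[OF assms(2)]] by auto

lemma after_eq: "spath (a @ upper P F @ b) \<Longrightarrow> F \<in> faces P \<Longrightarrow> after (a @ upper P F @ b) F = a @ lower P F @ b"
  unfolding after_def using spath_split_unique by (intro the_equality) blast+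

lemma ready_split:
  assumes "ready \<pi> F"
  obtains a b where "\<pi> = a @ upper P F @ b"
  using dpath_contains_contiguously[of "source P" \<pi> "sink P" "face_source P F" "upper P F" "face_sink P F"]
    face_dest(1,3)[of F] assms unfolding ready_def spath_def by metis

lemma ready_after:
  assumes "ready \<pi> G" "ready \<pi> H" "G \<noteq> H"
  shows "ready (after \<pi> G) H"
proof -
  obtain a b where ab: "\<pi> = a @ upper P G @ b" using ready_split assms(1) by blast
  have G: "spath (a @ upper P G @ b)" "G \<in> faces P" and H: "H \<in> faces P" "set (upper P H) \<subseteq> set \<pi>"
    using assms ab by (auto simp: ready_def)
  have "set (upper P H) \<subseteq> set a \<union> set b" using uppers_disjoint[OF G(2) H(1) assms(3)] H(2) ab by auto
  then show ?thesis using after_eq[OF G] spath_parts(3)[OF G] H(1) ab by (auto simp: ready_def)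
qed

lemma spath_after: "ready \<pi> F \<Longrightarrow> spath (after \<pi> F)"
  using after_eq spath_parts(3) ready_split by (metis ready_def)

text \<open>
  Upper sides of distinct faces have no arc in common and are contiguous.
\<close>

lemma left_or_right:
  assumes "ready \<pi> G" "ready \<pi> H" "G \<noteq> H"
  shows "left_of \<pi> G H \<or> left_of \<pi> H G"
proof -
  obtain a b where ab: "\<pi> = a @ upper P G @ b" using ready_split assms(1) by blast
  obtain c d where cd: "\<pi> = c @ upper P H @ d" using ready_split assms(2) by blast
  have GH: "G \<in> faces P" "H \<in> faces P" using assms by (auto simp: ready_def)
  have "a @ upper P G @ b = c @ upper P H @ d" using ab cd by simp
  from disjoint_sublists_ordered[OF this uppers_disjoint[OF GH assms(3)] face_dest(3)[OF GH(1)] face_dest(3)[OF GH(2)]]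
  show ?thesis
  proof
    assume "\<exists>v. c = a @ upper P G @ v \<and> b = v @ upper P H @ d"
    then show ?thesis using ab unfolding left_of_def by blast
  next
    assume "\<exists>v. a = c @ upper P H @ v \<and> d = v @ upper P G @ b"
    then show ?thesis using cd unfolding left_of_def by blast
  qed
qed

lemma spath_parts2:
  assumes "spath (w @ upper P G @ v @ upper P H @ u)" "G \<in> faces P" "H \<in> faces P"
  shows "dpath P (source P) w (face_source P G)" "dpath P (face_sink P G) v (face_source P H)"
    "dpath P (face_sink P H) u (sink P)"
proof -
  have 1: "spath ((w @ upper P G @ v) @ upper P H @ u)" using assms(1) by simp
  show w: "dpath P (source P) w (face_source P G)" using spath_parts(1)[of w G "v @ upper P H @ u"] assms by simp
  show "dpath P (face_sink P H) u (sink P)" using spath_parts(2)[OF 1 assms(3)] .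
  have d: "dpath P (source P) (w @ upper P G @ v) (face_source P H)" using spath_parts(1)[OF 1 assms(3)] .
  have "dpath P (face_sink P G) (v @ upper P H @ u) (sink P)"
    using spath_parts(2)[of w G "v @ upper P H @ u"] assms by simp
  then obtain m where m: "dpath P (face_sink P G) v m" by (auto simp: dpath_append)
  have "dpath P (source P) (w @ upper P G) (face_sink P G)" using w face_dest(1)[OF assms(2)] dpath_append by blast
  then have "dpath P (source P) ((w @ upper P G) @ v) m" using m dpath_append by blast
  then have "dpath P (source P) (w @ upper P G @ v) m" by simp
  moreover have "w @ upper P G @ v \<noteq> []" using face_dest(3)[OF assms(2)] by simp
  ultimately have "m = face_source P H" using G.awalk_ends[OF d] by auto
  then show "dpath P (face_sink P G) v (face_source P H)" using m by simp
qed

lemma left_of_prec: "spath \<pi> \<Longrightarrow> G \<in> faces P \<Longrightarrow> H \<in> faces P \<Longrightarrow> left_of \<pi> G H \<Longrightarrow> prec P G H"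
  using spath_parts2(2) unfolding left_of_def prec_def by blast

lemma prec_asym: "prec P G H \<Longrightarrow> \<not> prec P H G"
proof
  assume "prec P G H" "prec P H G"
  then obtain p q where pq: "dpath P (face_sink P G) p (face_source P H)" "dpath P (face_sink P H) q (face_source P G)"
    and F: "G \<in> faces P" "H \<in> faces P"
    by (auto simp: prec_def)
  have "dpath P (face_sink P G) (p @ upper P H @ q) (face_source P G)"
    using pq face_dest(1)[OF F(2)] dpath_append by blast
  then show False using dpath_no_return[OF face_dest(1)[OF F(1)]] face_dest(3)[OF F(1)] by blast
qed

lemma left_of_asym: "spath \<pi> \<Longrightarrow> G \<in> faces P \<Longrightarrow> H \<in> faces P \<Longrightarrow> left_of \<pi> G H \<Longrightarrow> \<not> left_of \<pi> H G"
  using left_of_prec prec_asym by blast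

lemma left_of_chain:
  assumes "spath \<pi>" "H \<in> faces P" "left_of \<pi> G H" "left_of \<pi> H K"
  obtains w v1 v2 u where "\<pi> = w @ upper P G @ v1 @ upper P H @ v2 @ upper P K @ u"
proof -
  obtain w v u where "\<pi> = w @ upper P G @ v @ upper P H @ u" using assms(3) unfolding left_of_def by blast
  then have 1: "\<pi> = (w @ upper P G @ v) @ upper P H @ u" by simp
  obtain w' v' u' where 2: "\<pi> = w' @ upper P H @ v' @ upper P K @ u'" using assms(4) unfolding left_of_def by blast
  have "u = v' @ upper P K @ u'" using spath_split_unique(2)[OF assms(1,2) 1 2] .
  then show ?thesis using that[of w v v' u'] 1 by simp
qed

lemma after_left:
  assumes "spath (w @ upper P G @ v @ upper P H @ u)" "G \<in> faces P"
  shows "after (w @ upper P G @ v @ upper P H @ u) G = w @ lower P G @ v @ upper P H @ u"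
  using after_eq[OF assms] .

lemma after_right:
  assumes "spath (w @ upper P G @ v @ upper P H @ u)" "H \<in> faces P"
  shows "after (w @ upper P G @ v @ upper P H @ u) H = w @ upper P G @ v @ lower P H @ u"
  using after_eq[of "w @ upper P G @ v" H u] assms by simp

lemma after_commute:
  assumes "ready \<pi> G" "ready \<pi> H" "G \<noteq> H"
  shows "after (after \<pi> G) H = after (after \<pi> H) G"
proof -
  have main: "after (after \<pi> G) H = after (after \<pi> H) G" if h: "left_of \<pi> G H" "ready \<pi> G" "ready \<pi> H" for G H
  proof -
    obtain w v u where \<pi>: "\<pi> = w @ upper P G @ v @ upper P H @ u" using h(1) unfolding left_of_def by blast
    have s: "spath (w @ upper P G @ v @ upper P H @ u)" "G \<in> faces P" "H \<in> faces P" using h \<pi> by (auto simp: ready_def)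
    have "spath (w @ lower P G @ v @ upper P H @ u)" using spath_parts(3)[OF s(1,2)] .
    then have "after (after \<pi> G) H = w @ lower P G @ v @ lower P H @ u"
      using after_left[OF s(1,2)] after_eq[of "w @ lower P G @ v" H u] s(3) \<pi> by simp
    moreover have "spath (w @ upper P G @ v @ lower P H @ u)"
      using spath_parts(3)[of "w @ upper P G @ v" H u] s by simp
    then have "after (after \<pi> H) G = w @ lower P G @ v @ lower P H @ u"
      using after_right[OF s(1,3)] after_eq[of w G "v @ lower P H @ u"] s(2) \<pi> by simp
    ultimately show ?thesis by simp
  qed
  show ?thesis using left_or_right[OF assms] main assms by metis
qed

end

section \<open>Cells labelled by paths and faces\<close>

locale labelled_scheme = pasting_scheme P + gray_category K + labelling K P l
  for P :: "'e scheme_data" and K :: "('o, 'a, 'b, 'c) gray_cat" and l :: "('o, 'a, 'b, 'e) labelling_data"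
begin

abbreviation ob :: "complex \<Rightarrow> 'o" where "ob \<equiv> lab0 l"
abbreviation hom :: "complex \<Rightarrow> complex \<Rightarrow> ('a, 'b, 'c) two_cat" where "hom x y \<equiv> ghom K (ob x) (ob y)"
abbreviation cmp :: "complex \<Rightarrow> complex \<Rightarrow> complex \<Rightarrow> ('a, 'b, 'c) gray_map" where
  "cmp x y z \<equiv> gcomp K (ob x) (ob y) (ob z)"
abbreviation plab :: "complex \<Rightarrow> 'e list \<Rightarrow> 'a" where "plab \<equiv> path_label K P l"
abbreviation X :: "('a, 'b, 'c) two_cat" where "X \<equiv> label_hom K P l"
abbreviation wh1 :: "complex \<Rightarrow> complex \<Rightarrow> 'e list \<Rightarrow> 'b \<Rightarrow> 'e list \<Rightarrow> 'b" where
  "wh1 x y p \<theta> q \<equiv> whisker1 K (ob (source P)) (ob x) (ob y) (ob (sink P)) (plab y q) \<theta> (plab (source P) p)"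
abbreviation wh2 :: "complex \<Rightarrow> complex \<Rightarrow> 'e list \<Rightarrow> 'c \<Rightarrow> 'e list \<Rightarrow> 'c" where
  "wh2 x y p \<theta> q \<equiv> whisker2 K (ob (source P)) (ob x) (ob y) (ob (sink P)) (plab y q) \<theta> (plab (source P) p)"

lemma ob_in: "dpath P x p y \<Longrightarrow> ob x \<in> gobj K" "dpath P x p y \<Longrightarrow> ob y \<in> gobj K"
  using lab0_in dpath_ends_in by blast+

lemma plab_Cons:
  assumes "dpath P u (e # p) v"
  shows "plab u (e # p) = on_obj (cmp u (trg e) v) (plab (trg e) p) (lab1 l e)"
proof -
  have "dpath P (trg e) p v" using assms by (simp add: dpath_Cons)
  then have "last (G.awalk_verts (trg e) p) = v" by simp
  then show ?thesis by (simp add: Let_def)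
qed

lemma plab_in: "dpath P u p v \<Longrightarrow> plab u p \<in> cells0 (hom u v)"
proof (induction p arbitrary: u)
  case Nil
  then have "u = v" "ob v \<in> gobj K" using lab0_in by auto
  then show ?case using unit_in by simp
next
  case (Cons e p)
  have e: "e \<in> arcs (graph P)" "u = src e" "dpath P (trg e) p v" using Cons.prems by (auto simp: dpath_Cons)
  have "on_obj (cmp u (trg e) v) (plab (trg e) p) (lab1 l e) \<in> cells0 (hom u v)"
    by (rule functor0[OF right_functor[OF ob_in(1)[OF Cons.prems] ob_in[OF e(3)] Cons.IH[OF e(3)]]])
      (use lab1_in[OF e(1)] e(2) in simp)
  then show ?case using plab_Cons[OF Cons.prems] by simp
qed

lemma plab_append:
  assumes "dpath P u p m" "dpath P m q v"
  shows "plab u (p @ q) = on_obj (cmp u m v) (plab m q) (plab u p)"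
  using assms(1)
proof (induction p arbitrary: u)
  case Nil
  then show ?case using unit_right_obj[OF ob_in[OF assms(2)] plab_in[OF assms(2)]] by simp
next
  case (Cons e p)
  have e: "e \<in> arcs (graph P)" "u = src e" "dpath P (trg e) p m" using Cons.prems by (auto simp: dpath_Cons)
  have pq: "dpath P u (e # p @ q) v" using Cons.prems assms(2) dpath_append[of u "e # p" q v] by auto
  show ?case
    using plab_Cons[OF pq] plab_Cons[OF Cons.prems] Cons.IH[OF e(3)] lab1_in[OF e(1)] e(2)
      assoc_obj[OF ob_in(1)[OF Cons.prems] ob_in[OF e(3)] ob_in(2)[OF assms(2)] plab_in[OF assms(2)] plab_in[OF e(3)], of "lab1 l e"]
    by simp
qed

lemma lab2_cell1:
  assumes "F \<in> faces P"
  shows "cell1 (hom (face_source P F) (face_sink P F)) (lab2 l F)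
    (plab (face_source P F) (upper P F)) (plab (face_source P F) (lower P F))"
  using lab2_in[OF assms] src_lab2[OF assms] tgt_lab2[OF assms] by (simp add: cell1_def)

lemma wh_functor:
  assumes "dpath P (source P) p x" "dpath P y q (sink P)"
  shows "strict_two_functor (hom x y) X
    (\<lambda>z. on_obj (cmp (source P) y (sink P)) (plab y q) (on_obj (cmp (source P) x y) z (plab (source P) p)))
    (\<lambda>\<theta>. wh1 x y p \<theta> q) (\<lambda>\<Theta>. wh2 x y p \<Theta> q)"
  unfolding label_hom_def
  using whisker_functor[OF ob_in[OF assms(1)] ob_in[OF assms(2)] plab_in[OF assms(1)] plab_in[OF assms(2)]] .

text \<open>
  Associativity absorbs into the whiskering the part \<open>r\<close> of a path that follows a cell.
\<close>

lemma wh_right: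
  assumes p: "dpath P (source P) p x" and r: "dpath P y r z" and q: "dpath P z q (sink P)"
  shows "\<theta> \<in> cells1 (hom x y) \<Longrightarrow> wh1 x z p (on_1R (cmp x y z) (plab y r) \<theta>) q = wh1 x y p \<theta> (r @ q)"
    and "\<Theta> \<in> cells2 (hom x y) \<Longrightarrow> wh2 x z p (on_2R (cmp x y z) (plab y r) \<Theta>) q = wh2 x y p \<Theta> (r @ q)"
proof -
  note obs = ob_in[OF p] ob_in[OF r] and t = ob_in(2)[OF q]
  note lf = left_functor[OF obs(1,2,3) plab_in[OF p]]
  show "wh1 x z p (on_1R (cmp x y z) (plab y r) \<theta>) q = wh1 x y p \<theta> (r @ q)" if \<theta>: "\<theta> \<in> cells1 (hom x y)"
  proof -
    have "on_1L (cmp (source P) x y) \<theta> (plab (source P) p) \<in> cells1 (hom (source P) y)"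
      using functor1[OF lf, of \<theta>] \<theta> by (simp add: cell1_def)
    then show ?thesis
      unfolding whisker1_def plab_append[OF r q]
      using assoc_1M[OF obs plab_in[OF r] \<theta> plab_in[OF p]]
        assoc_1R[OF obs(1,3,4) t plab_in[OF q] plab_in[OF r]] by simp
  qed
  show "wh2 x z p (on_2R (cmp x y z) (plab y r) \<Theta>) q = wh2 x y p \<Theta> (r @ q)" if \<Theta>: "\<Theta> \<in> cells2 (hom x y)"
  proof -
    have "on_2L (cmp (source P) x y) \<Theta> (plab (source P) p) \<in> cells2 (hom (source P) y)"
      using functor2[OF lf, of \<Theta>] \<Theta> by (simp add: cell2_def)
    then show ?thesis
      unfolding whisker2_def plab_append[OF r q]
      using assoc_2M[OF obs plab_in[OF r] \<Theta> plab_in[OF p]]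
        assoc_2R[OF obs(1,3,4) t plab_in[OF q] plab_in[OF r]] by simp
  qed
qed

text \<open>
  Likewise for the part \<open>r\<close> that precedes a cell.
\<close>

lemma wh_left:
  assumes p: "dpath P (source P) p x" and r: "dpath P x r y" and z: "ob z \<in> gobj K"
  shows "\<theta> \<in> cells1 (hom y z) \<Longrightarrow> wh1 x z p (on_1L (cmp x y z) \<theta> (plab x r)) q = wh1 y z (p @ r) \<theta> q"
    and "\<Theta> \<in> cells2 (hom y z) \<Longrightarrow> wh2 x z p (on_2L (cmp x y z) \<Theta> (plab x r)) q = wh2 y z (p @ r) \<Theta> q"
  unfolding whisker1_def whisker2_def plab_append[OF p r]
  using assoc_1L[OF ob_in[OF p] ob_in(2)[OF r] z _ plab_in[OF r] plab_in[OF p]]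
    assoc_2L[OF ob_in[OF p] ob_in(2)[OF r] z _ plab_in[OF r] plab_in[OF p]] by simp_all

sublocale X: two_category X
  unfolding label_hom_def using hom_two_category lab0_in source_in sink_in by simp

lemma whiskered_face_wh1: "whiskered_face K P l a F b = wh1 (face_source P F) (face_sink P F) a (lab2 l F) b"
  by (simp add: whiskered_face_def)

lemma whiskered_face_cell1:
  assumes "spath (a @ upper P F @ b)" "F \<in> faces P"
  shows "cell1 X (whiskered_face K P l a F b) (plab (source P) (a @ upper P F @ b)) (plab (source P) (a @ lower P F @ b))"
proof -
  note d = spath_parts[OF assms] and f = face_dest(1,2)[OF assms(2)]
  have eq: "plab (source P) (a @ r @ b) = on_obj (cmp (source P) (face_sink P F) (sink P)) (plab (face_sink P F) b)
      (on_obj (cmp (source P) (face_source P F) (face_sink P F)) (plab (face_source P F) r) (plab (source P) a))"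
    if r: "dpath P (face_source P F) r (face_sink P F)" for r
  proof -
    have "dpath P (source P) (a @ r) (face_sink P F)" using d(1) r dpath_append by blast
    then show ?thesis using plab_append[OF _ d(2), of "source P" "a @ r"] plab_append[OF d(1) r] by simp
  qed
  show ?thesis
    unfolding whiskered_face_wh1 eq[OF f(1)] eq[OF f(2)]
    using functor1[OF wh_functor[OF d(1,2)] lab2_cell1[OF assms(2)]] .
qed

text \<open>
  The whiskered label of \<open>F\<close>; the position of \<open>F\<close> on \<open>\<pi>\<close> is determined by \<open>\<pi>\<close> and \<open>F\<close>.
\<close>

definition fcell :: "'e list \<Rightarrow> complex set \<Rightarrow> 'b" where
  "fcell \<pi> F = (THE \<theta>. \<exists>a b. \<pi> = a @ upper P F @ b \<and> \<theta> = whiskered_face K P l a F b)"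

lemma fcell_eq:
  "spath (a @ upper P F @ b) \<Longrightarrow> F \<in> faces P \<Longrightarrow> fcell (a @ upper P F @ b) F = whiskered_face K P l a F b"
  unfolding fcell_def using spath_split_unique by (intro the_equality) blast+

lemma fcell_cell1:
  assumes "ready \<pi> F"
  shows "cell1 X (fcell \<pi> F) (plab (source P) \<pi>) (plab (source P) (after \<pi> F))"
proof -
  obtain a b where ab: "\<pi> = a @ upper P F @ b" using ready_split[OF assms] .
  have "spath (a @ upper P F @ b)" "F \<in> faces P" using assms ab by (auto simp: ready_def)
  from whiskered_face_cell1[OF this] fcell_eq[OF this] after_eq[OF this] show ?thesis using ab by simp
qed

abbreviation inner_gray :: "complex set \<Rightarrow> 'e list \<Rightarrow> complex set \<Rightarrow> 'c" where
  "inner_gray G v H \<equiv> gray_cell (cmp (face_source P G) (face_sink P G) (face_sink P H))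
     (on_1L (cmp (face_sink P G) (face_source P H) (face_sink P H)) (lab2 l H) (plab (face_sink P G) v)) (lab2 l G)"

lemma whiskered_gray_cell_wh2:
  "whiskered_gray_cell K P l w G v H u = wh2 (face_source P G) (face_sink P H) w (inner_gray G v H) u"
  by (simp add: whiskered_gray_cell_def Let_def)

lemma behind_cell1:
  assumes "dpath P x v (face_source P H)" "H \<in> faces P"
  shows "cell1 (hom x (face_sink P H)) (on_1L (cmp x (face_source P H) (face_sink P H)) (lab2 l H) (plab x v))
    (plab x (v @ upper P H)) (plab x (v @ lower P H))"
  using functor1[OF left_functor[OF ob_in[OF assms(1)] ob_in(2)[OF face_dest(1)[OF assms(2)]] plab_in[OF assms(1)]] lab2_cell1[OF assms(2)]]
  unfolding plab_append[OF assms(1) face_dest(1)[OF assms(2)]] plab_append[OF assms(1) face_dest(2)[OF assms(2)]] .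

lemma whiskered_gray_cell2:
  assumes \<pi>: "spath (w @ upper P G @ v @ upper P H @ u)" and G: "G \<in> faces P" and H: "H \<in> faces P"
  shows "cell2 X (whiskered_gray_cell K P l w G v H u)
      (comp1 X (whiskered_face K P l (w @ lower P G @ v) H u) (whiskered_face K P l w G (v @ upper P H @ u)))
      (comp1 X (whiskered_face K P l w G (v @ lower P H @ u)) (whiskered_face K P l (w @ upper P G @ v) H u))"
    "\<exists>\<Psi> \<alpha> \<beta>. inverse2 X (whiskered_gray_cell K P l w G v H u) \<Psi> \<alpha> \<beta>"
proof -
  let ?a = "face_source P G" and ?b = "face_sink P G" and ?c = "face_source P H" and ?d = "face_sink P H"
  note d = spath_parts2[OF \<pi> G H] and fG = face_dest(1,2)[OF G] and fH = face_dest(1,2)[OF H]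
  note oa = ob_in[OF fG(1)] and oc = ob_in[OF fH(1)]
  let ?\<alpha> = "on_1L (cmp ?b ?c ?d) (lab2 l H) (plab ?b v)"
  note \<alpha> = behind_cell1[OF d(2) H] and \<beta> = lab2_cell1[OF G]
  have lG: "lab2 l G \<in> cells1 (hom ?a ?b)" and lH: "lab2 l H \<in> cells1 (hom ?c ?d)"
    using \<beta> lab2_cell1[OF H] by (auto simp: cell1_def)
  have \<alpha>in: "?\<alpha> \<in> cells1 (hom ?b ?d)" using \<alpha> by (simp add: cell1_def)
  note \<gamma> = gray_cell2[OF oa oc(2) \<alpha> \<beta>]
  note wf = wh_functor[OF d(1,3)]
  interpret ad: two_category "hom ?a ?d" by (rule hom_two_category[OF oa(1) oc(2)])
  have 1: "cell1 (hom ?a ?d) (on_1L (cmp ?a ?b ?d) ?\<alpha> (plab ?a r)) (on_obj (cmp ?a ?b ?d) (plab ?b (v @ upper P H)) (plab ?a r))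
      (on_obj (cmp ?a ?b ?d) (plab ?b (v @ lower P H)) (plab ?a r))" if r: "dpath P ?a r ?b" for r
    using functor1[OF left_functor[OF oa oc(2) plab_in[OF r]] \<alpha>] .
  have 2: "cell1 (hom ?a ?d) (on_1R (cmp ?a ?b ?d) (plab ?b s) (lab2 l G)) (on_obj (cmp ?a ?b ?d) (plab ?b s) (plab ?a (upper P G)))
      (on_obj (cmp ?a ?b ?d) (plab ?b s) (plab ?a (lower P G)))" if s: "dpath P ?b s ?d" for s
    using functor1[OF right_functor[OF oa oc(2) plab_in[OF s]] \<beta>] .
  have e1: "wh1 ?a ?d w (on_1L (cmp ?a ?b ?d) ?\<alpha> (plab ?a r)) u = whiskered_face K P l (w @ r @ v) H u"
    if r: "dpath P ?a r ?b" for r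
  proof -
    have wr: "dpath P (source P) (w @ r) ?b" using d(1) r dpath_append by blast
    show ?thesis
      unfolding whiskered_face_wh1 wh_left(1)[OF d(1) r oc(2) \<alpha>in] wh_left(1)[OF wr d(2) oc(2) lH] by simp
  qed
  have e2: "wh1 ?a ?d w (on_1R (cmp ?a ?b ?d) (plab ?b s) (lab2 l G)) u = whiskered_face K P l w G (s @ u)"
    if s: "dpath P ?b s ?d" for s
    unfolding whiskered_face_wh1 wh_right(1)[OF d(1) s d(3) lG] by simp
  have s: "dpath P ?b (v @ upper P H) ?d" "dpath P ?b (v @ lower P H) ?d" using d(2) fH dpath_append by blast+
  show "cell2 X (whiskered_gray_cell K P l w G v H u)
      (comp1 X (whiskered_face K P l (w @ lower P G @ v) H u) (whiskered_face K P l w G (v @ upper P H @ u)))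
      (comp1 X (whiskered_face K P l w G (v @ lower P H @ u)) (whiskered_face K P l (w @ upper P G @ v) H u))"
    using functor2[OF wf \<gamma>(1)]
    unfolding functor_comp1[OF wf 2[OF s(1)] 1[OF fG(2)]] functor_comp1[OF wf 1[OF fG(1)] 2[OF s(2)]]
      e1[OF fG(1)] e1[OF fG(2)] e2[OF s(1)] e2[OF s(2)] whiskered_gray_cell_wh2 by simp
  show "\<exists>\<Psi> \<alpha> \<beta>. inverse2 X (whiskered_gray_cell K P l w G v H u) \<Psi> \<alpha> \<beta>"
    using functor_inverse2[OF wf ad.iso_inverse2[OF \<gamma>(2,1)]] unfolding whiskered_gray_cell_wh2 by blast
qed

text \<open>
  The Yang-Baxter equation for the labels of \<open>G\<close>, \<open>H\<close> and \<open>N\<close>, where \<open>v1\<close> and \<open>v2\<close> are absorbed into the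
  cells to the right of them and \<open>w\<close> and \<open>u\<close> into the 2-functor. What remains is to recognise the twelve
  cells as whiskered faces and whiskered Gray cells.
\<close>

lemma whiskered_yang_baxter:
  assumes \<pi>: "spath (w @ upper P G @ v1 @ upper P H @ v2 @ upper P N @ u)"
    and G: "G \<in> faces P" and H: "H \<in> faces P" and N: "N \<in> faces P"
  shows "vcomp X (X.lw (whiskered_face K P l w G (v1 @ lower P H @ v2 @ lower P N @ u))
        (whiskered_gray_cell K P l (w @ upper P G @ v1) H v2 N u))
      (vcomp X (X.rw (whiskered_gray_cell K P l w G (v1 @ lower P H @ v2) N u)
          (whiskered_face K P l (w @ upper P G @ v1) H (v2 @ upper P N @ u)))
        (X.lw (whiskered_face K P l (w @ lower P G @ v1 @ lower P H @ v2) N u)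
          (whiskered_gray_cell K P l w G v1 H (v2 @ upper P N @ u))))
    = vcomp X (X.rw (whiskered_gray_cell K P l w G v1 H (v2 @ lower P N @ u))
          (whiskered_face K P l (w @ upper P G @ v1 @ upper P H @ v2) N u))
      (vcomp X (X.lw (whiskered_face K P l (w @ lower P G @ v1) H (v2 @ lower P N @ u))
          (whiskered_gray_cell K P l w G (v1 @ upper P H @ v2) N u))
        (X.rw (whiskered_gray_cell K P l (w @ lower P G @ v1) H v2 N u)
          (whiskered_face K P l w G (v1 @ upper P H @ v2 @ upper P N @ u))))"
proof -
  let ?a = "face_source P G" and ?b = "face_sink P G" and ?c' = "face_source P H" and ?c = "face_sink P H"
    and ?d' = "face_source P N" and ?d = "face_sink P N"
  have \<pi>': "spath ((w @ upper P G @ v1) @ upper P H @ v2 @ upper P N @ u)" using \<pi> by simp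
  note d1 = spath_parts2[OF \<pi> G H] and d2 = spath_parts2[OF \<pi>' H N]
  note fG = face_dest(1,2)[OF G] and fH = face_dest(1,2)[OF H] and fN = face_dest(1,2)[OF N]
  note oG = ob_in[OF fG(1)] and oH = ob_in[OF fH(1)] and oN = ob_in[OF fN(1)]
  let ?B = "on_1L (cmp ?b ?c' ?c) (lab2 l H) (plab ?b v1)" and ?C = "on_1L (cmp ?c ?d' ?d) (lab2 l N) (plab ?c v2)"
  note a = lab2_cell1[OF G] and b = behind_cell1[OF d1(2) H] and c = behind_cell1[OF d2(2) N]
  have in1: "lab2 l G \<in> cells1 (hom ?a ?b)" "lab2 l H \<in> cells1 (hom ?c' ?c)" "lab2 l N \<in> cells1 (hom ?d' ?d)"
    "?B \<in> cells1 (hom ?b ?c)" "?C \<in> cells1 (hom ?c ?d)"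
    using a lab2_cell1[OF H] lab2_cell1[OF N] b c by (auto simp: cell1_def)
  have dH: "dpath P ?b (v1 @ upper P H) ?c" "dpath P ?b (v1 @ lower P H) ?c" using d1(2) fH dpath_append by blast+
  have dN: "dpath P ?c (v2 @ upper P N) ?d" "dpath P ?c (v2 @ lower P N) ?d" using d2(2) fN dpath_append by blast+
  \<comment> \<open>One equation for each kind of cell in the Yang-Baxter equation; \<open>r\<close>, \<open>s\<close> and \<open>t\<close> stand for the
    upper or the lower side of \<open>G\<close>, \<open>H\<close> and \<open>N\<close>.\<close>
  have c1: "wh1 ?a ?d w (on_1R (cmp ?a ?c ?d) (plab ?c t) (on_1R (cmp ?a ?b ?c) (plab ?b s) (lab2 l G))) u
      = whiskered_face K P l w G (s @ t @ u)" if "dpath P ?b s ?c" "dpath P ?c t ?d" for s t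
  proof -
    have "on_1R (cmp ?a ?b ?c) (plab ?b s) (lab2 l G) \<in> cells1 (hom ?a ?c)"
      using functor1[OF right_functor[OF oG oH(2) plab_in[OF that(1)]] a] by (simp add: cell1_def)
    moreover have "dpath P ?c (t @ u) (sink P)" using that(2) d2(3) dpath_append by blast
    ultimately show ?thesis
      unfolding whiskered_face_wh1 using wh_right(1)[OF d1(1) that(2) d2(3)] wh_right(1)[OF d1(1) that(1) _ in1(1)] by simp
  qed
  have c2: "wh1 ?a ?d w (on_1R (cmp ?a ?c ?d) (plab ?c t) (on_1L (cmp ?a ?b ?c) ?B (plab ?a r))) u
      = whiskered_face K P l (w @ r @ v1) H (t @ u)" if "dpath P ?a r ?b" "dpath P ?c t ?d" for r t
  proof -
    have "on_1L (cmp ?a ?b ?c) ?B (plab ?a r) \<in> cells1 (hom ?a ?c)"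
      using functor1[OF left_functor[OF oG oH(2) plab_in[OF that(1)]] b] by (simp add: cell1_def)
    moreover have "dpath P (source P) (w @ r) ?b" using d1(1) that(1) dpath_append by blast
    ultimately show ?thesis
      unfolding whiskered_face_wh1
      using wh_right(1)[OF d1(1) that(2) d2(3)] wh_left(1)[OF d1(1) that(1) oH(2) in1(4)]
        wh_left(1)[OF _ d1(2) oH(2) in1(2), of "w @ r"] by simp
  qed
  have c3: "wh1 ?a ?d w (on_1L (cmp ?a ?c ?d) ?C (on_obj (cmp ?a ?b ?c) (plab ?b s) (plab ?a r))) u
      = whiskered_face K P l (w @ r @ s @ v2) N u" if "dpath P ?a r ?b" "dpath P ?b s ?c" for r s
  proof -
    have rs: "dpath P ?a (r @ s) ?c" using that dpath_append by blast
    then have "dpath P (source P) (w @ r @ s) ?c" using d1(1) dpath_append by blast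
    then show ?thesis
      unfolding whiskered_face_wh1 plab_append[OF that, symmetric]
      using wh_left(1)[OF d1(1) rs oN(2) in1(5)] wh_left(1)[OF _ d2(2) oN(2) in1(3), of "w @ r @ s"] by simp
  qed
  have g1: "wh2 ?a ?d w (on_2R (cmp ?a ?c ?d) (plab ?c t) (gray_cell (cmp ?a ?b ?c) ?B (lab2 l G))) u
      = whiskered_gray_cell K P l w G v1 H (t @ u)" if "dpath P ?c t ?d" for t
  proof -
    have "gray_cell (cmp ?a ?b ?c) ?B (lab2 l G) \<in> cells2 (hom ?a ?c)"
      using gray_cell2(1)[OF oG oH(2) b a] by (simp add: cell2_def)
    then show ?thesis unfolding whiskered_gray_cell_wh2 using wh_right(2)[OF d1(1) that d2(3)] by simp
  qed
  have g2: "wh2 ?a ?d w (gray_cell (cmp ?a ?b ?d) (on_1L (cmp ?b ?c ?d) ?C (plab ?b s)) (lab2 l G)) u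
      = whiskered_gray_cell K P l w G (s @ v2) N u" if "dpath P ?b s ?c" for s
    unfolding whiskered_gray_cell_wh2 plab_append[OF that d2(2)]
    using assoc_1L[OF oG(2) oH(2) oN in1(3) plab_in[OF d2(2)] plab_in[OF that]] by simp
  have g3: "wh2 ?a ?d w (on_2L (cmp ?a ?b ?d) (gray_cell (cmp ?b ?c ?d) ?C ?B) (plab ?a r)) u
      = whiskered_gray_cell K P l (w @ r @ v1) H v2 N u" if "dpath P ?a r ?b" for r
  proof -
    have wr: "dpath P (source P) (w @ r) ?b" using d1(1) that dpath_append by blast
    have \<gamma>: "gray_cell (cmp ?c' ?c ?d) ?C (lab2 l H) \<in> cells2 (hom ?c' ?d)"
      using gray_cell2(1)[OF oH oN(2) c lab2_cell1[OF H]] by (simp add: cell2_def)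
    have LM: "gray_cell (cmp ?b ?c ?d) ?C ?B = on_2L (cmp ?b ?c' ?d) (gray_cell (cmp ?c' ?c ?d) ?C (lab2 l H)) (plab ?b v1)"
      using assoc_gray_LM[OF oG(2) oH oN(2) in1(5,2) plab_in[OF d1(2)]] by simp
    have "gray_cell (cmp ?b ?c ?d) ?C ?B \<in> cells2 (hom ?b ?d)"
      using gray_cell2(1)[OF oG(2) oH(2) oN(2) c b] by (simp add: cell2_def)
    then have "wh2 ?a ?d w (on_2L (cmp ?a ?b ?d) (gray_cell (cmp ?b ?c ?d) ?C ?B) (plab ?a r)) u
      = wh2 ?b ?d (w @ r) (gray_cell (cmp ?b ?c ?d) ?C ?B) u"
      using wh_left(2)[OF d1(1) that oN(2)] by simp
    also have "\<dots> = wh2 ?c' ?d ((w @ r) @ v1) (gray_cell (cmp ?c' ?c ?d) ?C (lab2 l H)) u"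
      unfolding LM using wh_left(2)[OF wr d1(2) oN(2) \<gamma>] .
    finally show ?thesis by (simp add: whiskered_gray_cell_wh2)
  qed
  have eqs: "w @ upper P G @ v1 @ upper P H @ v2 = w @ upper P G @ (v1 @ upper P H) @ v2" by simp
  show ?thesis
    using gray_yang_baxter[OF oG oH(2) oN(2) a b c wh_functor[OF d1(1) d2(3)]]
    unfolding c1[OF dH(1) dN(1)] c1[OF dH(1) dN(2)] c1[OF dH(2) dN(1)] c1[OF dH(2) dN(2)]
      c2[OF fG(1) dN(1)] c2[OF fG(1) dN(2)] c2[OF fG(2) dN(1)] c2[OF fG(2) dN(2)]
      c3[OF fG(1) dH(1)] c3[OF fG(1) dH(2)] c3[OF fG(2) dH(1)] c3[OF fG(2) dH(2)]
      g1[OF dN(1)] g1[OF dN(2)] g2[OF dH(1)] g2[OF dH(2)] g3[OF fG(1)] g3[OF fG(2)]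
    by simp
qed

end

section \<open>Cells whiskered on both sides\<close>

context two_category
begin

definition flank :: "'b \<Rightarrow> 'c \<Rightarrow> 'b \<Rightarrow> 'c" where "flank \<theta>' \<Phi> \<theta> = lw \<theta>' (rw \<Phi> \<theta>)"

lemma inverse2_flank:
  assumes "inverse2 X \<Phi> \<Psi> \<alpha> \<beta>" "cell1 X \<theta> w x" "cell1 X \<alpha> x y" "cell1 X \<theta>' y z"
  shows "inverse2 X (flank \<theta>' \<Phi> \<theta>) (flank \<theta>' \<Psi> \<theta>) (comp1 X \<theta>' (comp1 X \<alpha> \<theta>)) (comp1 X \<theta>' (comp1 X \<beta> \<theta>))"
  unfolding flank_def by (rule inverse2_lw[OF inverse2_rw[OF assms(1-3)] cell1_comp[OF assms(2,3)] assms(4)])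

lemma flank_vcomp:
  assumes "cell2 X \<Phi> \<alpha> \<beta>" "cell2 X \<Psi> \<beta> \<gamma>" "cell1 X \<theta> w x" "cell1 X \<alpha> x y" "cell1 X \<theta>' y z"
  shows "flank \<theta>' (vcomp X \<Psi> \<Phi>) \<theta> = vcomp X (flank \<theta>' \<Psi> \<theta>) (flank \<theta>' \<Phi> \<theta>)"
proof -
  have b: "cell1 X \<beta> x y" using cell2_cell1 assms(1,4) by blast
  show ?thesis
    unfolding flank_def rw_vcomp[OF assms(1-4)]
    by (rule lw_vcomp[OF cell2_rw[OF assms(1,3,4)] cell2_rw[OF assms(2,3) b] cell1_comp[OF assms(3,4)] assms(5)])
qed

lemma flank_lw:
  assumes "cell2 X \<Phi> \<alpha> \<beta>" "cell1 X \<theta> v w" "cell1 X \<alpha> w x" "cell1 X \<kappa> x y" "cell1 X \<theta>' y z"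
  shows "flank (comp1 X \<theta>' \<kappa>) \<Phi> \<theta> = flank \<theta>' (lw \<kappa> \<Phi>) \<theta>"
  unfolding flank_def lw_rw[OF assms(1-4)]
    lw_lw[OF cell2_rw[OF assms(1-3)] cell1_comp[OF assms(2,3)] assms(4,5)] ..

lemma flank_rw:
  assumes "cell2 X \<Phi> \<alpha> \<beta>" "cell1 X \<theta> v w" "cell1 X \<kappa> w x" "cell1 X \<alpha> x y"
  shows "flank \<theta>' \<Phi> (comp1 X \<kappa> \<theta>) = flank \<theta>' (rw \<Phi> \<kappa>) \<theta>"
  unfolding flank_def rw_rw[OF assms] ..

lemma flank_flank:
  assumes "cell2 X \<Phi> \<alpha> \<beta>" "cell1 X \<theta> v w" "cell1 X \<alpha> w x" "cell1 X \<theta>1 x y" "cell1 X \<theta>' y z"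
  shows "flank (comp1 X \<theta>' \<theta>1) \<Phi> \<theta> = lw \<theta>' (flank \<theta>1 \<Phi> \<theta>)"
  unfolding flank_def lw_lw[OF cell2_rw[OF assms(1-3)] cell1_comp[OF assms(2,3)] assms(4,5)] ..

text \<open>
  Relation (b): the interchange law for \<open>A\<close> and \<open>B\<close> with a 1-cell between them.
\<close>

lemma distant_cells_commute:
  assumes A: "cell2 X A g g'" and B: "cell2 X B k k'"
    and c: "cell1 X \<theta>0 v0 v1" "cell1 X g v1 v2" "cell1 X \<theta>1 v2 v3" "cell1 X k v3 v4" "cell1 X \<theta>2 v4 v5"
  shows "vcomp X (flank \<theta>2 B (comp1 X \<theta>1 (comp1 X g' \<theta>0))) (flank (comp1 X (comp1 X \<theta>2 k) \<theta>1) A \<theta>0)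
    = vcomp X (flank (comp1 X (comp1 X \<theta>2 k') \<theta>1) A \<theta>0) (flank \<theta>2 B (comp1 X \<theta>1 (comp1 X g \<theta>0)))"
proof -
  have g': "cell1 X g' v1 v2" and k': "cell1 X k' v3 v4" using cell2_cell1 A B c by blast+
  let ?A = "flank \<theta>1 A \<theta>0" and ?\<alpha> = "comp1 X \<theta>1 (comp1 X g \<theta>0)" and ?\<alpha>' = "comp1 X \<theta>1 (comp1 X g' \<theta>0)"
  have \<alpha>: "cell1 X ?\<alpha> v0 v3" using cell1_comp c by blast
  have \<alpha>': "cell1 X ?\<alpha>' v0 v3" using cell1_comp c g' by blast
  have A': "cell2 X ?A ?\<alpha> ?\<alpha>'"
    unfolding flank_def using cell2_lw[OF cell2_rw[OF A c(1,2)] cell1_comp[OF c(1,2)] c(3)] .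
  have e: "flank (comp1 X (comp1 X \<theta>2 \<kappa>) \<theta>1) A \<theta>0 = lw \<theta>2 (lw \<kappa> ?A)" if \<kappa>: "cell1 X \<kappa> v3 v4" for \<kappa>
    using flank_flank[OF A c(1,2,3) cell1_comp[OF \<kappa> c(5)]] lw_lw[OF A' \<alpha> \<kappa> c(5)] by simp
  have "vcomp X (flank \<theta>2 B ?\<alpha>') (flank (comp1 X (comp1 X \<theta>2 k) \<theta>1) A \<theta>0)
      = lw \<theta>2 (vcomp X (rw B ?\<alpha>') (lw k ?A))"
    unfolding e[OF c(4)] flank_def[of \<theta>2 B]
    using lw_vcomp[OF cell2_lw[OF A' \<alpha> c(4)] cell2_rw[OF B \<alpha>' c(4)] cell1_comp[OF \<alpha> c(4)] c(5)] by simp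
  also have "\<dots> = lw \<theta>2 (vcomp X (lw k' ?A) (rw B ?\<alpha>))" using whisker_interchange[OF A' B \<alpha> c(4)] by simp
  also have "\<dots> = vcomp X (flank (comp1 X (comp1 X \<theta>2 k') \<theta>1) A \<theta>0) (flank \<theta>2 B ?\<alpha>)"
    unfolding e[OF k'] flank_def[of \<theta>2 B]
    using lw_vcomp[OF cell2_rw[OF B \<alpha> c(4)] cell2_lw[OF A' \<alpha> k'] cell1_comp[OF \<alpha> c(4)] c(5)] .
  finally show ?thesis .
qed

end

section \<open>Vertical composites\<close>

context labelled_scheme
begin

abbreviation vc :: "'e list \<Rightarrow> complex set list \<Rightarrow> 'e list \<Rightarrow> 'b \<Rightarrow> bool" where
  "vc \<equiv> vertical_composite K P l"

lemma vc_Nil: "vc \<pi> [] \<rho> \<theta> \<longleftrightarrow> \<rho> = \<pi> \<and> \<theta> = id1 X (plab (source P) \<pi>)"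
  by (subst vertical_composite.simps) auto

lemma vc_Cons: "vc \<pi> (F # Fs) \<rho> \<theta> \<longleftrightarrow>
    (\<exists>a b \<theta>'. \<pi> = a @ upper P F @ b \<and> vc (a @ lower P F @ b) Fs \<rho> \<theta>' \<and> \<theta> = comp1 X \<theta>' (whiskered_face K P l a F b))"
  by (subst vertical_composite.simps) auto

lemma vc_Cons_ready:
  assumes "ready \<pi> F"
  shows "vc \<pi> (F # Fs) \<rho> \<theta> \<longleftrightarrow> (\<exists>\<theta>'. vc (after \<pi> F) Fs \<rho> \<theta>' \<and> \<theta> = comp1 X \<theta>' (fcell \<pi> F))"
proof -
  obtain a b where ab: "\<pi> = a @ upper P F @ b" using ready_split[OF assms] .
  have s: "spath (a @ upper P F @ b)" "F \<in> faces P" using assms ab by (auto simp: ready_def)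
  have "a' = a \<and> b' = b" if "\<pi> = a' @ upper P F @ b'" for a' b'
    using spath_split_unique[OF s, of a b a' b'] that ab by simp
  then show ?thesis unfolding vc_Cons using ab after_eq[OF s] fcell_eq[OF s] by metis
qed

lemma vc_head_ready:
  assumes "vc \<pi> (F # Fs) \<rho> \<theta>" "spath \<pi>" "F \<in> faces P"
  shows "ready \<pi> F"
  using assms unfolding vc_Cons ready_def by auto

lemma vc_cell1:
  assumes "vc \<pi> Fs \<rho> \<theta>" "spath \<pi>" "set Fs \<subseteq> faces P"
  shows "cell1 X \<theta> (plab (source P) \<pi>) (plab (source P) \<rho>) \<and> spath \<rho>"
  using assms
proof (induction Fs arbitrary: \<pi> \<theta>)
  case Nil
  have "plab (source P) \<pi> \<in> cells0 X" using plab_in Nil.prems(2) unfolding spath_def label_hom_def by blast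
  then show ?case using Nil.prems X.cell1_id by (simp add: vc_Nil)
next
  case (Cons F Fs)
  have r: "ready \<pi> F" using vc_head_ready Cons.prems by simp
  obtain \<theta>' where \<theta>': "vc (after \<pi> F) Fs \<rho> \<theta>'" "\<theta> = comp1 X \<theta>' (fcell \<pi> F)"
    using Cons.prems(1) unfolding vc_Cons_ready[OF r] by blast
  show ?case
    using Cons.IH[OF \<theta>'(1) spath_after[OF r]] Cons.prems(3) X.cell1_comp[OF fcell_cell1[OF r]] \<theta>'(2) by auto
qed

lemma vc_unique:
  assumes "vc \<pi> Fs \<rho> \<theta>" "vc \<pi> Fs \<rho>' \<theta>'" "spath \<pi>" "set Fs \<subseteq> faces P"
  shows "\<rho> = \<rho>' \<and> \<theta> = \<theta>'"
  using assms
proof (induction Fs arbitrary: \<pi> \<theta> \<theta>')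
  case Nil
  then show ?case by (simp add: vc_Nil)
next
  case (Cons F Fs)
  have r: "ready \<pi> F" using vc_head_ready Cons.prems by simp
  show ?case
    using Cons.prems(1,2,4) Cons.IH[OF _ _ spath_after[OF r]] unfolding vc_Cons_ready[OF r] by auto
qed

lemma vc_append:
  assumes "vc \<pi> Fs \<rho> \<theta>" "vc \<rho> Gs \<sigma> \<theta>'" "spath \<pi>" "set Fs \<subseteq> faces P" "set Gs \<subseteq> faces P"
  shows "vc \<pi> (Fs @ Gs) \<sigma> (comp1 X \<theta>' \<theta>)"
  using assms
proof (induction Fs arbitrary: \<pi> \<theta>)
  case Nil
  then have "\<rho> = \<pi>" "\<theta> = id1 X (plab (source P) \<pi>)" by (auto simp: vc_Nil)
  moreover have "cell1 X \<theta>' (plab (source P) \<pi>) (plab (source P) \<sigma>)"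
    using vc_cell1[OF Nil.prems(2)] Nil.prems \<open>\<rho> = \<pi>\<close> by simp
  ultimately show ?case using Nil.prems X.comp1_id(1) by simp
next
  case (Cons F Fs)
  have r: "ready \<pi> F" using vc_head_ready Cons.prems by simp
  obtain \<theta>1 where \<theta>1: "vc (after \<pi> F) Fs \<rho> \<theta>1" "\<theta> = comp1 X \<theta>1 (fcell \<pi> F)"
    using Cons.prems(1) unfolding vc_Cons_ready[OF r] by blast
  have Fs: "set Fs \<subseteq> faces P" using Cons.prems(4) by simp
  note c1 = vc_cell1[OF \<theta>1(1) spath_after[OF r] Fs]
  have "vc (after \<pi> F) (Fs @ Gs) \<sigma> (comp1 X \<theta>' \<theta>1)"
    using Cons.IH[OF \<theta>1(1) Cons.prems(2) spath_after[OF r] Fs Cons.prems(5)] .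
  moreover have "comp1 X \<theta>' \<theta> = comp1 X (comp1 X \<theta>' \<theta>1) (fcell \<pi> F)"
    unfolding \<theta>1(2) using X.comp1_assoc[OF fcell_cell1[OF r] conjunct1[OF c1]
      conjunct1[OF vc_cell1[OF Cons.prems(2) conjunct2[OF c1] Cons.prems(5)]]] by simp
  ultimately show ?case unfolding append_Cons vc_Cons_ready[OF r] by blast
qed

lemma sweep_vc: "sweep P \<pi> Fs \<rho> \<Longrightarrow> \<exists>\<theta>. vc \<pi> Fs \<rho> \<theta>"
  by (induction rule: sweep.induct) (auto intro: vertical_composite.intros)

lemma lin_prefix:
  assumes "U @ V \<in> lin"
  obtains \<pi> \<theta> \<theta>' where "vc (top_path P) U \<pi> \<theta>" "vc \<pi> V (bottom_path P) \<theta>'" "spath \<pi>" "set \<pi> = arcs_after U"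
proof -
  obtain \<pi> where \<pi>: "sweep P (top_path P) U \<pi>" "spath \<pi>" "set \<pi> = arcs_after U" using sweep_prefix[OF assms] by blast
  obtain \<rho> where \<rho>: "sweep P (top_path P) U \<rho>" "sweep P \<rho> V (bottom_path P)"
    using sweep_split[OF sweep_complete[OF assms]] .
  have "set U \<subseteq> faces P" using assms by (auto simp: linear_extensions_iff)
  then have "\<rho> = \<pi>" using sweep_deterministic[OF \<rho>(1) \<pi>(1) spath_top] by blast
  then show ?thesis using that sweep_vc[OF \<pi>(1)] sweep_vc[OF \<rho>(2)] \<pi>(2,3) by metis
qed

lemma lin_faces: "U \<in> lin \<Longrightarrow> set U = faces P"
  by (simp add: linear_extensions_iff)

lemma Phi_obj_eq:
  assumes "Fs \<in> lin" "vc (top_path P) Fs (bottom_path P) \<theta>"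
  shows "Phi_obj K P l Fs = \<theta>"
  unfolding Phi_obj_def using vc_unique[OF _ _ spath_top] assms lin_faces[OF assms(1)] by (intro the_equality) auto

lemma Phi_obj_vc:
  assumes "Fs \<in> lin"
  shows "vc (top_path P) Fs (bottom_path P) (Phi_obj K P l Fs)"
proof -
  obtain \<pi> \<theta> \<theta>' where "vc (top_path P) [] \<pi> \<theta>" "vc \<pi> Fs (bottom_path P) \<theta>'"
    by (rule lin_prefix[of "[]" Fs]) (use assms in auto)
  then have "vc (top_path P) Fs (bottom_path P) \<theta>'" by (simp add: vc_Nil)
  then show ?thesis using Phi_obj_eq[OF assms] by simp
qed

lemma Phi_obj_cell1:
  "Fs \<in> lin \<Longrightarrow> cell1 X (Phi_obj K P l Fs) (plab (source P) (top_path P)) (plab (source P) (bottom_path P))"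
  using vc_cell1[OF Phi_obj_vc spath_top] lin_faces by blast

section \<open>Swapping two faces on a path\<close>

text \<open>
  The swap of two faces before it is composed with the cells of the faces processed earlier and later. Its
  direction is read off from the positions on the path instead of the relation \<open>\<prec>\<close>.
\<close>

definition local_swap :: "'e list \<Rightarrow> complex set \<Rightarrow> complex set \<Rightarrow> 'c" where
  "local_swap \<pi> G H = (THE c.
     (\<exists>w v u. \<pi> = w @ upper P G @ v @ upper P H @ u \<and> c = whiskered_gray_cell K P l w G v H u) \<or>
     (\<exists>w v u. \<pi> = w @ upper P H @ v @ upper P G @ u \<and> c = inv_arrow (vert_cat X) (whiskered_gray_cell K P l w H v G u)))"

lemma left_split_unique:
  assumes "spath \<pi>" "G \<in> faces P" "H \<in> faces P"
    and "\<pi> = w @ upper P G @ v @ upper P H @ u" "\<pi> = w' @ upper P G @ v' @ upper P H @ u'"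
  shows "w' = w \<and> v' = v \<and> u' = u"
proof -
  have "w = w'" using spath_split_unique(1)[OF assms(1,2,4,5)] .
  moreover have "w @ upper P G @ v = w' @ upper P G @ v'" "u = u'"
    using spath_split_unique[OF assms(1,3), of "w @ upper P G @ v" u "w' @ upper P G @ v'" u'] assms(4,5) by simp_all
  ultimately show ?thesis by simp
qed

lemma local_swap_eq:
  assumes "spath (w @ upper P G @ v @ upper P H @ u)" "G \<in> faces P" "H \<in> faces P"
  shows "local_swap (w @ upper P G @ v @ upper P H @ u) G H = whiskered_gray_cell K P l w G v H u"
    "local_swap (w @ upper P G @ v @ upper P H @ u) H G = inv_arrow (vert_cat X) (whiskered_gray_cell K P l w G v H u)"
proof -
  let ?\<pi> = "w @ upper P G @ v @ upper P H @ u"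
  have L: "left_of ?\<pi> G H" unfolding left_of_def by blast
  have nr: "?\<pi> \<noteq> w' @ upper P H @ v' @ upper P G @ u'" for w' v' u'
    using left_of_asym[OF assms L] unfolding left_of_def by blast
  have un: "w' = w \<and> v' = v \<and> u' = u" if "?\<pi> = w' @ upper P G @ v' @ upper P H @ u'" for w' v' u'
    using left_split_unique[OF assms HOL.refl that] .
  show "local_swap ?\<pi> G H = whiskered_gray_cell K P l w G v H u"
    unfolding local_swap_def
  proof (rule the_equality)
    show "(\<exists>w' v' u'. ?\<pi> = w' @ upper P G @ v' @ upper P H @ u' \<and> whiskered_gray_cell K P l w G v H u = whiskered_gray_cell K P l w' G v' H u') \<or>
     (\<exists>w' v' u'. ?\<pi> = w' @ upper P H @ v' @ upper P G @ u' \<and> whiskered_gray_cell K P l w G v H u = inv_arrow (vert_cat X) (whiskered_gray_cell K P l w' H v' G u'))"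
      by blast
  qed (use un nr in blast)
  show "local_swap ?\<pi> H G = inv_arrow (vert_cat X) (whiskered_gray_cell K P l w G v H u)"
    unfolding local_swap_def
  proof (rule the_equality)
    show "(\<exists>w' v' u'. ?\<pi> = w' @ upper P H @ v' @ upper P G @ u' \<and> inv_arrow (vert_cat X) (whiskered_gray_cell K P l w G v H u) = whiskered_gray_cell K P l w' H v' G u') \<or>
     (\<exists>w' v' u'. ?\<pi> = w' @ upper P G @ v' @ upper P H @ u' \<and> inv_arrow (vert_cat X) (whiskered_gray_cell K P l w G v H u) = inv_arrow (vert_cat X) (whiskered_gray_cell K P l w' G v' H u'))"
      by blast
  qed (use un nr in blast)
qed

lemma local_swap_inverse2:
  assumes "ready \<pi> G" "ready \<pi> H" "G \<noteq> H"
  shows "inverse2 X (local_swap \<pi> G H) (local_swap \<pi> H G)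
    (comp1 X (fcell (after \<pi> G) H) (fcell \<pi> G)) (comp1 X (fcell (after \<pi> H) G) (fcell \<pi> H))"
proof -
  have main: "inverse2 X (local_swap \<pi> G H) (local_swap \<pi> H G)
      (comp1 X (fcell (after \<pi> G) H) (fcell \<pi> G)) (comp1 X (fcell (after \<pi> H) G) (fcell \<pi> H))"
    if h: "left_of \<pi> G H" "ready \<pi> G" "ready \<pi> H" for G H
  proof -
    obtain w v u where \<pi>: "\<pi> = w @ upper P G @ v @ upper P H @ u" using h(1) unfolding left_of_def by blast
    have s: "spath (w @ upper P G @ v @ upper P H @ u)" "G \<in> faces P" "H \<in> faces P" using h \<pi> by (auto simp: ready_def)
    have s': "spath ((w @ upper P G @ v) @ upper P H @ u)" using s(1) by simp
    have sl: "spath ((w @ lower P G @ v) @ upper P H @ u)" using spath_parts(3)[OF s(1,2)] by simp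
    have sr: "spath (w @ upper P G @ v @ lower P H @ u)" using spath_parts(3)[OF s' s(3)] by simp
    have f: "fcell \<pi> G = whiskered_face K P l w G (v @ upper P H @ u)"
      "fcell \<pi> H = whiskered_face K P l (w @ upper P G @ v) H u"
      "fcell (after \<pi> G) H = whiskered_face K P l (w @ lower P G @ v) H u"
      "fcell (after \<pi> H) G = whiskered_face K P l w G (v @ lower P H @ u)"
      using fcell_eq[OF s(1,2)] fcell_eq[OF s' s(3)] fcell_eq[OF sl s(3)] fcell_eq[OF sr s(2)]
        after_left[OF s(1,2)] after_right[OF s(1,3)] \<pi> by simp_all
    note g = whiskered_gray_cell2[OF s]
    obtain \<Psi> \<alpha> \<beta> where i: "inverse2 X (whiskered_gray_cell K P l w G v H u) \<Psi> \<alpha> \<beta>" using g(2) by blast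
    then have "iso_arrow (vert_cat X) (whiskered_gray_cell K P l w G v H u)"
      by (auto simp: inverse2_iff iso_arrow_def)
    from X.iso_inverse2[OF this g(1)] show ?thesis unfolding f using local_swap_eq[OF s] \<pi> by simp
  qed
  show ?thesis
    using left_or_right[OF assms] main[OF _ assms(1,2)] inverse2_sym[OF main[OF _ assms(2,1)]] by blast
qed

section \<open>Swapping three faces on a path\<close>

definition triple :: "'e list \<Rightarrow> complex set \<Rightarrow> complex set \<Rightarrow> complex set \<Rightarrow> 'b" where
  "triple \<pi> G H N = comp1 X (fcell (after (after \<pi> G) H) N) (comp1 X (fcell (after \<pi> G) H) (fcell \<pi> G))"

definition first_swap :: "'e list \<Rightarrow> complex set \<Rightarrow> complex set \<Rightarrow> complex set \<Rightarrow> 'c" where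
  "first_swap \<pi> G H N = X.lw (fcell (after (after \<pi> G) H) N) (local_swap \<pi> G H)"

definition second_swap :: "'e list \<Rightarrow> complex set \<Rightarrow> complex set \<Rightarrow> complex set \<Rightarrow> 'c" where
  "second_swap \<pi> G H N = X.rw (local_swap (after \<pi> G) H N) (fcell \<pi> G)"

text \<open>
  Relation (c) for three faces on one path, without the faces processed earlier and later.
\<close>

definition hexagon :: "'e list \<Rightarrow> complex set \<Rightarrow> complex set \<Rightarrow> complex set \<Rightarrow> bool" where
  "hexagon \<pi> G H N \<longleftrightarrow>
     vcomp X (first_swap \<pi> H N G) (vcomp X (second_swap \<pi> H G N) (first_swap \<pi> G H N))
   = vcomp X (second_swap \<pi> N G H) (vcomp X (first_swap \<pi> G N H) (second_swap \<pi> G H N))"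

lemma first_swap_inverse2:
  assumes "ready \<pi> G" "ready \<pi> H" "ready \<pi> N" "G \<noteq> H" "G \<noteq> N" "H \<noteq> N"
  shows "inverse2 X (first_swap \<pi> G H N) (first_swap \<pi> H G N) (triple \<pi> G H N) (triple \<pi> H G N)"
proof -
  note r = ready_after[OF assms(1,2,4)] ready_after[OF assms(1,3,5)]
  have rN: "ready (after (after \<pi> G) H) N" using ready_after[OF r assms(6)] .
  show ?thesis
    unfolding first_swap_def triple_def after_commute[OF assms(1,2,4), symmetric]
    using X.inverse2_lw[OF local_swap_inverse2[OF assms(1,2,4)]
        X.cell1_comp[OF fcell_cell1[OF assms(1)] fcell_cell1[OF r(1)]] fcell_cell1[OF rN]] .
qed

lemma second_swap_inverse2:
  assumes "ready \<pi> G" "ready \<pi> H" "ready \<pi> N" "G \<noteq> H" "G \<noteq> N" "H \<noteq> N"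
  shows "inverse2 X (second_swap \<pi> G H N) (second_swap \<pi> G N H) (triple \<pi> G H N) (triple \<pi> G N H)"
proof -
  note r = ready_after[OF assms(1,2,4)] ready_after[OF assms(1,3,5)]
  have rN: "ready (after (after \<pi> G) H) N" "ready (after (after \<pi> G) N) H"
    using ready_after[OF r assms(6)] ready_after[OF r(2,1) assms(6)[symmetric]] by auto
  note c = fcell_cell1[OF assms(1)] fcell_cell1[OF r(1)] fcell_cell1[OF r(2)] fcell_cell1[OF rN(1)] fcell_cell1[OF rN(2)]
  show ?thesis
    unfolding second_swap_def triple_def
    using X.inverse2_rw[OF local_swap_inverse2[OF r assms(6)] c(1) X.cell1_comp[OF c(2,4)]]
    unfolding X.comp1_assoc[OF c(1,2,4)] X.comp1_assoc[OF c(1,3,5)] .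
qed

lemma hexagon_swap_first:
  assumes "hexagon \<pi> G H N" and r: "ready \<pi> G" "ready \<pi> H" "ready \<pi> N" and n: "G \<noteq> H" "G \<noteq> N" "H \<noteq> N"
  shows "hexagon \<pi> H G N"
proof -
  note n' = n(1)[symmetric] n(2)[symmetric] n(3)[symmetric]
  have c: "cell2 X (second_swap \<pi> H G N) (triple \<pi> H G N) (triple \<pi> H N G)"
      "cell2 X (first_swap \<pi> H N G) (triple \<pi> H N G) (triple \<pi> N H G)"
      "cell2 X (second_swap \<pi> G H N) (triple \<pi> G H N) (triple \<pi> G N H)"
      "cell2 X (first_swap \<pi> G N H) (triple \<pi> G N H) (triple \<pi> N G H)"
    using second_swap_inverse2[OF r(2,1,3) n'(1) n(3,2)] first_swap_inverse2[OF r(2,3,1) n(3) n'(1,2)]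
      second_swap_inverse2[OF r n] first_swap_inverse2[OF r(1,3,2) n(2,1) n'(3)] by (simp_all add: inverse2_def)
  show ?thesis
    unfolding hexagon_def
    by (rule X.hexagon_rotate[OF assms(1)[unfolded hexagon_def] c first_swap_inverse2[OF r n]
        second_swap_inverse2[OF r(3,1,2) n'(2,3) n(1)]])
qed

lemma hexagon_swap_last:
  assumes "hexagon \<pi> G H N" and r: "ready \<pi> G" "ready \<pi> H" "ready \<pi> N" and n: "G \<noteq> H" "G \<noteq> N" "H \<noteq> N"
  shows "hexagon \<pi> G N H"
proof -
  note n' = n(1)[symmetric] n(2)[symmetric] n(3)[symmetric]
  have c: "cell2 X (first_swap \<pi> G N H) (triple \<pi> G N H) (triple \<pi> N G H)"
      "cell2 X (second_swap \<pi> N G H) (triple \<pi> N G H) (triple \<pi> N H G)"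
      "cell2 X (first_swap \<pi> G H N) (triple \<pi> G H N) (triple \<pi> H G N)"
      "cell2 X (second_swap \<pi> H G N) (triple \<pi> H G N) (triple \<pi> H N G)"
    using first_swap_inverse2[OF r(1,3,2) n(2,1) n'(3)] second_swap_inverse2[OF r(3,1,2) n'(2,3) n(1)]
      first_swap_inverse2[OF r n] second_swap_inverse2[OF r(2,1,3) n'(1) n(3,2)] by (simp_all add: inverse2_def)
  show ?thesis
    unfolding hexagon_def
    by (rule X.hexagon_rotate[OF assms(1)[unfolded hexagon_def, symmetric] c second_swap_inverse2[OF r n]
        first_swap_inverse2[OF r(2,3,1) n(3) n'(1,2)], symmetric])
qed

lemma hexagon_left_to_right:
  assumes "spath (w @ upper P G @ v1 @ upper P H @ v2 @ upper P N @ u)" "G \<in> faces P" "H \<in> faces P" "N \<in> faces P"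
  shows "hexagon (w @ upper P G @ v1 @ upper P H @ v2 @ upper P N @ u) G H N"
proof -
  let ?p = "\<lambda>g h n. w @ g @ v1 @ h @ v2 @ n @ u"
  have \<pi>': "spath ((w @ upper P G @ v1) @ upper P H @ v2 @ upper P N @ u)" using assms(1) by simp
  note d1 = spath_parts2[OF assms(1-3)] and d2 = spath_parts2[OF \<pi>' assms(3,4)]
  have sp: "spath (?p g h n)" if "g = upper P G \<or> g = lower P G" "h = upper P H \<or> h = lower P H" "n = upper P N \<or> n = lower P N"
    for g h n
  proof -
    have "dpath P (face_source P G) g (face_sink P G)" "dpath P (face_source P H) h (face_sink P H)"
      "dpath P (face_source P N) n (face_sink P N)"
      using that face_dest(1,2) assms by blast+
    then show ?thesis using d1(1,2) d2(2,3) unfolding spath_def dpath_append by blast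
  qed
  have G: "after (?p (upper P G) h n) G = ?p (lower P G) h n"
      "fcell (?p (upper P G) h n) G = whiskered_face K P l w G (v1 @ h @ v2 @ n @ u)"
    if "h = upper P H \<or> h = lower P H" "n = upper P N \<or> n = lower P N" for h n
    using after_eq[OF sp[OF _ that], of G] fcell_eq[OF sp[OF _ that], of G] assms(2) by simp_all
  have H: "after (?p g (upper P H) n) H = ?p g (lower P H) n"
      "fcell (?p g (upper P H) n) H = whiskered_face K P l (w @ g @ v1) H (v2 @ n @ u)"
    if "g = upper P G \<or> g = lower P G" "n = upper P N \<or> n = lower P N" for g n
    using after_eq[of "w @ g @ v1" H "v2 @ n @ u"] fcell_eq[of "w @ g @ v1" H "v2 @ n @ u"] sp[OF that(1) _ that(2), of "upper P H"] assms(3)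
    by simp_all
  have N: "after (?p g h (upper P N)) N = ?p g h (lower P N)"
      "fcell (?p g h (upper P N)) N = whiskered_face K P l (w @ g @ v1 @ h @ v2) N u"
    if "g = upper P G \<or> g = lower P G" "h = upper P H \<or> h = lower P H" for g h
    using after_eq[of "w @ g @ v1 @ h @ v2" N u] fcell_eq[of "w @ g @ v1 @ h @ v2" N u] sp[OF that, of "upper P N"] assms(4)
    by simp_all
  have GH: "local_swap (?p (upper P G) (upper P H) n) G H = whiskered_gray_cell K P l w G v1 H (v2 @ n @ u)"
    if "n = upper P N \<or> n = lower P N" for n
    using local_swap_eq(1)[of w G v1 H "v2 @ n @ u"] sp[OF _ _ that, of "upper P G" "upper P H"] assms(2,3) by simp
  have GN: "local_swap (?p (upper P G) h (upper P N)) G N = whiskered_gray_cell K P l w G (v1 @ h @ v2) N u"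
    if "h = upper P H \<or> h = lower P H" for h
    using local_swap_eq(1)[of w G "v1 @ h @ v2" N u] sp[OF _ that, of "upper P G" "upper P N"] assms(2,4) by simp
  have HN: "local_swap (?p g (upper P H) (upper P N)) H N = whiskered_gray_cell K P l (w @ g @ v1) H v2 N u"
    if "g = upper P G \<or> g = lower P G" for g
    using local_swap_eq(1)[of "w @ g @ v1" H v2 N u] sp[OF that, of "upper P H" "upper P N"] assms(3,4) by simp
  show ?thesis
    unfolding hexagon_def first_swap_def second_swap_def
    using whiskered_yang_baxter[OF assms]
    by (simp only: G[OF disjI1[OF HOL.refl] disjI1[OF HOL.refl]] G[OF disjI2[OF HOL.refl] disjI1[OF HOL.refl]]
        G[OF disjI1[OF HOL.refl] disjI2[OF HOL.refl]] G[OF disjI2[OF HOL.refl] disjI2[OF HOL.refl]]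
        H[OF disjI1[OF HOL.refl] disjI1[OF HOL.refl]] H[OF disjI2[OF HOL.refl] disjI1[OF HOL.refl]]
        H[OF disjI1[OF HOL.refl] disjI2[OF HOL.refl]] H[OF disjI2[OF HOL.refl] disjI2[OF HOL.refl]]
        N[OF disjI1[OF HOL.refl] disjI1[OF HOL.refl]] N[OF disjI2[OF HOL.refl] disjI1[OF HOL.refl]]
        N[OF disjI1[OF HOL.refl] disjI2[OF HOL.refl]] N[OF disjI2[OF HOL.refl] disjI2[OF HOL.refl]]
        GH[OF disjI1[OF HOL.refl]] GH[OF disjI2[OF HOL.refl]] GN[OF disjI1[OF HOL.refl]] GN[OF disjI2[OF HOL.refl]]
        HN[OF disjI1[OF HOL.refl]] HN[OF disjI2[OF HOL.refl]])
qed

text \<open>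
  One of the six orders along the path holds, and the left-to-right case is carried over to it by exchanging
  neighbours.
\<close>

lemma hexagon_holds:
  assumes "ready \<pi> G" "ready \<pi> H" "ready \<pi> N" "G \<noteq> H" "G \<noteq> N" "H \<noteq> N"
  shows "hexagon \<pi> G H N"
proof -
  have base: "hexagon \<pi> G H N" if h: "left_of \<pi> G H" "left_of \<pi> H N" "ready \<pi> G" "ready \<pi> H" "ready \<pi> N" for G H N
  proof -
    have "spath \<pi>" "G \<in> faces P" "H \<in> faces P" "N \<in> faces P" using h by (auto simp: ready_def)
    then show ?thesis using left_of_chain[OF _ _ h(1,2)] hexagon_left_to_right by metis
  qed
  have trans: "left_of \<pi> G N" if h: "left_of \<pi> G H" "left_of \<pi> H N" "spath \<pi>" "H \<in> faces P" for G H N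
    using left_of_chain[OF h(3,4,1,2)] unfolding left_of_def by (metis append.assoc)
  have fs: "spath \<pi>" "G \<in> faces P" "H \<in> faces P" "N \<in> faces P" using assms by (auto simp: ready_def)
  note sw1 = hexagon_swap_first and sw2 = hexagon_swap_last
  note n = assms(4-6) assms(4-6)[symmetric]
  consider "left_of \<pi> G H" "left_of \<pi> H N" | "left_of \<pi> H G" "left_of \<pi> G N" | "left_of \<pi> G N" "left_of \<pi> N H"
    | "left_of \<pi> H N" "left_of \<pi> N G" | "left_of \<pi> N G" "left_of \<pi> G H" | "left_of \<pi> N H" "left_of \<pi> H G"
    using left_or_right[OF assms(1,2,4)] left_or_right[OF assms(1,3,5)] left_or_right[OF assms(2,3,6)] by blast
  then show ?thesis
  proof cases
    case 1
    then show ?thesis using base assms by blast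
  next
    case 2
    then show ?thesis using sw1[OF base[of H G N]] assms n by blast
  next
    case 3
    then show ?thesis using sw2[OF base[of G N H]] assms n by blast
  next
    case 4
    then show ?thesis using sw1[OF sw2[OF base[of H N G]]] assms n by blast
  next
    case 5
    then show ?thesis using sw2[OF sw1[OF base[of N G H]]] assms n by blast
  next
    case 6
    then show ?thesis using sw1[OF sw2[OF sw1[OF base[of N H G]]]] assms n by blast
  qed
qed

end

section \<open>The canonical functor\<close>

lemma (in two_category) category_hom_cat: "category (hom_cat X x y)"
proof
  fix \<alpha> assume a: "\<alpha> \<in> Obj (hom_cat X x y)"
  then have c: "cell1 X \<alpha> x y" by (simp add: hom_cat_def cell1_def)
  show "Ident (hom_cat X x y) \<alpha> \<in> Arr (hom_cat X x y)" "Dom (hom_cat X x y) (Ident (hom_cat X x y) \<alpha>) = \<alpha>"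
    "Cod (hom_cat X x y) (Ident (hom_cat X x y) \<alpha>) = \<alpha>"
    using cell2_id[OF c] c by (simp_all add: hom_cat_def cell1_def cell2_def)
next
  fix \<Phi> assume "\<Phi> \<in> Arr (hom_cat X x y)"
  then have c: "cell2 X \<Phi> (src2 X \<Phi>) (tgt2 X \<Phi>)" "src1 X (src2 X \<Phi>) = x" "tgt1 X (src2 X \<Phi>) = y"
    by (simp_all add: hom_cat_def cell2_def)
  then have "cell1 X (src2 X \<Phi>) x y" "cell1 X (tgt2 X \<Phi>) x y"
    using cell2_source[OF c(1)] by (auto simp: cell1_def)
  then show "Dom (hom_cat X x y) \<Phi> \<in> Obj (hom_cat X x y)" "Cod (hom_cat X x y) \<Phi> \<in> Obj (hom_cat X x y)"
    by (simp_all add: hom_cat_def cell1_def)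
  show "Compose (hom_cat X x y) \<Phi> (Ident (hom_cat X x y) (Dom (hom_cat X x y) \<Phi>)) = \<Phi>"
    "Compose (hom_cat X x y) (Ident (hom_cat X x y) (Cod (hom_cat X x y) \<Phi>)) \<Phi> = \<Phi>"
    using vcomp_id[OF c(1)] by (simp_all add: hom_cat_def)
next
  fix \<Phi> \<Psi>
  assume h: "\<Phi> \<in> Arr (hom_cat X x y)" "\<Psi> \<in> Arr (hom_cat X x y)" "Dom (hom_cat X x y) \<Psi> = Cod (hom_cat X x y) \<Phi>"
  then have "cell2 X (vcomp X \<Psi> \<Phi>) (src2 X \<Phi>) (tgt2 X \<Psi>)"
    using cell2_vcomp[of \<Phi> "src2 X \<Phi>" "tgt2 X \<Phi>" \<Psi> "tgt2 X \<Psi>"] by (simp add: hom_cat_def cell2_def)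
  then show "Compose (hom_cat X x y) \<Psi> \<Phi> \<in> Arr (hom_cat X x y)"
    "Dom (hom_cat X x y) (Compose (hom_cat X x y) \<Psi> \<Phi>) = Dom (hom_cat X x y) \<Phi>"
    "Cod (hom_cat X x y) (Compose (hom_cat X x y) \<Psi> \<Phi>) = Cod (hom_cat X x y) \<Psi>"
    using h by (simp_all add: hom_cat_def cell2_def)
next
  fix \<Phi> \<Psi> \<Theta>
  assume "\<Phi> \<in> Arr (hom_cat X x y)" "\<Psi> \<in> Arr (hom_cat X x y)" "\<Theta> \<in> Arr (hom_cat X x y)"
    "Dom (hom_cat X x y) \<Psi> = Cod (hom_cat X x y) \<Phi>" "Dom (hom_cat X x y) \<Theta> = Cod (hom_cat X x y) \<Psi>"
  then show "Compose (hom_cat X x y) \<Theta> (Compose (hom_cat X x y) \<Psi> \<Phi>) = Compose (hom_cat X x y) (Compose (hom_cat X x y) \<Theta> \<Psi>) \<Phi>"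
    using vcomp_assoc[of \<Phi> "src2 X \<Phi>" "tgt2 X \<Phi>" \<Psi> "tgt2 X \<Psi>" \<Theta> "tgt2 X \<Theta>"] by (simp add: hom_cat_def cell2_def)
qed

context labelled_scheme
begin

abbreviation sw :: "complex set swap set" where
  "sw \<equiv> swaps (faces P) (below P)\<^sup>+\<^sup>+"

lemma vc_split:
  assumes "vc \<pi> (Fs @ Gs) \<sigma> \<theta>" "spath \<pi>" "set Fs \<subseteq> faces P"
  obtains \<rho> \<theta>1 \<theta>2 where "vc \<pi> Fs \<rho> \<theta>1" "vc \<rho> Gs \<sigma> \<theta>2"
proof -
  have "\<exists>\<rho> \<theta>1 \<theta>2. vc \<pi> Fs \<rho> \<theta>1 \<and> vc \<rho> Gs \<sigma> \<theta>2" using assms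
  proof (induction Fs arbitrary: \<pi> \<theta>)
    case Nil
    then show ?case by (auto simp: vc_Nil)
  next
    case (Cons F Fs)
    have r: "ready \<pi> F" using vc_head_ready Cons.prems by simp
    obtain \<theta>' where h: "vc (after \<pi> F) (Fs @ Gs) \<sigma> \<theta>'" using Cons.prems(1) vc_Cons_ready[OF r] by auto
    have "set Fs \<subseteq> faces P" using Cons.prems(3) by simp
    from Cons.IH[OF h spath_after[OF r] this] obtain \<rho> \<theta>1 \<theta>2
      where "vc (after \<pi> F) Fs \<rho> \<theta>1" "vc \<rho> Gs \<sigma> \<theta>2" by blast
    then show ?case using vc_Cons_ready[OF r] by blast
  qed
  then show ?thesis using that by blast
qed

lemma vc_pair:
  assumes "ready \<pi> G" "ready \<pi> H" "G \<noteq> H"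
  shows "vc \<pi> [G, H] (after (after \<pi> G) H) (comp1 X (fcell (after \<pi> G) H) (fcell \<pi> G))"
proof -
  note r = ready_after[OF assms]
  have "cell1 X (fcell (after \<pi> G) H) (plab (source P) (after \<pi> G)) (plab (source P) (after (after \<pi> G) H))"
    using fcell_cell1[OF r] .
  then show ?thesis
    unfolding vc_Cons_ready[OF assms(1)] vc_Cons_ready[OF r] vc_Nil using X.comp1_id(2) by auto
qed

lemma lin_rest:
  assumes "U @ V \<in> lin" "vc (top_path P) U \<pi> \<theta>"
  obtains \<theta>' where "vc \<pi> V (bottom_path P) \<theta>'" "spath \<pi>" "set \<pi> = arcs_after U"
proof -
  obtain \<rho> \<eta> \<theta>' where r: "vc (top_path P) U \<rho> \<eta>" "vc \<rho> V (bottom_path P) \<theta>'" "spath \<rho>" "set \<rho> = arcs_after U"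
    by (rule lin_prefix[OF assms(1)])
  have "set U \<subseteq> faces P" using lin_faces[OF assms(1)] by auto
  then have "\<rho> = \<pi>" using vc_unique[OF r(1) assms(2) spath_top] by blast
  then show ?thesis using that r by blast
qed

lemma swap_opposite:
  assumes "(U, G, H, V) \<in> sw"
  shows "(U, H, G, V) \<in> sw"
  using swap_word_ends[OF swap_word_single[OF assms]] assms unfolding swaps_iff by blast

lemma swap_ready:
  assumes "(U, G, H, V) \<in> sw" "vc (top_path P) U \<pi> \<theta>"
  shows "ready \<pi> G" "ready \<pi> H" "G \<noteq> H"
proof -
  have l: "U @ G # H # V \<in> lin" "U @ H # G # V \<in> lin"
    using assms(1) swap_opposite[OF assms(1)] by (simp_all add: swaps_iff)
  obtain \<theta>' where \<pi>: "spath \<pi>" "set \<pi> = arcs_after U" using lin_rest[OF l(1) assms(2)] .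
  have "G \<in> faces P" "H \<in> faces P" using lin_faces[OF l(1)] by auto
  then show "ready \<pi> G" "ready \<pi> H"
    using \<pi> upper_within_arcs_after[OF l(1)] upper_within_arcs_after[OF l(2)] by (simp_all add: ready_def)
  show "G \<noteq> H" using l(1) by (auto simp: linear_extensions_iff)
qed

lemma swap_rest:
  assumes "(U, G, H, V) \<in> sw" "vc (top_path P) U \<pi> \<theta>"
  obtains \<theta>' where "vc (after (after \<pi> G) H) V (bottom_path P) \<theta>'"
proof -
  note r = swap_ready[OF assms]
  have l: "U @ G # H # V \<in> lin" using assms(1) by (simp add: swaps_iff)
  obtain \<eta> where "vc \<pi> (G # H # V) (bottom_path P) \<eta>" using lin_rest[OF l assms(2)] .
  then show ?thesis using that unfolding vc_Cons_ready[OF r(1)] vc_Cons_ready[OF ready_after[OF r]] by blast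
qed

lemma swap_faces:
  assumes "(U, G, H, V) \<in> sw"
  shows "set U \<subseteq> faces P" "G \<in> faces P" "H \<in> faces P" "set V \<subseteq> faces P"
proof -
  have "U @ G # H # V \<in> lin" using assms by (simp add: swaps_iff)
  from lin_faces[OF this] show "set U \<subseteq> faces P" "G \<in> faces P" "H \<in> faces P" "set V \<subseteq> faces P" by auto
qed

text \<open>
  The path reached after \<open>U\<close> and the cells on both sides are unique, so the description in the definition has
  exactly one solution.
\<close>

lemma forward_swap_eq:
  assumes swap: "(U, G, H, V) \<in> sw" and \<theta>: "vc (top_path P) U \<pi> \<theta>"
    and \<theta>': "vc (after (after \<pi> G) H) V (bottom_path P) \<theta>'" and left: "left_of \<pi> G H"
  shows "forward_swap K P l (U, G, H, V) = X.flank \<theta>' (local_swap \<pi> G H) \<theta>"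
proof -
  note r = swap_ready[OF swap \<theta>] and f = swap_faces[OF swap]
  obtain w v u where \<pi>: "\<pi> = w @ upper P G @ v @ upper P H @ u" using left unfolding left_of_def by blast
  have s: "spath (w @ upper P G @ v @ upper P H @ u)" using r(1) \<pi> by (simp add: ready_def)
  have sl: "spath ((w @ lower P G @ v) @ upper P H @ u)" using spath_parts(3)[OF s f(2)] by simp
  have \<rho>: "after (after \<pi> G) H = w @ lower P G @ v @ lower P H @ u"
    using after_left[OF s f(2)] after_eq[OF sl f(3)] \<pi> by simp
  have s\<rho>: "spath (w @ lower P G @ v @ lower P H @ u)" using spath_after[OF ready_after[OF r]] \<rho> by simp
  have flank: "X.flank \<theta>' (whiskered_gray_cell K P l w G v H u) \<theta>
      = hcomp X (id2 X \<theta>') (hcomp X (whiskered_gray_cell K P l w G v H u) (id2 X \<theta>))"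
    by (simp add: X.flank_def X.lw_def X.rw_def)
  show ?thesis
    unfolding forward_swap.simps
  proof (rule the_equality)
    show "\<exists>w' v' u' \<eta> \<eta>'. vc (top_path P) U (w' @ upper P G @ v' @ upper P H @ u') \<eta> \<and>
        vc (w' @ lower P G @ v' @ lower P H @ u') V (bottom_path P) \<eta>' \<and>
        X.flank \<theta>' (local_swap \<pi> G H) \<theta> = hcomp X (id2 X \<eta>') (hcomp X (whiskered_gray_cell K P l w' G v' H u') (id2 X \<eta>))"
      using \<theta>[unfolded \<pi>] \<theta>'[unfolded \<rho>] flank local_swap_eq(1)[OF s f(2,3)] \<pi> by metis
  next
    fix \<Gamma>
    assume "\<exists>w' v' u' \<eta> \<eta>'. vc (top_path P) U (w' @ upper P G @ v' @ upper P H @ u') \<eta> \<and>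
        vc (w' @ lower P G @ v' @ lower P H @ u') V (bottom_path P) \<eta>' \<and>
        \<Gamma> = hcomp X (id2 X \<eta>') (hcomp X (whiskered_gray_cell K P l w' G v' H u') (id2 X \<eta>))"
    then obtain w' v' u' \<eta> \<eta>' where h: "vc (top_path P) U (w' @ upper P G @ v' @ upper P H @ u') \<eta>"
        "vc (w' @ lower P G @ v' @ lower P H @ u') V (bottom_path P) \<eta>'"
        "\<Gamma> = hcomp X (id2 X \<eta>') (hcomp X (whiskered_gray_cell K P l w' G v' H u') (id2 X \<eta>))"
      by blast
    have 1: "\<pi> = w' @ upper P G @ v' @ upper P H @ u'" "\<theta> = \<eta>" using vc_unique[OF \<theta> h(1) spath_top f(1)] by blast+
    have e: "w' = w" "v' = v" "u' = u"
      using left_split_unique[OF s f(2,3) HOL.refl 1(1)[unfolded \<pi>]] by blast+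
    have "\<theta>' = \<eta>'" using vc_unique[OF \<theta>'[unfolded \<rho>] h(2)[unfolded e] s\<rho> f(4)] by blast
    then show "\<Gamma> = X.flank \<theta>' (local_swap \<pi> G H) \<theta>"
      using h(3) 1(2) e flank local_swap_eq(1)[OF s f(2,3)] \<pi> by simp
  qed
qed

lemma swap_cell1:
  assumes swap: "(U, G, H, V) \<in> sw" and \<theta>: "vc (top_path P) U \<pi> \<theta>"
    and \<theta>': "vc (after (after \<pi> G) H) V (bottom_path P) \<theta>'"
  shows "cell1 X \<theta> (plab (source P) (top_path P)) (plab (source P) \<pi>)"
    "cell1 X (comp1 X (fcell (after \<pi> G) H) (fcell \<pi> G)) (plab (source P) \<pi>) (plab (source P) (after (after \<pi> G) H))"
    "cell1 X \<theta>' (plab (source P) (after (after \<pi> G) H)) (plab (source P) (bottom_path P))"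
proof -
  note r = swap_ready[OF swap \<theta>] and f = swap_faces[OF swap]
  note r' = ready_after[OF r]
  show "cell1 X \<theta> (plab (source P) (top_path P)) (plab (source P) \<pi>)"
    using vc_cell1[OF \<theta> spath_top f(1)] by blast
  show "cell1 X (comp1 X (fcell (after \<pi> G) H) (fcell \<pi> G)) (plab (source P) \<pi>) (plab (source P) (after (after \<pi> G) H))"
    using X.cell1_comp[OF fcell_cell1[OF r(1)] fcell_cell1[OF r']] .
  show "cell1 X \<theta>' (plab (source P) (after (after \<pi> G) H)) (plab (source P) (bottom_path P))"
    using vc_cell1[OF \<theta>' spath_after[OF r'] f(4)] by blast
qed

lemma flanked_swap_inverse2:
  assumes swap: "(U, G, H, V) \<in> sw" and \<theta>: "vc (top_path P) U \<pi> \<theta>"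
    and \<theta>': "vc (after (after \<pi> G) H) V (bottom_path P) \<theta>'"
  shows "inverse2 X (X.flank \<theta>' (local_swap \<pi> G H) \<theta>) (X.flank \<theta>' (local_swap \<pi> H G) \<theta>)
    (comp1 X \<theta>' (comp1 X (comp1 X (fcell (after \<pi> G) H) (fcell \<pi> G)) \<theta>))
    (comp1 X \<theta>' (comp1 X (comp1 X (fcell (after \<pi> H) G) (fcell \<pi> H)) \<theta>))"
  using X.inverse2_flank[OF local_swap_inverse2[OF swap_ready[OF swap \<theta>]] swap_cell1[OF assms]] .

lemma Phi_swap_eq:
  assumes swap: "(U, G, H, V) \<in> sw" and \<theta>: "vc (top_path P) U \<pi> \<theta>"
    and \<theta>': "vc (after (after \<pi> G) H) V (bottom_path P) \<theta>'"
  shows "Phi_swap K P l (U, G, H, V) = X.flank \<theta>' (local_swap \<pi> G H) \<theta>"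
proof -
  note r = swap_ready[OF swap \<theta>]
  have s: "spath \<pi>" "G \<in> faces P" "H \<in> faces P" using r by (auto simp: ready_def)
  from left_or_right[OF r] show ?thesis
  proof
    assume L: "left_of \<pi> G H"
    then show ?thesis using left_of_prec[OF s L] forward_swap_eq[OF assms L] by (simp del: forward_swap.simps)
  next
    assume R: "left_of \<pi> H G"
    have "\<not> prec P G H" using prec_asym left_of_prec[OF s(1,3,2) R] by blast
    moreover have "forward_swap K P l (U, H, G, V) = X.flank \<theta>' (local_swap \<pi> H G) \<theta>"
      using forward_swap_eq[OF swap_opposite[OF swap] \<theta> _ R] \<theta>' after_commute[OF r] by simp
    ultimately show ?thesis
      using X.inverse2_inv_arrow[OF inverse2_sym[OF flanked_swap_inverse2[OF assms]]]
      by (simp del: forward_swap.simps)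
  qed
qed

lemma Phi_obj_swap:
  assumes swap: "(U, G, H, V) \<in> sw" and \<theta>: "vc (top_path P) U \<pi> \<theta>"
    and \<theta>': "vc (after (after \<pi> G) H) V (bottom_path P) \<theta>'"
  shows "Phi_obj K P l (U @ G # H # V) = comp1 X \<theta>' (comp1 X (comp1 X (fcell (after \<pi> G) H) (fcell \<pi> G)) \<theta>)"
proof -
  note f = swap_faces[OF swap]
  have l: "U @ G # H # V \<in> lin" using swap by (simp add: swaps_iff)
  have "vc (top_path P) (U @ [G, H]) (after (after \<pi> G) H) (comp1 X (comp1 X (fcell (after \<pi> G) H) (fcell \<pi> G)) \<theta>)"
    using vc_append[OF \<theta> vc_pair[OF swap_ready[OF swap \<theta>]] spath_top f(1)] f by simp
  from vc_append[OF this \<theta>' spath_top] show ?thesis using Phi_obj_eq[OF l] f by simp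
qed

lemma Phi_swap_inverse2:
  assumes swap: "(U, G, H, V) \<in> sw"
  shows "inverse2 X (Phi_swap K P l (U, G, H, V)) (Phi_swap K P l (U, H, G, V))
    (Phi_obj K P l (U @ G # H # V)) (Phi_obj K P l (U @ H # G # V))"
proof -
  have l: "U @ (G # H # V) \<in> lin" using swap by (simp add: swaps_iff)
  obtain \<pi> \<theta> \<eta> where \<theta>: "vc (top_path P) U \<pi> \<theta>" "vc \<pi> (G # H # V) (bottom_path P) \<eta>" by (rule lin_prefix[OF l])
  obtain \<theta>' where \<theta>': "vc (after (after \<pi> G) H) V (bottom_path P) \<theta>'" using swap_rest[OF swap \<theta>(1)] .
  have \<theta>'': "vc (after (after \<pi> H) G) V (bottom_path P) \<theta>'"
    using \<theta>' after_commute[OF swap_ready[OF swap \<theta>(1)]] by simp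
  note swap' = swap_opposite[OF swap]
  show ?thesis
    using flanked_swap_inverse2[OF swap \<theta>(1) \<theta>']
    unfolding Phi_swap_eq[OF swap \<theta>(1) \<theta>'] Phi_swap_eq[OF swap' \<theta>(1) \<theta>'']
      Phi_obj_swap[OF swap \<theta>(1) \<theta>'] Phi_obj_swap[OF swap' \<theta>(1) \<theta>''] .
qed

lemma Phi_swap_cell2:
  "g \<in> sw \<Longrightarrow> cell2 X (Phi_swap K P l g) (Phi_obj K P l (swap_dom g)) (Phi_obj K P l (swap_cod g))"
  using Phi_swap_inverse2 by (cases g) (auto simp: inverse2_def simp del: Phi_swap.simps)

abbreviation word :: "complex set list \<Rightarrow> complex set swap list \<Rightarrow> complex set list \<Rightarrow> bool" where
  "word \<equiv> swap_word (faces P) (below P)\<^sup>+\<^sup>+"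

lemma Phi_word_cell2:
  "word x w y \<Longrightarrow> cell2 X (Phi_word K P l x w) (Phi_obj K P l x) (Phi_obj K P l y)"
proof (induction rule: swap_word.induct)
  case (nil x)
  then show ?case using X.cell2_id[OF Phi_obj_cell1] by simp
next
  case (step g w y)
  then show ?case using X.cell2_vcomp[OF Phi_swap_cell2] by (simp del: Phi_swap.simps)
qed

lemma Phi_word_append:
  assumes "word x w y" "word y v z"
  shows "Phi_word K P l x (w @ v) = vcomp X (Phi_word K P l y v) (Phi_word K P l x w)"
  using assms
proof (induction rule: swap_word.induct)
  case (nil x)
  then show ?case using X.vcomp_id(1)[OF Phi_word_cell2[OF nil(2)]] by simp
next
  case (step g w y)
  show ?case
    using step.IH[OF step.prems] X.vcomp_assoc[OF Phi_swap_cell2[OF step.hyps(1)] Phi_word_cell2[OF step.hyps(2)] Phi_word_cell2[OF step.prems]]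
    by (simp del: Phi_swap.simps)
qed

lemma Phi_word_single:
  assumes "g \<in> sw"
  shows "Phi_word K P l x [g] = Phi_swap K P l g"
  using X.vcomp_id(2)[OF Phi_swap_cell2[OF assms]] by (simp del: Phi_swap.simps)

lemma Phi_word_two:
  assumes "h \<in> sw"
  shows "Phi_word K P l x [g, h] = vcomp X (Phi_swap K P l h) (Phi_swap K P l g)"
  using Phi_word_single[OF assms] by (simp del: Phi_swap.simps)

lemma Phi_word_three:
  assumes "g \<in> sw" "h \<in> sw" "k \<in> sw" "swap_dom h = swap_cod g" "swap_dom k = swap_cod h"
  shows "Phi_word K P l x [g, h, k] = vcomp X (Phi_swap K P l k) (vcomp X (Phi_swap K P l h) (Phi_swap K P l g))"
proof -
  have "cell2 X (Phi_swap K P l h) (Phi_obj K P l (swap_cod g)) (Phi_obj K P l (swap_cod h))"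
    "cell2 X (Phi_swap K P l k) (Phi_obj K P l (swap_cod h)) (Phi_obj K P l (swap_cod k))"
    using Phi_swap_cell2[OF assms(2)] Phi_swap_cell2[OF assms(3)] assms(4,5) by simp_all
  from X.vcomp_assoc[OF Phi_swap_cell2[OF assms(1)] this] show ?thesis
    using Phi_word_two[OF assms(3)] by (simp del: Phi_swap.simps)
qed

text \<open>
  The word is cut at the two swapped pairs: \<open>\<theta>0\<close>, \<open>\<theta>1\<close> and \<open>\<theta>2\<close> are the composites of \<open>U\<close>, \<open>V\<close> and
  \<open>W\<close>. Neither pair changes the paths that the other one sees.
\<close>

lemma Phi_respects_distant_swaps:
  assumes sw: "(U, G, H, V @ [M, N] @ W) \<in> sw" "(U @ [H, G] @ V, M, N, W) \<in> sw"
    "(U @ [G, H] @ V, M, N, W) \<in> sw" "(U, G, H, V @ [N, M] @ W) \<in> sw"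
  shows "vcomp X (Phi_swap K P l (U @ [H, G] @ V, M, N, W)) (Phi_swap K P l (U, G, H, V @ [M, N] @ W))
    = vcomp X (Phi_swap K P l (U, G, H, V @ [N, M] @ W)) (Phi_swap K P l (U @ [G, H] @ V, M, N, W))"
proof -
  note f = swap_faces[OF sw(1)]
  have VW: "set V \<subseteq> faces P" "M \<in> faces P" "N \<in> faces P" "set W \<subseteq> faces P" using f(4) by auto
  have l: "U @ (G # H # V @ [M, N] @ W) \<in> lin" using sw(1) by (simp add: swaps_iff)
  obtain \<pi> \<theta>0 where \<theta>0: "vc (top_path P) U \<pi> \<theta>0" by (rule lin_prefix[OF l])
  note r = swap_ready[OF sw(1) \<theta>0]
  have s: "spath \<pi>" using r(1) by (simp add: ready_def)
  define \<pi>1 where "\<pi>1 = after (after \<pi> G) H"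
  have \<pi>1': "after (after \<pi> H) G = \<pi>1" unfolding \<pi>1_def using after_commute[OF r] by simp
  have s1: "spath \<pi>1" unfolding \<pi>1_def using spath_after[OF ready_after[OF r]] .
  obtain \<eta> where \<eta>: "vc \<pi>1 (V @ [M, N] @ W) (bottom_path P) \<eta>" unfolding \<pi>1_def using swap_rest[OF sw(1) \<theta>0] .
  obtain \<pi>2 \<theta>1 \<eta>' where \<theta>1: "vc \<pi>1 V \<pi>2 \<theta>1" "vc \<pi>2 ([M, N] @ W) (bottom_path P) \<eta>'"
    using vc_split[OF \<eta> s1 VW(1)] .
  let ?g = "comp1 X (fcell (after \<pi> G) H) (fcell \<pi> G)" and ?g' = "comp1 X (fcell (after \<pi> H) G) (fcell \<pi> H)"
  have pre: "vc (top_path P) (U @ [G, H] @ V) \<pi>2 (comp1 X \<theta>1 (comp1 X ?g \<theta>0))"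
    using vc_append[OF vc_append[OF \<theta>0 vc_pair[OF r] spath_top f(1)] \<theta>1(1)[unfolded \<pi>1_def] spath_top] f(1-3) VW(1) by simp
  have pre': "vc (top_path P) (U @ [H, G] @ V) \<pi>2 (comp1 X \<theta>1 (comp1 X ?g' \<theta>0))"
    using vc_append[OF vc_append[OF \<theta>0 vc_pair[OF r(2,1) r(3)[symmetric]] spath_top f(1)] \<theta>1(1)[folded \<pi>1'] spath_top] f(1-3) VW(1)
    by simp
  note r2 = swap_ready[OF sw(3) pre]
  define \<pi>3 where "\<pi>3 = after (after \<pi>2 M) N"
  have \<pi>3': "after (after \<pi>2 N) M = \<pi>3" unfolding \<pi>3_def using after_commute[OF r2] by simp
  obtain \<theta>2 where \<theta>2: "vc \<pi>3 W (bottom_path P) \<theta>2" unfolding \<pi>3_def using swap_rest[OF sw(3) pre] .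
  have s2: "spath \<pi>2" using r2(1) by (simp add: ready_def)
  let ?k = "comp1 X (fcell (after \<pi>2 M) N) (fcell \<pi>2 M)" and ?k' = "comp1 X (fcell (after \<pi>2 N) M) (fcell \<pi>2 N)"
  have post: "vc \<pi>1 (V @ [M, N] @ W) (bottom_path P) (comp1 X (comp1 X \<theta>2 ?k) \<theta>1)"
    using vc_append[OF \<theta>1(1) vc_append[OF vc_pair[OF r2] \<theta>2[unfolded \<pi>3_def] s2] s1 VW(1)] VW by simp
  have post': "vc \<pi>1 (V @ [N, M] @ W) (bottom_path P) (comp1 X (comp1 X \<theta>2 ?k') \<theta>1)"
    using vc_append[OF \<theta>1(1) vc_append[OF vc_pair[OF r2(2,1) r2(3)[symmetric]] \<theta>2[folded \<pi>3'] s2] s1 VW(1)] VW by simp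
  note c2 = swap_cell1[OF sw(3) pre \<theta>2[unfolded \<pi>3_def]] and c1 = swap_cell1[OF sw(1) \<theta>0 post[unfolded \<pi>1_def]]
  have A: "cell2 X (local_swap \<pi> G H) ?g ?g'" using local_swap_inverse2[OF r] by (simp add: inverse2_def)
  have B: "cell2 X (local_swap \<pi>2 M N) ?k ?k'" using local_swap_inverse2[OF r2] by (simp add: inverse2_def)
  have t1: "cell1 X \<theta>1 (plab (source P) (after (after \<pi> G) H)) (plab (source P) \<pi>2)"
    using vc_cell1[OF \<theta>1(1) s1 VW(1)] unfolding \<pi>1_def by blast
  show ?thesis
    unfolding Phi_swap_eq[OF sw(2) pre' \<theta>2[unfolded \<pi>3_def]] Phi_swap_eq[OF sw(1) \<theta>0 post[unfolded \<pi>1_def]]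
      Phi_swap_eq[OF sw(4) \<theta>0 post'[unfolded \<pi>1_def]] Phi_swap_eq[OF sw(3) pre \<theta>2[unfolded \<pi>3_def]]
    using X.distant_cells_commute[OF A B c1(1,2) t1 c2(2,3)] .
qed

lemma Phi_first_swap:
  assumes swap: "(U, G, H, N # V) \<in> sw" and \<theta>: "vc (top_path P) U \<pi> \<theta>" and r: "ready \<pi> N" "G \<noteq> N" "H \<noteq> N"
    and \<theta>': "vc (after (after (after \<pi> G) H) N) V (bottom_path P) \<theta>'"
  shows "Phi_swap K P l (U, G, H, N # V) = X.flank \<theta>' (first_swap \<pi> G H N) \<theta>"
proof -
  note rs = swap_ready[OF swap \<theta>]
  note r2 = ready_after[OF rs] ready_after[OF rs(1) r(1,2)]
  have rN: "ready (after (after \<pi> G) H) N" using ready_after[OF r2 r(3)] .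
  have V: "set V \<subseteq> faces P" using swap_faces(4)[OF swap] by simp
  have post: "vc (after (after \<pi> G) H) (N # V) (bottom_path P) (comp1 X \<theta>' (fcell (after (after \<pi> G) H) N))"
    using \<theta>' vc_Cons_ready[OF rN] by blast
  have c: "cell2 X (local_swap \<pi> G H) (comp1 X (fcell (after \<pi> G) H) (fcell \<pi> G)) (comp1 X (fcell (after \<pi> H) G) (fcell \<pi> H))"
    using local_swap_inverse2[OF rs] by (simp add: inverse2_def)
  have t: "cell1 X \<theta>' (plab (source P) (after (after (after \<pi> G) H) N)) (plab (source P) (bottom_path P))"
    using vc_cell1[OF \<theta>' spath_after[OF rN] V] by blast
  show ?thesis
    unfolding Phi_swap_eq[OF swap \<theta> post] first_swap_def
    using X.flank_lw[OF c swap_cell1(1,2)[OF swap \<theta> post] fcell_cell1[OF rN] t] .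
qed

lemma Phi_second_swap:
  assumes swap: "(U @ [G], H, N, V) \<in> sw" and \<theta>: "vc (top_path P) U \<pi> \<theta>" and r: "ready \<pi> G"
    and \<theta>': "vc (after (after (after \<pi> G) H) N) V (bottom_path P) \<theta>'"
  shows "Phi_swap K P l (U @ [G], H, N, V) = X.flank \<theta>' (second_swap \<pi> G H N) \<theta>"
proof -
  have f: "set U \<subseteq> faces P" "G \<in> faces P" using swap_faces(1)[OF swap] by auto
  note G = fcell_cell1[OF r]
  have "vc \<pi> [G] (after \<pi> G) (fcell \<pi> G)"
    unfolding vc_Cons_ready[OF r] vc_Nil using X.comp1_id(2)[OF G] by simp
  from vc_append[OF \<theta> this spath_top f(1)] f(2)
  have pre: "vc (top_path P) (U @ [G]) (after \<pi> G) (comp1 X (fcell \<pi> G) \<theta>)" by simp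
  note rs = swap_ready[OF swap pre]
  have c: "cell2 X (local_swap (after \<pi> G) H N) (comp1 X (fcell (after (after \<pi> G) H) N) (fcell (after \<pi> G) H))
      (comp1 X (fcell (after (after \<pi> G) N) H) (fcell (after \<pi> G) N))"
    using local_swap_inverse2[OF rs] by (simp add: inverse2_def)
  have t: "cell1 X \<theta> (plab (source P) (top_path P)) (plab (source P) \<pi>)"
    using vc_cell1[OF \<theta> spath_top f(1)] by blast
  show ?thesis
    unfolding Phi_swap_eq[OF swap pre \<theta>'] second_swap_def
    using X.flank_rw[OF c t G swap_cell1(2)[OF swap pre \<theta>']] .
qed

text \<open>
  All six swaps have the same cells before and after the three faces, so the equation is the whiskered hexagon.
\<close>

lemma Phi_respects_hexagon:
  assumes sw: "(U, G, H, N # V) \<in> sw" "(U @ [H], G, N, V) \<in> sw" "(U, H, N, G # V) \<in> sw"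
    "(U @ [G], H, N, V) \<in> sw" "(U, G, N, H # V) \<in> sw" "(U @ [N], G, H, V) \<in> sw"
  shows "vcomp X (Phi_swap K P l (U, H, N, G # V))
      (vcomp X (Phi_swap K P l (U @ [H], G, N, V)) (Phi_swap K P l (U, G, H, N # V)))
    = vcomp X (Phi_swap K P l (U @ [N], G, H, V))
      (vcomp X (Phi_swap K P l (U, G, N, H # V)) (Phi_swap K P l (U @ [G], H, N, V)))"
proof -
  have l: "U @ (G # H # N # V) \<in> lin" using sw(1) by (simp add: swaps_iff)
  obtain \<pi> \<theta> where \<theta>: "vc (top_path P) U \<pi> \<theta>" by (rule lin_prefix[OF l])
  note rGH = swap_ready[OF sw(1) \<theta>] and rHN = swap_ready[OF sw(3) \<theta>] and rGN = swap_ready[OF sw(5) \<theta>]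
  note r = rGH(1,2) rHN(2) and n = rGH(3) rGN(3) rHN(3)
  note n' = n(1)[symmetric] n(2)[symmetric] n(3)[symmetric]
  have r1: "ready (after \<pi> G) H" "ready (after \<pi> G) N" "ready (after \<pi> N) G" "ready (after \<pi> N) H" "ready (after \<pi> H) N" "ready (after \<pi> H) G"
    using ready_after[OF r(1,2) n(1)] ready_after[OF r(1,3) n(2)] ready_after[OF r(3,1) n'(2)] ready_after[OF r(3,2) n'(3)]
      ready_after[OF r(2,3) n(3)] ready_after[OF r(2,1) n'(1)] by blast+
  have rN: "ready (after (after \<pi> G) H) N" using ready_after[OF r1(1,2) n(3)] .
  define \<rho> where "\<rho> = after (after (after \<pi> G) H) N"
  have \<rho>: "after (after (after \<pi> H) G) N = \<rho>" "after (after (after \<pi> H) N) G = \<rho>" "after (after (after \<pi> G) N) H = \<rho>"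
      "after (after (after \<pi> N) G) H = \<rho>" "after (after (after \<pi> G) H) N = \<rho>"
    unfolding \<rho>_def
    using after_commute[OF r(1,2) n(1)] after_commute[OF r1(6,5) n(2)] after_commute[OF r1(1,2) n(3)] after_commute[OF r(1,3) n(2)]
    by simp_all
  obtain \<eta> where \<eta>: "vc (after (after \<pi> G) H) (N # V) (bottom_path P) \<eta>" using swap_rest[OF sw(1) \<theta>] .
  then obtain \<theta>' where \<theta>': "vc \<rho> V (bottom_path P) \<theta>'" unfolding \<rho>_def using vc_Cons_ready[OF rN] by blast
  have f: "set U \<subseteq> faces P" "set V \<subseteq> faces P" using swap_faces[OF sw(1)] by auto
  have t: "cell1 X \<theta> (plab (source P) (top_path P)) (plab (source P) \<pi>)" using vc_cell1[OF \<theta> spath_top f(1)] by blast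
  have t': "cell1 X \<theta>' (plab (source P) \<rho>) (plab (source P) (bottom_path P))"
    using vc_cell1[OF \<theta>' _ f(2)] spath_after[OF rN] unfolding \<rho>_def by blast
  have tr: "cell1 X (triple \<pi> G H N) (plab (source P) \<pi>) (plab (source P) \<rho>)"
    unfolding triple_def \<rho>_def using X.cell1_comp[OF X.cell1_comp[OF fcell_cell1[OF r(1)] fcell_cell1[OF r1(1)]] fcell_cell1[OF rN]] .
  have a: "cell2 X (first_swap \<pi> G H N) (triple \<pi> G H N) (triple \<pi> H G N)"
    and b: "cell2 X (second_swap \<pi> H G N) (triple \<pi> H G N) (triple \<pi> H N G)"
    and c: "cell2 X (first_swap \<pi> H N G) (triple \<pi> H N G) (triple \<pi> N H G)"
    and d: "cell2 X (second_swap \<pi> G H N) (triple \<pi> G H N) (triple \<pi> G N H)"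
    and e: "cell2 X (first_swap \<pi> G N H) (triple \<pi> G N H) (triple \<pi> N G H)"
    and f: "cell2 X (second_swap \<pi> N G H) (triple \<pi> N G H) (triple \<pi> N H G)"
    using first_swap_inverse2[OF r n] second_swap_inverse2[OF r(2,1,3) n'(1) n(3,2)] first_swap_inverse2[OF r(2,3,1) n(3) n'(1,2)]
      second_swap_inverse2[OF r n] first_swap_inverse2[OF r(1,3,2) n(2,1) n'(3)] second_swap_inverse2[OF r(3,1,2) n'(2,3) n(1)]
    by (simp_all add: inverse2_def)
  have "X.flank \<theta>' (vcomp X (first_swap \<pi> H N G) (vcomp X (second_swap \<pi> H G N) (first_swap \<pi> G H N))) \<theta>
      = X.flank \<theta>' (vcomp X (second_swap \<pi> N G H) (vcomp X (first_swap \<pi> G N H) (second_swap \<pi> G H N))) \<theta>"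
    using hexagon_holds[OF r n] unfolding hexagon_def by simp
  then show ?thesis
    unfolding X.flank_vcomp[OF X.cell2_vcomp[OF a b] c t tr t'] X.flank_vcomp[OF a b t tr t']
      X.flank_vcomp[OF X.cell2_vcomp[OF d e] f t tr t'] X.flank_vcomp[OF d e t tr t']
    unfolding Phi_first_swap[OF sw(1) \<theta> r(3) n(2,3) \<theta>'[folded \<rho>(5)]] Phi_first_swap[OF sw(3) \<theta> r(1) n'(1,2) \<theta>'[folded \<rho>(2)]]
      Phi_first_swap[OF sw(5) \<theta> r(2) n(1) n'(3) \<theta>'[folded \<rho>(3)]]
      Phi_second_swap[OF sw(2) \<theta> r(2) \<theta>'[folded \<rho>(1)]] Phi_second_swap[OF sw(4) \<theta> r(1) \<theta>'[folded \<rho>(5)]]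
      Phi_second_swap[OF sw(6) \<theta> r(3) \<theta>'[folded \<rho>(4)]] .
qed

lemma Phi_word_respects_word_eq:
  "word_eq (faces P) (below P)\<^sup>+\<^sup>+ x y w w' \<Longrightarrow> Phi_word K P l x w = Phi_word K P l x w'"
proof (induction rule: word_eq.induct)
  case (append x y w w' z v v')
  note ws = word_eq_swap_word[OF append(1)] and vs = word_eq_swap_word[OF append(2)]
  show ?case
    using Phi_word_append[OF conjunct1[OF ws] conjunct1[OF vs]] Phi_word_append[OF conjunct2[OF ws] conjunct2[OF vs]] append(3,4)
    by simp
next
  case (rel_a U G H V)
  show ?case
    using Phi_word_two[OF rel_a(2)] Phi_swap_inverse2[OF rel_a(1)] by (simp add: inverse2_def del: Phi_swap.simps)
next
  case (rel_b U G H V M N W)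
  show ?case
    unfolding Phi_word_two[OF rel_b(2)] Phi_word_two[OF rel_b(4)] by (rule Phi_respects_distant_swaps[OF rel_b])
next
  case (rel_c U G H N V)
  show ?case
    using Phi_respects_hexagon[OF rel_c] Phi_word_three[OF rel_c(1,2,3)] Phi_word_three[OF rel_c(4,5,6)]
    by (simp del: Phi_word.simps Phi_swap.simps)
qed simp_all

lemma Phi_arr_eq:
  assumes "word x w y"
  shows "Phi_arr K P l (x, y, {w. word x w y}) = Phi_word K P l x w"
  unfolding Phi_arr.simps
proof (rule the_equality)
  show "\<forall>w' \<in> {w. word x w y}. Phi_word K P l x w = Phi_word K P l x w'"
    using Phi_word_respects_word_eq[OF parallel_words_equal[OF assms]] by blast
qed (use assms in blast)

theorem is_functor_Phi:
  "is_functor (choice_groupoid P) (hom_cat X (plab (source P) (top_path P)) (plab (source P) (bottom_path P)))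
     (Phi_obj K P l) (Phi_arr K P l)"
  (is "is_functor _ ?D _ _")
proof -
  let ?C = "linear_extension_groupoid (faces P) (below P)\<^sup>+\<^sup>+"
  interpret C: groupoid ?C by (rule groupoid_linear_extension_groupoid)
  interpret D: category ?D by (rule X.category_hom_cat)
  have arr: "\<exists>x y w. f = (x, y, {w. word x w y}) \<and> word x w y \<and> x \<in> lin \<and> y \<in> lin" if f_in: "f \<in> Arr ?C" for f
  proof -
    obtain x y where f: "f = (x, y, {w. word x w y})" "x \<in> lin" "y \<in> lin" using f_in unfolding Arr_groupoid by blast
    moreover obtain w where "word x w y" using linear_extensions_connected[OF f(2,3)] by blast
    ultimately show ?thesis by blast
  qed
  have ends: "Phi_word K P l x w \<in> Arr ?D \<and> Dom ?D (Phi_word K P l x w) = Phi_obj K P l x \<and> Cod ?D (Phi_word K P l x w) = Phi_obj K P l y"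
    if "word x w y" for x w y
    using Phi_word_cell2[OF that] Phi_obj_cell1[of x] swap_word_ends[OF that] by (simp add: hom_cat_def cell1_def cell2_def)
  have "is_functor ?C ?D (Phi_obj K P l) (Phi_arr K P l)"
  proof
    show "Phi_obj K P l x \<in> Obj ?D" if "x \<in> Obj ?C" for x
      using Phi_obj_cell1[of x] that by (simp add: hom_cat_def cell1_def)
  next
    fix f assume "f \<in> Arr ?C"
    then obtain x y w where f: "f = (x, y, {w. word x w y})" "word x w y" using arr by blast
    show "Phi_arr K P l f \<in> Arr ?D" "Dom ?D (Phi_arr K P l f) = Phi_obj K P l (Dom ?C f)"
        "Cod ?D (Phi_arr K P l f) = Phi_obj K P l (Cod ?C f)"
      unfolding f(1) Phi_arr_eq[OF f(2)] using ends[OF f(2)] by simp_all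
  next
    fix x assume "x \<in> Obj ?C"
    then have x: "x \<in> lin" by simp
    show "Phi_arr K P l (Ident ?C x) = Ident ?D (Phi_obj K P l x)"
      unfolding Ident_groupoid[OF x] Phi_arr_eq[OF swap_word.nil[OF x]] by (simp add: hom_cat_def)
  next
    fix f g assume h: "f \<in> Arr ?C" "g \<in> Arr ?C" "Dom ?C g = Cod ?C f"
    obtain x y w where f: "f = (x, y, {w. word x w y})" "word x w y" "x \<in> lin" "y \<in> lin" using arr[OF h(1)] by blast
    obtain y' z v where g: "g = (y', z, {w. word y' w z})" "word y' v z" "z \<in> lin" using arr[OF h(2)] by blast
    have y: "y' = y" using h(3) f(1) g(1) by simp
    note v = g(2)[unfolded y]
    show "Phi_arr K P l (Compose ?C g f) = Compose ?D (Phi_arr K P l g) (Phi_arr K P l f)"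
      unfolding f(1) g(1) y Compose_groupoid[OF f(3,4) g(3)] Phi_arr_eq[OF f(2)] Phi_arr_eq[OF v]
        Phi_arr_eq[OF swap_word_append[OF f(2) v]] Phi_word_append[OF f(2) v]
      by (simp add: hom_cat_def)
  qed
  then show ?thesis by (simp add: choice_groupoid_def)
qed

lemma composites_eq: "composites K P l = Phi_obj K P l ` Obj (choice_groupoid P)"
proof -
  have "{\<theta>. \<exists>Fs \<in> lin. vc (top_path P) Fs (bottom_path P) \<theta>} = Phi_obj K P l ` lin"
    using Phi_obj_vc Phi_obj_eq by blast
  then show ?thesis by (simp add: composites_def choice_groupoid_def)
qed

end

theorem theorem4p24:
  fixes P :: "'e scheme_data"
    and K :: "('o, 'a, 'b, 'c) gray_cat"
    and l :: "('o, 'a, 'b, 'e) labelling_data"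
    and S T :: 'o
    and p q :: 'a
  assumes "pasting_scheme P"
    and "gray_category K"
    and "labelling K P l"
    and "S = lab0 l (source P)"
    and "T = lab0 l (sink P)"
    and "p = path_label K P l (source P) (top_path P)"
    and "q = path_label K P l (source P) (bottom_path P)"
  shows "is_functor (choice_groupoid P) (hom_cat (ghom K S T) p q) (Phi_obj K P l) (Phi_arr K P l)
    \<and> composites K P l = Phi_obj K P l ` Obj (choice_groupoid P)
    \<and> groupoid (choice_groupoid P)
    \<and> contractible_category (choice_groupoid P)"
proof -
  interpret labelled_scheme P K l using assms(1-3) by (rule labelled_scheme.intro)
  obtain Fs where "Fs \<in> lin" using sweep_is_linear_extension .
  then have "contractible_category (choice_groupoid P)"
    unfolding choice_groupoid_def by (rule contractible_linear_extension_groupoid)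
  moreover have "groupoid (choice_groupoid P)"
    unfolding choice_groupoid_def by (rule groupoid_linear_extension_groupoid)
  moreover have "ghom K S T = X" by (simp add: label_hom_def assms(4,5))
  ultimately show ?thesis using is_functor_Phi composites_eq assms(6,7) by simp
qed

end
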